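(* Let $k$ be a field, $S=k[x_1,\dots,x_n]$, and let $I\subset(x_1,\dots,x_n)^2$ be a symmetric monomial ideal with $\Lambda(I)=\{\lambda\}$, i.e. $I=(x_1^{\lambda_{\pi(1)}}\cdots x_n^{\lambda_{\pi(n)}}:\pi\in\mathfrak S_n)$ for a single partition $\lambda=(\lambda_1\ge\dots\ge\lambda_n)$. Then $I$ is Golod if and only if either $\ell(\lambda)>\lfloor n/2\rfloor$, or both $\ell(\lambda)\le\lfloor n/2\rfloor$ and $\lambda_1=\lambda_2$.
   Context: A symmetric monomial ideal is a monomial ideal of $S$ stable under all permutations of the variables; $\mathfrak S_n$ is the symmetric group on $\{1,\dots,n\}$. A partition is $\lambda=(\lambda_1,\dots,\lambda_n)\in\mathbb Z_{\ge0}^n$ with $\lambda_1\ge\dots\ge\lambda_n$; its length is $\ell(\lambda)=\max\{i:\lambda_i\neq0\}$. $\Lambda(I)$ is the set of partitions $\lambda$ such that $x_1^{\lambda_1}\cdots x_n^{\lambda_n}$ is a minimal monomial generator of $I$. With $R=S/I$, the ideal $I$ is called Golod if the coefficientwise equality of power series \[ \sum_{j\ge0}\dim_k\operatorname{Tor}^R_j(k,k)\,t^j=\frac{(1+t)^n}{1-\sum_{j\ge1}\dim_k\operatorname{Tor}^S_j(R,k)\,t^{j+1}} \] holds. *)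

theory Defs
  imports
    "HOL-Algebra.Algebra"
    "HOL-Library.Poly_Mapping"
    "HOL-Combinatorics.Permutations"
    "HOL-Computational_Algebra.Formal_Power_Series"
    "Jordan_Normal_Form.VS_Connect"
begin

section \<open>Modules over a commutative ring\<close>

definition ring_module :: "('a, 'm) ring_scheme \<Rightarrow> ('a, 'a) module" where
  "ring_module A = \<lparr>carrier = carrier A, monoid.mult = monoid.mult A, one = one A,
     ring.zero = ring.zero A, add = add A, smult = monoid.mult A\<rparr>"

definition restrict_scalars :: "('c \<Rightarrow> 'a) \<Rightarrow> ('a, 'b, 'm) module_scheme \<Rightarrow> ('c, 'b) module" where
  "restrict_scalars \<phi> M = \<lparr>carrier = carrier M, monoid.mult = monoid.mult M, one = one M,
     ring.zero = ring.zero M, add = add M, smult = (\<lambda>c x. \<phi> c \<odot>\<^bsub>M\<^esub> x)\<rparr>"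

text \<open>The fields \<open>mult\<close> and \<open>one\<close> of a module record carry no meaning; below they are filled
  arbitrarily.\<close>

definition quot_module ::
    "('a, 'b, 'm) module_scheme \<Rightarrow> 'b set \<Rightarrow> ('a, 'b set) module" where
  "quot_module M U = \<lparr>carrier = a_rcosets\<^bsub>M\<^esub> U, monoid.mult = (\<lambda>V W. U), one = U, ring.zero = U,
     add = set_add M, smult = (\<lambda>a V. \<Union>x\<in>V. U +>\<^bsub>M\<^esub> (a \<odot>\<^bsub>M\<^esub> x))\<rparr>"

definition free_module :: "('a, 'm) ring_scheme \<Rightarrow> 'x set \<Rightarrow> ('a, 'x \<Rightarrow> 'a) module" where
  "free_module A V =
     (ring.func_space A V)\<lparr>carrier := {f \<in> V \<rightarrow>\<^sub>E carrier A. finite {x \<in> V. f x \<noteq> \<zero>\<^bsub>A\<^esub>}}\<rparr>"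

definition free_gen :: "('a, 'm) ring_scheme \<Rightarrow> 'x set \<Rightarrow> 'x \<Rightarrow> ('x \<Rightarrow> 'a)" where
  "free_gen A V x = (\<lambda>y\<in>V. if y = x then \<one>\<^bsub>A\<^esub> else \<zero>\<^bsub>A\<^esub>)"


section \<open>Tensor products\<close>

definition tensor_relations ::
    "('a, 'm) ring_scheme \<Rightarrow> ('a, 'b, 'r) module_scheme \<Rightarrow> ('a, 'c, 's) module_scheme
      \<Rightarrow> ('b \<times> 'c \<Rightarrow> 'a) set" where
  "tensor_relations A M N =
     (let V = carrier M \<times> carrier N; P = free_module A V; e = free_gen A V in
       {e (x \<oplus>\<^bsub>M\<^esub> x', y) \<ominus>\<^bsub>P\<^esub> (e (x, y) \<oplus>\<^bsub>P\<^esub> e (x', y)) | x x' y.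
          x \<in> carrier M \<and> x' \<in> carrier M \<and> y \<in> carrier N}
     \<union> {e (x, y \<oplus>\<^bsub>N\<^esub> y') \<ominus>\<^bsub>P\<^esub> (e (x, y) \<oplus>\<^bsub>P\<^esub> e (x, y')) | x y y'.
          x \<in> carrier M \<and> y \<in> carrier N \<and> y' \<in> carrier N}
     \<union> {e (a \<odot>\<^bsub>M\<^esub> x, y) \<ominus>\<^bsub>P\<^esub> (a \<odot>\<^bsub>P\<^esub> e (x, y)) | a x y.
          a \<in> carrier A \<and> x \<in> carrier M \<and> y \<in> carrier N}
     \<union> {e (x, a \<odot>\<^bsub>N\<^esub> y) \<ominus>\<^bsub>P\<^esub> (a \<odot>\<^bsub>P\<^esub> e (x, y)) | a x y.
          a \<in> carrier A \<and> x \<in> carrier M \<and> y \<in> carrier N})"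

definition tensor_null ::
    "('a, 'm) ring_scheme \<Rightarrow> ('a, 'b, 'r) module_scheme \<Rightarrow> ('a, 'c, 's) module_scheme
      \<Rightarrow> ('b \<times> 'c \<Rightarrow> 'a) set" where
  "tensor_null A M N =
     module.span A (free_module A (carrier M \<times> carrier N)) (tensor_relations A M N)"

definition tensor ::
    "('a, 'm) ring_scheme \<Rightarrow> ('a, 'b, 'r) module_scheme \<Rightarrow> ('a, 'c, 's) module_scheme
      \<Rightarrow> ('a, ('b \<times> 'c \<Rightarrow> 'a) set) module" where
  "tensor A M N = quot_module (free_module A (carrier M \<times> carrier N)) (tensor_null A M N)"

definition pure_tensor ::
    "('a, 'm) ring_scheme \<Rightarrow> ('a, 'b, 'r) module_scheme \<Rightarrow> ('a, 'c, 's) module_scheme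
      \<Rightarrow> 'b \<Rightarrow> 'c \<Rightarrow> ('b \<times> 'c \<Rightarrow> 'a) set" where
  "pure_tensor A M N x y =
     tensor_null A M N +>\<^bsub>free_module A (carrier M \<times> carrier N)\<^esub>
       free_gen A (carrier M \<times> carrier N) (x, y)"

text \<open>The map induced by \<open>u : M \<rightarrow> M'\<close> from the tensor product of \<open>M\<close> and \<open>N\<close> to that of
  \<open>M'\<close> and \<open>N\<close>, sending the pure tensor of \<open>x\<close> and \<open>y\<close> to that of \<open>u x\<close> and \<open>y\<close>. It is
  evaluated on a chosen representative \<open>f\<close>, the choice being irrelevant for linear \<open>u\<close>.\<close>

definition tensor_map ::
    "('a, 'm) ring_scheme \<Rightarrow> ('a, 'b, 'r) module_scheme \<Rightarrow> ('a, 'd, 't) module_scheme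
      \<Rightarrow> ('a, 'c, 's) module_scheme \<Rightarrow> ('b \<Rightarrow> 'd)
      \<Rightarrow> ('b \<times> 'c \<Rightarrow> 'a) set \<Rightarrow> ('d \<times> 'c \<Rightarrow> 'a) set" where
  "tensor_map A M M' N u t =
     (let f = (SOME f. f \<in> t) in
       \<Oplus>\<^bsub>tensor A M' N\<^esub> p \<in> {p \<in> carrier M \<times> carrier N. f p \<noteq> \<zero>\<^bsub>A\<^esub>}.
         f p \<odot>\<^bsub>tensor A M' N\<^esub> pure_tensor A M' N (u (fst p)) (snd p))"


section \<open>Free resolutions and Tor\<close>

text \<open>The free module in homological degree \<open>j\<close> has basis \<open>B j\<close>, and \<open>d j\<close> is the differential
  from degree \<open>Suc j\<close> to degree \<open>j\<close>. Bases are finite or countable, which suffices for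
  every module that is countably generated over a ring of countable dimension over a field.\<close>

definition free_resolution ::
    "('a, 'm) ring_scheme \<Rightarrow> ('a, 'b, 'r) module_scheme \<Rightarrow> (nat \<Rightarrow> nat set)
      \<Rightarrow> (nat \<Rightarrow> (nat \<Rightarrow> 'a) \<Rightarrow> (nat \<Rightarrow> 'a)) \<Rightarrow> ((nat \<Rightarrow> 'a) \<Rightarrow> 'b) \<Rightarrow> bool" where
  "free_resolution A M B d \<epsilon> \<longleftrightarrow>
     (let F = (\<lambda>j. free_module A (B j)) in
       \<epsilon> \<in> module_hom A (F 0) M \<and>
       (\<forall>j. d j \<in> module_hom A (F (Suc j)) (F j)) \<and>
       \<epsilon> ` carrier (F 0) = carrier M \<and>
       {x \<in> carrier (F 0). \<epsilon> x = \<zero>\<^bsub>M\<^esub>} = d 0 ` carrier (F 1) \<and>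
       (\<forall>j. {x \<in> carrier (F (Suc j)). d j x = \<zero>\<^bsub>F j\<^esub>} = d (Suc j) ` carrier (F (Suc (Suc j)))))"

definition tor_of_resolution ::
    "('a, 'm) ring_scheme \<Rightarrow> (nat \<Rightarrow> nat set) \<Rightarrow> (nat \<Rightarrow> (nat \<Rightarrow> 'a) \<Rightarrow> (nat \<Rightarrow> 'a))
      \<Rightarrow> ('a, 'c, 's) module_scheme \<Rightarrow> nat \<Rightarrow> ('a, ((nat \<Rightarrow> 'a) \<times> 'c \<Rightarrow> 'a) set set) module" where
  "tor_of_resolution A B d N j =
     (let F = (\<lambda>i. free_module A (B i));
          C = (\<lambda>i. tensor A (F i) N);
          D = (\<lambda>i. tensor_map A (F (Suc i)) (F i) N (d i));
          Z = (case j of 0 \<Rightarrow> carrier (C 0)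
               | Suc i \<Rightarrow> {t \<in> carrier (C (Suc i)). D i t = \<zero>\<^bsub>C i\<^esub>})
      in quot_module ((C j)\<lparr>carrier := Z\<rparr>) (D j ` carrier (C (Suc j))))"

definition Tor ::
    "('a, 'm) ring_scheme \<Rightarrow> nat \<Rightarrow> ('a, 'b, 'r) module_scheme \<Rightarrow> ('a, 'c, 's) module_scheme
      \<Rightarrow> ('a, ((nat \<Rightarrow> 'a) \<times> 'c \<Rightarrow> 'a) set set) module" where
  "Tor A j M N =
     (let (B, d, \<epsilon>) = (SOME (B, d, \<epsilon>). free_resolution A M B d \<epsilon>)
      in tor_of_resolution A B d N j)"

text \<open>The dimension over a field \<open>'k\<close> of a module over a \<open>'k\<close>-algebra with structure map \<open>\<phi>\<close>.\<close>

definition kdim :: "('k::field \<Rightarrow> 'a) \<Rightarrow> ('a, 'b, 'r) module_scheme \<Rightarrow> nat" where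
  "kdim \<phi> M = vectorspace.dim (class_ring :: 'k ring) (restrict_scalars \<phi> M)"


section \<open>Polynomial rings and monomial ideals\<close>

text \<open>A polynomial in \<open>x_1, x_2, ...\<close> is a finitely supported function from exponent vectors to
  coefficients. The variables of \<open>mpoly_ring n\<close> are \<open>x_1, ..., x_n\<close>.\<close>

type_synonym 'k mpol = "(nat \<Rightarrow>\<^sub>0 nat) \<Rightarrow>\<^sub>0 'k"

definition exponents :: "nat \<Rightarrow> (nat \<Rightarrow>\<^sub>0 nat) set" where
  "exponents n = {m. Poly_Mapping.keys m \<subseteq> {1..n}}"

definition mpoly_ring :: "nat \<Rightarrow> 'k::field mpol ring" where
  "mpoly_ring n = class_ring\<lparr>carrier := {p. Poly_Mapping.keys p \<subseteq> exponents n}\<rparr>"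

definition monom_of :: "(nat \<Rightarrow>\<^sub>0 nat) \<Rightarrow> 'k::field mpol" where
  "monom_of m = Poly_Mapping.single m 1"

definition const_pol :: "'k::field \<Rightarrow> 'k mpol" where
  "const_pol c = Poly_Mapping.single 0 c"

definition const_coeff :: "'k::field mpol \<Rightarrow> 'k" where
  "const_coeff p = Poly_Mapping.lookup p 0"

definition irrelevant_ideal :: "nat \<Rightarrow> 'k::field mpol set" where
  "irrelevant_ideal n =
     genideal (mpoly_ring n) {monom_of (Poly_Mapping.single i 1) | i. i \<in> {1..n}}"

definition monomial_ideal :: "nat \<Rightarrow> 'k::field mpol set \<Rightarrow> bool" where
  "monomial_ideal n I \<longleftrightarrow> (\<exists>E \<subseteq> exponents n. I = genideal (mpoly_ring n) (monom_of ` E))"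

text \<open>\<open>map_key\<close> is precomposition, so a monomial with exponent vector \<open>m \<circ> \<pi>\<close> is sent to
  the one with exponent vector \<open>m\<close>; in particular \<open>x_i\<close> is sent to \<open>x_(\<pi> i)\<close>.\<close>

definition permute_vars :: "(nat \<Rightarrow> nat) \<Rightarrow> 'k::field mpol \<Rightarrow> 'k mpol" where
  "permute_vars \<pi> p = Poly_Mapping.map_key (Poly_Mapping.map_key \<pi>) p"

definition symmetric_monomial_ideal :: "nat \<Rightarrow> 'k::field mpol set \<Rightarrow> bool" where
  "symmetric_monomial_ideal n I \<longleftrightarrow>
     monomial_ideal n I \<and> (\<forall>\<pi>. \<pi> permutes {1..n} \<longrightarrow> permute_vars \<pi> ` I = I)"

text \<open>\<open>E\<close> is the set of exponent vectors of a minimal set of monomial generators of \<open>I\<close>.\<close>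

definition min_monomial_gens :: "nat \<Rightarrow> 'k::field mpol set \<Rightarrow> (nat \<Rightarrow>\<^sub>0 nat) set \<Rightarrow> bool" where
  "min_monomial_gens n I E \<longleftrightarrow>
     E \<subseteq> exponents n \<and> genideal (mpoly_ring n) (monom_of ` E) = I \<and>
     (\<forall>E'. E' \<subset> E \<longrightarrow> genideal (mpoly_ring n) (monom_of ` E') \<noteq> I)"

text \<open>A partition with at most \<open>n\<close> parts is identified with its exponent vector.\<close>

definition partitions :: "nat \<Rightarrow> (nat \<Rightarrow>\<^sub>0 nat) set" where
  "partitions n = {\<mu> \<in> exponents n.
     \<forall>i j. 1 \<le> i \<and> i \<le> j \<and> j \<le> n \<longrightarrow> Poly_Mapping.lookup \<mu> j \<le> Poly_Mapping.lookup \<mu> i}"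

definition partition_length :: "(nat \<Rightarrow>\<^sub>0 nat) \<Rightarrow> nat" where
  "partition_length \<mu> = Max (insert 0 {i. Poly_Mapping.lookup \<mu> i \<noteq> 0})"

definition Lambda :: "nat \<Rightarrow> 'k::field mpol set \<Rightarrow> (nat \<Rightarrow>\<^sub>0 nat) set" where
  "Lambda n I = {\<mu> \<in> partitions n. \<exists>E. min_monomial_gens n I E \<and> \<mu> \<in> E}"


section \<open>Golod ideals\<close>

text \<open>\<open>residue_module\<close> is the residue field as a module over the polynomial ring, and
  \<open>residue_module_quot\<close> is the same field as a module over a quotient by an ideal contained in
  the irrelevant ideal: all members of a residue class then have the same constant coefficient.\<close>

definition residue_module :: "('k::field mpol, 'k) module" where
  "residue_module = restrict_scalars const_coeff (ring_module class_ring)"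

definition residue_module_quot :: "('k::field mpol set, 'k) module" where
  "residue_module_quot =
     restrict_scalars (\<lambda>V. the_elem (const_coeff ` V)) (ring_module class_ring)"

definition quot_betti :: "nat \<Rightarrow> 'k::field mpol set \<Rightarrow> nat \<Rightarrow> nat" where
  "quot_betti n I j =
     (let S = mpoly_ring n; R = S Quot I
      in kdim const_pol
           (Tor S j (restrict_scalars (\<lambda>s. I +>\<^bsub>S\<^esub> s) (ring_module R)) residue_module))"

definition residue_betti :: "nat \<Rightarrow> 'k::field mpol set \<Rightarrow> nat \<Rightarrow> nat" where
  "residue_betti n I j =
     (let S = mpoly_ring n; R = S Quot I
      in kdim (\<lambda>c. I +>\<^bsub>S\<^esub> const_pol c) (Tor R j residue_module_quot residue_module_quot))"

text \<open>The denominator has constant coefficient \<open>1\<close>, so the quotient of rational power series is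
  the formal one.\<close>

definition golod :: "nat \<Rightarrow> 'k::field mpol set \<Rightarrow> bool" where
  "golod n I \<longleftrightarrow>
     (Abs_fps (\<lambda>j. of_nat (residue_betti n I j)) :: rat fps) =
       (1 + fps_X) ^ n /
       (1 - fps_X * Abs_fps (\<lambda>j. if j = 0 then 0 else of_nat (quot_betti n I j)))"

end

theory Submission
  imports Defs
begin

text \<open>Monomial bookkeeping reduces both sides of the Golod identity to linear algebra over the field.
  Let \<open>G\<close> be the finite set of minimal generators. Lists over \<open>G\<close>, repetitions allowed, form a free
  resolution of the quotient ring \<open>R\<close> whose minimal part is an algebra \<open>A\<close> under concatenation, the product
  being zero unless the least common multiples are coprime. The two-sided bar construction of lists with
  coefficients in the Koszul complex gives a free resolution of the residue field over \<open>R\<close>; its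
  minimal part is the bar construction of \<open>A\<close> tensored with an exterior algebra. Hence the ideal is Golod iff
  every cycle of the bar construction without its multiplication part lifts to a cycle by adding shorter words.

  If the generators are pairwise not coprime, the multiplication part vanishes. If the largest part of the
  partition is strict and there is room for two disjoint supports, a Koszul-type functional detects a nonzero
  product. If the two largest parts agree, \<open>A\<close> is the homotopy image of an algebra in which all products lie
  in an acyclic ideal, so all Massey products are trivial.\<close>

text \<open>The Golod identity compares dimensions only. After (1+t)^n is cancelled, both sides
  become Hilbert series of homologies of one graded space of words, for the differentials
  \<open>dB\<close> and \<open>d0\<close>, which differ by a term that shortens words; this is why a
  statement about power series turns into a lifting property. Lists with repetitions replace subsets
  because concatenation is strictly associative and needs no reordering signs. The price is a
  nonzero differential on the minimal part, which is absorbed by passing to homology. Generation in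
  degree at least two keeps unit coefficients out of the action on the Koszul factor, so that this
  factor contributes exactly (1+t)^n. For equal largest parts the auxiliary ideal J consists of the
  multiples of generators with one largest exponent erased. It contains m/x_i for every monomial m
  of I, and the other exponent of the same size forces coprime monomials of J to multiply into I. If
  the largest part is strict, that second exponent is missing, and two blocks of generators with
  disjoint supports give a product that no correction removes.\<close>

type_synonym expo = "nat \<Rightarrow>\<^sub>0 nat"
type_synonym ('a, 'k) fv = "'a \<Rightarrow>\<^sub>0 'k"

abbreviation sgl :: "'a \<Rightarrow> 'b::zero \<Rightarrow> 'a \<Rightarrow>\<^sub>0 'b" where "sgl \<equiv> Poly_Mapping.single"
abbreviation lkp :: "('a, 'k::zero) fv \<Rightarrow> 'a \<Rightarrow> 'k" where "lkp \<equiv> Poly_Mapping.lookup"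
abbreviation keys :: "('a, 'k::zero) fv \<Rightarrow> 'a set" where "keys \<equiv> Poly_Mapping.keys"

section \<open>Homological algebra: Tor against a residue field can be read off from any finite free
  resolution\<close>

section \<open>Free modules and quotient modules\<close>

lemma free_module_sel:
 assumes "ring A"
 shows "carrier (free_module A V) = {f : V \<rightarrow>\<^sub>E carrier A. finite {x : V. f x ~= \<zero>\<^bsub>A\<^esub>}}"
  and "\<zero>\<^bsub>free_module A V\<^esub> = (\<lambda>x\<in>V. \<zero>\<^bsub>A\<^esub>)"
  and "f \<oplus>\<^bsub>free_module A V\<^esub> g = (\<lambda>x\<in>V. f x \<oplus>\<^bsub>A\<^esub> g x)"
  and "a \<odot>\<^bsub>free_module A V\<^esub> f = (\<lambda>x\<in>V. a \<otimes>\<^bsub>A\<^esub> f x)"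
 using assms by (simp_all add: free_module_def ring.func_space_def)

lemma free_moduleI:
 assumes "ring A" "!!x. x : V ==> f x : carrier A" "f : extensional V"
  "finite {x : V. f x ~= \<zero>\<^bsub>A\<^esub>}"
 shows "f : carrier (free_module A V)"
 using assms by (auto simp: free_module_sel PiE_def)

lemma free_module_val:
 assumes "ring A" "f : carrier (free_module A V)" "x : V"
 shows "f x : carrier A"
 using assms by (auto simp: free_module_sel)

lemma free_module_fin:
 assumes "ring A" "f : carrier (free_module A V)"
 shows "finite {x : V. f x ~= \<zero>\<^bsub>A\<^esub>}"
 using assms by (auto simp: free_module_sel)

lemma free_module_ext:
 assumes "ring A" "f : carrier (free_module A V)" "g : carrier (free_module A V)"
  "!!x. x : V ==> f x = g x"
 shows "f = g"
 using assms by (auto simp: free_module_sel intro: PiE_ext)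

lemma free_module_apply:
 assumes "ring A" "x : V"
 shows "\<zero>\<^bsub>free_module A V\<^esub> x = \<zero>\<^bsub>A\<^esub>"
  and "(f \<oplus>\<^bsub>free_module A V\<^esub> g) x = f x \<oplus>\<^bsub>A\<^esub> g x"
  and "(a \<odot>\<^bsub>free_module A V\<^esub> f) x = a \<otimes>\<^bsub>A\<^esub> f x"
 using assms by (simp_all add: free_module_sel)

lemma module_free_module:
 assumes "cring A"
 shows "module A (free_module A V)"
proof -
 interpret A: cring A by fact
 have r: "ring A" ..
 have add: "f \<oplus>\<^bsub>free_module A V\<^esub> g : carrier (free_module A V)"
  if f: "f : carrier (free_module A V)" and g: "g : carrier (free_module A V)" for f g
 proof (rule free_moduleI[OF r])
  show "finite {x : V. (f \<oplus>\<^bsub>free_module A V\<^esub> g) x ~= \<zero>\<^bsub>A\<^esub>}"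
   by (rule finite_subset[OF _ finite_UnI[OF free_module_fin[OF r f] free_module_fin[OF r g]]])
    (auto simp: free_module_apply[OF r])
 qed (use f g in \<open>auto simp: free_module_sel[OF r]\<close>)
 have sm: "a \<odot>\<^bsub>free_module A V\<^esub> f : carrier (free_module A V)"
  if a: "a : carrier A" and f: "f : carrier (free_module A V)" for f a
 proof (rule free_moduleI[OF r])
  show "finite {x : V. (a \<odot>\<^bsub>free_module A V\<^esub> f) x ~= \<zero>\<^bsub>A\<^esub>}"
   by (rule finite_subset[OF _ free_module_fin[OF r f]])
    (use a in \<open>auto simp: free_module_apply[OF r]\<close>)
 qed (use a f in \<open>auto simp: free_module_sel[OF r]\<close>)
 have z: "\<zero>\<^bsub>free_module A V\<^esub> : carrier (free_module A V)"
  by (rule free_moduleI[OF r]) (auto simp: free_module_sel[OF r])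
 have neg: "\<exists>g\<in>carrier (free_module A V). f \<oplus>\<^bsub>free_module A V\<^esub> g = \<zero>\<^bsub>free_module A V\<^esub>"
  if f: "f : carrier (free_module A V)" for f
 proof (rule bexI[of _ "(\<ominus>\<^bsub>A\<^esub> \<one>\<^bsub>A\<^esub>) \<odot>\<^bsub>free_module A V\<^esub> f"])
  show c: "(\<ominus>\<^bsub>A\<^esub> \<one>\<^bsub>A\<^esub>) \<odot>\<^bsub>free_module A V\<^esub> f : carrier (free_module A V)"
   by (rule sm) (use f in auto)
  show "f \<oplus>\<^bsub>free_module A V\<^esub> (\<ominus>\<^bsub>A\<^esub> \<one>\<^bsub>A\<^esub>) \<odot>\<^bsub>free_module A V\<^esub> f = \<zero>\<^bsub>free_module A V\<^esub>"
   by (rule free_module_ext[OF r add[OF f c] z])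
    (use f in \<open>auto simp: free_module_apply[OF r] free_module_val[OF r] A.l_minus A.r_neg\<close>)
 qed
 note v = free_module_val[OF r] and ap = free_module_apply[OF r]
 show ?thesis
  by (rule module_criteria[OF assms z])
   (use add sm neg in \<open>auto intro!: free_module_ext[OF r, where V = V] z
     simp: ap v A.a_ac A.m_assoc A.l_distr A.r_distr\<close>)
qed

lemma free_gen_apply:
 "y : V ==> free_gen A V x y = (if y = x then \<one>\<^bsub>A\<^esub> else \<zero>\<^bsub>A\<^esub>)"
 by (simp add: free_gen_def)

lemma free_gen_closed:
 assumes "cring A"
 shows "free_gen A V x : carrier (free_module A V)"
proof -
 interpret A: cring A by fact
 show ?thesis
  by (rule free_moduleI)
   (auto simp: free_gen_def A.ring_axioms intro: finite_subset[of _ "{x}"])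
qed

text \<open>Finiteness of the support drives the induction: it runs over a finite set containing the
  support, and clearing one coordinate splits off one multiple of a basis vector.\<close>

lemma free_module_induct [consumes 2, case_names zero step]:
 assumes A: "cring A" and f: "f : carrier (free_module A V)"
  and z: "P \<zero>\<^bsub>free_module A V\<^esub>"
  and s: "!!f a x. [|f : carrier (free_module A V); P f; a : carrier A; x : V|] ==>
   P (f \<oplus>\<^bsub>free_module A V\<^esub> a \<odot>\<^bsub>free_module A V\<^esub> free_gen A V x)"
 shows "P f"
proof -
 interpret A: cring A by fact
 interpret F: module A "free_module A V" by (rule module_free_module[OF A])
 have r: "ring A" ..
 have "\<forall>f\<in>carrier (free_module A V). {x\<in>V. f x ~= \<zero>\<^bsub>A\<^esub>} <= W --> P f" if "finite W" for W
  using that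
 proof (induction W)
  case empty
  have "f = \<zero>\<^bsub>free_module A V\<^esub>" if "f : carrier (free_module A V)" "{x\<in>V. f x ~= \<zero>\<^bsub>A\<^esub>} <= {}" for f
   by (rule free_module_ext[OF r that(1)]) (use that in \<open>auto simp: free_module_apply[OF r]\<close>)
  with z show ?case by auto
 next
  case (insert w W)
  show ?case
  proof (intro ballI impI)
   fix f assume f: "f : carrier (free_module A V)" and W: "{x\<in>V. f x ~= \<zero>\<^bsub>A\<^esub>} <= insert w W"
   show "P f"
   proof (cases "w : V")
    case False
    with W have "{x\<in>V. f x ~= \<zero>\<^bsub>A\<^esub>} <= W" by auto
    with insert.IH f show ?thesis by blast
   next
    case True
    define g where "g = (\<lambda>x\<in>V. if x = w then \<zero>\<^bsub>A\<^esub> else f x)"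
    have g: "g : carrier (free_module A V)"
     by (rule free_moduleI[OF r])
     (use f in \<open>auto simp: g_def free_module_val[OF r] intro: finite_subset[OF _ free_module_fin[OF r f]]\<close>)
    have "{x\<in>V. g x ~= \<zero>\<^bsub>A\<^esub>} <= W" using W by (auto simp: g_def)
    hence "P g" using insert.IH g by blast
    hence "P (g \<oplus>\<^bsub>free_module A V\<^esub> f w \<odot>\<^bsub>free_module A V\<^esub> free_gen A V w)"
     using g f True by (intro s) (auto simp: free_module_val[OF r])
    moreover have "g \<oplus>\<^bsub>free_module A V\<^esub> f w \<odot>\<^bsub>free_module A V\<^esub> free_gen A V w = f"
     by (rule free_module_ext[OF r _ f])
     (use f g True in \<open>auto simp: free_module_apply[OF r] free_module_val[OF r] free_gen_apply
     free_gen_closed[OF A] g_def\<close>)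
    ultimately show ?thesis by simp
   qed
  qed
 qed
 from this[OF free_module_fin[OF r f]] f show ?thesis by blast
qed

text \<open>The linear extension of \<open>g\<close> from the basis. The sum runs over the support
  so that the index set of the finite sum is finite; \<open>free_ext_superset\<close> then permits
  any larger finite set, which is what additivity requires.\<close>

definition free_ext ::
 "('a, 'm) ring_scheme => ('a, 'b, 'r) module_scheme => 'x set => ('x => 'b) => ('x => 'a) => 'b" where
 "free_ext A M V g f = (\<Oplus>\<^bsub>M\<^esub> x\<in>{x\<in>V. f x ~= \<zero>\<^bsub>A\<^esub>}. f x \<odot>\<^bsub>M\<^esub> g x)"

lemma free_ext_superset:
 assumes M: "module A M" and g: "g : V \<rightarrow> carrier M" and f: "f : carrier (free_module A V)"
  and W: "finite W" "{x\<in>V. f x ~= \<zero>\<^bsub>A\<^esub>} <= W" "W <= V"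
 shows "free_ext A M V g f = (\<Oplus>\<^bsub>M\<^esub> x\<in>W. f x \<odot>\<^bsub>M\<^esub> g x)"
proof -
 interpret M: module A M by fact
 have r: "ring A" ..
 note v = free_module_val[OF r f]
 show ?thesis unfolding free_ext_def
  by (rule M.add.finprod_mono_neutral_cong_left[OF W(1,2)]) (use g v W in \<open>auto simp: Pi_iff subset_iff\<close>)
qed

lemma free_ext_hom:
 assumes M: "module A M" and g: "g : V \<rightarrow> carrier M"
 shows "free_ext A M V g : module_hom A (free_module A V) M"
proof -
 interpret M: module A M by fact
 have r: "ring A" and A: "cring A" ..
 interpret F: module A "free_module A V" by (rule module_free_module[OF A])
 note v = free_module_val[OF r] and ap = free_module_apply[OF r]
 have cl: "free_ext A M V g f : carrier M" if f: "f : carrier (free_module A V)" for f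
  unfolding free_ext_def using g v[OF f] by (auto intro!: M.finsum_closed)
 have ad: "free_ext A M V g (f \<oplus>\<^bsub>free_module A V\<^esub> h) = free_ext A M V g f \<oplus>\<^bsub>M\<^esub> free_ext A M V g h"
  if f: "f : carrier (free_module A V)" and h: "h : carrier (free_module A V)" for f h
 proof -
  let ?W = "{x\<in>V. f x ~= \<zero>\<^bsub>A\<^esub>} \<union> {x\<in>V. h x ~= \<zero>\<^bsub>A\<^esub>}"
  have W: "finite ?W" "?W <= V" using free_module_fin[OF r f] free_module_fin[OF r h] by auto
  have "{x\<in>V. (f \<oplus>\<^bsub>free_module A V\<^esub> h) x ~= \<zero>\<^bsub>A\<^esub>} <= ?W" by (auto simp: ap)
  hence "free_ext A M V g (f \<oplus>\<^bsub>free_module A V\<^esub> h) = (\<Oplus>\<^bsub>M\<^esub> x\<in>?W. (f \<oplus>\<^bsub>free_module A V\<^esub> h) x \<odot>\<^bsub>M\<^esub> g x)"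
   using W f h by (intro free_ext_superset[OF M g]) auto
  also have "... = (\<Oplus>\<^bsub>M\<^esub> x\<in>?W. f x \<odot>\<^bsub>M\<^esub> g x \<oplus>\<^bsub>M\<^esub> h x \<odot>\<^bsub>M\<^esub> g x)"
   by (rule M.finsum_cong') (use g v[OF f] v[OF h] in \<open>auto simp: ap M.smult_l_distr Pi_iff\<close>)
  also have "... = (\<Oplus>\<^bsub>M\<^esub> x\<in>?W. f x \<odot>\<^bsub>M\<^esub> g x) \<oplus>\<^bsub>M\<^esub> (\<Oplus>\<^bsub>M\<^esub> x\<in>?W. h x \<odot>\<^bsub>M\<^esub> g x)"
   by (rule M.finsum_addf) (use g v[OF f] v[OF h] in auto)
  also have "... = free_ext A M V g f \<oplus>\<^bsub>M\<^esub> free_ext A M V g h"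
   using free_ext_superset[OF M g f W(1) _ W(2)] free_ext_superset[OF M g h W(1) _ W(2)] by auto
  finally show ?thesis .
 qed
 have sc: "free_ext A M V g (a \<odot>\<^bsub>free_module A V\<^esub> f) = a \<odot>\<^bsub>M\<^esub> free_ext A M V g f"
  if a: "a : carrier A" and f: "f : carrier (free_module A V)" for a f
 proof -
  let ?W = "{x\<in>V. f x ~= \<zero>\<^bsub>A\<^esub>}"
  have W: "finite ?W" "?W <= V" using free_module_fin[OF r f] by auto
  have "{x\<in>V. (a \<odot>\<^bsub>free_module A V\<^esub> f) x ~= \<zero>\<^bsub>A\<^esub>} <= ?W" using a by (auto simp: ap)
  hence "free_ext A M V g (a \<odot>\<^bsub>free_module A V\<^esub> f) = (\<Oplus>\<^bsub>M\<^esub> x\<in>?W. (a \<odot>\<^bsub>free_module A V\<^esub> f) x \<odot>\<^bsub>M\<^esub> g x)"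
   using W f a by (intro free_ext_superset[OF M g]) auto
  also have "... = (\<Oplus>\<^bsub>M\<^esub> x\<in>?W. a \<odot>\<^bsub>M\<^esub> (f x \<odot>\<^bsub>M\<^esub> g x))"
   by (rule M.finsum_cong') (use g v[OF f] a in \<open>auto simp: ap M.smult_assoc1 Pi_iff\<close>)
  also have "... = a \<odot>\<^bsub>M\<^esub> (\<Oplus>\<^bsub>M\<^esub> x\<in>?W. f x \<odot>\<^bsub>M\<^esub> g x)"
   by (rule M.finsum_smult_ldistr[symmetric]) (use g v[OF f] W a in auto)
  finally show ?thesis by (simp add: free_ext_def)
 qed
 show ?thesis using cl ad sc by (auto simp: module_hom_def)
qed

lemma free_ext_gen:
 assumes M: "module A M" and g: "g : V \<rightarrow> carrier M" and x: "x : V"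
 shows "free_ext A M V g (free_gen A V x) = g x"
proof -
 interpret M: module A M by fact
 have A: "cring A" ..
 have "free_ext A M V g (free_gen A V x) = (\<Oplus>\<^bsub>M\<^esub> y\<in>{x}. free_gen A V x y \<odot>\<^bsub>M\<^esub> g y)"
  by (rule free_ext_superset[OF M g free_gen_closed[OF A]]) (use x in \<open>auto simp: free_gen_apply split: if_splits\<close>)
 also have "... = g x" using x g by (simp add: free_gen_apply Pi_iff)
 finally show ?thesis .
qed

lemma mod_homI: "module A M ==> module A N ==> u : module_hom A M N ==> mod_hom A M N u"
 by (simp add: mod_hom_def mod_hom_axioms_def)

lemma module_hom_zero:
 assumes "module A M" "module A N" "u : module_hom A M N"
 shows "u \<zero>\<^bsub>M\<^esub> = \<zero>\<^bsub>N\<^esub>"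
 using mod_hom.f0_is_0[OF mod_homI[OF assms]] .

lemma module_hom_minus:
 assumes "module A M" "module A N" "u : module_hom A M N" "x : carrier M" "y : carrier M"
 shows "u (x \<ominus>\<^bsub>M\<^esub> y) = u x \<ominus>\<^bsub>N\<^esub> u y"
 using mod_hom.f_minus[OF mod_homI[OF assms(1-3)]] assms by simp

lemma module_hom_mem: "u : module_hom A M N ==> x : carrier M ==> u x : carrier N"
 by (auto dest: module_hom_closed)

lemma module_hom_comp:
 assumes "u : module_hom A M N" "v : module_hom A N P"
 shows "v \<circ> u : module_hom A M P"
 using assms by (auto simp: module_hom_def Pi_iff)

lemma module_hom_eqI:
 assumes A: "cring A" and M: "module A M"
  and u: "u : module_hom A (free_module A V) M" and v: "v : module_hom A (free_module A V) M"
  and e: "!!x. x : V ==> u (free_gen A V x) = v (free_gen A V x)"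
  and f: "f : carrier (free_module A V)"
 shows "u f = v f"
 using A f
proof (induction rule: free_module_induct)
 case zero
 show ?case
  by (simp add: module_hom_zero[OF module_free_module[OF A] M u] module_hom_zero[OF module_free_module[OF A] M v])
next
 case (step f a x)
 interpret F: module A "free_module A V" by (rule module_free_module[OF A])
 show ?case
  using step free_gen_closed[OF A, of V x]
  by (simp add: module_hom_add[OF u] module_hom_add[OF v] module_hom_smult[OF u] module_hom_smult[OF v] e)
qed

lemma module_hom_fun_minus:
 assumes M: "module A M" and N: "module A N"
  and u: "u : module_hom A M N" and v: "v : module_hom A M N"
 shows "(%x. u x \<ominus>\<^bsub>N\<^esub> v x) : module_hom A M N"
proof -
 interpret N: module A N by fact
 have "a \<odot>\<^bsub>N\<^esub> (\<ominus>\<^bsub>N\<^esub> x) = \<ominus>\<^bsub>N\<^esub> (a \<odot>\<^bsub>N\<^esub> x)" if "a : carrier A" "x : carrier N" for a x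
  using that by (rule N.smult_r_minus)
 thus ?thesis using u v
  by (auto simp: module_hom_def Pi_iff N.a_ac N.smult_r_distr a_minus_def N.minus_add)
qed

lemma quot_module_sel:
 "carrier (quot_module M U) = a_rcosets\<^bsub>M\<^esub> U" "\<zero>\<^bsub>quot_module M U\<^esub> = U"
 "V \<oplus>\<^bsub>quot_module M U\<^esub> W = set_add M V W"
 "a \<odot>\<^bsub>quot_module M U\<^esub> V = (\<Union>x\<in>V. U +>\<^bsub>M\<^esub> (a \<odot>\<^bsub>M\<^esub> x))"
 by (simp_all add: quot_module_def)

context
 fixes A M U
 assumes U: "submodule A U M"
begin

interpretation M: module A M using U by (simp add: submodule_def)

lemma submodule_abelian_subgroup: "abelian_subgroup U M"
proof (rule abelian_subgroupI3)
 have "\<ominus>\<^bsub>M\<^esub> x : U" if "x : U" for x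
 proof -
  have "(\<ominus>\<^bsub>A\<^esub> \<one>\<^bsub>A\<^esub>) \<odot>\<^bsub>M\<^esub> x : U" using U that by (auto simp: submodule_def)
  thus ?thesis using M.smult_minus_1[of x] that U by (auto simp: submodule_def subset_iff)
 qed
 thus "additive_subgroup U M"
  using U by (intro additive_subgroup.intro M.add.subgroupI)
   (auto simp: submodule_def a_inv_def)
 show "abelian_group M" ..
qed

interpretation S: abelian_subgroup U M by (rule submodule_abelian_subgroup)

lemma quot_coset_mem: "x : carrier M ==> U +>\<^bsub>M\<^esub> x : carrier (quot_module M U)"
 using S.a_subset by (simp add: quot_module_sel M.a_rcosetsI)

lemma quot_coset_ex:
 assumes "V : carrier (quot_module M U)"
 obtains x where "x : carrier M" "V = U +>\<^bsub>M\<^esub> x"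
 using assms by (auto simp: quot_module_sel A_RCOSETS_def' )

lemma quot_coset_eq_iff:
 assumes "x : carrier M" "y : carrier M"
 shows "U +>\<^bsub>M\<^esub> x = U +>\<^bsub>M\<^esub> y \<longleftrightarrow> x \<ominus>\<^bsub>M\<^esub> y : U"
proof -
 have "U +>\<^bsub>M\<^esub> x = U +>\<^bsub>M\<^esub> y \<longleftrightarrow> x : U +>\<^bsub>M\<^esub> y"
  using assms S.a_rcos_self S.a_repr_independence' S.a_repr_independenceD by metis
 also have "... \<longleftrightarrow> x \<ominus>\<^bsub>M\<^esub> y : U"
  using assms S.a_rcos_module[of y x] by (simp add: a_minus_def)
 finally show ?thesis .
qed

lemma quot_coset_add:
 assumes "x : carrier M" "y : carrier M"
 shows "(U +>\<^bsub>M\<^esub> x) \<oplus>\<^bsub>quot_module M U\<^esub> (U +>\<^bsub>M\<^esub> y) = U +>\<^bsub>M\<^esub> (x \<oplus>\<^bsub>M\<^esub> y)"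
 using assms by (simp add: quot_module_sel S.a_rcos_sum)

text \<open>In \<open>quot_module\<close> the scalar multiple is a union over all representatives of
  a coset. The union is a single coset because the multiples of two representatives differ by an
  element of \<open>U\<close>.\<close>

lemma quot_coset_smult:
 assumes a: "a : carrier A" and x: "x : carrier M"
 shows "a \<odot>\<^bsub>quot_module M U\<^esub> (U +>\<^bsub>M\<^esub> x) = U +>\<^bsub>M\<^esub> (a \<odot>\<^bsub>M\<^esub> x)"
proof -
 have "U +>\<^bsub>M\<^esub> (a \<odot>\<^bsub>M\<^esub> y) = U +>\<^bsub>M\<^esub> (a \<odot>\<^bsub>M\<^esub> x)" if "y : U +>\<^bsub>M\<^esub> x" for y
 proof -
  have y: "y : carrier M" using that x S.a_rcosets_carrier[OF M.a_rcosetsI[OF S.a_subset x]] by auto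
  have "y \<ominus>\<^bsub>M\<^esub> x : U" using that x y quot_coset_eq_iff[OF y x] S.a_repr_independence' by metis
  hence "a \<odot>\<^bsub>M\<^esub> (y \<ominus>\<^bsub>M\<^esub> x) : U" using a U by (auto simp: submodule_def)
  moreover have "a \<odot>\<^bsub>M\<^esub> (y \<ominus>\<^bsub>M\<^esub> x) = a \<odot>\<^bsub>M\<^esub> y \<ominus>\<^bsub>M\<^esub> a \<odot>\<^bsub>M\<^esub> x"
   using a x y by (simp add: a_minus_def M.smult_r_distr M.smult_r_minus)
  ultimately show ?thesis using a x y by (subst quot_coset_eq_iff) auto
 qed
 moreover have "U +>\<^bsub>M\<^esub> x ~= {}" using S.a_rcos_self[OF x] by auto
 ultimately show ?thesis by (auto simp: quot_module_sel)
qed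

lemma quot_coset_zero: "\<zero>\<^bsub>quot_module M U\<^esub> = U +>\<^bsub>M\<^esub> \<zero>\<^bsub>M\<^esub>"
 using S.a_subset by (simp add: quot_module_sel)

lemma module_quot_module: "module A (quot_module M U)"
proof (rule module_criteria)
 let ?Q = "quot_module M U"
 show "\<zero>\<^bsub>?Q\<^esub> : carrier ?Q" by (simp add: quot_coset_zero quot_coset_mem)
 show "\<forall>v\<in>carrier ?Q. \<exists>neg_v\<in>carrier ?Q. v \<oplus>\<^bsub>?Q\<^esub> neg_v = \<zero>\<^bsub>?Q\<^esub>"
 proof
  fix v assume "v : carrier ?Q"
  then obtain x where x: "x : carrier M" "v = U +>\<^bsub>M\<^esub> x" by (rule quot_coset_ex)
  thus "\<exists>neg_v\<in>carrier ?Q. v \<oplus>\<^bsub>?Q\<^esub> neg_v = \<zero>\<^bsub>?Q\<^esub>"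
   by (intro bexI[of _ "U +>\<^bsub>M\<^esub> (\<ominus>\<^bsub>M\<^esub> x)"]) (auto simp: quot_coset_add quot_coset_zero quot_coset_mem M.r_neg)
 qed
qed (auto elim!: quot_coset_ex simp: quot_coset_add quot_coset_zero quot_coset_mem quot_coset_smult
 M.a_ac M.smult_assoc1 M.smult_l_distr M.smult_r_distr, unfold_locales)

end

section \<open>Tensor products with the residue field\<close>

text \<open>\<open>\<pi>\<close> is the residue map onto the field and \<open>phh\<close> a section
  of it. The section lets a scalar of the field travel from the right tensor factor to the left one,
  which makes every tensor a pure one.\<close>

locale residue_field =
 fixes A :: "('a, 'm) ring_scheme" and \<pi> :: "'a => 'k::field" and phh :: "'k => 'a"
 assumes A: "cring A"
  and pi_hom: "\<pi> : Ring.ring_hom A (class_ring :: 'k ring)"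
  and phi_hom: "phh : Ring.ring_hom (class_ring :: 'k ring) A"
  and pi_phi: "\<pi> (phh c) = c"
begin

interpretation A: cring A by (rule A)

lemma rA: "ring A" ..

abbreviation N :: "('a, 'k) module" where "N \<equiv> restrict_scalars \<pi> (ring_module class_ring)"

lemma N_sel:
 "carrier N = UNIV" "x \<oplus>\<^bsub>N\<^esub> y = x + y" "\<zero>\<^bsub>N\<^esub> = 0" "a \<odot>\<^bsub>N\<^esub> x = \<pi> a * x"
 by (simp_all add: restrict_scalars_def ring_module_def)

lemma pi_simps:
 "\<pi> \<one>\<^bsub>A\<^esub> = 1"
 "a : carrier A ==> b : carrier A ==> \<pi> (a \<oplus>\<^bsub>A\<^esub> b) = \<pi> a + \<pi> b"
 "a : carrier A ==> b : carrier A ==> \<pi> (a \<otimes>\<^bsub>A\<^esub> b) = \<pi> a * \<pi> b"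
 using pi_hom by (auto simp: Ring.ring_hom_def)

lemma pi_zero: "\<pi> \<zero>\<^bsub>A\<^esub> = 0"
proof -
 have "\<pi> \<zero>\<^bsub>A\<^esub> = \<pi> \<zero>\<^bsub>A\<^esub> + \<pi> \<zero>\<^bsub>A\<^esub>"
  using pi_simps(2)[of "\<zero>\<^bsub>A\<^esub>" "\<zero>\<^bsub>A\<^esub>"] by (simp only: A.l_zero A.zero_closed)
 thus ?thesis by (metis add_cancel_right_right)
qed

lemma pi_minus: "a : carrier A ==> b : carrier A ==> \<pi> (a \<ominus>\<^bsub>A\<^esub> b) = \<pi> a - \<pi> b"
proof -
 assume a: "a : carrier A" and b: "b : carrier A"
 have "\<pi> a = \<pi> ((a \<ominus>\<^bsub>A\<^esub> b) \<oplus>\<^bsub>A\<^esub> b)"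
  using a b by (simp add: a_minus_def A.a_assoc A.l_neg)
 thus ?thesis using a b by (simp add: pi_simps)
qed

lemma phi_simps:
 "phh c : carrier A" "phh 1 = \<one>\<^bsub>A\<^esub>" "phh (c + d) = phh c \<oplus>\<^bsub>A\<^esub> phh d" "phh (c * d) = phh c \<otimes>\<^bsub>A\<^esub> phh d"
 using phi_hom by (auto simp: Ring.ring_hom_def)

lemma phi_zero: "phh 0 = \<zero>\<^bsub>A\<^esub>"
 using phi_simps(3)[of 0 0] phi_simps(1)[of 0] by (metis A.add.r_cancel_one' add_0)

lemma module_N: "module A N"
 by (rule module_criteria[OF A])
  (auto simp: N_sel pi_simps algebra_simps intro: exI[of _ "- x" for x])

text \<open>The element x \<otimes> 1. These elements exhaust the tensor product, see
  \<open>tens_surj\<close>, so that all later work can be done on the module itself.\<close>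

definition tens :: "('a, 'b, 'r) module_scheme => 'b => ('b \<times> 'k => 'a) set" where
 "tens M x = pure_tensor A M N x 1"

context
 fixes M :: "('a, 'b, 'r) module_scheme"
 assumes M: "module A M"
begin

interpretation M: module A M by (rule M)

abbreviation (input) "P \<equiv> free_module A (carrier M \<times> (UNIV :: 'k set))"

interpretation P: module A P by (rule module_free_module[OF A])

lemma gen_in_P: "free_gen A (carrier M \<times> (UNIV :: 'k set)) x : carrier P"
 by (rule free_gen_closed[OF A])

lemma tensor_relations_subset: "tensor_relations A M N <= carrier P"
 by (auto simp: tensor_relations_def Let_def N_sel gen_in_P)

lemma submodule_tensor_null: "submodule A (tensor_null A M N) P"
 unfolding tensor_null_def N_sel by (rule P.span_is_submodule[OF tensor_relations_subset])

lemma tensor_eq: "tensor A M N = quot_module P (tensor_null A M N)"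
 by (simp add: tensor_def N_sel)

lemma module_tensor: "module A (tensor A M N)"
 unfolding tensor_eq by (rule module_quot_module[OF submodule_tensor_null])

lemma pure_tensor_eq:
 "pure_tensor A M N x y = tensor_null A M N +>\<^bsub>P\<^esub> free_gen A (carrier M \<times> (UNIV :: 'k set)) (x, y)"
 by (simp add: pure_tensor_def N_sel)

lemma tensor_null_coset_eqI:
 assumes "x : carrier P" "y : carrier P" "x \<ominus>\<^bsub>P\<^esub> y : tensor_relations A M N"
 shows "tensor_null A M N +>\<^bsub>P\<^esub> x = tensor_null A M N +>\<^bsub>P\<^esub> y"
proof -
 have "tensor_relations A M N <= tensor_null A M N"
  unfolding tensor_null_def N_sel by (rule P.in_own_span[OF tensor_relations_subset])
 thus ?thesis using assms quot_coset_eq_iff[OF submodule_tensor_null assms(1,2)] by auto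
qed

lemmas null_facts = quot_coset_add[OF submodule_tensor_null] quot_coset_smult[OF submodule_tensor_null]

lemma pure_tensor_mem: "pure_tensor A M N x y : carrier (tensor A M N)"
 unfolding pure_tensor_eq tensor_eq by (rule quot_coset_mem[OF submodule_tensor_null gen_in_P])

lemma pure_tensor_add:
 assumes "x : carrier M" "x' : carrier M"
 shows "pure_tensor A M N (x \<oplus>\<^bsub>M\<^esub> x') y = pure_tensor A M N x y \<oplus>\<^bsub>tensor A M N\<^esub> pure_tensor A M N x' y"
 unfolding pure_tensor_eq tensor_eq null_facts(1)[OF gen_in_P gen_in_P]
 by (rule tensor_null_coset_eqI)
  (use assms in \<open>auto simp: gen_in_P tensor_relations_def Let_def N_sel\<close>)

lemma pure_tensor_smult:
 assumes "x : carrier M" "a : carrier A"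
 shows "pure_tensor A M N (a \<odot>\<^bsub>M\<^esub> x) y = a \<odot>\<^bsub>tensor A M N\<^esub> pure_tensor A M N x y"
 unfolding pure_tensor_eq tensor_eq null_facts(2)[OF assms(2) gen_in_P]
 by (rule tensor_null_coset_eqI)
  (use assms in \<open>auto simp: gen_in_P tensor_relations_def Let_def N_sel\<close>)

lemma pure_tensor_smult2:
 assumes "x : carrier M" "a : carrier A"
 shows "pure_tensor A M N x (\<pi> a * y) = a \<odot>\<^bsub>tensor A M N\<^esub> pure_tensor A M N x y"
 unfolding pure_tensor_eq tensor_eq null_facts(2)[OF assms(2) gen_in_P]
 by (rule tensor_null_coset_eqI)
  (use assms in \<open>auto simp: gen_in_P tensor_relations_def Let_def N_sel\<close>)

lemma tens_hom: "tens M : module_hom A M (tensor A M N)"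
 by (auto simp: module_hom_def tens_def pure_tensor_mem pure_tensor_add pure_tensor_smult)

text \<open>Since c = \<pi> (\<open>phh\<close> c) * 1, the tensor relations carry the scalar across
  the tensor sign.\<close>

lemma pure_tensor_tens:
 assumes "x : carrier M"
 shows "pure_tensor A M N x c = tens M (phh c \<odot>\<^bsub>M\<^esub> x)"
 using pure_tensor_smult2[OF assms phi_simps(1), of c 1] assms
 by (simp add: pi_phi tens_def pure_tensor_smult phi_simps)

lemma tens_surj:
 assumes "t : carrier (tensor A M N)"
 shows "\<exists>x\<in>carrier M. t = tens M x"
proof -
 interpret T: module A "tensor A M N" by (rule module_tensor)
 obtain g where g: "g : carrier P" "t = tensor_null A M N +>\<^bsub>P\<^esub> g"
  using assms unfolding tensor_eq by (rule quot_coset_ex[OF submodule_tensor_null])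
 have "\<exists>x\<in>carrier M. tensor_null A M N +>\<^bsub>P\<^esub> g = tens M x"
  using A g(1)
 proof (induction rule: free_module_induct)
  case zero
  have "tens M \<zero>\<^bsub>M\<^esub> = \<zero>\<^bsub>tensor A M N\<^esub>" by (rule module_hom_zero[OF M module_tensor tens_hom])
  thus ?case by (intro bexI[of _ "\<zero>\<^bsub>M\<^esub>"])
   (auto simp: tensor_eq quot_coset_zero[OF submodule_tensor_null])
 next
  case (step f a p)
  then obtain x where x: "x : carrier M" "tensor_null A M N +>\<^bsub>P\<^esub> f = tens M x" by auto
  obtain y c where p: "p = (y, c)" "y : carrier M" using step by auto
  have "tensor_null A M N +>\<^bsub>P\<^esub> (f \<oplus>\<^bsub>P\<^esub> a \<odot>\<^bsub>P\<^esub> free_gen A (carrier M \<times> (UNIV :: 'k set)) p)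
   = tens M x \<oplus>\<^bsub>tensor A M N\<^esub> a \<odot>\<^bsub>tensor A M N\<^esub> pure_tensor A M N y c"
   using step gen_in_P
   by (simp add: null_facts[symmetric] x(2)[symmetric] pure_tensor_eq p tensor_eq)
  also have "... = tens M (x \<oplus>\<^bsub>M\<^esub> a \<odot>\<^bsub>M\<^esub> (phh c \<odot>\<^bsub>M\<^esub> y))"
   using x p step by (simp add: pure_tensor_tens phi_simps module_hom_add[OF tens_hom] module_hom_smult[OF tens_hom])
  finally show ?case using x p step phi_simps
   by (intro bexI[of _ "x \<oplus>\<^bsub>M\<^esub> a \<odot>\<^bsub>M\<^esub> (phh c \<odot>\<^bsub>M\<^esub> y)"]) auto
 qed
 with g show ?thesis by simp
qed

text \<open>Two representatives of a tensor differ by an element of the span of the relations, and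
  this span lies in the kernel of \<open>H\<close>. This is the universal property in the form in
  which well-definedness is checked below.\<close>

lemma kill_relations:
 fixes Q :: "('a, 'q, 's) module_scheme"
 assumes Q: "module A Q" and H: "H : module_hom A P Q"
  and k: "!!r. r : tensor_relations A M N ==> H r = \<zero>\<^bsub>Q\<^esub>"
  and g: "g : carrier P" "g' : carrier P"
  and e: "tensor_null A M N +>\<^bsub>P\<^esub> g = tensor_null A M N +>\<^bsub>P\<^esub> g'"
 shows "H g = H g'"
proof -
 interpret Q: module A Q by (rule Q)
 interpret h: mod_hom A P Q H by (rule mod_homI[OF module_free_module[OF A] Q H])
 have "tensor_relations A M N <= h.ker" using k tensor_relations_subset by (auto simp: h.ker_def)
 hence "tensor_null A M N <= h.ker"
  unfolding tensor_null_def N_sel by (rule P.span_is_subset[OF _ h.ker_is_submodule])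
 moreover have "g \<ominus>\<^bsub>P\<^esub> g' : tensor_null A M N"
  using e quot_coset_eq_iff[OF submodule_tensor_null g] by simp
 ultimately have "H (g \<ominus>\<^bsub>P\<^esub> g') = \<zero>\<^bsub>Q\<^esub>" by (auto simp: h.ker_def)
 thus ?thesis using g module_hom_mem[OF H] by (simp add: Q.minus_other_side)
qed

lemma free_ext_kill_relations:
 fixes Q :: "('a, 'q, 's) module_scheme"
 assumes Q: "module A Q" and h: "!!x c. x : carrier M ==> h (x, c) : carrier Q"
  and h1: "!!x x' c. x : carrier M ==> x' : carrier M ==> h (x \<oplus>\<^bsub>M\<^esub> x', c) = h (x, c) \<oplus>\<^bsub>Q\<^esub> h (x', c)"
  and h2: "!!x c c'. x : carrier M ==> h (x, c + c') = h (x, c) \<oplus>\<^bsub>Q\<^esub> h (x, c')"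
  and h3: "!!a x c. a : carrier A ==> x : carrier M ==> h (a \<odot>\<^bsub>M\<^esub> x, c) = a \<odot>\<^bsub>Q\<^esub> h (x, c)"
  and h4: "!!a x c. a : carrier A ==> x : carrier M ==> h (x, \<pi> a * c) = a \<odot>\<^bsub>Q\<^esub> h (x, c)"
  and r: "r : tensor_relations A M N"
 shows "free_ext A Q (carrier M \<times> UNIV) h r = \<zero>\<^bsub>Q\<^esub>"
proof -
 let ?V = "carrier M \<times> (UNIV :: 'k set)"
 interpret Q: module A Q by (rule Q)
 have hV: "h : ?V \<rightarrow> carrier Q" using h by auto
 interpret h: mod_hom A P Q "free_ext A Q ?V h"
  by (rule mod_homI[OF module_free_module[OF A] Q free_ext_hom[OF Q hV]])
 have e: "free_ext A Q ?V h (free_gen A ?V (x, c)) = h (x, c)" if "x : carrier M" for x c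
  by (rule free_ext_gen[OF Q hV]) (use that in auto)
 show ?thesis using r
  by (auto simp: tensor_relations_def Let_def N_sel gen_in_P e h1 h2 h3 h4 h)
qed

end

context
 fixes M :: "('a, 'b, 'r) module_scheme" and M' :: "('a, 'd, 't) module_scheme" and u
 assumes M: "module A M" and M': "module A M'" and u: "u : module_hom A M M'"
begin

interpretation M: module A M by (rule M)
interpretation M': module A M' by (rule M')

text \<open>The representative chosen inside \<open>tensor_map\<close> need not be the generator at
  (x, 1). Both have the same image, because the extension of the bilinear map \<open>?h\<close>
  kills the tensor relations.\<close>

lemma tensor_map_tens:
 assumes x: "x : carrier M"
 shows "tensor_map A M M' N u (tens M x) = tens M' (u x)"
proof -
 let ?V = "carrier M \<times> (UNIV :: 'k set)" and ?T = "tensor A M' N"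
 let ?h = "%p. pure_tensor A M' N (u (fst p)) (snd p)"
 interpret T: module A ?T by (rule module_tensor[OF M'])
 interpret P: module A "free_module A ?V" by (rule module_free_module[OF A])
 have hV: "?h : ?V \<rightarrow> carrier ?T" by (auto simp: pure_tensor_mem[OF M'])
 have um: "u y : carrier M'" if "y : carrier M" for y using module_hom_mem[OF u that] .
 note M't = pure_tensor_mem[OF M'] pure_tensor_add[OF M'] pure_tensor_smult[OF M'] pure_tensor_smult2[OF M']
 have c2: "pure_tensor A M' N y (c + c') = pure_tensor A M' N y c \<oplus>\<^bsub>?T\<^esub> pure_tensor A M' N y c'"
  if "y : carrier M'" for y c c'
  using that by (simp add: pure_tensor_tens[OF M'] phi_simps M'.smult_l_distr module_hom_add[OF tens_hom[OF M']])
 define g where "g = (SOME g. g : tens M x)"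
 have e: "free_gen A ?V (x, 1) : carrier (free_module A ?V)" by (rule gen_in_P[OF M])
 interpret S: abelian_subgroup "tensor_null A M N" "free_module A ?V"
  by (rule submodule_abelian_subgroup[OF submodule_tensor_null[OF M]])
 have tx: "tens M x = tensor_null A M N +>\<^bsub>free_module A ?V\<^esub> free_gen A ?V (x, 1)"
  by (simp add: tens_def pure_tensor_eq[OF M])
 have "free_gen A ?V (x, 1) : tens M x" unfolding tx by (rule S.a_rcos_self[OF e])
 hence g: "g : tens M x" unfolding g_def by (rule someI[of "%g. g : tens M x"])
 have gP: "g : carrier (free_module A ?V)"
  using g S.a_rcosets_carrier[OF P.a_rcosetsI[OF S.a_subset e]] unfolding tx by auto
 have "tensor_map A M M' N u (tens M x) = free_ext A ?T ?V ?h g"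
  by (simp add: tensor_map_def Let_def g_def free_ext_def N_sel)
 also have "... = free_ext A ?T ?V ?h (free_gen A ?V (x, 1))"
 proof (rule kill_relations[OF M module_tensor[OF M'] free_ext_hom[OF module_tensor[OF M'] hV] _ gP e])
  show "free_ext A ?T ?V ?h r = \<zero>\<^bsub>?T\<^esub>" if "r : tensor_relations A M N" for r
   by (rule free_ext_kill_relations[OF M module_tensor[OF M'] _ _ _ _ _ that])
    (auto simp: M't um module_hom_add[OF u] module_hom_smult[OF u] c2)
  show "tensor_null A M N +>\<^bsub>free_module A ?V\<^esub> g = tensor_null A M N +>\<^bsub>free_module A ?V\<^esub> free_gen A ?V (x, 1)"
   using g e S.a_repr_independence' unfolding tx by metis
 qed
 also have "... = ?h (x, 1)"
  by (rule free_ext_gen[OF module_tensor[OF M'] hV]) (use x in auto)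
 finally show ?thesis by (simp add: tens_def)
qed

end

context
 fixes B :: "'x set"
begin

abbreviation (input) "F \<equiv> free_module A B"

lemma mF: "module A F" by (rule module_free_module[OF A])

interpretation F: module A F by (rule mF)

text \<open>Every coordinate is replaced by the constant with the same residue. Tensoring with the
  residue field does not see this replacement (\<open>tens_hat\<close>).\<close>

definition hat :: "('x => 'a) => ('x => 'a)" where
 "hat f = (\<lambda>b\<in>B. phh (\<pi> (f b)))"

lemma hat_mem:
 assumes "f : carrier F"
 shows "hat f : carrier F"
 by (rule free_moduleI[OF rA])
  (auto simp: hat_def phi_simps intro!: finite_subset[OF _ free_module_fin[OF rA assms]], metis pi_zero phi_zero)

lemma tens_hat:
 assumes "f : carrier F"
 shows "tens F f = tens F (hat f)"
 using A assms
proof (induction rule: free_module_induct)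
 case zero
 have "hat \<zero>\<^bsub>F\<^esub> = \<zero>\<^bsub>F\<^esub>"
  by (auto simp: hat_def free_module_sel[OF rA] pi_zero phi_zero)
 thus ?case by simp
next
 case (step f a x)
 let ?e = "free_gen A B x"
 have a: "a : carrier A" using step by simp
 have e: "?e : carrier F" by (rule free_gen_closed[OF A])
 have "hat (f \<oplus>\<^bsub>F\<^esub> a \<odot>\<^bsub>F\<^esub> ?e) = hat f \<oplus>\<^bsub>F\<^esub> phh (\<pi> a) \<odot>\<^bsub>F\<^esub> ?e"
  by (rule free_module_ext[OF rA hat_mem])
   (use step e in \<open>auto simp: hat_def free_module_apply[OF rA] free_module_val[OF rA] free_gen_apply
    pi_simps phi_simps pi_zero phi_zero hat_mem F.smult_closed[OF phi_simps(1)]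
    intro!: F.add.m_closed hat_mem[unfolded hat_def]\<close>)
 moreover have "tens F (a \<odot>\<^bsub>F\<^esub> ?e) = tens F (phh (\<pi> a) \<odot>\<^bsub>F\<^esub> ?e)"
  using pure_tensor_smult[OF mF e a, of 1] pure_tensor_smult2[OF mF e a, of 1]
   pure_tensor_tens[OF mF e, of "\<pi> a"]
  by (simp add: tens_def)
 ultimately show ?case using step e hat_mem[OF step(1)]
  by (simp add: module_hom_add[OF tens_hom[OF mF]] phi_simps)
qed

text \<open>If all residues vanish, then \<open>hat f\<close> is zero. Conversely, reading off the
  residue of one coordinate and multiplying by the scalar in the second factor is a bilinear
  functional on F and N, hence it vanishes on a vanishing tensor. Tensoring a free module with the
  residue field is thus reduction of coordinates.\<close>

lemma tens_zero_iff:
 assumes f: "f : carrier F"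
 shows "tens F f = \<zero>\<^bsub>tensor A F N\<^esub> \<longleftrightarrow> (\<forall>b\<in>B. \<pi> (f b) = 0)"
proof
 assume "\<forall>b\<in>B. \<pi> (f b) = 0"
 hence "hat f = \<zero>\<^bsub>F\<^esub>" by (auto simp: hat_def free_module_sel[OF rA] phi_zero)
 thus "tens F f = \<zero>\<^bsub>tensor A F N\<^esub>"
  using tens_hat[OF f] module_hom_zero[OF mF module_tensor[OF mF] tens_hom[OF mF]] by simp
next
 assume z: "tens F f = \<zero>\<^bsub>tensor A F N\<^esub>"
 let ?V = "carrier F \<times> (UNIV :: 'k set)"
 interpret P: module A "free_module A ?V" by (rule module_free_module[OF A])
 show "\<forall>b\<in>B. \<pi> (f b) = 0"
 proof
  fix b assume b: "b : B"
  let ?h = "%p::('x => 'a) \<times> 'k. \<pi> (fst p b) * snd p"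
  have hV: "?h : ?V \<rightarrow> carrier N" by (auto simp: N_sel)
  have "free_ext A N ?V ?h (free_gen A ?V (f, 1)) = free_ext A N ?V ?h \<zero>\<^bsub>free_module A ?V\<^esub>"
  proof (rule kill_relations[OF mF module_N free_ext_hom[OF module_N hV] _ gen_in_P[OF mF]])
   show "free_ext A N ?V ?h r = \<zero>\<^bsub>N\<^esub>" if "r : tensor_relations A F N" for r
    by (rule free_ext_kill_relations[OF mF module_N _ _ _ _ _ that])
     (use b in \<open>auto simp: N_sel free_module_apply[OF rA] free_module_val[OF rA] pi_simps algebra_simps\<close>)
   show "tensor_null A F N +>\<^bsub>free_module A ?V\<^esub> free_gen A ?V (f, 1) =
    tensor_null A F N +>\<^bsub>free_module A ?V\<^esub> \<zero>\<^bsub>free_module A ?V\<^esub>"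
    using z by (simp add: tens_def pure_tensor_eq[OF mF] tensor_eq[OF mF]
     quot_coset_zero[OF submodule_tensor_null[OF mF]])
  qed auto
  also have "... = 0"
   using module_hom_zero[OF module_free_module[OF A] module_N free_ext_hom[OF module_N hV]]
   by (simp add: N_sel)
  finally show "\<pi> (f b) = 0"
   using free_ext_gen[OF module_N hV, of "(f, 1)"] f by simp
 qed
qed

end

end

section \<open>Comparison of free resolutions\<close>

text \<open>Free modules are projective: preimages are chosen for the basis and extended
  linearly.\<close>

lemma free_lift:
 assumes A: "cring A" and L: "module A L" and Y: "module A Y"
  and u: "u : module_hom A (free_module A V) L" and v: "v : module_hom A Y L"
  and im: "!!x. x : V ==> u (free_gen A V x) : v ` carrier Y"
 obtains w where "w : module_hom A (free_module A V) Y"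
  "!!f. f : carrier (free_module A V) ==> v (w f) = u f"
proof -
 obtain g where g: "!!x. x : V ==> g x : carrier Y" "!!x. x : V ==> v (g x) = u (free_gen A V x)"
  using im by (simp add: image_iff) metis
 let ?w = "free_ext A Y V g"
 have gV: "g : V \<rightarrow> carrier Y" using g by auto
 have w: "?w : module_hom A (free_module A V) Y" by (rule free_ext_hom[OF Y gV])
 have "(v \<circ> ?w) f = u f" if "f : carrier (free_module A V)" for f
  by (rule module_hom_eqI[OF A L module_hom_comp[OF w v] u _ that])
   (simp add: free_ext_gen[OF Y gV] g)
 with w that show ?thesis by auto
qed

lemma free_resolutionD:
 assumes "free_resolution A M B d \<epsilon>"
 shows "\<epsilon> : module_hom A (free_module A (B 0)) M"
  and "d j : module_hom A (free_module A (B (Suc j))) (free_module A (B j))"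
  and "\<epsilon> ` carrier (free_module A (B 0)) = carrier M"
  and "f : carrier (free_module A (B 1)) ==> \<epsilon> (d 0 f) = \<zero>\<^bsub>M\<^esub>"
  and "f : carrier (free_module A (B 0)) ==> \<epsilon> f = \<zero>\<^bsub>M\<^esub> ==> f : d 0 ` carrier (free_module A (B 1))"
  and "f : carrier (free_module A (B (Suc (Suc j)))) ==> d j (d (Suc j) f) = \<zero>\<^bsub>free_module A (B j)\<^esub>"
  and "f : carrier (free_module A (B (Suc j))) ==> d j f = \<zero>\<^bsub>free_module A (B j)\<^esub> ==>
   f : d (Suc j) ` carrier (free_module A (B (Suc (Suc j))))"
 using assms unfolding free_resolution_def Let_def by blast+

context
 fixes A :: "('a, 'm) ring_scheme" and M :: "('a, 'b, 'r) module_scheme" and B d \<epsilon> B' d' \<epsilon>'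
 assumes A: "cring A" and M: "module A M"
  and res: "free_resolution A M B d \<epsilon>" and res': "free_resolution A M B' d' \<epsilon>'"
begin

abbreviation (input) "F i \<equiv> free_module A (B i :: nat set)"
abbreviation (input) "F' i \<equiv> free_module A (B' i :: nat set)"

lemmas mF = module_free_module[OF A]
lemmas D = free_resolutionD[OF res] and D' = free_resolutionD[OF res']

text \<open>A lift in degree n continues to degree n+1 because its composite with the differential
  lands in cycles of the other resolution, which are boundaries there. That containment is carried
  along in the invariant \<open>?P\<close>, which puts the construction into the form of a dependent
  choice.\<close>

lemma chain_lift:
 obtains al where "!!j. al j : module_hom A (F j) (F' j)"
  "!!f. f : carrier (F 0) ==> \<epsilon>' (al 0 f) = \<epsilon> f"
  "!!j f. f : carrier (F (Suc j)) ==> d' j (al (Suc j) f) = al j (d j f)"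
proof -
 let ?P = "%n a. a : module_hom A (F n) (F' n) & (n = 0 --> (\<forall>f\<in>carrier (F 0). \<epsilon>' (a f) = \<epsilon> f)) &
  (\<forall>f\<in>carrier (F (Suc n)). a (d n f) : d' n ` carrier (F' (Suc n)))"
 let ?Q = "%n a b. \<forall>f\<in>carrier (F (Suc n)). d' n (b f) = a (d n f)"
 have "EX a. \<forall>n. ?P n (a n) & ?Q n (a n) (a (Suc n))"
 proof (rule dependent_nat_choice[of ?P ?Q])
  have im: "!!x. x : B 0 ==> \<epsilon> (free_gen A (B 0) x) : \<epsilon>' ` carrier (F' 0)"
   unfolding D'(3) by (rule module_hom_mem[OF D(1) free_gen_closed[OF A]])
  obtain a where a: "a : module_hom A (F 0) (F' 0)" "!!f. f : carrier (F 0) ==> \<epsilon>' (a f) = \<epsilon> f"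
   by (rule free_lift[OF A M mF D(1) D'(1) im]) (assumption, rule that)
  have "a (d 0 f) : d' 0 ` carrier (F' 1)" if f: "f : carrier (F 1)" for f
  proof -
   have df: "d 0 f : carrier (F 0)" using module_hom_mem[OF D(2)[of 0]] f by simp
   show ?thesis by (rule D'(5)) (use a df D(4)[OF f] module_hom_mem[OF a(1)] in auto)
  qed
  with a show "EX a. ?P 0 a" by (intro exI[of _ a]) auto
 next
  fix a n assume P: "?P n a"
  hence a: "a : module_hom A (F n) (F' n)" by (rule conjunct1)
  have u: "a \<circ> d n : module_hom A (F (Suc n)) (F' n)" by (rule module_hom_comp[OF D(2) a])
  have im: "!!x. x : B (Suc n) ==> (a \<circ> d n) (free_gen A (B (Suc n)) x) : d' n ` carrier (F' (Suc n))"
   unfolding comp_def by (rule bspec[OF P[THEN conjunct2, THEN conjunct2] free_gen_closed[OF A]])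
  obtain b where b: "b : module_hom A (F (Suc n)) (F' (Suc n))"
   "!!f. f : carrier (F (Suc n)) ==> d' n (b f) = (a \<circ> d n) f"
   by (rule free_lift[OF A mF mF u D'(2) im]) (assumption, rule that)
  have "b (d (Suc n) f) : d' (Suc n) ` carrier (F' (Suc (Suc n)))" if f: "f : carrier (F (Suc (Suc n)))" for f
  proof -
   have df: "d (Suc n) f : carrier (F (Suc n))" by (rule module_hom_mem[OF D(2) f])
   show ?thesis
    by (rule D'(7)[OF module_hom_mem[OF b(1) df]])
     (simp add: b(2)[OF df] D(6)[OF f] module_hom_zero[OF mF mF a])
  qed
  with b show "EX b. ?P (Suc n) b & ?Q n a b" by (intro exI[of _ b]) auto
 qed
 then obtain a where a: "\<forall>n. ?P n (a n) & ?Q n (a n) (a (Suc n))" ..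
 show ?thesis by (rule that[of a]) (use a in simp_all)
qed

text \<open>The invariant \<open>?P\<close> records that d' s d = (al - \<beta>) d. It makes al -
  \<beta> - s d a cycle in the next degree, so exactness supplies the next component of the
  homotopy.\<close>

lemma chain_homotopy:
 assumes al: "!!j. al j : module_hom A (F j) (F' j)" and be: "!!j. \<beta> j : module_hom A (F j) (F' j)"
  and e: "!!f. f : carrier (F 0) ==> \<epsilon>' (al 0 f) = \<epsilon>' (\<beta> 0 f)"
  and ca: "!!j f. f : carrier (F (Suc j)) ==> d' j (al (Suc j) f) = al j (d j f)"
  and cb: "!!j f. f : carrier (F (Suc j)) ==> d' j (\<beta> (Suc j) f) = \<beta> j (d j f)"
 obtains s where "!!j. s j : module_hom A (F j) (F' (Suc j))"
  "!!f. f : carrier (F 0) ==> d' 0 (s 0 f) = al 0 f \<ominus>\<^bsub>F' 0\<^esub> \<beta> 0 f"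
  "!!j f. f : carrier (F (Suc j)) ==>
   d' (Suc j) (s (Suc j) f) = al (Suc j) f \<ominus>\<^bsub>F' (Suc j)\<^esub> \<beta> (Suc j) f \<ominus>\<^bsub>F' (Suc j)\<^esub> s j (d j f)"
proof -
 let ?P = "%n s. s : module_hom A (F n) (F' (Suc n)) &
  (n = 0 --> (\<forall>f\<in>carrier (F 0). d' 0 (s f) = al 0 f \<ominus>\<^bsub>F' 0\<^esub> \<beta> 0 f)) &
  (\<forall>f\<in>carrier (F (Suc n)). d' n (s (d n f)) = al n (d n f) \<ominus>\<^bsub>F' n\<^esub> \<beta> n (d n f))"
 let ?Q = "%n s t. \<forall>f\<in>carrier (F (Suc n)).
  d' (Suc n) (t f) = al (Suc n) f \<ominus>\<^bsub>F' (Suc n)\<^esub> \<beta> (Suc n) f \<ominus>\<^bsub>F' (Suc n)\<^esub> s (d n f)"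
 have "EX s. \<forall>n. ?P n (s n) & ?Q n (s n) (s (Suc n))"
 proof (rule dependent_nat_choice[of ?P ?Q])
  interpret F0: module A "F' 0" by (rule mF)
  interpret M: module A M by (rule M)
  have u: "(%f. al 0 f \<ominus>\<^bsub>F' 0\<^esub> \<beta> 0 f) : module_hom A (F 0) (F' 0)"
   by (rule module_hom_fun_minus[OF mF mF al be])
  have im: "al 0 f \<ominus>\<^bsub>F' 0\<^esub> \<beta> 0 f : d' 0 ` carrier (F' (Suc 0))" if f: "f : carrier (F 0)" for f
   using D'(5)[of "al 0 f \<ominus>\<^bsub>F' 0\<^esub> \<beta> 0 f"] f module_hom_mem[OF al f] module_hom_mem[OF be f]
    module_hom_minus[OF mF M D'(1)] e[OF f] module_hom_mem[OF D'(1)]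
   by (simp add: a_minus_def M.r_neg)
  obtain s where s: "s : module_hom A (F 0) (F' (Suc 0))"
   "!!f. f : carrier (F 0) ==> d' 0 (s f) = al 0 f \<ominus>\<^bsub>F' 0\<^esub> \<beta> 0 f"
   by (rule free_lift[OF A mF mF u D'(2) im[OF free_gen_closed[OF A]]]) (rule that)
  thus "EX s. ?P 0 s" using module_hom_mem[OF D(2)] by (intro exI[of _ s]) auto
 next
  fix s n assume P: "?P n s"
  interpret Fn: module A "F' n" by (rule mF)
  interpret Fn1: module A "F' (Suc n)" by (rule mF)
  interpret Fn2: module A "F' (Suc (Suc n))" by (rule mF)
  have s: "s : module_hom A (F n) (F' (Suc n))" by (rule conjunct1[OF P])
  let ?u = "%f. al (Suc n) f \<ominus>\<^bsub>F' (Suc n)\<^esub> \<beta> (Suc n) f \<ominus>\<^bsub>F' (Suc n)\<^esub> s (d n f)"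
  have u: "?u : module_hom A (F (Suc n)) (F' (Suc n))"
   using module_hom_fun_minus[OF mF mF module_hom_fun_minus[OF mF mF al be] module_hom_comp[OF D(2) s]]
   by (simp add: comp_def)
  have im: "?u f : d' (Suc n) ` carrier (F' (Suc (Suc n)))" if f: "f : carrier (F (Suc n))" for f
  proof (rule D'(7))
   have df: "d n f : carrier (F n)" by (rule module_hom_mem[OF D(2) f])
   note mem = module_hom_mem[OF al f] module_hom_mem[OF be f] module_hom_mem[OF s df]
    module_hom_mem[OF al df] module_hom_mem[OF be df]
   show "?u f : carrier (F' (Suc n))" by (rule module_hom_mem[OF u f])
   have "d' n (?u f) = d' n (al (Suc n) f) \<ominus>\<^bsub>F' n\<^esub> d' n (\<beta> (Suc n) f) \<ominus>\<^bsub>F' n\<^esub> d' n (s (d n f))"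
    using mem by (simp add: module_hom_minus[OF mF mF D'(2)])
   thus "d' n (?u f) = \<zero>\<^bsub>F' n\<^esub>"
    using P f mem by (simp add: ca cb a_minus_def Fn.r_neg)
  qed
  obtain t where t: "t : module_hom A (F (Suc n)) (F' (Suc (Suc n)))"
   "!!f. f : carrier (F (Suc n)) ==> d' (Suc n) (t f) = ?u f"
   by (rule free_lift[OF A mF mF u D'(2) im[OF free_gen_closed[OF A]]]) (rule that)
  have "d' (Suc n) (t (d (Suc n) f)) =
   al (Suc n) (d (Suc n) f) \<ominus>\<^bsub>F' (Suc n)\<^esub> \<beta> (Suc n) (d (Suc n) f)" if f: "f : carrier (F (Suc (Suc n)))" for f
  proof -
   have df: "d (Suc n) f : carrier (F (Suc n))" by (rule module_hom_mem[OF D(2) f])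
   show ?thesis using t(2)[OF df] module_hom_mem[OF al df] module_hom_mem[OF be df]
    by (simp add: D(6)[OF f] module_hom_zero[OF mF mF s] a_minus_def)
  qed
  with t show "EX t. ?P (Suc n) t & ?Q n s t" by (intro exI[of _ t]) auto
 qed
 then obtain s where s: "\<forall>n. ?P n (s n) & ?Q n (s n) (s (Suc n))" ..
 show ?thesis by (rule that[of s]) (use s in simp_all)
qed

end

lemma (in abelian_group) a_minus_zero: "x : carrier G ==> x \<ominus> \<zero> = x"
 unfolding a_minus_def by (metis a_inv_closed l_neg r_zero zero_closed)

context residue_field
begin

interpretation A: cring A by (rule A)

abbreviation (input) vanishes :: "'x set => ('x => 'a) => bool" where
 "vanishes V f \<equiv> \<forall>b\<in>V. \<pi> (f b) = 0"

lemma pi_at: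
 assumes "f : carrier (free_module A V)" "b : V"
 shows "g : carrier (free_module A V) ==> \<pi> ((f \<oplus>\<^bsub>free_module A V\<^esub> g) b) = \<pi> (f b) + \<pi> (g b)"
  and "a : carrier A ==> \<pi> ((a \<odot>\<^bsub>free_module A V\<^esub> f) b) = \<pi> a * \<pi> (f b)"
  and "\<pi> (\<zero>\<^bsub>free_module A V\<^esub> b) = 0"
 using assms free_module_val[OF rA assms] free_module_val[OF rA _ assms(2), of g]
 by (simp_all add: free_module_apply[OF rA] pi_simps pi_zero)

text \<open>A vector with vanishing residues becomes zero after tensoring, and \<open>u\<close>
  induces a map between the tensor products; so its image becomes zero as well.\<close>

lemma hom_vanishes:
 assumes u: "u : module_hom A (free_module A V) (free_module A W)"
  and f: "f : carrier (free_module A V)" and v: "vanishes V f"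
 shows "vanishes W (u f)"
proof -
 interpret W: module A "free_module A W" by (rule mF)
 have t: "module A (tensor A (free_module A W) N)" by (rule module_tensor[OF mF])
 interpret T: module A "tensor A (free_module A W) N" by (rule t)
 let ?D = "tensor_map A (free_module A V) (free_module A W) N u"
 interpret V: module A "free_module A V" by (rule mF)
 have z: "tens (free_module A V) f = tens (free_module A V) \<zero>\<^bsub>free_module A V\<^esub>"
  using tens_zero_iff[OF f] v module_hom_zero[OF mF module_tensor[OF mF] tens_hom[OF mF], of V] by simp
 have "tens (free_module A W) (u f) = ?D (tens (free_module A V) f)"
  by (rule tensor_map_tens[OF mF mF u f, symmetric])
 also have "... = ?D (tens (free_module A V) \<zero>\<^bsub>free_module A V\<^esub>)" using z by simp
 also have "... = tens (free_module A W) (u \<zero>\<^bsub>free_module A V\<^esub>)"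
  by (rule tensor_map_tens[OF mF mF u]) simp
 also have "... = \<zero>\<^bsub>tensor A (free_module A W) N\<^esub>"
  by (simp add: module_hom_zero[OF mF mF u] module_hom_zero[OF mF t tens_hom[OF mF]])
 finally show ?thesis using tens_zero_iff[OF module_hom_mem[OF u f]] by simp
qed

lemma vanishes_minus:
 assumes "f : carrier (free_module A V)" "g : carrier (free_module A V)"
 shows "vanishes V (f \<ominus>\<^bsub>free_module A V\<^esub> g) \<longleftrightarrow> (\<forall>b\<in>V. \<pi> (f b) = \<pi> (g b))"
proof -
 interpret V: module A "free_module A V" by (rule mF)
 have "\<pi> ((f \<ominus>\<^bsub>free_module A V\<^esub> g) b) = \<pi> (f b) - \<pi> (g b)" if b: "b : V" for b
 proof -
  have "f b = (f \<ominus>\<^bsub>free_module A V\<^esub> g \<oplus>\<^bsub>free_module A V\<^esub> g) b"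
   using assms by (simp add: a_minus_def V.a_assoc V.l_neg)
  hence "\<pi> (f b) = \<pi> ((f \<ominus>\<^bsub>free_module A V\<^esub> g) b) + \<pi> (g b)"
   using pi_at(1)[OF V.minus_closed[OF assms] b assms(2)] by simp
  thus ?thesis by simp
 qed
 thus ?thesis by auto
qed

text \<open>Representatives in the free module of the cycles of the complex tensored with the
  residue field. In degree 0 every element qualifies.\<close>

definition reduced_cycles ::
  "(nat => nat set) => (nat => (nat => 'a) => nat => 'a) => nat => (nat => 'a) set" where
 "reduced_cycles B d j = {f : carrier (free_module A (B j)). \<forall>i. j = Suc i --> vanishes (B i) (d i f)}"

context
 fixes B :: "nat => nat set" and d :: "nat => (nat => 'a) => nat => 'a"
 assumes d: "!!j. d j : module_hom A (free_module A (B (Suc j))) (free_module A (B j))"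
  and dd: "!!j f. f : carrier (free_module A (B (Suc (Suc j)))) ==>
   d j (d (Suc j) f) = \<zero>\<^bsub>free_module A (B j)\<^esub>"
begin

text \<open>\<open>\<kappa>\<close> sends f to the class of f \<otimes> 1. Its properties replace
  the tensor products and the quotient modules in the definition of Tor by conditions on residues of
  coordinates, and nothing after this lemma opens a tensor product again except through
  them.\<close>

lemma tor_of_resolution_quotient:
 fixes j
 defines "T \<equiv> tor_of_resolution A B d N j"
 obtains \<kappa> where "module A T"
  "!!f. f : reduced_cycles B d j ==> \<kappa> f : carrier T"
  "!!f g. f : reduced_cycles B d j ==> g : reduced_cycles B d j ==>
   \<kappa> (f \<oplus>\<^bsub>free_module A (B j)\<^esub> g) = \<kappa> f \<oplus>\<^bsub>T\<^esub> \<kappa> g"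
  "!!a f. a : carrier A ==> f : reduced_cycles B d j ==>
   \<kappa> (a \<odot>\<^bsub>free_module A (B j)\<^esub> f) = a \<odot>\<^bsub>T\<^esub> \<kappa> f"
  "!!t. t : carrier T ==> \<exists>f\<in>reduced_cycles B d j. t = \<kappa> f"
  "!!f. f : reduced_cycles B d j ==> \<kappa> f = \<zero>\<^bsub>T\<^esub> \<longleftrightarrow>
   (\<exists>g\<in>carrier (free_module A (B (Suc j))). \<forall>b\<in>B j. \<pi> (f b) = \<pi> (d j g b))"
proof -
 let ?F = "%i. free_module A (B i)" and ?C = "%i. tensor A (free_module A (B i)) N"
 let ?D = "%i. tensor_map A (?F (Suc i)) (?F i) N (d i)"
 let ?Z = "case j of 0 => carrier (?C 0) | Suc i => {t : carrier (?C (Suc i)). ?D i t = \<zero>\<^bsub>?C i\<^esub>}"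
 let ?U = "?D j ` carrier (?C (Suc j))" and ?t = "tens (?F j)"
 have mC: "module A (?C i)" for i by (rule module_tensor[OF mF])
 interpret F: module A "?F j" by (rule mF)
 interpret F1: module A "?F (Suc j)" by (rule mF)
 interpret C: module A "?C j" by (rule mC)
 interpret t: mod_hom A "?F j" "?C j" ?t by (rule mod_homI[OF mF mC tens_hom[OF mF]])
 have Dt: "?D i (tens (?F (Suc i)) f) = tens (?F i) (d i f)" if "f : carrier (?F (Suc i))" for i f
  by (rule tensor_map_tens[OF mF mF d that])
 have car: "carrier (?C i) = tens (?F i) ` carrier (?F i)" for i
  using tens_surj[OF mF] module_hom_mem[OF tens_hom[OF mF]] by (auto simp: image_iff)
 have Z: "?Z = ?t ` reduced_cycles B d j"
 proof (cases j)
  case (Suc i)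
  have "?D i (tens (?F (Suc i)) f) = \<zero>\<^bsub>?C i\<^esub> \<longleftrightarrow> vanishes (B i) (d i f)" if f: "f : carrier (?F (Suc i))" for f
   unfolding Dt[OF f] by (rule tens_zero_iff[OF module_hom_mem[OF d f]])
  thus ?thesis by (auto simp: Suc reduced_cycles_def car)
 qed (simp add: car reduced_cycles_def)
 have rc: "f : carrier (?F j)" if "f : reduced_cycles B d j" for f using that by (simp add: reduced_cycles_def)
 have rc0: "\<zero>\<^bsub>?F j\<^esub> : reduced_cycles B d j"
  by (auto simp: reduced_cycles_def module_hom_zero[OF mF mF d] free_module_apply[OF rA] pi_zero)
 have rca: "f \<oplus>\<^bsub>?F j\<^esub> g : reduced_cycles B d j" if "f : reduced_cycles B d j" "g : reduced_cycles B d j" for f g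
  using that module_hom_mem[OF d]
  by (auto simp: reduced_cycles_def module_hom_add[OF d] pi_at)
 have rcs: "a \<odot>\<^bsub>?F j\<^esub> f : reduced_cycles B d j" if "a : carrier A" "f : reduced_cycles B d j" for f a
  using that module_hom_mem[OF d]
  by (auto simp: reduced_cycles_def module_hom_smult[OF d] pi_at)
 have sZ: "submodule A ?Z (?C j)"
 proof (rule submodule.intro[OF mC])
  show "?Z <= carrier (?C j)" unfolding Z using rc by auto
  show "\<zero>\<^bsub>?C j\<^esub> : ?Z" using imageI[OF rc0, of ?t] unfolding Z t.f0_is_0 .
  show "v \<oplus>\<^bsub>?C j\<^esub> w : ?Z" if vw: "v : ?Z" "w : ?Z" for v w
  proof -
   obtain f g where fg: "f : reduced_cycles B d j" "g : reduced_cycles B d j" "v = ?t f" "w = ?t g"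
    using vw unfolding Z by auto
   show ?thesis unfolding Z
    by (rule image_eqI[OF _ rca[OF fg(1,2)]]) (simp add: fg rc t.f_add)
  qed
  show "a \<odot>\<^bsub>?C j\<^esub> v : ?Z" if a: "a : carrier A" and v: "v : ?Z" for a v
  proof -
   obtain f where f: "f : reduced_cycles B d j" "v = ?t f" using v unfolding Z by auto
   show ?thesis unfolding Z
    by (rule image_eqI[OF _ rcs[OF a f(1)]]) (simp add: f rc a t.f_smult)
  qed
 qed
 let ?M = "(?C j)\<lparr>carrier := ?Z\<rparr>"
 have mM: "module A ?M" by (rule C.submodule_is_module[OF sZ])
 interpret Mm: module A ?M by (rule mM)
 have U: "?U = ?t ` d j ` carrier (?F (Suc j))" by (auto simp: car Dt image_image)
 have dj: "d j g : reduced_cycles B d j" if "g : carrier (?F (Suc j))" for g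
  using that module_hom_mem[OF d that]
  by (auto simp: reduced_cycles_def dd free_module_apply[OF rA] pi_zero)
 have sU: "submodule A ?U ?M"
 proof (rule submodule.intro[OF mM])
  show "?U <= carrier ?M" unfolding U using dj by (auto simp: Z)
  show "\<zero>\<^bsub>?M\<^esub> : ?U" unfolding U image_image
   by (rule image_eqI[OF _ F1.zero_closed]) (simp add: module_hom_zero[OF mF mF d, of j])
  show "v \<oplus>\<^bsub>?M\<^esub> w : ?U" if vw: "v : ?U" "w : ?U" for v w
  proof -
   obtain g h where g: "g : carrier (?F (Suc j))" "v = ?t (d j g)" and h: "h : carrier (?F (Suc j))" "w = ?t (d j h)"
    using vw unfolding U by auto
   have "v \<oplus>\<^bsub>?M\<^esub> w = ?t (d j (g \<oplus>\<^bsub>?F (Suc j)\<^esub> h))"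
    using g h module_hom_mem[OF d] by (simp add: module_hom_add[OF d])
   thus ?thesis using g h unfolding U by auto
  qed
  show "a \<odot>\<^bsub>?M\<^esub> v : ?U" if a: "a : carrier A" and v: "v : ?U" for a v
  proof -
   obtain g where g: "g : carrier (?F (Suc j))" "v = ?t (d j g)" using v unfolding U by auto
   have "a \<odot>\<^bsub>?M\<^esub> v = ?t (d j (a \<odot>\<^bsub>?F (Suc j)\<^esub> g))"
    using g a module_hom_mem[OF d] by (simp add: module_hom_smult[OF d])
   thus ?thesis using g a unfolding U by auto
  qed
 qed
 have T: "T = quot_module ?M ?U" by (simp add: T_def tor_of_resolution_def Let_def)
 let ?k = "%f. ?U +>\<^bsub>?M\<^esub> ?t f"
 have tm: "?t f : carrier ?M" if "f : reduced_cycles B d j" for f using that by (simp add: Z)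
 show ?thesis
 proof (rule that[of ?k])
  show "module A T" unfolding T by (rule module_quot_module[OF sU])
  show "?k f : carrier T" if "f : reduced_cycles B d j" for f
   unfolding T by (rule quot_coset_mem[OF sU tm[OF that]])
  show "?k (f \<oplus>\<^bsub>?F j\<^esub> g) = ?k f \<oplus>\<^bsub>T\<^esub> ?k g" if "f : reduced_cycles B d j" "g : reduced_cycles B d j" for f g
   unfolding T quot_coset_add[OF sU tm[OF that(1)] tm[OF that(2)]] using rc that by simp
  show "?k (a \<odot>\<^bsub>?F j\<^esub> f) = a \<odot>\<^bsub>T\<^esub> ?k f" if "a : carrier A" "f : reduced_cycles B d j" for a f
   unfolding T quot_coset_smult[OF sU that(1) tm[OF that(2)]] using rc that by simp
  show "\<exists>f\<in>reduced_cycles B d j. t = ?k f" if "t : carrier T" for t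
   using that unfolding T by (rule quot_coset_ex[OF sU]) (auto simp: Z)
  show "?k f = \<zero>\<^bsub>T\<^esub> \<longleftrightarrow> (\<exists>g\<in>carrier (?F (Suc j)). \<forall>b\<in>B j. \<pi> (f b) = \<pi> (d j g b))"
   if f: "f : reduced_cycles B d j" for f
  proof -
   have "?k f = \<zero>\<^bsub>T\<^esub> \<longleftrightarrow> ?t f \<ominus>\<^bsub>?M\<^esub> \<zero>\<^bsub>?M\<^esub> : ?U"
    unfolding T quot_coset_zero[OF sU] by (rule quot_coset_eq_iff[OF sU tm[OF f] Mm.zero_closed])
   also have "?t f \<ominus>\<^bsub>?M\<^esub> \<zero>\<^bsub>?M\<^esub> = ?t f"
    by (rule Mm.a_minus_zero[OF tm[OF f]])
   also have "?t f : ?U \<longleftrightarrow> (\<exists>g\<in>carrier (?F (Suc j)). ?t f = ?t (d j g))" unfolding U by auto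
   also have "... \<longleftrightarrow> (\<exists>g\<in>carrier (?F (Suc j)). \<forall>b\<in>B j. \<pi> (f b) = \<pi> (d j g b))"
   proof (rule bex_cong[OF refl])
    fix g assume g: "g : carrier (?F (Suc j))"
    note m = rc[OF f] module_hom_mem[OF d g]
    have "?t f = ?t (d j g) \<longleftrightarrow> ?t (f \<ominus>\<^bsub>?F j\<^esub> d j g) = \<zero>\<^bsub>?C j\<^esub>"
     using m by (simp add: C.minus_other_side)
    also have "... \<longleftrightarrow> (\<forall>b\<in>B j. \<pi> (f b) = \<pi> (d j g b))"
     using tens_zero_iff[of "f \<ominus>\<^bsub>?F j\<^esub> d j g" "B j"] vanishes_minus[OF m] m by simp
    finally show "?t f = ?t (d j g) \<longleftrightarrow> (\<forall>b\<in>B j. \<pi> (f b) = \<pi> (d j g b))" .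
   qed
   finally show ?thesis .
  qed
 qed
qed

end

text \<open>\<open>Tor\<close> uses a resolution picked by choice, of which only exactness is known
  and whose bases may be infinite. Comparison maps in both directions and the homotopies of their
  two composites transport the description to the given resolution with finite bases. There a class
  is represented by a coefficient vector over the field, and \<open>red\<close> is the differential
  with its entries reduced to residues.\<close>

lemma kdim_Tor_reduced:
 fixes M :: "('a, 'b, 'r) module_scheme" and B :: "nat => nat set"
 assumes M: "module A M" and res: "free_resolution A M B d \<epsilon>" and fin: "!!j. finite (B j)"
 defines "red \<equiv> %j v b. \<pi> (d j (\<lambda>x\<in>B (Suc j). phh (v x)) b)"
 obtains \<kappa> where "module A (Tor A j M N)"
  "!!v. v : {v. (\<forall>x. x ~: B j --> v x = 0) & (\<forall>i. j = Suc i --> (\<forall>b\<in>B i. red i v b = 0))} ==>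
   \<kappa> v : carrier (Tor A j M N)"
  "!!v w. v : {v. (\<forall>x. x ~: B j --> v x = 0) & (\<forall>i. j = Suc i --> (\<forall>b\<in>B i. red i v b = 0))} ==>
   w : {v. (\<forall>x. x ~: B j --> v x = 0) & (\<forall>i. j = Suc i --> (\<forall>b\<in>B i. red i v b = 0))} ==>
   \<kappa> (%x. v x + w x) = \<kappa> v \<oplus>\<^bsub>Tor A j M N\<^esub> \<kappa> w"
  "!!v c. v : {v. (\<forall>x. x ~: B j --> v x = 0) & (\<forall>i. j = Suc i --> (\<forall>b\<in>B i. red i v b = 0))} ==>
   \<kappa> (%x. c * v x) = phh c \<odot>\<^bsub>Tor A j M N\<^esub> \<kappa> v"
  "!!t. t : carrier (Tor A j M N) ==>
   \<exists>v\<in>{v. (\<forall>x. x ~: B j --> v x = 0) & (\<forall>i. j = Suc i --> (\<forall>b\<in>B i. red i v b = 0))}. t = \<kappa> v"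
  "!!v. v : {v. (\<forall>x. x ~: B j --> v x = 0) & (\<forall>i. j = Suc i --> (\<forall>b\<in>B i. red i v b = 0))} ==>
   \<kappa> v = \<zero>\<^bsub>Tor A j M N\<^esub> \<longleftrightarrow> (EX w. (\<forall>x. x ~: B (Suc j) --> w x = 0) & (\<forall>b\<in>B j. v b = red j w b))"
proof -
 let ?Z = "{v. (\<forall>x. x ~: B j --> v x = 0) & (\<forall>i. j = Suc i --> (\<forall>b\<in>B i. red i v b = 0))}"
 obtain C e \<eta> where Ce: "(C, e, \<eta>) = (SOME (C, e, \<eta>). free_resolution A M C e \<eta>)"
  by (metis prod_cases3)
 have "case (SOME (C, e, \<eta>). free_resolution A M C e \<eta>) of (C, e, \<eta>) => free_resolution A M C e \<eta>"
  by (rule someI[of _ "(B, d, \<epsilon>)"]) (simp add: res)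
 hence res': "free_resolution A M C e \<eta>" by (simp add: Ce[symmetric])
 have Tor: "Tor A j M N = tor_of_resolution A C e N j"
  by (simp add: Tor_def Ce[symmetric])
 let ?F = "%i. free_module A (C i)" and ?G = "%i. free_module A (B i)"
 note D = free_resolutionD[OF res] and D' = free_resolutionD[OF res']
 obtain \<psi> where ps: "!!j. \<psi> j : module_hom A (?G j) (?F j)"
  "!!f. f : carrier (?G 0) ==> \<eta> (\<psi> 0 f) = \<epsilon> f"
  "!!j f. f : carrier (?G (Suc j)) ==> e j (\<psi> (Suc j) f) = \<psi> j (d j f)"
  by (rule chain_lift[OF A M res res']) (rule that)
 obtain \<rho> where rh: "!!j. \<rho> j : module_hom A (?F j) (?G j)"
  "!!f. f : carrier (?F 0) ==> \<epsilon> (\<rho> 0 f) = \<eta> f"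
  "!!j f. f : carrier (?F (Suc j)) ==> d j (\<rho> (Suc j) f) = \<rho> j (e j f)"
  by (rule chain_lift[OF A M res' res]) (rule that)
 have idh: "(%x. x) : module_hom A K K" for K :: "('a, nat => 'a) module" by (simp add: module_hom_def)
 note pm = module_hom_mem[OF ps(1)] and rm = module_hom_mem[OF rh(1)]
 have h1: "(%f. \<psi> j (\<rho> j f)) : module_hom A (?F j) (?F j)" for j
  using module_hom_comp[OF rh(1) ps(1), of j] by (simp add: comp_def)
 have h2: "\<eta> (\<psi> 0 (\<rho> 0 f)) = \<eta> f" if "f : carrier (?F 0)" for f
  using that by (simp add: ps rh pm rm)
 have h3: "e j (\<psi> (Suc j) (\<rho> (Suc j) f)) = \<psi> j (\<rho> j (e j f))" if "f : carrier (?F (Suc j))" for j f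
  using that by (simp add: ps rh pm rm)
 obtain s where s: "!!j. s j : module_hom A (?F j) (?F (Suc j))"
  "!!f. f : carrier (?F 0) ==> e 0 (s 0 f) = \<psi> 0 (\<rho> 0 f) \<ominus>\<^bsub>?F 0\<^esub> f"
  "!!j f. f : carrier (?F (Suc j)) ==>
   e (Suc j) (s (Suc j) f) = \<psi> (Suc j) (\<rho> (Suc j) f) \<ominus>\<^bsub>?F (Suc j)\<^esub> f \<ominus>\<^bsub>?F (Suc j)\<^esub> s j (e j f)"
  by (rule chain_homotopy[OF A M res' res', where al = "%j f. \<psi> j (\<rho> j f)" and \<beta> = "%j f. f", OF h1 idh h2 h3 refl])
   ((assumption | rule that)+)
 have h1: "(%f. \<rho> j (\<psi> j f)) : module_hom A (?G j) (?G j)" for j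
  using module_hom_comp[OF ps(1) rh(1), of j] by (simp add: comp_def)
 have h2: "\<epsilon> (\<rho> 0 (\<psi> 0 f)) = \<epsilon> f" if "f : carrier (?G 0)" for f
  using that by (simp add: ps rh pm rm)
 have h3: "d j (\<rho> (Suc j) (\<psi> (Suc j) f)) = \<rho> j (\<psi> j (d j f))" if "f : carrier (?G (Suc j))" for j f
  using that by (simp add: ps rh pm rm)
 obtain s' where s': "!!j. s' j : module_hom A (?G j) (?G (Suc j))"
  "!!f. f : carrier (?G 0) ==> d 0 (s' 0 f) = \<rho> 0 (\<psi> 0 f) \<ominus>\<^bsub>?G 0\<^esub> f"
  "!!j f. f : carrier (?G (Suc j)) ==>
   d (Suc j) (s' (Suc j) f) = \<rho> (Suc j) (\<psi> (Suc j) f) \<ominus>\<^bsub>?G (Suc j)\<^esub> f \<ominus>\<^bsub>?G (Suc j)\<^esub> s' j (d j f)"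
  by (rule chain_homotopy[OF A M res res, where al = "%j f. \<rho> j (\<psi> j f)" and \<beta> = "%j f. f", OF h1 idh h2 h3 refl])
   ((assumption | rule that)+)
 have pi_m: "\<pi> ((f \<ominus>\<^bsub>free_module A V\<^esub> g) b) = \<pi> (f b) - \<pi> (g b)"
  if "f : carrier (free_module A V)" "g : carrier (free_module A V)" "b : V" for f g V and b :: nat
 proof -
  interpret V: module A "free_module A V" by (rule mF)
  have "f b = (f \<ominus>\<^bsub>free_module A V\<^esub> g \<oplus>\<^bsub>free_module A V\<^esub> g) b"
   using that by (simp add: a_minus_def V.a_assoc V.l_neg)
  thus ?thesis using pi_at(1)[OF V.minus_closed[OF that(1,2)] that(3,2)] by simp
 qed
 \<comment> \<open>On reduced cycles the round trip \<psi> \<rho> differs from the identity by a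
   boundary modulo residues: the second term of the homotopy formula is the image of
   \<open>e i f\<close>, whose residues vanish.\<close>
 have ret: "\<exists>g\<in>carrier (?F (Suc j)). \<forall>b\<in>C j. \<pi> (\<psi> j (\<rho> j f) b) - \<pi> (f b) = \<pi> (e j g b)"
  if f: "f : carrier (?F j)" and v: "!!i. j = Suc i ==> vanishes (C i) (e i f)" for f
 proof (rule bexI[of _ "s j f"])
  interpret Fj: module A "?F j" by (rule mF)
  show "s j f : carrier (?F (Suc j))" by (rule module_hom_mem[OF s(1) f])
  show "\<forall>b\<in>C j. \<pi> (\<psi> j (\<rho> j f) b) - \<pi> (f b) = \<pi> (e j (s j f) b)"
  proof (cases j)
   case 0
   thus ?thesis using s(2)[of f] f pi_m[OF pm[OF rm]] by simp
  next
   case (Suc i)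
   have f': "f : carrier (?F (Suc i))" using f Suc by simp
   have ef: "e i f : carrier (?F i)" by (rule module_hom_mem[OF D'(2) f'])
   have se: "vanishes (C (Suc i)) (s i (e i f))" by (rule hom_vanishes[OF s(1) ef v[OF Suc]])
   show ?thesis
    using s(3)[OF f'] f' se module_hom_mem[OF s(1) ef] pm[OF rm[OF f']] Fj.minus_closed
    by (simp add: Suc pi_m)
  qed
 qed
 have ret': "\<exists>g\<in>carrier (?G (Suc j)). \<forall>b\<in>B j. \<pi> (\<rho> j (\<psi> j f) b) - \<pi> (f b) = \<pi> (d j g b)"
  if f: "f : carrier (?G j)" and v: "!!i. j = Suc i ==> vanishes (B i) (d i f)" for f
 proof (rule bexI[of _ "s' j f"])
  interpret Gj: module A "?G j" by (rule mF)
  show "s' j f : carrier (?G (Suc j))" by (rule module_hom_mem[OF s'(1) f])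
  show "\<forall>b\<in>B j. \<pi> (\<rho> j (\<psi> j f) b) - \<pi> (f b) = \<pi> (d j (s' j f) b)"
  proof (cases j)
   case 0
   thus ?thesis using s'(2)[of f] f pi_m[OF rm[OF pm]] by simp
  next
   case (Suc i)
   have f': "f : carrier (?G (Suc i))" using f Suc by simp
   have ef: "d i f : carrier (?G i)" by (rule module_hom_mem[OF D(2) f'])
   have se: "vanishes (B (Suc i)) (s' i (d i f))" by (rule hom_vanishes[OF s'(1) ef v[OF Suc]])
   show ?thesis
    using s'(3)[OF f'] f' se module_hom_mem[OF s'(1) ef] rm[OF pm[OF f']] Gj.minus_closed
    by (simp add: Suc pi_m)
  qed
 qed
 define up where "up i v = (\<lambda>x\<in>B i. phh (v x))" for i and v :: "nat => 'k"
 have upm: "up i v : carrier (?G i)" for i v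
  by (rule free_moduleI[OF rA]) (auto simp: up_def phi_simps fin)
 have pup: "\<pi> (up i v b) = v b" if "b : B i" for i v b using that by (simp add: up_def pi_phi)
 have red: "red i v b = \<pi> (d i (up (Suc i) v) b)" for i v b by (simp add: red_def up_def)
 have up_add: "up i (%x. v x + w x) = up i v \<oplus>\<^bsub>?G i\<^esub> up i w" for i v w
  by (auto simp: up_def free_module_sel[OF rA] phi_simps)
 have up_sm: "up i (%x. c * v x) = phh c \<odot>\<^bsub>?G i\<^esub> up i v" for i v c
  by (auto simp: up_def free_module_sel[OF rA] phi_simps)
 have transfer: "\<forall>b\<in>W. \<pi> (u f b) = \<pi> (u g b)"
  if u: "u : module_hom A (free_module A V) (free_module A W)"
   and f: "f : carrier (free_module A V)" and g: "g : carrier (free_module A V)"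
   and e: "\<forall>b\<in>V. \<pi> (f b) = \<pi> (g b)" for u f g and V W :: "nat set"
 proof -
  interpret V: module A "free_module A V" by (rule mF)
  have "vanishes W (u (f \<ominus>\<^bsub>free_module A V\<^esub> g))"
   by (rule hom_vanishes[OF u V.minus_closed[OF f g]]) (use e vanishes_minus[OF f g] in simp)
  thus ?thesis
   using vanishes_minus[OF module_hom_mem[OF u f] module_hom_mem[OF u g]]
   by (simp add: module_hom_minus[OF mF mF u f g])
 qed
 obtain \<kappa> where k: "module A (Tor A j M N)"
  "!!f. f : reduced_cycles C e j ==> \<kappa> f : carrier (Tor A j M N)"
  "!!f g. f : reduced_cycles C e j ==> g : reduced_cycles C e j ==>
   \<kappa> (f \<oplus>\<^bsub>?F j\<^esub> g) = \<kappa> f \<oplus>\<^bsub>Tor A j M N\<^esub> \<kappa> g"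
  "!!a f. a : carrier A ==> f : reduced_cycles C e j ==>
   \<kappa> (a \<odot>\<^bsub>?F j\<^esub> f) = a \<odot>\<^bsub>Tor A j M N\<^esub> \<kappa> f"
  "!!t. t : carrier (Tor A j M N) ==> \<exists>f\<in>reduced_cycles C e j. t = \<kappa> f"
  "!!f. f : reduced_cycles C e j ==> \<kappa> f = \<zero>\<^bsub>Tor A j M N\<^esub> \<longleftrightarrow>
   (\<exists>g\<in>carrier (?F (Suc j)). \<forall>b\<in>C j. \<pi> (f b) = \<pi> (e j g b))"
  by (rule tor_of_resolution_quotient[where B = C and d = e and j = j, OF D'(2) D'(6), folded Tor])
   ((assumption | rule that)+)
 note rcd = reduced_cycles_def
 have psm: "\<psi> j (up j v) : reduced_cycles C e j" if v: "v : ?Z" for v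
  unfolding rcd
 proof (safe intro!: pm upm)
  fix i b assume j: "j = Suc i" and b: "b : C i"
  have "vanishes (B i) (d i (up (Suc i) v))" using v j by (auto simp: red)
  hence "vanishes (C i) (\<psi> i (d i (up (Suc i) v)))"
   by (rule hom_vanishes[OF ps(1) module_hom_mem[OF D(2) upm]])
  thus "\<pi> (e i (\<psi> (Suc i) (up (Suc i) v)) b) = 0" using b ps(3)[OF upm] by simp
 qed
 show ?thesis
 proof (rule that[of "%v. \<kappa> (\<psi> j (up j v))"])
  show "module A (Tor A j M N)" by (rule k)
  show "\<kappa> (\<psi> j (up j v)) : carrier (Tor A j M N)" if "v : ?Z" for v by (rule k(2)[OF psm[OF that]])
  show "\<kappa> (\<psi> j (up j (%x. v x + w x))) = \<kappa> (\<psi> j (up j v)) \<oplus>\<^bsub>Tor A j M N\<^esub> \<kappa> (\<psi> j (up j w))"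
   if "v : ?Z" "w : ?Z" for v w
   using k(3)[OF psm[OF that(1)] psm[OF that(2)]] by (simp add: up_add module_hom_add[OF ps(1)] upm)
  show "\<kappa> (\<psi> j (up j (%x. c * v x))) = phh c \<odot>\<^bsub>Tor A j M N\<^esub> \<kappa> (\<psi> j (up j v))" if "v : ?Z" for v c
   using k(4)[OF phi_simps(1) psm[OF that]] by (simp add: up_sm module_hom_smult[OF ps(1)] upm phi_simps)
  show "\<exists>v\<in>?Z. t = \<kappa> (\<psi> j (up j v))" if t: "t : carrier (Tor A j M N)" for t
  proof -
   obtain f where f: "f : reduced_cycles C e j" "t = \<kappa> f" using k(5)[OF t] by auto
   have fF: "f : carrier (?F j)" and fv: "!!i. j = Suc i ==> vanishes (C i) (e i f)"
    using f(1) unfolding rcd by auto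
   define v where "v = (%x. if x : B j then \<pi> (\<rho> j f x) else 0)"
   have pv: "\<forall>b\<in>B j. \<pi> (up j v b) = \<pi> (\<rho> j f b)" by (simp add: pup v_def)
   have vZ: "v : ?Z"
   proof (safe)
    fix i b assume j: "j = Suc i" and b: "b : B i"
    have fi: "f : carrier (?F (Suc i))" using fF j by simp
    have "\<pi> (d i (up (Suc i) v) b) = \<pi> (d i (\<rho> (Suc i) f) b)"
     using transfer[OF D(2) upm rm[OF fi]] pv b j by simp
    also have "... = \<pi> (\<rho> i (e i f) b)" using rh(3)[OF fi] by simp
    also have "... = 0" using hom_vanishes[OF rh(1) module_hom_mem[OF D'(2) fi] fv[OF j]] b by simp
    finally show "red i v b = 0" by (simp add: red)
   qed (simp add: v_def)
   interpret Fj: module A "?F j" by (rule mF)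
   interpret T: module A "Tor A j M N" by (rule k(1))
   obtain g where g: "g : carrier (?F (Suc j))" "\<forall>b\<in>C j. \<pi> (\<psi> j (\<rho> j f) b) - \<pi> (f b) = \<pi> (e j g b)"
    using ret[OF fF fv] by blast
   have h: "\<forall>b\<in>C j. \<pi> (\<psi> j (up j v) b) = \<pi> (\<psi> j (\<rho> j f) b)"
    by (rule transfer[OF ps(1) upm rm[OF fF] pv])
   \<comment> \<open>\<open>\<kappa>\<close> is known to respect sums and scalar multiples, so the
     difference of the two cycles is written with the scalar -1.\<close>
   let ?m = "\<ominus>\<^bsub>A\<^esub> \<one>\<^bsub>A\<^esub>"
   have m: "?m : carrier A" by simp
   have mf: "?m \<odot>\<^bsub>?F j\<^esub> f : reduced_cycles C e j"
    using f(1) m fF by (auto simp: rcd module_hom_smult[OF D'(2)] pi_at module_hom_mem[OF D'(2)])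
   have pmm: "\<pi> ?m = - 1" using pi_minus[of "\<zero>\<^bsub>A\<^esub>" "\<one>\<^bsub>A\<^esub>"] by (simp add: a_minus_def pi_zero pi_simps)
   let ?df = "\<psi> j (up j v) \<oplus>\<^bsub>?F j\<^esub> ?m \<odot>\<^bsub>?F j\<^esub> f"
   have dfr: "?df : reduced_cycles C e j"
   proof -
    have c1: "\<psi> j (up j v) : carrier (?F j)" and c2: "?m \<odot>\<^bsub>?F j\<^esub> f : carrier (?F j)"
     using psm[OF vZ] mf by (simp_all add: rcd)
    have "\<pi> (e i ?df b) = 0" if j: "j = Suc i" and b: "b : C i" for i b
    proof -
     have c: "\<psi> j (up j v) : carrier (?F (Suc i))" "?m \<odot>\<^bsub>?F j\<^esub> f : carrier (?F (Suc i))"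
     using c1 c2 j by simp_all
     have "e i ?df = e i (\<psi> j (up j v)) \<oplus>\<^bsub>?F i\<^esub> e i (?m \<odot>\<^bsub>?F j\<^esub> f)"
     using module_hom_add[OF D'(2) c] j by simp
     thus ?thesis
     using psm[OF vZ] mf j b pi_at(1)[OF module_hom_mem[OF D'(2) c(1)] b module_hom_mem[OF D'(2) c(2)]]
     by (simp add: rcd)
    qed
    with c1 c2 show ?thesis by (simp add: rcd)
   qed
   have "\<forall>b\<in>C j. \<pi> (?df b) = \<pi> (e j g b)"
    using g(2) h m fF by (simp add: pi_at pm upm pmm)
   hence "\<kappa> ?df = \<zero>\<^bsub>Tor A j M N\<^esub>" using k(6)[OF dfr] g(1) by blast
   moreover have "\<kappa> ?df = \<kappa> (\<psi> j (up j v)) \<oplus>\<^bsub>Tor A j M N\<^esub> \<ominus>\<^bsub>Tor A j M N\<^esub> \<kappa> f"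
    using k(3)[OF psm[OF vZ] mf] k(4)[OF m f(1)] T.smult_minus_1[OF k(2)[OF f(1)]] by simp
   ultimately have "\<kappa> (\<psi> j (up j v)) = \<kappa> f"
    using k(2)[OF f(1)] k(2)[OF psm[OF vZ]] by (metis T.minus_equality T.minus_minus T.a_inv_closed)
   thus ?thesis using f(2) vZ by auto
  qed
  show "\<kappa> (\<psi> j (up j v)) = \<zero>\<^bsub>Tor A j M N\<^esub> \<longleftrightarrow>
   (EX w. (\<forall>x. x ~: B (Suc j) --> w x = 0) & (\<forall>b\<in>B j. v b = red j w b))" if v: "v : ?Z" for v
   unfolding k(6)[OF psm[OF v]]
  proof
   assume "\<exists>g\<in>carrier (?F (Suc j)). \<forall>b\<in>C j. \<pi> (\<psi> j (up j v) b) = \<pi> (e j g b)"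
   then obtain g where g: "g : carrier (?F (Suc j))" "\<forall>b\<in>C j. \<pi> (\<psi> j (up j v) b) = \<pi> (e j g b)" by blast
   have "!!i. j = Suc i ==> vanishes (B i) (d i (up j v))" using v by (auto simp: red)
   then obtain h where h: "h : carrier (?G (Suc j))"
    "\<forall>b\<in>B j. \<pi> (\<rho> j (\<psi> j (up j v)) b) - \<pi> (up j v b) = \<pi> (d j h b)"
    using ret'[OF upm] by blast
   interpret G1: module A "?G (Suc j)" by (rule mF)
   let ?q = "\<rho> (Suc j) g \<ominus>\<^bsub>?G (Suc j)\<^esub> h"
   have q: "?q : carrier (?G (Suc j))" using rm[OF g(1)] h(1) by simp
   define w where "w = (%x. if x : B (Suc j) then \<pi> (?q x) else 0)"
   have "v b = red j w b" if b: "b : B j" for b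
   proof -
    have "red j w b = \<pi> (d j ?q b)"
     unfolding red using transfer[OF D(2) upm q, of w] b by (simp add: pup w_def)
    also have "... = \<pi> (d j (\<rho> (Suc j) g) b) - \<pi> (d j h b)"
     using b rm[OF g(1)] h(1) module_hom_mem[OF D(2)]
     by (simp add: module_hom_minus[OF mF mF D(2)] pi_m)
    also have "\<pi> (d j (\<rho> (Suc j) g) b) = \<pi> (\<rho> j (\<psi> j (up j v)) b)"
     using transfer[OF rh(1) pm[OF upm] module_hom_mem[OF D'(2) g(1)] g(2)] b rh(3)[OF g(1)] by simp
    also have "... - \<pi> (d j h b) = v b" using h(2) b by (simp add: pup[symmetric] algebra_simps)
    finally show ?thesis by simp
   qed
   thus "EX w. (\<forall>x. x ~: B (Suc j) --> w x = 0) & (\<forall>b\<in>B j. v b = red j w b)"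
    by (intro exI[of _ w]) (simp add: w_def)
  next
   assume "EX w. (\<forall>x. x ~: B (Suc j) --> w x = 0) & (\<forall>b\<in>B j. v b = red j w b)"
   then obtain w where w: "\<forall>b\<in>B j. v b = red j w b" by blast
   have "\<forall>b\<in>B j. \<pi> (up j v b) = \<pi> (d j (up (Suc j) w) b)" using w by (simp add: pup red)
   hence "\<forall>b\<in>C j. \<pi> (\<psi> j (up j v) b) = \<pi> (\<psi> j (d j (up (Suc j) w)) b)"
    by (rule transfer[OF ps(1) upm module_hom_mem[OF D(2) upm]])
   thus "\<exists>g\<in>carrier (?F (Suc j)). \<forall>b\<in>C j. \<pi> (\<psi> j (up j v) b) = \<pi> (e j g b)"
    using ps(3)[OF upm] pm[OF upm] by (intro bexI[of _ "\<psi> (Suc j) (up (Suc j) w)"]) auto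
  qed
 qed
qed

end

section \<open>From Tor to finite-dimensional linear algebra over the field, one multidegree at a
  time\<close>

section \<open>Finitely supported vectors\<close>

definition scl :: "'k::field => ('a, 'k) fv => ('a, 'k) fv" where
 "scl c x = Poly_Mapping.map ((*) c) x"

lemma lookup_scl [simp]: "lkp (scl c x) a = c * lkp x a"
 by (simp add: scl_def Poly_Mapping.map.rep_eq when_def)

interpretation pm: vector_space "scl :: 'k::field => ('a, 'k) fv => ('a, 'k) fv"
 by unfold_locales (auto intro!: poly_mapping_eqI simp: lookup_add algebra_simps)

interpretation pmp: vector_space_pair "scl :: 'k::field => ('a, 'k) fv => ('a, 'k) fv"
 "scl :: 'k::field => ('b, 'k) fv => ('b, 'k) fv" ..

abbreviation unit_vec :: "'a => ('a, 'k::field) fv" where "unit_vec a \<equiv> sgl a 1"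

lemma scl_single [simp]: "scl c (sgl a d) = sgl a (c * d)"
 by (rule poly_mapping_eqI) (simp add: lookup_single when_def)

lemma scl_minus_one: "scl (- 1) x = - x"
 by (rule poly_mapping_eqI) simp

lemma keys_scl: "keys (scl c x) <= keys x"
 by (auto simp: in_keys_iff)

definition lin :: "('a => ('b, 'k) fv) => ('a, 'k::field) fv => ('b, 'k) fv" where
 "lin f x = (\<Sum>a\<in>keys x. scl (lkp x a) (f a))"

lemma lin_superset: "finite W ==> keys x <= W ==> lin f x = (\<Sum>a\<in>W. scl (lkp x a) (f a))"
 unfolding lin_def by (rule sum.mono_neutral_left) (auto simp: in_keys_iff)

lemma lin_add [simp]: "lin f (x + y) = lin f x + lin f y"
proof -
 let ?W = "keys x \<union> keys y"
 have "lin f (x + y) = (\<Sum>a\<in>?W. scl (lkp (x + y) a) (f a))"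
  by (rule lin_superset) (auto simp: in_keys_iff lookup_add)
 also have "... = lin f x + lin f y"
  by (simp add: lin_superset[of ?W] lookup_add pm.scale_left_distrib sum.distrib)
 finally show ?thesis .
qed

lemma lin_scl [simp]: "lin f (scl c x) = scl c (lin f x)"
proof -
 have "lin f (scl c x) = (\<Sum>a\<in>keys x. scl (lkp (scl c x) a) (f a))"
  by (rule lin_superset) (auto simp: in_keys_iff)
 thus ?thesis by (simp add: lin_def pm.scale_sum_right)
qed

lemma linear_lin: "Vector_Spaces.linear scl scl (lin f)"
 by unfold_locales auto

lemma lin_zero [simp]: "lin f 0 = 0" by (simp add: lin_def)

lemma lin_minus [simp]: "lin f (- x) = - lin f x"
 using lin_scl[of f "-1" x] by (simp add: scl_minus_one)

lemma lin_diff [simp]: "lin f (x - y) = lin f x - lin f y"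
 using lin_add[of f x "- y"] by simp

lemma lin_sum: "lin f (\<Sum>i\<in>I. g i) = (\<Sum>i\<in>I. lin f (g i))"
 by (induction I rule: infinite_finite_induct) auto

lemma lin_single [simp]: "lin f (sgl a c) = scl c (f a)"
 by (cases "c = 0") (simp_all add: lin_def)

lemma lin_cong: "(!!a. a : keys x ==> f a = g a) ==> lin f x = lin g x"
 unfolding lin_def by (rule sum.cong) auto

lemma lin_lin: "lin f (lin g x) = lin (%a. lin f (g a)) x"
 by (simp add: lin_def[of g] lin_def[of "%a. lin f (g a)"] lin_sum)

lemma lin_fun_add: "lin (%a. f a + g a) x = lin f x + lin g x"
 by (simp add: lin_def pm.scale_right_distrib sum.distrib)

lemma lin_fun_diff: "lin (%a. f a - g a) x = lin f x - lin g x"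
 by (simp add: lin_def pm.scale_right_diff_distrib sum_subtractf)

lemma lin_fun_minus: "lin (%a. - f a) x = - lin f x"
 by (simp add: lin_def sum_negf)

lemma lin_fun_scl: "lin (%a. scl c (f a)) x = scl c (lin f x)"
 by (simp add: lin_def pm.scale_sum_right mult.commute)

lemma lin_fun_zero [simp]: "lin (%a. 0) x = 0"
 by (simp add: lin_def)

lemma lin_unit_vec [simp]: "lin unit_vec x = x"
 by (rule poly_mapping_eqI) (simp add: lin_def lookup_sum lookup_single when_def in_keys_iff)

lemma lookup_lin: "lkp (lin f x) b = (\<Sum>a\<in>keys x. lkp x a * lkp (f a) b)"
 by (simp add: lin_def lookup_sum)

lemma keys_lin: "keys (lin f x) <= (\<Union>a\<in>keys x. keys (f a))"
proof
 fix b assume "b : keys (lin f x)"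
 hence "(\<Sum>a\<in>keys x. lkp x a * lkp (f a) b) ~= 0" by (simp add: in_keys_iff lookup_lin)
 then obtain a where "a : keys x" "lkp x a * lkp (f a) b ~= 0" by (rule sum.not_neutral_contains_not_neutral)
 thus "b : (\<Union>a\<in>keys x. keys (f a))" by (auto simp: in_keys_iff)
qed

lemma keys_lin_subset: "(!!a. a : keys x ==> keys (f a) <= Q) ==> keys (lin f x) <= Q"
 using keys_lin[of f x] by blast

lemma keys_add_subset: "keys x <= Q ==> keys y <= Q ==> keys (x + y) <= Q"
 using keys_add[of x y] by blast

lemma keys_diff_subset: "keys x <= Q ==> keys y <= Q ==> keys (x - y) <= Q"
proof
 fix a assume "keys x <= Q" "keys y <= Q" "a : keys (x - y)"
 thus "a : Q" by (cases "a : keys x"; cases "a : keys y") (auto simp: in_keys_iff lookup_minus)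
qed

lemma keys_scl_subset: "keys x <= Q ==> keys (scl c x) <= Q"
 using keys_scl[of c x] by blast

text \<open>Written through \<open>lin\<close> so that compositions of restrictions with linear maps
  fuse by \<open>lin_lin\<close>.\<close>

definition restr :: "'a set => ('a, 'k) fv => ('a, 'k::field) fv" where
 "restr S x = lin (%a. if a : S then unit_vec a else 0) x"

lemma lookup_restr [simp]: "lkp (restr S x) a = (if a : S then lkp x a else 0)"
proof -
 have "lkp (restr S x) a = (\<Sum>b\<in>keys x. if b = a then (if a : S then lkp x a else 0) else 0)"
  unfolding restr_def lookup_lin by (rule sum.cong) (auto simp: lookup_single when_def)
 thus ?thesis by (auto simp: in_keys_iff)
qed

lemma restr_linear [simp]:
 "restr S (x + y) = restr S x + restr S y" "restr S (x - y) = restr S x - restr S y"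
 "restr S (- x) = - restr S x" "restr S (scl c x) = scl c (restr S x)" "restr S 0 = 0"
 by (simp_all add: restr_def)

lemma keys_restr: "keys (restr S x) = keys x \<inter> S"
 by (auto simp: in_keys_iff split: if_splits)

lemma restr_id: "keys x <= S ==> restr S x = x"
 by (rule poly_mapping_eqI) (auto simp: in_keys_iff)

lemma restr_zero_iff: "restr S x = 0 \<longleftrightarrow> keys x \<inter> S = {}"
 by (metis keys_restr keys_eq_empty)

lemma restr_single: "restr S (sgl a c) = (if a : S then sgl a c else 0)"
 by (rule poly_mapping_eqI) (auto simp: lookup_single when_def)

lemma subspace_keys: "pm.subspace {x :: ('a, 'k::field) fv. keys x <= B}"
 by (rule pm.subspaceI) (simp_all add: keys_add_subset keys_scl_subset)

lemma keys_span: "{x :: ('a, 'k::field) fv. keys x <= B} = pm.span (unit_vec ` B)"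
proof
 show "pm.span (unit_vec ` B) <= {x :: ('a, 'k) fv. keys x <= B}"
  by (rule pm.span_minimal[OF _ subspace_keys]) auto
 have "x : pm.span (unit_vec ` B)" if "keys x <= B" for x :: "('a, 'k) fv"
 proof -
  have "x = (\<Sum>a\<in>keys x. scl (lkp x a) (unit_vec a))" using lin_unit_vec[of x, symmetric] unfolding lin_def .
  also have "... : pm.span (unit_vec ` B)"
   using that by (intro pm.span_sum pm.span_scale pm.span_base) auto
  finally show ?thesis .
 qed
 thus "{x :: ('a, 'k) fv. keys x <= B} <= pm.span (unit_vec ` B)" by auto
qed

text \<open>The finite ambient coordinate set bounds every independent set. So a basis K of the
  smaller space extends to a finite basis E of the larger one, and their cardinalities may be
  subtracted.\<close>

lemma fin_basis_extend:
 fixes V W :: "('a, 'k::field) fv set"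
 assumes V: "pm.subspace V" and W: "pm.subspace W" "W <= V" and B: "finite B" "V <= {x. keys x <= B}"
 obtains K E where "finite E" "K <= E" "E <= V" "W = pm.span K" "V = pm.span E"
  "card K = pm.dim W" "card E = pm.dim V" "K <= W"
proof -
 obtain K where K: "K <= W" "pm.independent K" "W <= pm.span K" "card K = pm.dim W"
  using pm.basis_exists[of W] by blast
 have KV: "K <= V" using K W by blast
 obtain E where E: "K <= E" "E <= V" "pm.independent E" "V <= pm.span E"
  by (rule pm.maximal_independent_subset_extend[OF KV K(2)])
 have "E <= pm.span (unit_vec ` B)" unfolding keys_span[symmetric] using B E by blast
 hence "finite E" using pm.independent_span_bound[of "unit_vec ` B" E] B E by blast
 moreover have "W = pm.span K" "V = pm.span E"
  using K E pm.span_minimal[OF K(1) W(1)] pm.span_minimal[OF E(2) V] by auto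
 moreover have "card E = pm.dim V" using pm.dim_eq_card[of E V] E(3) \<open>V = pm.span E\<close> pm.span_span by metis
 ultimately show ?thesis using that K E by blast
qed

lemma fin_dim_finite:
 fixes V :: "('a, 'k::field) fv set"
 assumes "finite B" "V <= {x. keys x <= B}"
 obtains E where "finite E" "E <= V" "V <= pm.span E" "card E = pm.dim V" "pm.independent E"
proof -
 obtain E where E: "E <= V" "pm.independent E" "V <= pm.span E" "card E = pm.dim V"
  using pm.basis_exists[of V] by blast
 have "E <= pm.span (unit_vec ` B)" unfolding keys_span[symmetric] using assms E by blast
 hence "finite E" using pm.independent_span_bound[of "unit_vec ` B" E] assms E by blast
 with E that show ?thesis by blast
qed

lemma dim_mono:
 fixes V W :: "('a, 'k::field) fv set"
 assumes "finite B" "W <= {x. keys x <= B}" "V <= W"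
 shows "pm.dim V <= pm.dim W"
proof -
 obtain E where E: "finite E" "W <= pm.span E" "card E = pm.dim W"
  using fin_dim_finite[OF assms(1,2)] by metis
 thus ?thesis using pm.dim_le_card[of V E] assms by auto
qed

lemma dim_eq_imp_eq:
 fixes V W :: "('a, 'k::field) fv set"
 assumes B: "finite B" "W <= {x. keys x <= B}" and VW: "V <= W" and V: "pm.subspace V" and W: "pm.subspace W"
  and d: "pm.dim W <= pm.dim V"
 shows "V = W"
proof -
 obtain K E where KE: "finite E" "K <= E" "V = pm.span K" "W = pm.span E" "card K = pm.dim V" "card E = pm.dim W"
  using fin_basis_extend[OF W V VW B] by metis
 hence "K = E" using d by (metis card_seteq)
 with KE show ?thesis by simp
qed

lemma dim_keys:
 assumes "finite B"
 shows "pm.dim {x :: ('a, 'k::field) fv. keys x <= B} = card B"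
proof -
 have inj: "inj_on (unit_vec :: 'a => ('a, 'k) fv) B"
  by (rule inj_onI) (metis keys_single singleton_inject zero_neq_one)
 have "pm.independent (unit_vec ` B :: ('a, 'k) fv set)"
 proof (rule pm.independent_if_scalars_zero)
  fix f and x :: "('a, 'k) fv" assume z: "(\<Sum>x\<in>unit_vec ` B. scl (f x) x) = (0 :: ('a, 'k) fv)" and x: "x : unit_vec ` B"
  obtain b where b: "b : B" "x = unit_vec b" using x by auto
  have "0 = lkp (\<Sum>x\<in>unit_vec ` B. scl (f x) x) b" by (simp add: z)
  also have "... = (\<Sum>c\<in>B. f (unit_vec c) * lkp (unit_vec c) b)"
   by (simp add: lookup_sum sum.reindex[OF inj] del: scl_single)
  also have "... = f (unit_vec b)"
   using assms b by (simp add: lookup_single when_def if_distrib[of "%y. _ * y"] cong: if_cong)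
  finally show "f x = 0" using b by simp
 qed (use assms in simp)
 hence "pm.dim (pm.span (unit_vec ` B :: ('a, 'k) fv set)) = card (unit_vec ` B :: ('a, 'k) fv set)"
  by (simp add: pm.dim_eq_card_independent)
 thus ?thesis by (simp add: keys_span card_image[OF inj])
qed

text \<open>A basis K of the kernel is extended to a basis E of V. The images of E - K span the
  image, which gives one inequality; preimages of a basis of the image together with K span V, which
  gives the other.\<close>

lemma rank_nullity_pm:
 fixes f :: "('a, 'k::field) fv => ('b, 'k) fv"
 assumes f: "Vector_Spaces.linear scl scl f" and V: "pm.subspace V" and B: "finite B" "V <= {x. keys x <= B}"
 shows "pm.dim V = pm.dim (f ` V) + pm.dim {x\<in>V. f x = 0}"
proof -
 interpret f: Vector_Spaces.linear scl scl f by (rule f)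
 let ?W = "{x\<in>V. f x = 0}"
 have W: "pm.subspace ?W"
  using V by (auto intro!: pm.subspaceI simp: f.zero f.add f.scale pm.subspace_0 pm.subspace_add pm.subspace_scale)
 have WV: "?W <= V" by auto
 obtain K E where KE: "finite E" "K <= E" "E <= V" "?W = pm.span K" "V = pm.span E"
  "card K = pm.dim ?W" "card E = pm.dim V" "K <= ?W"
  by (rule fin_basis_extend[OF V W WV B]) (rule that)
 have fK: "finite K" using KE finite_subset by blast
 have "f ` V <= pm.span (f ` (E - K))"
 proof -
  have "f ` E <= pm.span (f ` (E - K))"
  proof
   fix y assume "y : f ` E"
   then obtain e where e: "e : E" "y = f e" by auto
   show "y : pm.span (f ` (E - K))"
   proof (cases "e : K")
    case True thus ?thesis using KE(8) e by (auto simp: pm.span_zero)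
   next
    case False thus ?thesis using e by (auto intro: pm.span_base)
   qed
  qed
  hence "pm.span (f ` E) <= pm.span (f ` (E - K))" by (rule pm.span_minimal[OF _ pm.subspace_span])
  thus ?thesis by (simp only: KE(5) f.span_image)
 qed
 hence "pm.dim (f ` V) <= card (f ` (E - K))" using KE(1) by (intro pm.dim_le_card) auto
 also have "... <= card E - card K" using KE fK by (metis card_Diff_subset card_image_le finite_Diff)
 finally have le: "pm.dim (f ` V) + pm.dim ?W <= pm.dim V"
  using KE(1,2,6,7) card_mono[of E K] by linarith
 obtain D where D: "D <= f ` V" "pm.independent D" "f ` V <= pm.span D" "card D = pm.dim (f ` V)"
  using pm.basis_exists[of "f ` V"] by blast
 have "f ` V <= pm.span (f ` E)" by (simp only: KE(5) f.span_image)
 hence "finite D" using pm.independent_span_bound[of "f ` E" D] KE(1) D by blast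
 obtain g where g: "!!y. y : D ==> g y : V & f (g y) = y" using bchoice[of D "%y x. x : V & f x = y"] D(1) by blast
 have "V <= pm.span (g ` D \<union> K)"
 proof
  fix x assume x: "x : V"
  have fg: "f ` (g ` D) = D" using g by force
  have "f x : f ` pm.span (g ` D)" using x D(3) fg by (metis f.span_image imageI subsetD)
  then obtain y where y: "y : pm.span (g ` D)" "f x = f y" by auto
  have "pm.span (g ` D) <= V" by (rule pm.span_minimal[OF _ V]) (use g in auto)
  hence "x - y : ?W" using x y V by (auto simp: f.diff pm.subspace_diff)
  hence "x - y : pm.span K" using KE(4) by simp
  hence "(x - y) + y : pm.span (g ` D \<union> K)"
   using y(1) by (intro pm.span_add) (auto intro: subsetD[OF pm.span_mono])
  thus "x : pm.span (g ` D \<union> K)" by simp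
 qed
 hence "pm.dim V <= card (g ` D \<union> K)" using \<open>finite D\<close> fK by (intro pm.dim_le_card) auto
 also have "... <= card D + card K"
  using card_Un_le[of "g ` D" K] card_image_le[OF \<open>finite D\<close>, of g] by linarith
 finally show ?thesis using le D(4) KE(6) by linarith
qed

text \<open>Dimension here is the least size of a finite generating set, so two bounds are combined:
  the images of a basis of V relative to the kernel generate T, and any generating set, pulled back
  and joined with a basis of the kernel, spans V.\<close>

lemma kdim_quotient:
 fixes T :: "('a, 'c, 's) module_scheme" and phh :: "'k::field => 'a" and V :: "('b, 'k) fv set"
 assumes T: "module A T" and phi: "phh : Ring.ring_hom (class_ring :: 'k ring) A"
  and V: "pm.subspace V" and B: "finite B" "V <= {x. keys x <= B}"
  and k1: "!!x. x : V ==> \<kappa> x : carrier T"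
  and k2: "!!x y. x : V ==> y : V ==> \<kappa> (x + y) = \<kappa> x \<oplus>\<^bsub>T\<^esub> \<kappa> y"
  and k3: "!!c x. x : V ==> \<kappa> (scl c x) = phh c \<odot>\<^bsub>T\<^esub> \<kappa> x"
  and k4: "!!t. t : carrier T ==> \<exists>x\<in>V. t = \<kappa> x"
 shows "kdim phh T = pm.dim V - pm.dim {x\<in>V. \<kappa> x = \<zero>\<^bsub>T\<^esub>}"
proof -
 interpret T: module A T by (rule T)
 let ?R = "restrict_scalars phh T" and ?W = "{x\<in>V. \<kappa> x = \<zero>\<^bsub>T\<^esub>}"
 have ph: "phh c : carrier A" "phh 1 = \<one>\<^bsub>A\<^esub>" "phh (c + d) = phh c \<oplus>\<^bsub>A\<^esub> phh d" "phh (c * d) = phh c \<otimes>\<^bsub>A\<^esub> phh d" for c d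
  using phi by (auto simp: Ring.ring_hom_def)
 have sel: "carrier ?R = carrier T" "!!x y. x \<oplus>\<^bsub>?R\<^esub> y = x \<oplus>\<^bsub>T\<^esub> y" "\<zero>\<^bsub>?R\<^esub> = \<zero>\<^bsub>T\<^esub>" "!!c x. c \<odot>\<^bsub>?R\<^esub> x = phh c \<odot>\<^bsub>T\<^esub> x"
  by (simp_all add: restrict_scalars_def)
 have mR: "module (class_ring :: 'k ring) ?R"
  by (rule module_criteria)
   (auto simp: sel ph T.a_ac T.smult_l_distr T.smult_r_distr T.smult_assoc1 class_cring.cring_axioms
    intro!: bexI[of _ "\<ominus>\<^bsub>T\<^esub> x" for x] T.r_neg)
 interpret R: vectorspace "class_ring :: 'k ring" ?R
  by (rule vectorspace.intro[OF mR class_field])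
 have k0: "\<kappa> 0 = \<zero>\<^bsub>T\<^esub>"
  using k2[of 0 0] k1[of 0] V by (simp add: pm.subspace_0)
 have W: "pm.subspace ?W"
 proof (rule pm.subspaceI)
  show "scl c x : ?W" if "x : ?W" for c x
   using that V k3 T.smult_r_null[OF ph(1)] by (simp add: pm.subspace_scale)
 qed (use V k0 k2 in \<open>auto simp: pm.subspace_0 pm.subspace_add\<close>)
 have WV: "?W <= V" by auto
 obtain K E where KE: "finite E" "K <= E" "E <= V" "?W = pm.span K" "V = pm.span E"
  "card K = pm.dim ?W" "card E = pm.dim V" "K <= ?W"
  by (rule fin_basis_extend[OF V W WV B]) (rule that)
 have fK: "finite K" using KE finite_subset by blast
 let ?m = "pm.dim V - pm.dim ?W"
 have lower: "?m <= card D" if D: "finite D" "D <= carrier ?R" "R.gen_set D" for D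
 proof -
  obtain g where g: "!!y. y : D ==> g y : V & \<kappa> (g y) = y" using bchoice[of D "%y x. x : V & \<kappa> x = y"] D(2) k4 sel(1) by blast
  have gV: "pm.span (g ` D) <= V" by (rule pm.span_minimal[OF _ V]) (use g in auto)
  have "submodule (class_ring :: 'k ring) (\<kappa> ` pm.span (g ` D)) ?R"
  proof (rule submodule.intro[OF mR])
   show "\<kappa> ` pm.span (g ` D) <= carrier ?R" using k1 gV by (auto simp: sel)
   show "\<zero>\<^bsub>?R\<^esub> : \<kappa> ` pm.span (g ` D)" using k0 pm.span_zero by (metis image_eqI sel(3))
   show "v \<oplus>\<^bsub>?R\<^esub> w : \<kappa> ` pm.span (g ` D)" if vw: "v : \<kappa> ` pm.span (g ` D)" "w : \<kappa> ` pm.span (g ` D)" for v w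
   proof -
    obtain x y where xy: "x : pm.span (g ` D)" "y : pm.span (g ` D)" "v = \<kappa> x" "w = \<kappa> y" using vw by auto
    hence "v \<oplus>\<^bsub>?R\<^esub> w = \<kappa> (x + y)" using gV by (subst k2) (auto simp: sel)
    thus ?thesis using xy pm.span_add by blast
   qed
   show "c \<odot>\<^bsub>?R\<^esub> v : \<kappa> ` pm.span (g ` D)" if v: "v : \<kappa> ` pm.span (g ` D)" for c v
   proof -
    obtain x where x: "x : pm.span (g ` D)" "v = \<kappa> x" using v by auto
    hence "c \<odot>\<^bsub>?R\<^esub> v = \<kappa> (scl c x)" using gV by (subst k3) (auto simp: sel)
    thus ?thesis using x pm.span_scale by blast
   qed
  qed
  moreover have "D <= \<kappa> ` pm.span (g ` D)" using g pm.span_base by (metis image_eqI subsetI)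
  ultimately have "R.span D <= \<kappa> ` pm.span (g ` D)" by (intro R.span_is_subset) auto
  hence car: "carrier T <= \<kappa> ` pm.span (g ` D)" using D(3) by (simp add: sel)
  have "V <= pm.span (g ` D \<union> K)"
  proof
   fix x assume x: "x : V"
   obtain y where y: "y : pm.span (g ` D)" "\<kappa> x = \<kappa> y" using k1[OF x] car by auto
   have yV: "y : V" using y gV by auto
   have my: "- y : V" using yV V pm.subspace_neg by blast
   have "\<kappa> y \<oplus>\<^bsub>T\<^esub> \<kappa> (- y) = \<zero>\<^bsub>T\<^esub>" using k2[OF yV my] k0 by simp
   hence "\<kappa> (x - y) = \<zero>\<^bsub>T\<^esub>" using k2[OF x my] y(2) by simp
   hence "x - y : ?W" using x yV V by (auto simp: pm.subspace_diff)
   hence "x - y : pm.span K" using KE(4) by simp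
   hence "(x - y) + y : pm.span (g ` D \<union> K)"
    using y(1) by (intro pm.span_add) (auto intro: subsetD[OF pm.span_mono])
   thus "x : pm.span (g ` D \<union> K)" by simp
  qed
  hence "pm.dim V <= card (g ` D \<union> K)" using D(1) fK by (intro pm.dim_le_card) auto
  also have "... <= card D + card K"
   using card_Un_le[of "g ` D" K] card_image_le[OF D(1), of g] by linarith
  finally show ?thesis using KE(6) by linarith
 qed
 let ?D = "\<kappa> ` (E - K)"
 have Dc: "?D <= carrier ?R" "finite ?D" using k1 KE by (auto simp: sel)
 interpret SD: submodule "class_ring :: 'k ring" "R.span ?D" ?R by (rule R.span_is_submodule[OF Dc(1)])
 have "x : V & \<kappa> x : R.span ?D" if "x : pm.span E" for x
  using that
 proof (induction rule: pm.span_induct_alt)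
  case base thus ?case using SD.zero_closed V by (simp add: k0 sel pm.subspace_0)
 next
  case (step c e x)
  have xV: "x : V" using step(2) by simp
  have eV: "e : V" using step(1) KE(3) by auto
  have ke: "\<kappa> e : R.span ?D"
  proof (cases "e : K")
   case True thus ?thesis using KE(8) SD.zero_closed by (auto simp: sel)
  next
   case False thus ?thesis using step(1) R.in_own_span[OF Dc(1)] by auto
  qed
  have "\<kappa> (scl c e + x) = c \<odot>\<^bsub>?R\<^esub> \<kappa> e \<oplus>\<^bsub>?R\<^esub> \<kappa> x"
   using eV xV V by (simp add: sel k2 k3 pm.subspace_scale)
  also have "... : R.span ?D" using ke step by (intro SD.m_closed SD.smult_closed) auto
  finally show ?case using eV xV V by (simp add: pm.subspace_add pm.subspace_scale)
 qed
 hence "carrier ?R <= R.span ?D" using k4 KE(5) by (auto simp: sel)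
 hence gen: "R.gen_set ?D" using SD.subset by auto
 have "card ?D <= ?m" using KE fK by (metis card_Diff_subset card_image_le finite_Diff)
 hence "card ?D = ?m" using lower[OF Dc(2,1) gen] by simp
 hence "(LEAST n. EX D. finite D & card D = n & D <= carrier ?R & R.gen_set D) = ?m"
  using Dc gen lower by (intro Least_equality) auto
 thus ?thesis by (simp add: kdim_def R.dim_def)
qed

section \<open>Multigraded resolutions over monomial quotient rings\<close>

definition mle :: "expo => expo => bool" where
 "mle \<mu> al \<longleftrightarrow> (\<forall>i. lkp \<mu> i <= lkp al i)"

lemma mle_refl [simp]: "mle \<mu> \<mu>" by (simp add: mle_def)
lemma mle_zero [simp]: "mle 0 \<mu>" by (simp add: mle_def)
lemma mle_trans: "mle \<mu> \<nu> ==> mle \<nu> \<kappa> ==> mle \<mu> \<kappa>" by (auto simp: mle_def intro: order_trans)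
lemma mle_add [simp]: "mle \<mu> (\<mu> + \<nu>)" "mle \<mu> (\<nu> + \<mu>)" by (simp_all add: mle_def lookup_add)
lemma mle_mono: "mle \<mu> \<nu> ==> mle \<mu>' \<nu>' ==> mle (\<mu> + \<mu>') (\<nu> + \<nu>')"
 by (auto simp: mle_def lookup_add intro: add_mono)
lemma mle_antisym: "mle \<mu> \<nu> ==> mle \<nu> \<mu> ==> \<mu> = \<nu>"
 by (rule poly_mapping_eqI) (auto simp: mle_def intro: antisym)
lemma mle_diff_add: "mle \<mu> \<nu> ==> (\<nu> - \<mu>) + \<mu> = \<nu>"
 by (rule poly_mapping_eqI) (simp add: mle_def lookup_add lookup_minus)
lemma mle_add_diff: "mle \<mu> \<nu> ==> \<mu> + (\<nu> - \<mu>) = \<nu>"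
 by (rule poly_mapping_eqI) (simp add: mle_def lookup_add lookup_minus)

lemma mle_chain:
 assumes "mle \<nu> \<mu>" "mle \<nu> al"
 shows "mle (\<mu> - \<nu>) (al - \<nu>) \<longleftrightarrow> mle \<mu> al" "mle \<mu> al ==> al - \<nu> - (\<mu> - \<nu>) = al - \<mu>"
proof -
 show "mle (\<mu> - \<nu>) (al - \<nu>) \<longleftrightarrow> mle \<mu> al"
  using assms by (auto simp: mle_def lookup_minus) (metis diff_le_mono le_diff_iff)+
 show "mle \<mu> al ==> al - \<nu> - (\<mu> - \<nu>) = al - \<mu>"
  using assms by (intro poly_mapping_eqI) (auto simp: mle_def lookup_minus)
qed

lemma exponents_add: "\<mu> : exponents n ==> \<nu> : exponents n ==> \<mu> + \<nu> : exponents n"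
 unfolding exponents_def using keys_add[of \<mu> \<nu>] by blast

lemma exponents_mle: "mle \<mu> \<nu> ==> \<nu> : exponents n ==> \<mu> : exponents n"
 by (auto simp: exponents_def mle_def subset_iff in_keys_iff) (metis le_zero_eq neq0_conv not_less)+

lemma exponents_diff: "\<nu> : exponents n ==> \<nu> - \<mu> : exponents n"
 by (rule exponents_mle) (auto simp: mle_def lookup_minus)

lemma zero_exponents [simp]: "0 : exponents n" by (simp add: exponents_def)

lemma mpoly_ring_sel:
 "carrier (mpoly_ring n) = {p :: 'k::field mpol. keys p <= exponents n}"
 "monoid.mult (mpoly_ring n) p q = p * (q :: 'k mpol)" "\<one>\<^bsub>mpoly_ring n\<^esub> = (1 :: 'k mpol)"
 "p \<oplus>\<^bsub>mpoly_ring n\<^esub> q = p + (q :: 'k mpol)" "\<zero>\<^bsub>mpoly_ring n\<^esub> = (0 :: 'k mpol)"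
 by (simp_all add: mpoly_ring_def)

lemma poly_sum_single: "(p :: 'k::field mpol) = (\<Sum>m\<in>keys p. sgl m (lkp p m))"
 using lin_unit_vec[of p, symmetric] unfolding lin_def scl_single mult_1_right .

lemma lookup_mult_single:
 fixes p :: "'k::field mpol"
 shows "lkp (p * sgl \<mu> c) gmm = (if mle \<mu> gmm then lkp p (gmm - \<mu>) * c else 0)"
proof -
 have "p * sgl \<mu> c = (\<Sum>m\<in>keys p. sgl (m + \<mu>) (lkp p m * c))"
  by (subst poly_sum_single[of p]) (simp add: sum_distrib_right mult_single)
 hence *: "lkp (p * sgl \<mu> c) gmm = (\<Sum>m\<in>keys p. if m + \<mu> = gmm then lkp p m * c else 0)"
  by (simp add: lookup_sum lookup_single when_def)
 have iff: "m + \<mu> = gmm \<longleftrightarrow> mle \<mu> gmm & m = gmm - \<mu>" for m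
  using mle_diff_add[of \<mu> gmm] by auto
 show ?thesis unfolding * iff by (auto simp: in_keys_iff)
qed

lemma keys_mult_exponents:
 fixes p q :: "'k::field mpol"
 assumes "keys p <= exponents n" "keys q <= exponents n"
 shows "keys (p * q) <= exponents n"
 using keys_mult[of p q] assms exponents_add by blast

lemma cring_mpoly_ring: "cring (mpoly_ring n :: 'k::field mpol ring)"
proof (rule cringI)
 show "abelian_group (mpoly_ring n :: 'k mpol ring)"
 proof (rule abelian_groupI)
  fix x :: "'k mpol" assume "x : carrier (mpoly_ring n)"
  thus "\<exists>y\<in>carrier (mpoly_ring n). y \<oplus>\<^bsub>mpoly_ring n\<^esub> x = \<zero>\<^bsub>mpoly_ring n\<^esub>"
   by (intro bexI[of _ "- x"]) (auto simp: mpoly_ring_sel subset_iff in_keys_iff)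
 qed (auto simp: mpoly_ring_sel algebra_simps intro: keys_add_subset[THEN subsetD])
 show "Group.comm_monoid (mpoly_ring n :: 'k mpol ring)"
  by (rule Group.comm_monoidI)
   (auto simp: mpoly_ring_sel algebra_simps intro: keys_mult_exponents[THEN subsetD])
qed (auto simp: mpoly_ring_sel algebra_simps)

text \<open>One interface for both rings of the Golod identity: the polynomial ring, with
  \<open>W\<close> empty and \<open>tht\<close> the identity, and the quotient by a monomial ideal,
  with \<open>W\<close> its set of monomials. Only the kernel of \<open>tht\<close> is prescribed,
  so ring elements may be polynomials or cosets.\<close>

locale mono_quotient =
 fixes n :: nat and A :: "('a, 'm) ring_scheme" and tht :: "'k::field mpol => 'a" and W :: "expo set"
  and \<pi> :: "'a => 'k" and phh :: "'k => 'a"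
 assumes A: "cring A"
  and theta: "tht : Ring.ring_hom (mpoly_ring n) A"
  and surj: "carrier A = tht ` carrier (mpoly_ring n)"
  and ker: "p : carrier (mpoly_ring n) ==> tht p = \<zero>\<^bsub>A\<^esub> \<longleftrightarrow> keys p <= W"
  and W: "W <= exponents n" "\<mu> : W ==> \<nu> : exponents n ==> \<mu> + \<nu> : W" "0 ~: W"
  and pi: "p : carrier (mpoly_ring n) ==> \<pi> (tht p) = const_coeff p"
  and phi: "phh c = tht (const_pol c)"
begin

interpretation A: cring A by (rule A)

lemma th:
 assumes "keys p <= exponents n" "keys q <= exponents n"
 shows "tht p : carrier A" "tht (p + q) = tht p \<oplus>\<^bsub>A\<^esub> tht q" "tht (p * q) = tht p \<otimes>\<^bsub>A\<^esub> tht q" "tht 1 = \<one>\<^bsub>A\<^esub>"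
 using theta assms by (auto simp: Ring.ring_hom_def mpoly_ring_sel)

lemma th0: "tht 0 = \<zero>\<^bsub>A\<^esub>" using ker[of 0] by (simp add: mpoly_ring_sel)

lemma keys_const: "keys (const_pol c) <= exponents n"
 by (simp add: const_pol_def)

lemma pi': "keys p <= exponents n ==> \<pi> (tht p) = lkp p 0"
 using pi by (simp add: mpoly_ring_sel const_coeff_def)

lemma lookup_mult_zero: "lkp (p * q) 0 = lkp p 0 * lkp (q :: 'k mpol) 0"
proof -
 have "lkp (p * q) 0 = (\<Sum>m\<in>keys q. lkp (p * sgl m (lkp q m)) 0)"
  by (subst (1) poly_sum_single[of q]) (simp add: sum_distrib_left lookup_sum)
 also have "... = (\<Sum>m\<in>keys q. if m = 0 then lkp p 0 * lkp q 0 else 0)"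
  by (rule sum.cong) (auto simp: lookup_mult_single intro: mle_antisym)
 finally show ?thesis by (auto simp: in_keys_iff)
qed

sublocale residue_field A \<pi> phh
proof
 show "\<pi> : Ring.ring_hom A (class_ring :: 'k ring)"
  using surj by (auto simp: Ring.ring_hom_def mpoly_ring_sel pi' th(2-4)[symmetric] lookup_add lookup_mult_zero
   keys_mult_exponents keys_add_subset)
 show "phh : Ring.ring_hom (class_ring :: 'k ring) A"
 proof -
  have "phh (x + y) = phh x \<oplus>\<^bsub>A\<^esub> phh y" "phh (x * y) = phh x \<otimes>\<^bsub>A\<^esub> phh y" for x y
   using th(2,3)[OF keys_const[of x] keys_const[of y]]
   by (simp_all add: phi const_pol_def single_add mult_single)
  moreover have "phh x : carrier A" for x using th(1)[OF keys_const keys_const] by (simp add: phi)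
  moreover have "phh 1 = \<one>\<^bsub>A\<^esub>" using th(4)[OF keys_const keys_const] by (simp add: phi const_pol_def)
  ultimately show ?thesis by (auto simp: Ring.ring_hom_def)
 qed
 show "\<pi> (phh c) = c" for c using pi'[OF keys_const[of c]] by (simp add: phi const_pol_def)
qed

text \<open>The representative of a ring element that contains no monomial of \<open>W\<close>. It
  is unique by \<open>nf_theta\<close>, which makes it additive.\<close>

definition nf :: "'a => 'k mpol" where
 "nf a = (SOME p. keys p <= exponents n - W & tht p = a)"

lemma theta_restr:
 assumes "keys p <= exponents n"
 shows "tht (restr (- W) p) = tht p"
proof -
 have k: "keys (restr (- W) p) <= exponents n" "keys (restr W p) <= exponents n"
  using assms by (auto simp: keys_restr)
 have "p = restr (- W) p + restr W p" by (rule poly_mapping_eqI) (simp add: lookup_add)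
 hence "tht p = tht (restr (- W) p) \<oplus>\<^bsub>A\<^esub> tht (restr W p)" using th(2)[OF k] by metis
 moreover have "tht (restr W p) = \<zero>\<^bsub>A\<^esub>" using k by (subst ker) (auto simp: mpoly_ring_sel keys_restr)
 ultimately show ?thesis using th(1)[OF k(1) k(1)] by simp
qed

lemma nf:
 assumes "a : carrier A"
 shows "keys (nf a) <= exponents n - W" "tht (nf a) = a"
proof -
 obtain p where p: "keys p <= exponents n" "tht p = a" using assms surj by (auto simp: mpoly_ring_sel)
 have "EX p. keys p <= exponents n - W & tht p = a"
  using p theta_restr[OF p(1)] by (intro exI[of _ "restr (- W) p"]) (auto simp: keys_restr)
 from someI_ex[OF this] show "keys (nf a) <= exponents n - W" "tht (nf a) = a" by (auto simp: nf_def)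
qed

lemma theta_eq_iff:
 assumes "keys p <= exponents n" "keys q <= exponents n"
 shows "tht p = tht q \<longleftrightarrow> keys (p - q) <= W"
proof -
 have k: "keys (p - q) <= exponents n" by (rule keys_diff_subset[OF assms])
 have "tht p = tht (p - q) \<oplus>\<^bsub>A\<^esub> tht q" using th(2)[OF k assms(2)] by simp
 hence "tht p = tht q \<longleftrightarrow> tht (p - q) = \<zero>\<^bsub>A\<^esub>" using th(1)[OF k k] th(1)[OF assms(2,2)] by auto
 thus ?thesis using ker[of "p - q"] k by (simp add: mpoly_ring_sel)
qed

lemma nf_theta:
 assumes "keys p <= exponents n"
 shows "nf (tht p) = restr (- W) p"
proof -
 have c: "tht p : carrier A" by (rule th(1)[OF assms assms])
 have k: "keys (restr (- W) p) <= exponents n" using assms by (auto simp: keys_restr)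
 have "keys (nf (tht p) - restr (- W) p) <= W"
  using nf[OF c] k theta_restr[OF assms] by (subst theta_eq_iff[symmetric]) auto
 moreover have "keys (nf (tht p) - restr (- W) p) <= - W"
  using nf(1)[OF c] by (intro keys_diff_subset) (auto simp: keys_restr)
 ultimately have "nf (tht p) - restr (- W) p = 0" by (metis keys_eq_empty disjoint_eq_subset_Compl inf.absorb_iff2 inf_commute Int_absorb1)
 thus ?thesis by simp
qed

lemma nf_add: "a : carrier A ==> b : carrier A ==> nf (a \<oplus>\<^bsub>A\<^esub> b) = nf a + nf b"
proof -
 assume a: "a : carrier A" and b: "b : carrier A"
 have k: "keys (nf a) <= exponents n" "keys (nf b) <= exponents n" using nf(1)[OF a] nf(1)[OF b] by auto
 have "nf (tht (nf a + nf b)) = restr (- W) (nf a + nf b)" by (rule nf_theta[OF keys_add_subset[OF k]])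
 moreover have "restr (- W) (nf a + nf b) = nf a + nf b"
  by (rule restr_id[OF keys_add_subset]) (use nf(1)[OF a] nf(1)[OF b] in auto)
 ultimately show ?thesis using th(2)[OF k] nf(2)[OF a] nf(2)[OF b] by simp
qed

lemma nf_zero: "nf \<zero>\<^bsub>A\<^esub> = 0"
 using nf_theta[of 0] by (simp add: th0)

lemma nf_phi: "nf (phh c) = const_pol c"
 using nf_theta[OF keys_const] W(3) by (simp add: phi restr_id[of _ "- W"] const_pol_def restr_single)

end

text \<open>The monomial basis of the multidegree \<open>al\<close> component of the free module on
  \<open>B\<close> over S/W: the generator b contributes the monomial with exponent al - dg b times
  b, provided this monomial survives in the quotient.\<close>

definition strand ::
 "expo set => ('b => expo) => 'b set => expo => 'b set" where
 "strand W dg B al = {b : B. mle (dg b) al & al - dg b ~: W}"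

text \<open>The entries of \<open>D\<close> between generators of equal multidegree. They are the
  entries whose monomial coefficient is a unit, that is, those which survive reduction to the
  residue field.\<close>

definition deg_part :: "('b => expo) => ('b => ('b, 'k::field) fv) => 'b => ('b, 'k) fv" where
 "deg_part dg D b = restr {b'. dg b' = dg b} (D b)"

context mono_quotient
begin

interpretation A: cring A by (rule A)

lemma th_mem: "keys p <= exponents n ==> tht p : carrier A"
 by (rule th(1))

lemma th_sum:
 assumes "finite I" "!!i. i : I ==> keys (p i) <= exponents n"
 shows "keys (\<Sum>i\<in>I. p i) <= exponents n" "tht (\<Sum>i\<in>I. p i) = (\<Oplus>\<^bsub>A\<^esub>i\<in>I. tht (p i))"
proof -
 have "keys (\<Sum>i\<in>I. p i) <= exponents n & tht (\<Sum>i\<in>I. p i) = (\<Oplus>\<^bsub>A\<^esub>i\<in>I. tht (p i))"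
  using assms
 proof (induction I rule: finite_induct)
  case empty thus ?case by (simp add: th0)
 next
  case (insert i I)
  have c: "(%i. tht (p i)) : I \<rightarrow> carrier A" using insert.prems by (auto intro: th_mem)
  have ci: "tht (p i) : carrier A" using insert.prems by (auto intro: th_mem)
  have k: "keys (p i) <= exponents n" "keys (\<Sum>i\<in>I. p i) <= exponents n" using insert by auto
  show ?case using insert th(2)[OF k] keys_add_subset[OF k] A.finsum_insert[OF insert(1,2) c ci] by simp
 qed
 thus "keys (\<Sum>i\<in>I. p i) <= exponents n" "tht (\<Sum>i\<in>I. p i) = (\<Oplus>\<^bsub>A\<^esub>i\<in>I. tht (p i))" by auto
qed

text \<open>A resolution with its monomial coefficients stripped off: \<open>D\<close> is a matrix
  of scalars, while the monomials are determined by the degrees \<open>dg\<close>. The assumptions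
  \<open>ex\<close> and \<open>ex0\<close> state exactness strand by strand, as complexes of vector
  spaces. \<open>b0\<close> is the single generator in degree 0, and \<open>W'\<close> consists of
  the monomials annihilating the cyclic generator \<open>g\<close> of M.\<close>

context
 fixes M :: "('a, 'c, 'r) module_scheme" and g :: 'c and W' :: "expo set"
  and B :: "nat => 'b set" and dg :: "'b => expo" and D :: "'b => ('b, 'k) fv" and b0 :: 'b
 assumes fin: "!!j. finite (B j)" and degB: "!!j b. b : B j ==> dg b : exponents n"
  and Dk: "!!j b. b : B (Suc j) ==> keys (D b) <= B j"
  and Ddeg: "!!j b b'. b : B (Suc j) ==> b' : keys (D b) ==> mle (dg b') (dg b)"
  and B0: "B 0 = {b0}" "dg b0 = 0" "D b0 = 0"
  and ex: "!!al j x. [|al : exponents n; keys x <= strand W dg (B (Suc j)) al|] ==>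
   restr (strand W dg (B j) al) (lin D x) = 0 \<longleftrightarrow>
   (EX y. keys y <= strand W dg (B (Suc (Suc j))) al & restr (strand W dg (B (Suc j)) al) (lin D y) = x)"
  and ex0: "!!al. [|al : exponents n; al ~: W|] ==>
   al : W' \<longleftrightarrow> (EX y. keys y <= strand W dg (B 1) al & restr {b0} (lin D y) = unit_vec b0)"
  and M: "module A M" and g: "g : carrier M" and gen: "!!m. m : carrier M ==> \<exists>a\<in>carrier A. m = a \<odot>\<^bsub>M\<^esub> g"
  and ann: "!!p. keys p <= exponents n ==> tht p \<odot>\<^bsub>M\<^esub> g = \<zero>\<^bsub>M\<^esub> \<longleftrightarrow> keys p <= W'"
begin

interpretation M: module A M by (rule M)

text \<open>Bases of a \<open>free_resolution\<close> consist of natural numbers. One injection on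
  the union of all degrees numbers the basis elements of every degree at once.\<close>

definition "Ub = (\<Union>j. B j)"
abbreviation (input) "io \<equiv> to_nat_on Ub"
abbreviation (input) "oi \<equiv> from_nat_into Ub"
definition "Bn j = io ` B j"

lemma countable_Ub: "countable Ub" unfolding Ub_def using fin by (intro countable_UN) (auto intro: countable_finite)

lemma oi_io: "b : B j ==> oi (io b) = b"
 by (rule from_nat_into_to_nat_on[OF countable_Ub]) (auto simp: Ub_def)

lemma oi_mem: "x : Bn j ==> oi x : B j & io (oi x) = x"
 by (auto simp: Bn_def oi_io)

lemma io_mem: "b : B j ==> io b : Bn j" by (simp add: Bn_def)

lemma finite_Bn: "finite (Bn j)" by (simp add: Bn_def fin)

text \<open>The coordinate of the differential at b', computed on normal forms; here the monomial
  coefficient with exponent dg b - dg b' is put back.\<close>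

definition dpoly :: "nat => (nat => 'a) => 'b => 'k mpol" where
 "dpoly j f b' = (\<Sum>b\<in>B (Suc j). nf (f (io b)) * sgl (dg b - dg b') (lkp (D b) b'))"

definition dif :: "nat => (nat => 'a) => nat => 'a" where
 "dif j f = (\<lambda>x\<in>Bn j. tht (dpoly j f (oi x)))"

abbreviation (input) "Fr j \<equiv> free_module A (Bn j)"

lemma Fr_val: "f : carrier (Fr j) ==> b : B j ==> f (io b) : carrier A"
 by (rule free_module_val[OF rA _ io_mem])

lemma nfE: "a : carrier A ==> keys (nf a) <= exponents n" using nf(1) by blast

lemma keys_single_deg: "b : B j ==> keys (sgl (dg b - \<mu>) (c :: 'k)) <= exponents n"
 using exponents_diff[OF degB] by auto

lemma keys_dpoly:
 assumes "f : carrier (Fr (Suc j))"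
 shows "keys (dpoly j f b') <= exponents n"
 unfolding dpoly_def
 by (rule th_sum(1)[OF fin keys_mult_exponents[OF nfE[OF Fr_val[OF assms]] keys_single_deg]])

lemma theta_dpoly:
 assumes f: "f : carrier (Fr (Suc j))"
 shows "tht (dpoly j f b') =
  (\<Oplus>\<^bsub>A\<^esub>b\<in>B (Suc j). f (io b) \<otimes>\<^bsub>A\<^esub> tht (sgl (dg b - dg b') (lkp (D b) b')))"
proof -
 have "tht (dpoly j f b') = (\<Oplus>\<^bsub>A\<^esub>b\<in>B (Suc j). tht (nf (f (io b)) * sgl (dg b - dg b') (lkp (D b) b')))"
  unfolding dpoly_def
  by (rule th_sum(2)[OF fin keys_mult_exponents[OF nfE[OF Fr_val[OF f]] keys_single_deg]])
 also have "... = (\<Oplus>\<^bsub>A\<^esub>b\<in>B (Suc j). f (io b) \<otimes>\<^bsub>A\<^esub> tht (sgl (dg b - dg b') (lkp (D b) b')))"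
 proof (rule A.finsum_cong')
  show "(%b. f (io b) \<otimes>\<^bsub>A\<^esub> tht (sgl (dg b - dg b') (lkp (D b) b'))) : B (Suc j) \<rightarrow> carrier A"
   using Fr_val[OF f] th(1)[OF keys_single_deg keys_single_deg] by auto
  fix b assume b: "b : B (Suc j)"
  show "tht (nf (f (io b)) * sgl (dg b - dg b') (lkp (D b) b')) =
   f (io b) \<otimes>\<^bsub>A\<^esub> tht (sgl (dg b - dg b') (lkp (D b) b'))"
   using th(3)[OF nfE[OF Fr_val[OF f b]] keys_single_deg[OF b]] nf(2)[OF Fr_val[OF f b]] by simp
 qed simp
 finally show ?thesis .
qed

lemma dif_hom: "dif j : module_hom A (Fr (Suc j)) (Fr j)"
proof -
 have c: "tht (sgl (dg b - dg b') (lkp (D b) b')) : carrier A" if "b : B (Suc j)" for b b'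
  using th(1)[OF keys_single_deg[OF that] keys_single_deg[OF that]] .
 have mem: "dif j f : carrier (Fr j)" if f: "f : carrier (Fr (Suc j))" for f
  by (rule free_moduleI[OF rA])
   (use th(1)[OF keys_dpoly[OF f] keys_dpoly[OF f]] finite_Bn in \<open>auto simp: dif_def\<close>)
 interpret F: module A "Fr (Suc j)" by (rule mF)
 interpret F': module A "Fr j" by (rule mF)
 have ad: "dif j (f \<oplus>\<^bsub>Fr (Suc j)\<^esub> h) = dif j f \<oplus>\<^bsub>Fr j\<^esub> dif j h"
  if f: "f : carrier (Fr (Suc j))" and h: "h : carrier (Fr (Suc j))" for f h
 proof (rule free_module_ext[OF rA mem F'.a_closed[OF mem[OF f] mem[OF h]]])
  show "f \<oplus>\<^bsub>Fr (Suc j)\<^esub> h : carrier (Fr (Suc j))" using f h by simp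
  fix x assume x: "x : Bn j"
  let ?m = "%b. tht (sgl (dg b - dg (oi x)) (lkp (D b) (oi x)))"
  have "(\<Oplus>\<^bsub>A\<^esub>b\<in>B (Suc j). (f \<oplus>\<^bsub>Fr (Suc j)\<^esub> h) (io b) \<otimes>\<^bsub>A\<^esub> ?m b)
   = (\<Oplus>\<^bsub>A\<^esub>b\<in>B (Suc j). f (io b) \<otimes>\<^bsub>A\<^esub> ?m b \<oplus>\<^bsub>A\<^esub> h (io b) \<otimes>\<^bsub>A\<^esub> ?m b)"
   by (rule A.finsum_cong')
    (use Fr_val[OF f] Fr_val[OF h] c io_mem in \<open>auto simp: free_module_apply[OF rA] A.l_distr\<close>)
  also have "... = (\<Oplus>\<^bsub>A\<^esub>b\<in>B (Suc j). f (io b) \<otimes>\<^bsub>A\<^esub> ?m b) \<oplus>\<^bsub>A\<^esub> (\<Oplus>\<^bsub>A\<^esub>b\<in>B (Suc j). h (io b) \<otimes>\<^bsub>A\<^esub> ?m b)"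
   by (rule A.finsum_addf) (use Fr_val[OF f] Fr_val[OF h] c in auto)
  finally show "dif j (f \<oplus>\<^bsub>Fr (Suc j)\<^esub> h) x = (dif j f \<oplus>\<^bsub>Fr j\<^esub> dif j h) x"
   using x f h by (simp add: dif_def theta_dpoly free_module_apply[OF rA])
 qed
 have sm: "dif j (a \<odot>\<^bsub>Fr (Suc j)\<^esub> f) = a \<odot>\<^bsub>Fr j\<^esub> dif j f"
  if a: "a : carrier A" and f: "f : carrier (Fr (Suc j))" for a f
 proof (rule free_module_ext[OF rA mem F'.smult_closed[OF a mem[OF f]]])
  show "a \<odot>\<^bsub>Fr (Suc j)\<^esub> f : carrier (Fr (Suc j))" using a f by simp
  fix x assume x: "x : Bn j"
  let ?m = "%b. tht (sgl (dg b - dg (oi x)) (lkp (D b) (oi x)))"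
  have "(\<Oplus>\<^bsub>A\<^esub>b\<in>B (Suc j). (a \<odot>\<^bsub>Fr (Suc j)\<^esub> f) (io b) \<otimes>\<^bsub>A\<^esub> ?m b)
   = (\<Oplus>\<^bsub>A\<^esub>b\<in>B (Suc j). a \<otimes>\<^bsub>A\<^esub> (f (io b) \<otimes>\<^bsub>A\<^esub> ?m b))"
   by (rule A.finsum_cong')
    (use Fr_val[OF f] a c io_mem in \<open>auto simp: free_module_apply[OF rA] A.m_assoc\<close>)
  also have "... = a \<otimes>\<^bsub>A\<^esub> (\<Oplus>\<^bsub>A\<^esub>b\<in>B (Suc j). f (io b) \<otimes>\<^bsub>A\<^esub> ?m b)"
   by (rule A.finsum_rdistr[symmetric]) (use Fr_val[OF f] a c fin in auto)
  finally show "dif j (a \<odot>\<^bsub>Fr (Suc j)\<^esub> f) x = (a \<odot>\<^bsub>Fr j\<^esub> dif j f) x"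
   using x f a by (simp add: dif_def theta_dpoly free_module_apply[OF rA])
 qed
 show ?thesis using mem ad sm by (auto simp: module_hom_def)
qed

definition strv :: "nat => (nat => 'a) => expo => ('b, 'k) fv" where
 "strv j f al = (\<Sum>b\<in>B j. sgl b (if mle (dg b) al then lkp (nf (f (io b))) (al - dg b) else 0))"

lemma lookup_strv:
 "lkp (strv j f al) b = (if b : B j & mle (dg b) al then lkp (nf (f (io b))) (al - dg b) else 0)"
 unfolding strv_def using fin[of j] by (simp add: lookup_sum lookup_single when_def)

lemma keys_strv:
 assumes "f : carrier (Fr j)"
 shows "keys (strv j f al) <= strand W dg (B j) al"
proof
 fix b assume "b : keys (strv j f al)"
 hence b: "b : B j" "mle (dg b) al" "al - dg b : keys (nf (f (io b)))"
  by (auto simp: in_keys_iff lookup_strv split: if_splits)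
 thus "b : strand W dg (B j) al"
  using nf(1)[OF Fr_val[OF assms b(1)]] by (auto simp: strand_def)
qed

text \<open>In a fixed multidegree multiplication by monomials is invisible, and the differential
  becomes the scalar matrix \<open>D\<close>. The restriction accounts for monomials that fall into
  \<open>W\<close> and become zero in the quotient.\<close>

lemma strv_dif:
 assumes f: "f : carrier (Fr (Suc j))" and al: "al : exponents n"
 shows "strv j (dif j f) al = restr (strand W dg (B j) al) (lin D (strv (Suc j) f al))"
proof (rule poly_mapping_eqI)
 fix b'
 have L: "lkp (lin D (strv (Suc j) f al)) b' = (\<Sum>b\<in>B (Suc j). lkp (strv (Suc j) f al) b * lkp (D b) b')"
  unfolding lookup_lin by (rule sum.mono_neutral_left[OF fin])
   (auto simp: in_keys_iff lookup_strv split: if_splits)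
 show "lkp (strv j (dif j f) al) b' = lkp (restr (strand W dg (B j) al) (lin D (strv (Suc j) f al))) b'"
 proof (cases "b' : B j & mle (dg b') al")
  case False
  thus ?thesis by (auto simp: lookup_strv strand_def)
 next
  case True
  have "lkp (strv j (dif j f) al) b' = lkp (nf (tht (dpoly j f b'))) (al - dg b')"
   using True io_mem[of b' j] oi_io[of b' j] by (simp add: lookup_strv dif_def)
  also have "... = (if al - dg b' : W then 0 else lkp (dpoly j f b') (al - dg b'))"
   by (simp add: nf_theta[OF keys_dpoly[OF f]])
  also have "lkp (dpoly j f b') (al - dg b') = (\<Sum>b\<in>B (Suc j). lkp (strv (Suc j) f al) b * lkp (D b) b')"
   unfolding dpoly_def lookup_sum
  proof (rule sum.cong[OF refl])
   fix b assume b: "b : B (Suc j)"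
   show "lkp (nf (f (io b)) * sgl (dg b - dg b') (lkp (D b) b')) (al - dg b') =
    lkp (strv (Suc j) f al) b * lkp (D b) b'"
   proof (cases "lkp (D b) b' = 0")
    case False
    hence "mle (dg b') (dg b)" using Ddeg[OF b] by (auto simp: in_keys_iff)
    thus ?thesis using b True mle_chain[of "dg b'" "dg b" al]
     by (simp add: lookup_mult_single lookup_strv)
   qed simp
  qed
  finally show ?thesis using True by (simp add: L strand_def)
 qed
qed

lemma strv_eq_zero:
 assumes f: "f : carrier (Fr j)" and z: "!!al. al : exponents n ==> strv j f al = 0"
 shows "f = \<zero>\<^bsub>Fr j\<^esub>"
proof -
 interpret F: module A "Fr j" by (rule mF)
 show ?thesis
 proof (rule free_module_ext[OF rA f F.zero_closed])
  fix x assume x: "x : Bn j"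
  define b where "b = oi x"
  have b: "b : B j" "io b = x" using oi_mem[OF x] by (auto simp: b_def)
  have c: "f x : carrier A" using Fr_val[OF f b(1)] b by simp
  have "nf (f x) = 0"
  proof (rule poly_mapping_eqI)
   fix m
   show "lkp (nf (f x)) m = lkp 0 m"
   proof (cases "m : exponents n")
    case True
    have "dg b + m : exponents n" using degB[OF b(1)] True by (rule exponents_add)
    from z[OF this] have "lkp (strv j f (dg b + m)) b = 0" by simp
    thus ?thesis using b by (simp add: lookup_strv)
   next
    case False
    thus ?thesis using nfE[OF c] by (auto simp: in_keys_iff)
   qed
  qed
  thus "f x = \<zero>\<^bsub>Fr j\<^esub> x" using nf(2)[OF c] x by (simp add: th0 free_module_apply[OF rA])
 qed
qed

text \<open>Only finitely many strands of f are nonzero. Preimages chosen in these strands are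
  collected into the polynomials \<open>P b\<close>; for a fixed b different strands contribute
  different monomials, so the strands of the result are the chosen vectors.\<close>

lemma assemble:
 assumes f: "f : carrier (Fr j)"
  and y: "!!al. al : exponents n ==> EX y. keys y <= strand W dg (B (Suc j)) al &
   restr (strand W dg (B j) al) (lin D y) = strv j f al"
 shows "\<exists>h\<in>carrier (Fr (Suc j)). dif j h = f"
proof -
 interpret F: module A "Fr j" by (rule mF)
 define Q where "Q = {al : exponents n. strv j f al ~= 0}"
 have "Q <= (\<Union>b\<in>B j. (%m. m + dg b) ` keys (nf (f (io b))))"
 proof
  fix al assume "al : Q"
  then obtain b where "b : keys (strv j f al)" unfolding Q_def by (metis (mono_tags, lifting) ex_in_conv keys_eq_empty mem_Collect_eq)
  hence b: "b : B j" "mle (dg b) al" "al - dg b : keys (nf (f (io b)))"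
   by (auto simp: in_keys_iff lookup_strv split: if_splits)
  thus "al : (\<Union>b\<in>B j. (%m. m + dg b) ` keys (nf (f (io b))))"
   using mle_diff_add[OF b(2)] by (intro UN_I[OF b(1)] image_eqI[OF _ b(3)]) simp
 qed
 hence fQ: "finite Q" by (rule finite_subset) (use fin in auto)
 obtain Y where Y: "!!al. al : Q ==> keys (Y al) <= strand W dg (B (Suc j)) al &
   restr (strand W dg (B j) al) (lin D (Y al)) = strv j f al"
  using bchoice[of Q "%al y. keys y <= strand W dg (B (Suc j)) al & restr (strand W dg (B j) al) (lin D y) = strv j f al"] y
  unfolding Q_def by blast
 define P where "P b = (\<Sum>al\<in>Q. sgl (al - dg b) (lkp (Y al) b))" for b
 have kP: "keys (P b) <= exponents n" for b
  unfolding P_def by (rule th_sum(1)[OF fQ]) (auto simp: Q_def intro: exponents_diff)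
 define h where "h = (\<lambda>x\<in>Bn (Suc j). tht (P (oi x)))"
 have h: "h : carrier (Fr (Suc j))"
  by (rule free_moduleI[OF rA]) (use th(1)[OF kP kP] finite_Bn in \<open>auto simp: h_def\<close>)
 have sh: "strv (Suc j) h al = (if al : Q then Y al else 0)" if al: "al : exponents n" for al
 proof (rule poly_mapping_eqI)
  fix b
  have kY: "lkp (Y \<beta>) b ~= 0 ==> \<beta> : Q ==> b : B (Suc j) & mle (dg b) \<beta> & \<beta> - dg b ~: W" for \<beta>
   using Y[of \<beta>] by (auto simp: strand_def in_keys_iff)
  show "lkp (strv (Suc j) h al) b = lkp (if al : Q then Y al else 0) b"
  proof (cases "b : B (Suc j) & mle (dg b) al")
   case False
   thus ?thesis using kY[of al] by (auto simp: lookup_strv)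
  next
   case True
   have "lkp (strv (Suc j) h al) b = lkp (nf (tht (P b))) (al - dg b)"
    using True io_mem[of b "Suc j"] oi_io[of b "Suc j"] by (simp add: lookup_strv h_def)
   also have "... = (if al - dg b : W then 0 else (\<Sum>\<beta>\<in>Q. if \<beta> - dg b = al - dg b then lkp (Y \<beta>) b else 0))"
    unfolding nf_theta[OF kP] lookup_restr by (simp add: P_def lookup_sum lookup_single when_def)
   also have "(\<Sum>\<beta>\<in>Q. if \<beta> - dg b = al - dg b then lkp (Y \<beta>) b else 0) = (\<Sum>\<beta>\<in>Q. if \<beta> = al then lkp (Y al) b else 0)"
   proof (rule sum.cong[OF refl])
    fix \<beta> assume be: "\<beta> : Q"
    show "(if \<beta> - dg b = al - dg b then lkp (Y \<beta>) b else 0) = (if \<beta> = al then lkp (Y al) b else 0)"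
    proof (cases "lkp (Y \<beta>) b = 0")
     case False
     hence "mle (dg b) \<beta>" using kY be by blast
     hence "\<beta> - dg b = al - dg b \<longleftrightarrow> \<beta> = al" using True mle_diff_add by metis
     thus ?thesis by auto
    qed auto
   qed
   also have "... = (if al : Q then lkp (Y al) b else 0)" using fQ by simp
   finally show ?thesis using kY[of al] by auto
  qed
 qed
 have dh: "dif j h : carrier (Fr j)" by (rule module_hom_mem[OF dif_hom h])
 have "strv j (dif j h) al = strv j f al" if "al : exponents n" for al
  using strv_dif[OF h that] sh[OF that] Y[of al] that by (auto simp: Q_def)
 moreover have "strv j (dif j h \<ominus>\<^bsub>Fr j\<^esub> f) al = strv j (dif j h) al - strv j f al" for al
 proof (rule poly_mapping_eqI)
  fix b
  have c: "dif j h \<ominus>\<^bsub>Fr j\<^esub> f : carrier (Fr j)" using dh f by simp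
  have e: "dif j h = (dif j h \<ominus>\<^bsub>Fr j\<^esub> f) \<oplus>\<^bsub>Fr j\<^esub> f"
   using dh f by (simp add: a_minus_def F.a_assoc F.l_neg)
  have "nf (dif j h (io b)) = nf ((dif j h \<ominus>\<^bsub>Fr j\<^esub> f) (io b)) + nf (f (io b))" if "b : B j"
   by (subst e) (simp add: free_module_apply[OF rA io_mem[OF that]] nf_add Fr_val[OF c that] Fr_val[OF f that])
  thus "lkp (strv j (dif j h \<ominus>\<^bsub>Fr j\<^esub> f) al) b = lkp (strv j (dif j h) al - strv j f al) b"
   by (simp add: lookup_strv lookup_minus lookup_add)
 qed
 ultimately have "dif j h \<ominus>\<^bsub>Fr j\<^esub> f = \<zero>\<^bsub>Fr j\<^esub>" using dh f by (intro strv_eq_zero) auto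
 thus ?thesis using h dh f by (intro bexI[of _ h]) auto
qed

definition aug :: "(nat => 'a) => 'c" where "aug f = f (io b0) \<odot>\<^bsub>M\<^esub> g"

text \<open>Each exactness claim reduces to its strands: \<open>assemble\<close> produces preimages
  from strandwise preimages, and \<open>strv_eq_zero\<close> detects vanishing strandwise.\<close>

lemma resolution: "free_resolution A M Bn dif aug"
 unfolding free_resolution_def Let_def
proof (intro conjI allI)
 have b0: "b0 : B 0" by (simp add: B0)
 interpret F0: module A "Fr 0" by (rule mF)
 have s0: "strand W dg (B 0) al = (if al : W then {} else {b0})" for al
  by (auto simp: strand_def B0)
 have sv0: "strv 0 f al = sgl b0 (lkp (nf (f (io b0))) al)" for f al
  by (rule poly_mapping_eqI) (auto simp: lookup_strv B0 lookup_single when_def)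
 show "aug : module_hom A (Fr 0) M"
  using g Fr_val[OF _ b0] io_mem[OF b0]
  by (auto simp: module_hom_def aug_def free_module_apply[OF rA] M.smult_l_distr M.smult_assoc1)
 show "dif j : module_hom A (Fr (Suc j)) (Fr j)" for j by (rule dif_hom)
 have augz: "aug f = \<zero>\<^bsub>M\<^esub> \<longleftrightarrow> keys (nf (f (io b0))) <= W'" if "f : carrier (Fr 0)" for f
  using ann[OF nfE[OF Fr_val[OF that b0]]] nf(2)[OF Fr_val[OF that b0]] by (simp add: aug_def)
 show "aug ` carrier (Fr 0) = carrier M"
 proof (intro equalityI subsetI)
  fix m assume "m : aug ` carrier (Fr 0)"
  thus "m : carrier M" using Fr_val[OF _ b0] g by (auto simp: aug_def)
 next
  fix m assume "m : carrier M"
  then obtain a where a: "a : carrier A" "m = a \<odot>\<^bsub>M\<^esub> g" using gen by blast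
  have "(\<lambda>x\<in>Bn 0. a) : carrier (Fr 0)" by (rule free_moduleI[OF rA]) (use a finite_Bn in auto)
  moreover have "aug (\<lambda>x\<in>Bn 0. a) = m" using io_mem[OF b0] a by (simp add: aug_def)
  ultimately show "m : aug ` carrier (Fr 0)" by blast
 qed
 show "{x : carrier (Fr 0). aug x = \<zero>\<^bsub>M\<^esub>} = dif 0 ` carrier (Fr 1)"
 proof (intro equalityI subsetI)
  fix f assume "f : {x : carrier (Fr 0). aug x = \<zero>\<^bsub>M\<^esub>}"
  hence f: "f : carrier (Fr 0)" and fW: "keys (nf (f (io b0))) <= W'" using augz by auto
  have "\<exists>h\<in>carrier (Fr (Suc 0)). dif 0 h = f"
  proof (rule assemble[OF f])
   fix al assume al: "al : exponents n"
   show "EX y. keys y <= strand W dg (B (Suc 0)) al & restr (strand W dg (B 0) al) (lin D y) = strv 0 f al"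
   proof (cases "lkp (nf (f (io b0))) al = 0")
    case True
    thus ?thesis by (intro exI[of _ 0]) (simp add: sv0)
   next
    case False
    hence "al : keys (nf (f (io b0)))" by (simp add: in_keys_iff)
    hence aW: "al : W'" "al ~: W" using fW nf(1)[OF Fr_val[OF f b0]] by auto
    then obtain y where "keys y <= strand W dg (B 1) al" "restr {b0} (lin D y) = unit_vec b0"
     using ex0[OF al] by blast
    thus ?thesis using aW
     by (intro exI[of _ "scl (lkp (nf (f (io b0))) al) y"]) (auto simp: s0 sv0 intro: keys_scl[THEN subsetD, THEN subsetD[rotated]])
   qed
  qed
  thus "f : dif 0 ` carrier (Fr 1)" by auto
 next
  fix f assume "f : dif 0 ` carrier (Fr 1)"
  then obtain h where h: "h : carrier (Fr (Suc 0))" "f = dif 0 h" by auto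
  have f: "f : carrier (Fr 0)" using module_hom_mem[OF dif_hom h(1)] h by simp
  have "keys (nf (f (io b0))) <= W'"
  proof
   fix al assume al: "al : keys (nf (f (io b0)))"
   hence a: "al : exponents n" "al ~: W" using nf(1)[OF Fr_val[OF f b0]] by auto
   let ?c = "lkp (nf (f (io b0))) al"
   have "restr {b0} (lin D (strv 1 h al)) = sgl b0 ?c"
    using strv_dif[OF h(1) a(1)] a(2) h(2) by (simp add: s0 sv0)
   hence "restr {b0} (lin D (scl (inverse ?c) (strv 1 h al))) = unit_vec b0"
    using al by (simp add: in_keys_iff)
   moreover have "keys (scl (inverse ?c) (strv 1 h al)) <= strand W dg (B 1) al"
    by (rule keys_scl_subset[OF keys_strv]) (use h in simp)
   ultimately show "al : W'" using ex0[OF a] by blast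
  qed
  with f augz show "f : {x : carrier (Fr 0). aug x = \<zero>\<^bsub>M\<^esub>}" by auto
 qed
 fix j
 show "{x : carrier (Fr (Suc j)). dif j x = \<zero>\<^bsub>Fr j\<^esub>} = dif (Suc j) ` carrier (Fr (Suc (Suc j)))"
 proof (intro equalityI subsetI)
  fix f assume "f : {x : carrier (Fr (Suc j)). dif j x = \<zero>\<^bsub>Fr j\<^esub>}"
  hence f: "f : carrier (Fr (Suc j))" and z: "dif j f = \<zero>\<^bsub>Fr j\<^esub>" by auto
  have sz: "strv j \<zero>\<^bsub>Fr j\<^esub> al = 0" for al
   by (rule poly_mapping_eqI) (simp add: lookup_strv free_module_apply[OF rA io_mem] nf_zero)
  have "\<exists>h\<in>carrier (Fr (Suc (Suc j))). dif (Suc j) h = f"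
  proof (rule assemble[OF f])
   fix al assume al: "al : exponents n"
   have "restr (strand W dg (B j) al) (lin D (strv (Suc j) f al)) = 0"
    using strv_dif[OF f al] z sz by simp
   thus "EX y. keys y <= strand W dg (B (Suc (Suc j))) al &
    restr (strand W dg (B (Suc j)) al) (lin D y) = strv (Suc j) f al"
    using ex[OF al keys_strv[OF f]] by blast
  qed
  thus "f : dif (Suc j) ` carrier (Fr (Suc (Suc j)))" by auto
 next
  fix f assume "f : dif (Suc j) ` carrier (Fr (Suc (Suc j)))"
  then obtain h where h: "h : carrier (Fr (Suc (Suc j)))" "f = dif (Suc j) h" by auto
  have f: "f : carrier (Fr (Suc j))" using module_hom_mem[OF dif_hom h(1)] h by simp
  have "dif j f = \<zero>\<^bsub>Fr j\<^esub>"
  proof (rule strv_eq_zero[OF module_hom_mem[OF dif_hom f]])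
   fix al assume al: "al : exponents n"
   have "restr (strand W dg (B j) al) (lin D (strv (Suc j) f al)) = 0"
    using ex[OF al keys_strv[OF f]] keys_strv[OF h(1)] strv_dif[OF h(1) al] h(2) by metis
   thus "strv j (dif j f) al = 0" using strv_dif[OF f al] by simp
  qed
  with f show "f : {x : carrier (Fr (Suc j)). dif j x = \<zero>\<^bsub>Fr j\<^esub>}" by simp
 qed
qed

context
 assumes dd: "!!j b. b : B (Suc (Suc j)) ==> lin (deg_part dg D) (deg_part dg D b) = 0"
begin

abbreviation (input) "rD \<equiv> lin (deg_part dg D)"

lemma lookup_rD:
 assumes y: "keys y <= B (Suc j)"
 shows "lkp (rD y) b' = (\<Sum>b\<in>B (Suc j). lkp y b * (if dg b' = dg b then lkp (D b) b' else 0))"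
 unfolding lookup_lin deg_part_def lookup_restr
 by (rule sum.mono_neutral_cong_left[OF fin y]) (auto simp: in_keys_iff)

lemma keys_rD: "keys y <= B (Suc j) ==> keys (rD y) <= B j"
 by (rule keys_lin_subset) (use Dk in \<open>auto simp: deg_part_def keys_restr\<close>)

lemma rD_rD:
 assumes "keys y <= B (Suc (Suc j))"
 shows "rD (rD y) = 0"
proof -
 have "rD (rD y) = lin (%b. rD (deg_part dg D b)) y" by (rule lin_lin)
 also have "... = lin (%b. 0) y" by (rule lin_cong) (use assms dd in auto)
 finally show ?thesis by simp
qed

text \<open>The residue of a monomial coefficient is its constant term, which is nonzero only for
  exponent zero. So the reduced differential has the entry of \<open>D\<close> between generators of
  equal degree and zero elsewhere.\<close>

lemma kdim_Tor_graded:
 "kdim phh (Tor A j M N) =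
  pm.dim {x. keys x <= B j & rD x = 0} - pm.dim (rD ` {y. keys y <= B (Suc j)})"
proof -
 let ?red = "%i v b. \<pi> (dif i (\<lambda>x\<in>Bn (Suc i). phh (v x)) b)"
 \<comment> \<open>\<open>pb\<close> and \<open>fw\<close> translate between functions on the
   numbered bases and vectors on the original basis elements.\<close>
 define pb where "pb i v = (\<Sum>b\<in>B i. sgl b (v (io b)))" for i and v :: "nat => 'k"
 define fw where "fw i x y = (if y : Bn i then lkp x (oi y) else (0 :: 'k))" for i x and y :: nat
 have pb: "lkp (pb i v) b = (if b : B i then v (io b) else 0)" for i v b
  unfolding pb_def using fin[of i] by (simp add: lookup_sum lookup_single when_def)
 have kpb: "keys (pb i v) <= B i" for i v by (auto simp: in_keys_iff pb split: if_splits)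
 have pf: "pb i (fw i x) = x" if "keys x <= B i" for i x
  by (rule poly_mapping_eqI) (use that io_mem[of _ i] oi_io[of _ i] in \<open>auto simp: pb fw_def in_keys_iff\<close>)
 have fp: "fw i (pb i v) = v" if "\<forall>y. y ~: Bn i --> v y = 0" for i v
  using that oi_mem[of _ i] by (auto simp: fw_def pb)
 have red: "?red i v (io b') = lkp (rD (pb (Suc i) v)) b'" if b': "b' : B i" for i v b'
 proof -
  let ?f = "\<lambda>x\<in>Bn (Suc i). phh (v x)"
  have f: "?f : carrier (Fr (Suc i))"
   by (rule free_moduleI[OF rA]) (use phi_simps finite_Bn in auto)
  have "?red i v (io b') = \<pi> (tht (dpoly i ?f b'))"
   using io_mem[OF b'] oi_io[OF b'] by (simp add: dif_def)
  also have "... = lkp (dpoly i ?f b') 0" by (rule pi'[OF keys_dpoly[OF f]])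
  also have "... = (\<Sum>b\<in>B (Suc i). lkp (pb (Suc i) v) b * (if dg b' = dg b then lkp (D b) b' else 0))"
   unfolding dpoly_def lookup_sum
  proof (rule sum.cong[OF refl])
   fix b assume b: "b : B (Suc i)"
   show "lkp (nf (?f (io b)) * sgl (dg b - dg b') (lkp (D b) b')) 0 =
    lkp (pb (Suc i) v) b * (if dg b' = dg b then lkp (D b) b' else 0)"
   proof (cases "lkp (D b) b' = 0")
    case False
    hence m: "mle (dg b') (dg b)" using Ddeg[OF b] by (auto simp: in_keys_iff)
    have "mle (dg b - dg b') 0 \<longleftrightarrow> dg b' = dg b"
     using mle_diff_add[OF m] mle_antisym[of "dg b - dg b'" 0] by auto
    thus ?thesis using b io_mem[OF b]
     by (simp add: lookup_mult_single nf_phi pb const_pol_def)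
   qed simp
  qed
  also have "... = lkp (rD (pb (Suc i) v)) b'" by (rule lookup_rD[OF kpb, symmetric])
  finally show ?thesis .
 qed
 let ?Z = "{v. (\<forall>x. x ~: Bn j --> v x = 0) & (\<forall>i. j = Suc i --> (\<forall>b\<in>Bn i. ?red i v b = 0))}"
 let ?V = "{x. keys x <= B j & rD x = 0}" and ?I = "rD ` {y. keys y <= B (Suc j)}"
 have ZV: "fw j x : ?Z" if x: "x : ?V" for x
 proof -
  have "?red i (fw j x) b = 0" if j: "j = Suc i" and b: "b : Bn i" for i b
  proof -
   have "?red i (fw j x) b = lkp (rD (pb (Suc i) (fw j x))) (oi b)"
    using red[of "oi b" i "fw j x"] oi_mem[OF b] by simp
   also have "pb (Suc i) (fw j x) = x" using pf[of x j] x j by simp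
   also have "lkp (rD x) (oi b) = 0" using x by simp
   finally show ?thesis .
  qed
  thus ?thesis by (simp add: fw_def)
 qed
 have VZ: "pb j v : ?V" if v: "v : ?Z" for v
 proof -
  have "rD (pb j v) = 0"
  proof (cases j)
   case 0
   have "rD (pb j v) = lin (%b. 0) (pb j v)"
    by (rule lin_cong) (use kpb[of j v] 0 B0 in \<open>auto simp: deg_part_def\<close>)
   thus ?thesis by simp
  next
   case (Suc i)
   show ?thesis
   proof (rule poly_mapping_eqI)
    fix b'
    show "lkp (rD (pb j v)) b' = lkp 0 b'"
    proof (cases "b' : B i")
     case True
     thus ?thesis using red[OF True, of v] v Suc io_mem[OF True] by simp
    next
     case False
     thus ?thesis using keys_rD[of "pb j v" i] kpb[of j v] Suc by (auto simp: in_keys_iff)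
    qed
   qed
  qed
  thus ?thesis using kpb by simp
 qed
 obtain \<kappa> where k: "module A (Tor A j M N)" "!!v. v : ?Z ==> \<kappa> v : carrier (Tor A j M N)"
  "!!v w. v : ?Z ==> w : ?Z ==> \<kappa> (%x. v x + w x) = \<kappa> v \<oplus>\<^bsub>Tor A j M N\<^esub> \<kappa> w"
  "!!v c. v : ?Z ==> \<kappa> (%x. c * v x) = phh c \<odot>\<^bsub>Tor A j M N\<^esub> \<kappa> v"
  "!!t. t : carrier (Tor A j M N) ==> \<exists>v\<in>?Z. t = \<kappa> v"
  "!!v. v : ?Z ==> \<kappa> v = \<zero>\<^bsub>Tor A j M N\<^esub> \<longleftrightarrow> (EX w. (\<forall>x. x ~: Bn (Suc j) --> w x = 0) & (\<forall>b\<in>Bn j. v b = ?red j w b))"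
  by (rule kdim_Tor_reduced[OF M resolution finite_Bn, where j = j]) ((assumption | rule that)+)
 have sV: "pm.subspace ?V" by (rule pm.subspaceI) (simp_all add: keys_add_subset keys_scl_subset)
 have "kdim phh (Tor A j M N) = pm.dim ?V - pm.dim {x\<in>?V. \<kappa> (fw j x) = \<zero>\<^bsub>Tor A j M N\<^esub>}"
 proof (rule kdim_quotient[where \<kappa> = "%x. \<kappa> (fw j x)", OF k(1) phi_hom sV fin[of j]])
  show "?V <= {x. keys x <= B j}" by auto
  show "\<kappa> (fw j x) : carrier (Tor A j M N)" if "x : ?V" for x by (rule k(2)[OF ZV[OF that]])
  have "fw j (x + y) = (%z. fw j x z + fw j y z)" for x y by (auto simp: fw_def lookup_add)
  thus "\<kappa> (fw j (x + y)) = \<kappa> (fw j x) \<oplus>\<^bsub>Tor A j M N\<^esub> \<kappa> (fw j y)" if "x : ?V" "y : ?V" for x y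
   using k(3)[OF ZV[OF that(1)] ZV[OF that(2)]] by simp
  have "fw j (scl c x) = (%z. c * fw j x z)" for c x by (auto simp: fw_def)
  thus "\<kappa> (fw j (scl c x)) = phh c \<odot>\<^bsub>Tor A j M N\<^esub> \<kappa> (fw j x)" if "x : ?V" for c x
   using k(4)[OF ZV[OF that]] by simp
  show "\<exists>x\<in>?V. t = \<kappa> (fw j x)" if t: "t : carrier (Tor A j M N)" for t
  proof -
   obtain v where v: "v : ?Z" "t = \<kappa> v" using k(5)[OF t] by blast
   thus ?thesis using VZ[OF v(1)] fp[of j v] by (intro bexI[of _ "pb j v"]) auto
  qed
 qed
 also have "{x\<in>?V. \<kappa> (fw j x) = \<zero>\<^bsub>Tor A j M N\<^esub>} = ?I"
 proof (intro equalityI subsetI)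
  fix x assume "x : {x\<in>?V. \<kappa> (fw j x) = \<zero>\<^bsub>Tor A j M N\<^esub>}"
  hence x: "x : ?V" and z: "\<kappa> (fw j x) = \<zero>\<^bsub>Tor A j M N\<^esub>" by auto
  obtain w where w: "\<forall>b\<in>Bn j. fw j x b = ?red j w b" using k(6)[OF ZV[OF x]] z by blast
  have "x = rD (pb (Suc j) w)"
  proof (rule poly_mapping_eqI)
   fix b
   show "lkp x b = lkp (rD (pb (Suc j) w)) b"
   proof (cases "b : B j")
    case True
    have "lkp x b = fw j x (io b)" using io_mem[OF True] oi_io[OF True] by (simp add: fw_def)
    also have "... = ?red j w (io b)" using w io_mem[OF True] by blast
    also have "... = lkp (rD (pb (Suc j) w)) b" by (rule red[OF True])
    finally show ?thesis .
   next
    case False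
    have "b ~: keys x" using x False by blast
    moreover have "b ~: keys (rD (pb (Suc j) w))" using keys_rD[OF kpb, of j w] False by blast
    ultimately show ?thesis by (simp add: in_keys_iff)
   qed
  qed
  thus "x : ?I" using kpb by blast
 next
  fix x assume "x : ?I"
  then obtain y where y: "keys y <= B (Suc j)" "x = rD y" by blast
  have x: "x : ?V"
  proof (cases j)
   case 0
   have "rD x = lin (%b. 0) x"
    by (rule lin_cong) (use keys_rD[OF y(1)] y(2) 0 B0 in \<open>auto simp: deg_part_def\<close>)
   thus ?thesis using keys_rD[OF y(1)] y(2) by simp
  next
   case (Suc i)
   thus ?thesis using keys_rD[OF y(1)] y rD_rD[of y i] by simp
  qed
  have "fw j x b = ?red j (fw (Suc j) y) b" if b: "b : Bn j" for b
  proof -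
   have "?red j (fw (Suc j) y) b = lkp (rD (pb (Suc j) (fw (Suc j) y))) (oi b)"
    using red[of "oi b" j "fw (Suc j) y"] oi_mem[OF b] by simp
   also have "pb (Suc j) (fw (Suc j) y) = y" by (rule pf[OF y(1)])
   also have "lkp (rD y) (oi b) = fw j x b" using b y(2) by (simp add: fw_def)
   finally show ?thesis by (rule sym)
  qed
  moreover have "\<forall>x. x ~: Bn (Suc j) --> fw (Suc j) y x = 0" by (simp add: fw_def)
  ultimately have "EX w. (\<forall>x. x ~: Bn (Suc j) --> w x = 0) & (\<forall>b\<in>Bn j. fw j x b = ?red j w b)" by blast
  hence "\<kappa> (fw j x) = \<zero>\<^bsub>Tor A j M N\<^esub>" unfolding k(6)[OF ZV[OF x]] .
  with x show "x : {x\<in>?V. \<kappa> (fw j x) = \<zero>\<^bsub>Tor A j M N\<^esub>}" by simp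
 qed
 finally show ?thesis .
qed

end

end

end

lemma keys_linE:
 assumes "b : keys (lin f x)"
 obtains a where "a : keys x" "b : keys (f a)"
proof -
 have "b : (\<Union>a\<in>keys x. keys (f a))" by (rule subsetD[OF keys_lin assms])
 thus ?thesis using that by (rule UN_E)
qed

lemma keys_addE:
 assumes "b : keys (x + y)"
 obtains "b : keys x" | "b : keys y"
 using subsetD[OF keys_add assms] by (rule UnE)

lemma keys_diffE:
 fixes x y :: "('a, 'k::field) fv"
 assumes "b : keys (x - y)"
 obtains "b : keys x" | "b : keys y"
proof -
 have "keys (x - y) <= keys x \<union> keys y" by (rule keys_diff_subset) simp_all
 hence "b : keys x \<union> keys y" using assms by (rule subsetD)
 thus ?thesis using that by (rule UnE)
qed

lemma keys_sclD: "b : keys (scl c x) ==> b : keys x"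
 by (rule subsetD[OF keys_scl])

section \<open>Combinatorial complexes and the bar resolution of the residue field\<close>

section \<open>Acyclicity by triangular homotopies\<close>

text \<open>\<open>h\<close> contracts the complex up to terms of smaller measure. For a cycle x the
  difference x - f (h x) is again a cycle, and its support has smaller measure; induction on a bound
  for the measure finishes. Homotopies that depend on a choice which the boundary may disturb are
  handled in this way.\<close>

lemma triangular_acyclic:
 fixes f h :: "'a => ('a, 'k::field) fv" and m :: "'a => nat"
 assumes fQ: "!!a. a : Q ==> keys (f a) <= Q" and ff: "!!a. a : Q ==> lin f (f a) = 0"
  and hQ: "!!a. a : Q ==> keys (h a) <= Q"
  and e: "!!a. a : Q ==> keys (lin f (h a) + lin h (f a) - unit_vec a) <= {b. m b < m a}"
  and x: "keys x <= Q" "lin f x = 0"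
 shows "EX y. keys y <= Q & lin f y = x"
proof -
 have ffx: "lin f (lin f y) = 0" if "keys y <= Q" for y
 proof -
  have "lin f (lin f y) = lin (%a. 0) y" unfolding lin_lin by (rule lin_cong) (use that ff in auto)
  thus ?thesis by simp
 qed
 have "\<forall>x. keys x <= Q & lin f x = 0 & keys x <= {b. m b < N} --> (EX y. keys y <= Q & lin f y = x)" for N
 proof (induction N)
  case 0
  have "EX y. keys y <= Q & lin f y = x" if "keys x <= {b. m b < 0}" for x :: "('a, 'k) fv"
  proof -
   have "keys x = {}" using that by simp
   hence "x = 0" by (metis keys_eq_empty)
   thus ?thesis by (intro exI[of _ 0]) simp
  qed
  thus ?case by blast
 next
  case (Suc N)
  show ?case
  proof (intro allI impI)
   fix x assume "keys x <= Q & lin f x = 0 & keys x <= {b. m b < Suc N}"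
   hence x: "keys x <= Q" "lin f x = 0" "keys x <= {b. m b < Suc N}" by auto
   let ?e = "%a. lin f (h a) + lin h (f a) - unit_vec a"
   have hx: "keys (lin h x) <= Q" by (rule keys_lin_subset) (use hQ x in auto)
   have "lin ?e x = lin f (lin h x) + lin h (lin f x) - x"
    by (simp add: lin_fun_add lin_fun_diff lin_lin)
   hence eq: "x - lin f (lin h x) = - lin ?e x" using x(2) by simp
   have "keys (lin ?e x) <= {b. m b < N}"
   proof (rule keys_lin_subset)
    fix a assume "a : keys x"
    hence "a : Q" "m a < Suc N" using x by auto
    thus "keys (?e a) <= {b. m b < N}" using e[of a] by auto
   qed
   hence k: "keys (x - lin f (lin h x)) <= {b. m b < N}" unfolding eq
    by (simp add: subset_iff in_keys_iff del: keys_minus)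
   have kQ: "keys (x - lin f (lin h x)) <= Q"
    by (rule keys_diff_subset[OF x(1) keys_lin_subset]) (use hx fQ in auto)
   have "lin f (x - lin f (lin h x)) = 0" using x(2) ffx[OF hx] by simp
   then obtain y where y: "keys y <= Q" "lin f y = x - lin f (lin h x)"
    using Suc[rule_format, of "x - lin f (lin h x)"] k kQ by auto
   hence "keys (y + lin h x) <= Q & lin f (y + lin h x) = x"
    using hx by (simp add: keys_add_subset)
   thus "EX y. keys y <= Q & lin f y = x" by blast
  qed
 qed
 moreover have "keys x <= {b. m b < Suc (Max (m ` keys x))}" by (auto simp: less_Suc_eq_le)
 ultimately show ?thesis using x by metis
qed

text \<open>The components of the preimage in other degrees have images supported away from degree
  j. The sum of these images also has to lie in degree j, hence it is zero, and the components may
  be dropped.\<close>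

lemma graded_preimage:
 fixes f :: "'a => ('a, 'k::field) fv" and g :: "'a => nat"
 assumes g: "!!a b. a : Q ==> b : keys (f a) ==> g a = Suc (g b)"
  and y: "keys y <= Q" and x: "lin f y = x" "keys x <= {b. g b = j}"
 shows "EX y'. keys y' <= Q \<inter> {b. g b = Suc j} & lin f y' = x"
proof (intro exI conjI)
 let ?y = "restr {b. g b = Suc j} y" and ?z = "restr (- {b. g b = Suc j}) y"
 show "keys ?y <= Q \<inter> {b. g b = Suc j}" using y by (auto simp: keys_restr)
 have "y = ?y + ?z" by (rule poly_mapping_eqI) (simp add: lookup_add)
 hence s: "lin f y = lin f ?y + lin f ?z" by (metis lin_add)
 have k1: "keys (lin f ?y) <= {b. g b = j}"
 proof (rule keys_lin_subset)
  fix a assume "a : keys ?y"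
  hence "a : Q" "g a = Suc j" using y by (auto simp: keys_restr)
  thus "keys (f a) <= {b. g b = j}" using g[of a] by auto
 qed
 have "keys (lin f ?z) <= - {b. g b = j}"
 proof (rule keys_lin_subset)
  fix a assume "a : keys ?z"
  hence "a : Q" "g a ~= Suc j" using y by (auto simp: keys_restr)
  thus "keys (f a) <= - {b. g b = j}" using g[of a] by auto
 qed
 moreover have "keys (lin f ?z) <= {b. g b = j}"
  using keys_diff_subset[OF x(2) k1] s x(1) by (metis add_diff_cancel_left')
 ultimately have "keys (lin f ?z) = {}" by blast
 hence "lin f ?z = 0" by (metis keys_eq_empty)
 thus "lin f ?y = x" using s x(1) by simp
qed

section \<open>The ordered Taylor complex\<close>

abbreviation pre :: "'g => 'g list => ('g list, 'k::field) fv" where "pre u m \<equiv> unit_vec (u # m)"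

text \<open>The boundary omits one letter at a time. All monomial coefficients are set to one: the
 multigraded complexes below are recovered from it strand by strand.\<close>

fun bd :: "'g list => ('g list, 'k::field) fv" where
 "bd [] = 0"
| "bd (u # l) = unit_vec l - lin (pre u) (bd l)"

abbreviation sg :: "'g list => 'k::field" where "sg l \<equiv> (- 1) ^ length l"

text \<open>The graded Leibniz rule: together with concatenation, the boundary turns lists into a
  differential graded algebra in which every letter has boundary 1.\<close>

lemma bd_append: "bd (l @ m) = lin (%x. unit_vec (x @ m)) (bd l) + scl (sg l) (lin (%x. unit_vec (l @ x)) (bd m))"
proof (induction l)
 case (Cons u l)
 show ?case by (simp add: Cons.IH lin_lin)
qed simp

lemma bd_bd: "lin bd (bd l) = (0 :: ('g list, 'k::field) fv)"
proof (induction l)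
 case (Cons u l)
 have "lin bd (bd (u # l)) = bd l - (lin unit_vec (bd l) - lin (pre u) (lin bd (bd l) :: ('g list, 'k) fv))"
  by (simp add: lin_lin lin_fun_diff del: lin_unit_vec)
 thus ?case using Cons.IH by simp
qed simp

lemma keys_bd:
 assumes "m : keys (bd l :: ('g list, 'k::field) fv)"
 shows "set m <= set l & length l = Suc (length m)"
 using assms
proof (induction l arbitrary: m)
 case (Cons u l)
 have "keys (bd (u # l) :: ('g list, 'k) fv) <= insert l ((#) u ` keys (bd l :: ('g list, 'k) fv))"
  by (simp, rule keys_diff_subset) (auto intro!: keys_lin_subset)
 with Cons show ?case by fastforce
qed simp

section \<open>The Koszul complex\<close>

definition ksign :: "nat => nat set => 'k::field" where "ksign i E = (- 1) ^ card {j\<in>E. j < i}"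

text \<open>A set E stands for the exterior product of the e_i with i in E in increasing order. The
  variables are set to one here as well, so e_i has boundary 1.\<close>

definition bK :: "nat set => (nat set, 'k::field) fv" where
 "bK E = (\<Sum>i\<in>E. scl (ksign i E) (unit_vec (E - {i})))"

text \<open>Left multiplication by e_i in the exterior algebra.\<close>

definition eps :: "nat => nat set => (nat set, 'k::field) fv" where
 "eps i E = (if i : E then 0 else scl (ksign i E) (unit_vec (insert i E)))"

lemma ksign_square: "ksign i E * ksign i E = (1 :: 'k::field)"
 by (simp add: ksign_def power_add[symmetric] flip: mult_2)

lemma ksign_insert:
 assumes "finite E" "i ~: E" "i ~= j"
 shows "ksign j (insert i E) = (if i < j then - ksign j E else (ksign j E :: 'k::field))"
proof -
 have "{k : insert i E. k < j} = (if i < j then insert i {k\<in>E. k < j} else {k\<in>E. k < j})" by auto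
 thus ?thesis using assms by (simp add: ksign_def)
qed

lemma ksign_self: "ksign i (insert i E) = ksign i E" "ksign i (E - {i}) = ksign i E"
proof -
 have "{j : insert i E. j < i} = {j\<in>E. j < i}" "{j : E - {i}. j < i} = {j\<in>E. j < i}" by auto
 thus "ksign i (insert i E) = ksign i E" "ksign i (E - {i}) = ksign i E" by (simp_all add: ksign_def)
qed

text \<open>The Leibniz rule for left multiplication by e_i, whose boundary is 1. For i in E one
  boundary term is undone and eps vanishes; otherwise the sums cancel in pairs by the signs in
  \<open>*\<close>.\<close>

lemma bK_eps:
 assumes E: "finite E"
 shows "lin bK (eps i E) + lin (eps i) (bK E) = (unit_vec E :: (nat set, 'k::field) fv)"
proof (cases "i : E")
 case True
 have "lin (eps i) (bK E) = (\<Sum>j\<in>E. if j = i then unit_vec E else (0 :: (nat set, 'k) fv))"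
  unfolding bK_def lin_sum
  by (rule sum.cong) (use True in \<open>auto simp: eps_def ksign_self ksign_square insert_absorb\<close>)
 thus ?thesis using True E by (simp add: eps_def)
next
 case False
 have *: "ksign i E * ksign j (insert i E) = - (ksign j E * (ksign i (E - {j}) :: 'k))" if j: "j : E" for j
 proof -
  have ne: "i ~= j" using j False by auto
  have "ksign i E = ksign i (insert j (E - {j}))" using j by (simp add: insert_absorb)
  also have "... = (if j < i then - ksign i (E - {j}) else (ksign i (E - {j}) :: 'k))"
   by (rule ksign_insert) (use E ne in auto)
  finally show ?thesis using ksign_insert[OF E False ne] ne by (auto simp: algebra_simps)
 qed
 have ins: "insert i (E - {j}) = insert i E - {j}" if "j : E" for j using that False by auto
 have "lin (eps i) (bK E) = (\<Sum>j\<in>E. scl (ksign j E * ksign i (E - {j})) (unit_vec (insert i E - {j}) :: (nat set, 'k) fv))"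
  unfolding bK_def lin_sum by (rule sum.cong) (use False in \<open>auto simp: eps_def ins\<close>)
 moreover have "lin bK (eps i E) = scl (ksign i E * ksign i (insert i E)) (unit_vec E)
   + (\<Sum>j\<in>E. scl (ksign i E * ksign j (insert i E)) (unit_vec (insert i E - {j}) :: (nat set, 'k) fv))"
  using False E by (simp add: eps_def bK_def pm.scale_sum_right pm.scale_right_distrib del: scl_single)
 moreover have "(\<Sum>j\<in>E. scl (ksign i E * ksign j (insert i E)) (unit_vec (insert i E - {j}) :: (nat set, 'k) fv))
   = - (\<Sum>j\<in>E. scl (ksign j E * ksign i (E - {j})) (unit_vec (insert i E - {j})))"
  unfolding sum_negf[symmetric] by (rule sum.cong) (simp_all add: * single_uminus)
 ultimately show ?thesis by (simp add: ksign_self ksign_square)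
qed

lemma keys_bK: "E' : keys (bK E :: (nat set, 'k::field) fv) ==> \<exists>i\<in>E. E' = E - {i}"
 using keys_sum[of "%i. scl (ksign i E) (unit_vec (E - {i}) :: (nat set, 'k) fv)" E]
 unfolding bK_def by (auto split: if_splits)

lemma keys_eps: "E' : keys (eps i E :: (nat set, 'k::field) fv) ==> i ~: E & E' = insert i E"
 by (auto simp: eps_def split: if_splits)

text \<open>Up to sign \<open>insert i E\<close> is e_i times E, and \<open>bK_eps\<close> moves the
  boundary past e_i.\<close>

lemma bK_bK: "finite E ==> lin bK (bK E) = (0 :: (nat set, 'k::field) fv)"
proof (induction E rule: finite_induct)
 case (insert i E)
 have ins: "unit_vec (insert i E) = scl (ksign i E) (eps i E :: (nat set, 'k) fv)"
  using insert(2) by (simp add: eps_def ksign_square)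
 have "lin bK (unit_vec (insert i E)) = scl (ksign i E) (unit_vec E - lin (eps i) (bK E :: (nat set, 'k) fv))"
  unfolding ins lin_scl using bK_eps[OF insert(1), of i, where 'k = 'k] by (simp add: eq_diff_eq)
 hence b: "bK (insert i E) = scl (ksign i E) (unit_vec E - lin (eps i) (bK E :: (nat set, 'k) fv))" by simp
 have "lin bK (lin (eps i) (bK E)) = lin (%E'. unit_vec E' - lin (eps i) (bK E' :: (nat set, 'k) fv)) (bK E)"
  unfolding lin_lin
 proof (rule lin_cong)
  fix E' assume "E' : keys (bK E :: (nat set, 'k) fv)"
  hence "finite E'" using keys_bK insert(1) by fastforce
  from bK_eps[OF this, of i, where 'k = 'k] show "lin bK (eps i E') = unit_vec E' - lin (eps i) (bK E' :: (nat set, 'k) fv)"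
   by (simp add: eq_diff_eq)
 qed
 also have "... = bK E - lin (eps i) (lin bK (bK E))" by (simp add: lin_fun_diff lin_lin)
 finally show ?case using insert(3) by (simp add: b)
qed (simp add: bK_def)

section \<open>The bar construction\<close>

text \<open>A triple (l, w, E) stands for l \<otimes> [w] \<otimes> e_E in the two-sided bar
  construction whose left coefficients are the list algebra and whose right coefficients are the
  Koszul complex.\<close>

type_synonym 'g xbase = "'g list \<times> 'g list list \<times> nat set"

context
 fixes ix :: "'g => nat"
begin

text \<open>The algebra map from lists to the exterior algebra that sends a letter u to e_(ix u),
  acting by left multiplication. It is the lift of the identity from the resolution of the quotient
  ring to the Koszul complex, with coefficients stripped.\<close>

fun psi :: "'g list => nat set => (nat set, 'k::field) fv" where
 "psi [] E = unit_vec E"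
| "psi (u # l) E = lin (eps (ix u)) (psi l E)"

abbreviation jK :: "nat set => ('g xbase, 'k::field) fv" where "jK E \<equiv> unit_vec ([], [], E)"

text \<open>The augmentation of the bar construction onto the Koszul complex, followed by the
  inclusion of the latter.\<close>

definition irho :: "'g xbase => ('g xbase, 'k::field) fv" where
 "irho = (%(l, w, E). if w = [] then lin jK (psi l E) else 0)"

text \<open>The extra degeneracy, which turns the left coefficient into a bar letter. It vanishes on
  an empty left factor, so bar letters stay nonempty.\<close>

definition beta :: "'g xbase => ('g xbase, 'k::field) fv" where
 "beta = (%(l, w, E). if l = [] then 0 else unit_vec ([], l # w, E))"

definition cat :: "'g list => 'g xbase => ('g xbase, 'k::field) fv" where
 "cat m = (%(l, w, E). unit_vec (m @ l, w, E))"

text \<open>The differential is not entered face by face. It is determined by the Leibniz rule in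
  the left factor and by the homotopy identity d beta + beta d = 1 - irho: solving that identity for
  d at ([], m # w, E) gives the recursion. Signs and merging terms then come out by
  themselves.\<close>

fun DX :: "'g list => 'g list list => nat set => ('g xbase, 'k::field) fv" where
 "DX l [] E = lin (%x. unit_vec (x, [], E)) (bd l) + scl (sg l) (lin (%E'. unit_vec (l, [], E')) (bK E))"
| "DX l (m # w) E = lin (%x. unit_vec (x, m # w, E)) (bd l)
  + scl (sg l) (lin (cat l) (unit_vec (m, w, E) - irho (m, w, E) - lin beta (DX m w E)))"

definition DXb :: "'g xbase => ('g xbase, 'k::field) fv" where
 "DXb = (%(l, w, E). DX l w E)"

lemma psi_append: "psi (l @ m) E = lin (psi l) (psi m E :: (nat set, 'k::field) fv)"
 by (induction l) (simp_all add: lin_lin)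

lemma keys_psi:
 "E' : keys (psi l E :: (nat set, 'k::field) fv) ==> E' = ix ` set l \<union> E & distinct (map ix l) & ix ` set l \<inter> E = {}"
proof (induction l arbitrary: E')
 case (Cons u l)
 then obtain E1 where "E1 : keys (psi l E :: (nat set, 'k) fv)" "E' : keys (eps (ix u) E1 :: (nat set, 'k) fv)"
  using keys_lin[of "eps (ix u)" "psi l E :: (nat set, 'k) fv"] by auto
 with Cons.IH[of E1] keys_eps[of E' "ix u" E1, where 'k = 'k] show ?case by auto
qed auto

lemma psi_chain:
 assumes "finite E"
 shows "lin bK (psi l E) = lin (%x. psi x E) (bd l) + scl (sg l) (lin (psi l) (bK E :: (nat set, 'k::field) fv))"
proof (induction l)
 case (Cons u l)
 have "lin bK (psi (u # l) E) = lin (%E'. unit_vec E' - lin (eps (ix u)) (bK E' :: (nat set, 'k) fv)) (psi l E)"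
  unfolding psi.simps lin_lin
 proof (rule lin_cong)
  fix E' assume "E' : keys (psi l E :: (nat set, 'k) fv)"
  hence "finite E'" using keys_psi assms by fastforce
  from bK_eps[OF this, of "ix u", where 'k = 'k] show "lin bK (eps (ix u) E') = unit_vec E' - lin (eps (ix u)) (bK E' :: (nat set, 'k) fv)"
   by (simp add: eq_diff_eq)
 qed
 also have "... = psi l E - lin (eps (ix u)) (lin bK (psi l E))" by (simp add: lin_fun_diff lin_lin)
 also have "... = psi l E - lin (%x. psi (u # x) E) (bd l) - scl (sg l) (lin (psi (u # l)) (bK E))"
 proof -
  have "psi (u # l) = (%E. lin (eps (ix u)) (psi l E :: (nat set, 'k) fv))" by (rule ext) simp
  hence "lin (%E. lin (eps (ix u)) (psi l E)) (bK E) = lin (psi (u # l)) (bK E :: (nat set, 'k) fv)" by simp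
  thus ?thesis by (simp add: Cons.IH lin_lin)
 qed
 also have "... = lin (%x. psi x E) (bd (u # l)) + scl (sg (u # l)) (lin (psi (u # l)) (bK E))"
  by (simp add: lin_lin)
 finally show ?case .
qed simp

lemma cat_simp: "cat [] y = unit_vec y"
 by (cases y) (simp add: cat_def)

lemma lin_cat_Nil [simp]: "lin (cat []) y = (y :: ('g xbase, 'k::field) fv)"
proof -
 have "lin (cat []) y = lin unit_vec y" by (rule lin_cong) (simp add: cat_simp)
 thus ?thesis by simp
qed

lemma DX_left: "DX l w E = lin (%x. unit_vec (x, w, E)) (bd l) + scl (sg l) (lin (cat l) (DX [] w E :: ('g xbase, 'k::field) fv))"
proof (cases w)
 case Nil
 thus ?thesis by (simp add: lin_lin cat_def)
next
 case (Cons m v)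
 thus ?thesis by (simp add: cat_simp)
qed

lemma DX_append:
 "DX (l @ m) w E = lin (%x. unit_vec (x @ m, w, E)) (bd l) + scl (sg l) (lin (cat l) (DX m w E :: ('g xbase, 'k::field) fv))"
proof -
 have c: "lin (cat (l @ m)) y = lin (cat l) (lin (cat m) y)" for y :: "('g xbase, 'k) fv"
  unfolding lin_lin by (rule lin_cong) (auto simp: cat_def split: prod.splits)
 show ?thesis
  unfolding DX_left[of "l @ m"] DX_left[of m] c
  by (simp add: bd_append lin_lin power_add pm.scale_right_distrib) (simp add: cat_def)
qed

lemma irho_jK: "irho ([], [], E) = (jK E :: ('g xbase, 'k::field) fv)"
 by (simp add: irho_def)

lemma lin_irho_irho: "lin irho (irho y) = (irho y :: ('g xbase, 'k::field) fv)"
proof (cases y)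
 case (fields l w E)
 show ?thesis unfolding fields irho_def by (simp add: lin_lin)
qed

lemma lin_irho_beta: "lin irho (beta y) = (0 :: ('g xbase, 'k::field) fv)"
 by (cases y) (simp add: irho_def beta_def)

lemma lin_beta_irho: "lin beta (irho y) = (0 :: ('g xbase, 'k::field) fv)"
 by (cases y) (simp add: irho_def beta_def lin_lin)

lemma lin_beta_beta: "lin beta (beta y) = (0 :: ('g xbase, 'k::field) fv)"
 by (cases y) (simp add: beta_def)

lemma DXb_irho: "lin DXb (irho (l, w, E)) = (if w = [] then lin jK (lin bK (psi l E)) else (0 :: ('g xbase, 'k::field) fv))"
 by (simp add: irho_def lin_lin DXb_def)

text \<open>Without bar letters this is \<open>psi_chain\<close>. With a bar letter both sides
  vanish: the recursive term has the form y - irho y - beta z, and irho is idempotent and kills the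
  image of beta.\<close>

lemma irho_chain:
 assumes E: "finite E"
 shows "lin irho (DX l w E) = lin DXb (irho (l, w, E) :: ('g xbase, 'k::field) fv)"
proof (cases w)
 case Nil
 thus ?thesis unfolding DXb_irho psi_chain[OF E] by (simp add: lin_lin irho_def)
next
 case (Cons m v)
 let ?Z = "unit_vec (m, v, E) - irho (m, v, E) - lin beta (DX m v E) :: ('g xbase, 'k) fv"
 let ?P = "%(x, w, E'). lin jK (psi l E') :: ('g xbase, 'k) fv"
 have 1: "lin irho (lin (cat l) y) = lin ?P (lin irho y)" for y :: "('g xbase, 'k) fv"
  unfolding lin_lin
  by (rule lin_cong) (auto simp: irho_def cat_def psi_append lin_lin split: prod.splits)
 have "lin irho ?Z = irho (m, v, E) - lin irho (irho (m, v, E)) - lin (%y. lin irho (beta y)) (DX m v E)"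
  by (simp add: lin_lin)
 also have "... = 0" by (simp add: lin_irho_irho lin_irho_beta)
 finally have "lin irho (lin (cat l) ?Z) = 0" unfolding 1 by simp
 moreover have "lin irho (lin (%x. unit_vec (x, m # v, E)) (bd l)) = (0 :: ('g xbase, 'k) fv)"
  by (simp add: lin_lin irho_def)
 ultimately show ?thesis unfolding DXb_irho Cons by simp
qed

definition wfx :: "'g xbase => bool" where
 "wfx = (%(l, w, E). [] ~: set w & finite E)"

text \<open>For a nonempty left factor this is the recursion defining \<open>DX\<close>. For an
  empty one the term d beta is zero, and beta applied to the recursion returns the original triple
  because beta kills the images of irho and beta; nonempty bar letters are used here.\<close>

lemma DXb_beta:
 assumes "wfx y"
 shows "lin DXb (beta y) + lin beta (DXb y) = unit_vec y - (irho y :: ('g xbase, 'k::field) fv)"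
proof (cases y)
 case (fields l w E)
 show ?thesis
 proof (cases "l = []")
  case False
  thus ?thesis by (simp add: fields beta_def DXb_def cat_simp)
 next
  case True
  show ?thesis
  proof (cases w)
   case Nil
   thus ?thesis using True by (simp add: fields beta_def DXb_def irho_jK lin_lin)
  next
   case (Cons m v)
   hence m: "m ~= []" using assms by (auto simp: fields wfx_def)
   have "lin beta (DXb y) = beta (m, v, E) - lin beta (irho (m, v, E)) - lin (%y. lin beta (beta y)) (DX m v E)"
    by (simp add: fields True Cons DXb_def lin_lin cat_simp)
   hence "lin beta (DXb y) = (unit_vec y :: ('g xbase, 'k) fv)"
    using m by (simp add: lin_beta_irho lin_beta_beta) (simp add: fields True Cons beta_def)
   thus ?thesis by (simp add: fields True Cons beta_def irho_def)
  qed
 qed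
qed

lemma lin_swap: "lin (%a. lin (%b. f a b) y) x = lin (%b. lin (%a. f a b) x) (y :: ('b, 'k::field) fv)"
 unfolding lin_def pm.scale_sum_right by (subst sum.swap) (simp add: mult.commute)

text \<open>Expanding d d by the Leibniz rule leaves the square of \<open>bd\<close>, the square at
  the empty left factor, and two mixed terms. The mixed terms cancel because \<open>bd\<close>
  shortens the list by one and so reverses \<open>sg\<close>.\<close>

lemma DXb_DX_left:
 assumes "lin DXb (DX [] w E) = (0 :: ('g xbase, 'k::field) fv)"
 shows "lin DXb (DX l w E) = (0 :: ('g xbase, 'k::field) fv)"
proof -
 let ?Y = "DX [] w E :: ('g xbase, 'k) fv" and ?Z = "lin (%x. lin (cat x) (DX [] w E)) (bd l) :: ('g xbase, 'k) fv"
 have "lin DXb (lin (%x. unit_vec (x, w, E)) (bd l)) = lin (%x. DX x w E :: ('g xbase, 'k) fv) (bd l)"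
  by (simp add: lin_lin DXb_def)
 also have "... = lin (%x. lin (%z. unit_vec (z, w, E)) (bd x) + scl (sg x) (lin (cat x) ?Y)) (bd l)"
  by (rule lin_cong) (rule DX_left)
 also have "... = lin (%z. unit_vec (z, w, E)) (lin bd (bd l)) + lin (%x. scl (sg x) (lin (cat x) ?Y)) (bd l)"
  by (simp add: lin_fun_add lin_lin)
 also have "lin (%x. scl (sg x) (lin (cat x) ?Y)) (bd l) = lin (%x. scl (- sg l) (lin (cat x) ?Y)) (bd l)"
 proof (rule lin_cong)
  fix x assume "x : keys (bd l :: ('g list, 'k) fv)"
  hence "length l = Suc (length x)" using keys_bd by blast
  thus "scl (sg x) (lin (cat x) ?Y) = scl (- sg l) (lin (cat x) ?Y)" by simp
 qed
 finally have 1: "lin DXb (lin (%x. unit_vec (x, w, E)) (bd l)) = - scl (sg l) ?Z"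
  by (simp add: bd_bd lin_fun_minus lin_fun_scl)
 have "lin DXb (lin (cat l) ?Y) = lin (%y. lin (%x. cat x y) (bd l) + scl (sg l) (lin (cat l) (DXb y))) ?Y"
  unfolding lin_lin
  by (rule lin_cong) (auto simp: cat_def DXb_def DX_append[unfolded cat_def] split: prod.splits)
 also have "... = ?Z + scl (sg l) (lin (cat l) (lin DXb ?Y))"
  by (simp add: lin_fun_add lin_fun_scl lin_lin lin_swap[of "%y x. cat x y"])
 finally have 2: "lin DXb (lin (cat l) ?Y) = ?Z" using assms by simp
 show ?thesis unfolding DX_left[of l w E] lin_add lin_scl 1 2 by simp
qed

lemma keys_beta: "b : keys (beta y :: ('g xbase, 'k::field) fv) ==> EX l w E. y = (l, w, E) & l ~= [] & b = ([], l # w, E)"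
 by (cases y) (auto simp: beta_def split: if_splits)

lemma keys_irho:
 assumes "b : keys (irho (l, w, E) :: ('g xbase, 'k::field) fv)"
 shows "w = [] & (\<exists>E'\<in>keys (psi l E :: (nat set, 'k) fv). b = ([], [], E'))"
proof -
 have w: "w = []" using assms by (auto simp: irho_def split: if_splits)
 hence "b : keys (lin jK (psi l E :: (nat set, 'k) fv))" using assms by (simp add: irho_def)
 then obtain E' where "E' : keys (psi l E :: (nat set, 'k) fv)" "b : keys (jK E' :: ('g xbase, 'k) fv)" by (rule keys_linE)
 thus ?thesis using w by auto
qed

text \<open>The familiar faces of the bar construction, recovered from the recursion: they are the
  shape in which multidegrees and homological degrees are estimated.\<close>

lemma keys_DX_Cons:
 assumes "b : keys (DX l (m # w) E :: ('g xbase, 'k::field) fv)"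
 obtains (left) x where "x : keys (bd l :: ('g list, 'k) fv)" "b = (x, m # w, E)"
 | (merge) "b = (l @ m, w, E)"
 | (act) E' where "w = []" "E' : keys (psi m E :: (nat set, 'k) fv)" "b = (l, [], E')"
 | (right) p v F where "(p, v, F) : keys (DX m w E :: ('g xbase, 'k) fv)" "p ~= []" "b = (l, p # v, F)"
proof -
 let ?Z = "unit_vec (m, w, E) - irho (m, w, E) - lin beta (DX m w E) :: ('g xbase, 'k) fv"
 from assms show ?thesis unfolding DX.simps
 proof (rule keys_addE)
  assume "b : keys (lin (%x. unit_vec (x, m # w, E)) (bd l) :: ('g xbase, 'k) fv)"
  then obtain x where "x : keys (bd l :: ('g list, 'k) fv)" "b : keys (unit_vec (x, m # w, E) :: ('g xbase, 'k) fv)"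
   by (rule keys_linE)
  thus ?thesis using left by simp
 next
  assume "b : keys (scl (sg l) (lin (cat l) ?Z))"
  hence "b : keys (lin (cat l) ?Z)" by (rule keys_sclD)
  then obtain z where z: "z : keys ?Z" "b : keys (cat l z :: ('g xbase, 'k) fv)" by (rule keys_linE)
  from z(1) show ?thesis
  proof (rule keys_diffE)
   assume "z : keys (lin beta (DX m w E) :: ('g xbase, 'k) fv)"
   then obtain y where y: "y : keys (DX m w E :: ('g xbase, 'k) fv)" "z : keys (beta y :: ('g xbase, 'k) fv)"
    by (rule keys_linE)
   obtain p v F where "y = (p, v, F)" "p ~= []" "z = ([], p # v, F)" using keys_beta[OF y(2)] by blast
   thus ?thesis using z(2) y(1) right by (simp add: cat_def)
  next
   assume "z : keys (unit_vec (m, w, E) - irho (m, w, E) :: ('g xbase, 'k) fv)"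
   thus ?thesis
   proof (rule keys_diffE)
    assume "z : keys (unit_vec (m, w, E) :: ('g xbase, 'k) fv)"
    thus ?thesis using z(2) merge by (simp add: cat_def)
   next
    assume "z : keys (irho (m, w, E) :: ('g xbase, 'k) fv)"
    from keys_irho[OF this] obtain E' where "w = []" "E' : keys (psi m E :: (nat set, 'k) fv)" "z = ([], [], E')"
     by blast
    thus ?thesis using z(2) act by (simp add: cat_def)
   qed
  qed
 qed
qed

lemma keys_DX_Nil:
 assumes "b : keys (DX l [] E :: ('g xbase, 'k::field) fv)"
 obtains (left) x where "x : keys (bd l :: ('g list, 'k) fv)" "b = (x, [], E)"
 | (koszul) E' where "E' : keys (bK E :: (nat set, 'k) fv)" "b = (l, [], E')"
proof -
 let ?K = "lin (%E'. unit_vec (l, [], E')) (bK E) :: ('g xbase, 'k) fv"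
 from assms show ?thesis unfolding DX.simps
 proof (rule keys_addE)
  assume "b : keys (lin (%x. unit_vec (x, [], E)) (bd l) :: ('g xbase, 'k) fv)"
  then obtain x where "x : keys (bd l :: ('g list, 'k) fv)" "b : keys (unit_vec (x, [], E) :: ('g xbase, 'k) fv)"
   by (rule keys_linE)
  thus ?thesis using left by simp
 next
  assume "b : keys (scl (sg l) ?K)"
  hence "b : keys ?K" by (rule keys_sclD)
  then obtain E' where "E' : keys (bK E :: (nat set, 'k) fv)" "b : keys (unit_vec (l, [], E') :: ('g xbase, 'k) fv)"
   by (rule keys_linE)
  thus ?thesis using koszul by simp
 qed
qed

lemma wfx_DX:
 assumes "wfx (l, w, E)" "b : keys (DX l w E :: ('g xbase, 'k::field) fv)"
 shows "wfx b"
 using assms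
proof (induction w arbitrary: l E b)
 case Nil
 show ?case using Nil(2)
 proof (cases rule: keys_DX_Nil)
  case (koszul E')
  hence "finite E'" using keys_bK Nil(1) by (fastforce simp: wfx_def)
  thus ?thesis using koszul by (simp add: wfx_def)
 qed (use Nil in \<open>simp add: wfx_def\<close>)
next
 case (Cons m w)
 have mw: "wfx (m, w, E)" using Cons.prems(1) by (auto simp: wfx_def)
 show ?case using Cons.prems(2)
 proof (cases rule: keys_DX_Cons)
  case (act E')
  hence "finite E'" using keys_psi Cons.prems(1) by (fastforce simp: wfx_def)
  thus ?thesis using act by (simp add: wfx_def)
 next
  case (right p v F)
  thus ?thesis using Cons.IH[OF mw] by (auto simp: wfx_def)
 qed (use Cons.prems in \<open>simp_all add: wfx_def\<close>)
qed

text \<open>With y = d (m, w, E), the homotopy identity rewrites d (beta y) as y - irho y - beta (d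
  y). After cancellation there remain the commutation of irho with d and the induction hypothesis d
  y = 0.\<close>

lemma DXb_DX:
 assumes "wfx (l, w, E)"
 shows "lin DXb (DX l w E) = (0 :: ('g xbase, 'k::field) fv)"
 using assms
proof (induction w arbitrary: l E)
 case Nil
 have "lin DXb (DX [] [] E) = lin jK (lin bK (bK E :: (nat set, 'k) fv))"
  by (simp add: lin_lin DXb_def)
 also have "... = 0" using Nil by (simp add: wfx_def bK_bK)
 finally show ?case by (rule DXb_DX_left)
next
 case (Cons m w)
 have mw: "wfx (m, w, E)" and E: "finite E" using Cons.prems(1) by (auto simp: wfx_def)
 let ?y = "DX m w E :: ('g xbase, 'k) fv"
 have b: "lin DXb (lin beta ?y) = ?y - lin irho ?y - lin beta (lin DXb ?y)"
 proof -
  have "lin DXb (lin beta ?y) = lin (%y. unit_vec y - irho y - lin beta (DXb y)) ?y"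
   unfolding lin_lin
  proof (rule lin_cong)
   fix y assume "y : keys ?y"
   hence "wfx y" by (rule wfx_DX[OF mw])
   from DXb_beta[OF this, where 'k = 'k] show "lin DXb (beta y) = unit_vec y - irho y - lin beta (DXb y :: ('g xbase, 'k) fv)"
    by (simp add: eq_diff_eq)
  qed
  also have "... = ?y - lin irho ?y - lin beta (lin DXb ?y)"
   by (simp add: lin_fun_diff lin_lin)
  finally show ?thesis .
 qed
 have "lin DXb (DX [] (m # w) E) = lin DXb (unit_vec (m, w, E) - irho (m, w, E) - lin beta ?y)"
  unfolding DX.simps bd.simps lin_zero add_0 list.size power_0 pm.scale_one lin_cat_Nil by (rule refl)
 also have "... = DXb (m, w, E) - lin DXb (irho (m, w, E)) - lin DXb (lin beta ?y)"
  by simp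
 also have "... = lin irho ?y - lin DXb (irho (m, w, E)) + lin beta (lin DXb ?y)"
  unfolding b by (simp add: DXb_def)
 also have "... = 0" using irho_chain[OF E, of m w, where 'k = 'k] Cons.IH[OF mw] by simp
 finally show ?case by (rule DXb_DX_left)
qed

end

section \<open>Degrees\<close>

definition mlcm :: "expo => expo => expo" where
 "mlcm a b = a + (b - a)"

lemma lookup_mlcm: "lkp (mlcm a b) i = max (lkp a i) (lkp b i)"
 by (simp add: mlcm_def lookup_add lookup_minus)

lemma mle_mlcm: "mle (mlcm a b) c \<longleftrightarrow> mle a c & mle b c"
 by (auto simp: mle_def lookup_mlcm)

lemma mle_plus_iff: "mle (a + b) c \<longleftrightarrow> mle b c & mle a (c - b)"
 unfolding mle_def lookup_add lookup_minus
proof (intro iffI conjI allI)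
 fix i assume *: "\<forall>i. lkp a i + lkp b i <= lkp c i"
 show "lkp b i <= lkp c i" "lkp a i <= lkp c i - lkp b i" using *[rule_format, of i] by simp_all
next
 fix i assume "(\<forall>i. lkp b i <= lkp c i) & (\<forall>i. lkp a i <= lkp c i - lkp b i)"
 hence "lkp b i <= lkp c i" "lkp a i <= lkp c i - lkp b i" by auto
 thus "lkp a i + lkp b i <= lkp c i" by simp
qed

lemma mle_diff_mono: "mle a b ==> mle (c - b) (c - a)"
 by (simp add: mle_def lookup_minus diff_le_mono2)

definition sqf :: "nat set => expo" where
 "sqf E = (\<Sum>i\<in>E. sgl i 1)"

lemma lookup_sqf: "finite E ==> lkp (sqf E) i = (if i : E then 1 else 0)"
 by (simp add: sqf_def lookup_sum lookup_single when_def)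

lemma sqf_empty [simp]: "sqf {} = 0" by (simp add: sqf_def)

lemma sqf_exponents: "E <= {1..n} ==> sqf E : exponents n"
proof -
 assume E: "E <= {1..n}"
 hence "finite E" by (rule finite_subset) simp
 hence "keys (sqf E) = E" by (simp add: set_eq_iff in_keys_iff lookup_sqf)
 thus ?thesis using E by (simp add: exponents_def)
qed

text \<open>\<open>gs\<close> maps labels to the exponents of the generators, and
  \<open>ix u\<close> is a variable dividing the generator u. With coefficients restored, the
  generator is the Koszul boundary of its quotient by that variable times e_(ix u).\<close>

locale bar_setup =
 fixes gs :: "'g => expo" and n :: nat and GL :: "'g set" and ix :: "'g => nat"
 assumes finGL: "finite GL" and gs: "!!u. u : GL ==> gs u : exponents n"
  and ix: "!!u. u : GL ==> ix u : {1..n} & lkp (gs u) (ix u) ~= 0"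
begin

fun lc :: "'g list => expo" where
 "lc [] = 0"
| "lc (u # l) = mlcm (gs u) (lc l)"

lemma mle_lc: "mle (lc l) al \<longleftrightarrow> (\<forall>u\<in>set l. mle (gs u) al)"
 by (induction l) (auto simp: mle_mlcm)

lemma mle_gs_lc: "u : set l ==> mle (gs u) (lc l)"
 using mle_lc[of l "lc l"] by simp

lemma lc_mono: "set m <= set l ==> mle (lc m) (lc l)"
 unfolding mle_lc[of m] using mle_gs_lc by blast

lemma lc_append_le: "mle (lc (l @ m)) (lc l + lc m)"
 unfolding mle_lc
proof
 fix u assume "u : set (l @ m)"
 then consider "u : set l" | "u : set m" by auto
 thus "mle (gs u) (lc l + lc m)"
  by cases (rule mle_trans[OF mle_gs_lc mle_add(1)] mle_trans[OF mle_gs_lc mle_add(2)], assumption)+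
qed

lemma lc_exponents: "(!!u. u : set l ==> gs u : exponents n) ==> lc l : exponents n"
proof (induction l)
 case (Cons u l)
 thus ?case by (simp add: mlcm_def exponents_add exponents_diff)
qed simp

definition dW :: "'g list list => expo" where "dW w = sum_list (map lc w)"

definition dF :: "'g list list \<times> nat set => expo" where "dF = (%(w, E). dW w + sqf E)"

definition dX :: "'g xbase => expo" where "dX = (%(l, w, E). lc l + dF (w, E))"

text \<open>Every bar letter is suspended, hence the successor. The definitions beginning with
  \<open>h\<close> are homological degrees, those beginning with \<open>d\<close>
  multidegrees.\<close>

definition hW :: "'g list list => nat" where "hW w = sum_list (map (%l. Suc (length l)) w)"

definition hF :: "'g list list \<times> nat set => nat" where "hF = (%(w, E). hW w + card E)"

definition hX :: "'g xbase => nat" where "hX = (%(l, w, E). length l + hF (w, E))"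

lemma dF_Cons: "dF (m # w, E) = dX (m, w, E)"
 by (simp add: dF_def dX_def dW_def add.assoc)

lemma dX_Nil: "dX ([], w, E) = dF (w, E)"
 by (simp add: dX_def)

lemma hF_Cons: "hF (m # w, E) = Suc (hX (m, w, E))"
 by (simp add: hF_def hX_def hW_def)

lemma hX_Nil: "hX ([], w, E) = hF (w, E)"
 by (simp add: hX_def)

definition okW :: "'g list list => bool" where "okW w \<longleftrightarrow> (\<forall>m\<in>set w. m ~= [] & set m <= GL)"

definition okX :: "'g xbase => bool" where
 "okX = (%(l, w, E). set l <= GL & okW w & E <= {1..n})"

lemma okX_wfx: "okX a ==> wfx a"
 by (auto simp: okX_def okW_def wfx_def intro: finite_subset split: prod.splits)

text \<open>A nonzero action needs distinct variables \<open>ix u\<close> outside E, and each of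
  them divides the generator it comes from.\<close>

lemma psi_degree:
 assumes m: "set m <= GL" and E: "E <= {1..n}" and E': "E' : keys (psi ix m E :: (nat set, 'k::field) fv)"
 shows "E' <= {1..n}" "mle (sqf E') (lc m + sqf E)" "card E' = length m + card E"
proof -
 note k = keys_psi[OF E']
 have fE: "finite E" using E finite_subset by blast
 show E'n: "E' <= {1..n}"
 proof -
  have "ix ` set m <= {1..n}" using m ix by blast
  thus ?thesis using k E by blast
 qed
 hence fE': "finite E'" using finite_subset by blast
 show "mle (sqf E') (lc m + sqf E)"
  unfolding mle_def
 proof
  fix i
  show "lkp (sqf E') i <= lkp (lc m + sqf E) i"
  proof (cases "i : ix ` set m")
   case True
   then obtain u where u: "u : set m" "i = ix u" by auto
   hence "lkp (gs u) i ~= 0" using ix m by auto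
   moreover have "lkp (gs u) i <= lkp (lc m) i" using mle_gs_lc[OF u(1)] by (simp add: mle_def)
   ultimately show ?thesis using fE' by (simp add: lookup_sqf lookup_add)
  next
   case False
   thus ?thesis using k fE fE' by (auto simp: lookup_sqf lookup_add)
  qed
 qed
 have "card E' = card (ix ` set m) + card E" using k fE by (simp add: card_Un_disjoint)
 also have "card (ix ` set m) = length m" using k distinct_card[of "map ix m"] by simp
 finally show "card E' = length m + card E" .
qed

lemma bK_degree:
 assumes E: "E <= {1..n}" and E': "E' : keys (bK E :: (nat set, 'k::field) fv)"
 shows "E' <= {1..n}" "mle (sqf E') (sqf E)" "card E = Suc (card E')"
proof -
 obtain i where i: "i : E" "E' = E - {i}" using keys_bK[OF E'] by blast
 have fE: "finite E" using E finite_subset by blast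
 show "E' <= {1..n}" using i E by auto
 show "mle (sqf E') (sqf E)" using i fE by (auto simp: mle_def lookup_sqf)
 show "card E = Suc (card E')" using card_Suc_Diff1[OF fE i(1)] i(2) by simp
qed

text \<open>Splitting into strands requires that no term of the differential exceeds the
  multidegree, with and without the left factor. For merged letters this is the inequality between
  an lcm and a product; for the action it is \<open>psi_degree\<close>.\<close>

lemma keys_DX_ok:
 assumes "okX (l, w, E)" "(l', w', E') : keys (DX ix l w E :: ('g xbase, 'k::field) fv)"
 shows "okX (l', w', E') & mle (dX (l', w', E')) (dX (l, w, E)) & mle (dF (w', E')) (dF (w, E)) &
  hX (l, w, E) = Suc (hX (l', w', E'))"
 using assms
proof (induction w arbitrary: l E l' w' E')
 case Nil
 have E: "E <= {1..n}" using Nil(1) by (simp add: okX_def)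
 show ?case using Nil(2)
 proof (cases rule: keys_DX_Nil)
  case (left x)
  thus ?thesis using Nil(1) keys_bd[OF left(1)] lc_mono[of x l]
   by (auto simp: okX_def dX_def hX_def hF_def intro: mle_mono)
 next
  case (koszul F)
  thus ?thesis using Nil(1) bK_degree[OF E koszul(1)]
   by (auto simp: okX_def okW_def dX_def dF_def dW_def hX_def hF_def hW_def intro: mle_mono)
 qed
next
 case (Cons m w)
 have E: "E <= {1..n}" and mw: "okX (m, w, E)" and l: "set l <= GL" and m: "set m <= GL" "m ~= []"
  using Cons.prems(1) by (auto simp: okX_def okW_def)
 show ?case using Cons.prems(2)
 proof (cases rule: keys_DX_Cons)
  case (left x)
  thus ?thesis using Cons.prems(1) keys_bd[OF left(1)] lc_mono[of x l]
   by (auto simp: okX_def dX_def hX_def intro: mle_mono)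
 next
  case merge
  have "mle (lc (l @ m) + dF (w, E)) (lc l + lc m + dF (w, E))" by (rule mle_mono[OF lc_append_le mle_refl])
  moreover have "mle (dF (w, E)) (dX (m, w, E))" by (simp add: dX_def)
  ultimately show ?thesis using merge mw l
   by (auto simp: okX_def dX_def hX_def dF_Cons hF_Cons add.assoc)
 next
  case (act F)
  note p = psi_degree[OF m(1) E act(2)]
  have d: "dF ([], F) = sqf F" "dF ([m], E) = lc m + sqf E" by (simp_all add: dF_def dW_def)
  show ?thesis using act p(1,3) l d mle_mono[OF mle_refl p(2)] p(2)
   by (auto simp: okX_def okW_def dX_def hX_def hF_def hW_def)
 next
  case (right p v F)
  note ih = Cons.IH[OF mw right(1)]
  have "mle (dF (p # v, F)) (dF (m # w, E))" using ih by (simp add: dF_Cons)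
  moreover have "okX (l, p # v, F)" using ih right(2) l by (auto simp: okX_def okW_def)
  ultimately show ?thesis using right ih
   by (auto simp: dX_def hX_def hF_Cons intro: mle_mono)
 qed
qed

definition Xal :: "expo => 'g xbase set" where "Xal al = {a. okX a & mle (dX a) al}"

text \<open>Of the strand \<open>Xal\<close> over the polynomial ring, the part that disappears over
  the quotient ring: the monomial accompanying (w, E) lies in the ideal. At these places the list
  factor runs through a strand of the resolution of the quotient ring that is exact.\<close>

definition Nal :: "expo set => expo => 'g xbase set" where
 "Nal W al = {a : Xal al. al - dF (snd a) : W}"

lemma DXb_Xal: "a : Xal al ==> keys (DXb ix a :: ('g xbase, 'k::field) fv) <= Xal al"
proof
 fix b assume a: "a : Xal al" and b: "b : keys (DXb ix a :: ('g xbase, 'k) fv)"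
 obtain l w E l' w' E' where ab: "a = (l, w, E)" "b = (l', w', E')" by (cases a; cases b)
 have "okX b & mle (dX b) (dX a)" using a b keys_DX_ok[of l w E l' w' E', where 'k = 'k]
  by (simp add: ab Xal_def DXb_def)
 thus "b : Xal al" using a mle_trans by (auto simp: Xal_def)
qed

lemma DXb_DXb: "okX a ==> lin (DXb ix) (DXb ix a) = (0 :: ('g xbase, 'k::field) fv)"
proof -
 assume a: "okX a"
 obtain l w E where aa: "a = (l, w, E)" by (cases a)
 have "lin (DXb ix) (DX ix l w E) = (0 :: ('g xbase, 'k) fv)" by (rule DXb_DX) (use okX_wfx[OF a] aa in simp)
 moreover have "DXb ix a = (DX ix l w E :: ('g xbase, 'k) fv)" by (simp add: aa DXb_def)
 ultimately show ?thesis by simp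
qed

text \<open>\<open>beta\<close> contracts the bar construction onto the Koszul complex, and
  multiplication by e_\<mu>, for a variable \<mu> occurring in al, contracts the Koszul complex in
  this multidegree. The combined homotopy is exact; the constant measure 0 expresses that no error
  term is allowed.\<close>

lemma Xal_acyclic:
 fixes x :: "('g xbase, 'k::field) fv"
 assumes al: "al : exponents n" "al ~= 0" and x: "keys x <= Xal al" "lin (DXb ix) x = 0"
 shows "EX y. keys y <= Xal al & lin (DXb ix) y = x"
proof -
 obtain \<mu> where mu: "lkp al \<mu> ~= 0" using al(2) by (metis lookup_zero poly_mapping_eqI)
 have "\<mu> : keys al" using mu by (simp add: in_keys_iff)
 hence mun: "\<mu> : {1..n}" using al(1) by (auto simp: exponents_def)
 let ?e = "%(l, w, E). lin jK (eps \<mu> E) :: ('g xbase, 'k) fv"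
 let ?h = "%a. beta a + lin ?e (irho ix a) :: ('g xbase, 'k) fv"
 show ?thesis
 proof (rule triangular_acyclic[where m = "%_. 0" and h = ?h, OF DXb_Xal _ _ _ x])
  fix a assume a: "a : Xal al"
  obtain l w E where aa: "a = (l, w, E)" by (cases a)
  have E: "finite E" "E <= {1..n}" using a finite_subset[of E "{1..n}"] by (auto simp: aa Xal_def okX_def)
  show "lin (DXb ix) (DXb ix a) = (0 :: ('g xbase, 'k) fv)" by (rule DXb_DXb) (use a in \<open>simp add: Xal_def\<close>)
  have keysb: "keys (beta a :: ('g xbase, 'k) fv) <= Xal al"
   using a by (auto simp: aa beta_def Xal_def okX_def okW_def dX_Nil dF_Cons)
  have keysi: "keys (irho ix a :: ('g xbase, 'k) fv) <= {([], [], F) | F. F <= {1..n} & mle (sqf F) al}"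
  proof
   fix b assume "b : keys (irho ix a :: ('g xbase, 'k) fv)"
   then obtain F where F: "w = []" "F : keys (psi ix l E :: (nat set, 'k) fv)" "b = ([], [], F)"
    unfolding aa using keys_irho by blast
   have l: "set l <= GL" and d: "mle (lc l + sqf E) al" using a F(1) by (auto simp: aa Xal_def okX_def dX_def dF_def dW_def)
   show "b : {([], [], F) | F. F <= {1..n} & mle (sqf F) al}"
    using psi_degree[OF l E(2) F(2)] F(3) d mle_trans by blast
  qed
  show "keys (?h a) <= Xal al"
  proof (rule keys_add_subset[OF keysb keys_lin_subset])
   fix b assume "b : keys (irho ix a :: ('g xbase, 'k) fv)"
   then obtain F where F: "b = ([], [], F)" "F <= {1..n}" "mle (sqf F) al" using keysi by blast
   have fF: "finite F" using F(2) finite_subset by blast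
   have "mle (sqf (insert \<mu> F)) al"
    using F(3) mu fF by (auto simp: mle_def lookup_sqf Suc_le_eq split: if_splits)
   hence "([], [], insert \<mu> F) : Xal al"
    using F(2) mun by (simp add: Xal_def okX_def okW_def dX_def dF_def dW_def)
   thus "keys (?e b) <= Xal al" by (auto simp: F(1) eps_def)
  qed
  have hK: "lin (DXb ix) (?e b) + lin ?e (lin jK (bK F)) = (unit_vec b :: ('g xbase, 'k) fv)"
   if "b = ([], [], F)" "finite F" for b F
  proof -
   have "lin (DXb ix) (?e b) + lin ?e (lin jK (bK F)) = lin jK (lin bK (eps \<mu> F) + lin (eps \<mu>) (bK F))"
    by (simp add: that lin_lin DXb_def)
   thus ?thesis using bK_eps[OF that(2), of \<mu>, where 'k = 'k] by (simp add: that)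
  qed
  have "lin (DXb ix) (lin ?e (irho ix a)) + lin ?e (lin (DXb ix) (irho ix a)) = (irho ix a :: ('g xbase, 'k) fv)"
  proof -
   have "lin (%b. lin (DXb ix) (?e b) + lin ?e (DXb ix b)) (irho ix a) = lin unit_vec (irho ix a :: ('g xbase, 'k) fv)"
   proof (rule lin_cong)
    fix b assume "b : keys (irho ix a :: ('g xbase, 'k) fv)"
    then obtain F where F: "b = ([], [], F)" "F <= {1..n}" using keysi by blast
    have fF: "finite F" using F(2) finite_subset by blast
    have "DXb ix b = (lin jK (bK F) :: ('g xbase, 'k) fv)" by (simp add: F(1) DXb_def)
    thus "lin (DXb ix) (?e b) + lin ?e (DXb ix b) = (unit_vec b :: ('g xbase, 'k) fv)"
     using hK[OF F(1) fF] by simp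
   qed
   thus ?thesis by (simp add: lin_fun_add lin_lin)
  qed
  moreover have "lin ?e (lin (irho ix) (DXb ix a)) = lin ?e (lin (DXb ix) (irho ix a))"
   using irho_chain[OF E(1), of ix l w, where 'k = 'k] by (simp add: aa DXb_def)
  moreover have "lin (DXb ix) (beta a) + lin beta (DXb ix a) = unit_vec a - (irho ix a :: ('g xbase, 'k) fv)"
   by (rule DXb_beta) (use a okX_wfx in \<open>auto simp: Xal_def\<close>)
  ultimately have "lin (DXb ix) (?h a) + lin ?h (DXb ix a) - unit_vec a = 0"
   by (simp add: lin_fun_add lin_lin[symmetric] algebra_simps)
  thus "keys (lin (DXb ix) (?h a) + lin ?h (DXb ix a) - unit_vec a) <= {b. (0 :: nat) < 0}"
   by simp
 qed
qed

definition WI :: "expo set" where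
 "WI = {m : exponents n. \<exists>u\<in>GL. mle (gs u) m}"

lemma WI_up: "m : WI ==> mle m m' ==> m' : exponents n ==> m' : WI"
 unfolding WI_def using mle_trans by blast

lemma DXb_Nal:
 assumes al: "al : exponents n" and a: "a : Nal WI al"
 shows "keys (DXb ix a :: ('g xbase, 'k::field) fv) <= Nal WI al"
proof
 fix b assume b: "b : keys (DXb ix a :: ('g xbase, 'k) fv)"
 obtain l w E l' w' E' where ab: "a = (l, w, E)" "b = (l', w', E')" by (cases a; cases b)
 have a': "okX (l, w, E)" "al - dF (w, E) : WI" "a : Xal al" using a by (auto simp: ab Nal_def Xal_def)
 have "mle (dF (w', E')) (dF (w, E))" using keys_DX_ok[OF a'(1), of l' w' E', where 'k = 'k] b by (simp add: ab DXb_def)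
 hence "al - dF (w', E') : WI"
  by (rule WI_up[OF a'(2) mle_diff_mono exponents_diff[OF al]])
 moreover have "b : Xal al" using DXb_Xal[OF a'(3)] b by blast
 ultimately show "b : Nal WI al" by (simp add: Nal_def ab)
qed

text \<open>Prepending a generator that divides al - dF (w, E) contracts the list factor. The
  generator depends on (w, E) only, so it is undisturbed while the boundary acts on the list; all
  other terms of the differential have smaller \<open>hF\<close>, which makes the homotopy
  triangular.\<close>

lemma Nal_acyclic:
 fixes x :: "('g xbase, 'k::field) fv"
 assumes al: "al : exponents n" and x: "keys x <= Nal WI al" "lin (DXb ix) x = 0"
 shows "EX y. keys y <= Nal WI al & lin (DXb ix) y = x"
proof -
 define U where "U b = (SOME u. u : GL & mle (gs u) (al - dF b))" for b
 have U: "U b : GL & mle (gs (U b)) (al - dF b)" if "al - dF b : WI" for b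
  unfolding U_def by (rule someI_ex) (use that in \<open>auto simp: WI_def\<close>)
 let ?h = "%(l, w, E). unit_vec (U (w, E) # l, w, E) :: ('g xbase, 'k) fv"
 show ?thesis
 proof (rule triangular_acyclic[where m = "%a. hF (snd a)" and h = ?h, OF DXb_Nal[OF al] _ _ _ x])
  fix a assume a: "a : Nal WI al"
  obtain l w E where aa: "a = (l, w, E)" by (cases a)
  have ok: "okX (l, w, E)" "al - dF (w, E) : WI" "mle (dX (l, w, E)) al"
   using a by (auto simp: aa Nal_def Xal_def)
  show "lin (DXb ix) (DXb ix a) = (0 :: ('g xbase, 'k) fv)" using DXb_DXb ok(1) aa by simp
  let ?u = "U (w, E)"
  have u: "?u : GL" "mle (gs ?u) (al - dF (w, E))" using U[OF ok(2)] by auto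
  have "mle (lc (?u # l) + dF (w, E)) al"
   using ok(3) u(2) by (simp add: dX_def mle_plus_iff mle_mlcm)
  hence "(?u # l, w, E) : Nal WI al" using ok u(1) by (simp add: Nal_def Xal_def okX_def dX_def del: lc.simps)
  thus "keys (?h a) <= Nal WI al" by (simp add: aa)
  let ?Y = "DX ix [] w E :: ('g xbase, 'k) fv"
  have e: "lin (DXb ix) (?h a) + lin ?h (DXb ix a) - unit_vec a
   = scl (sg (?u # l)) (lin (cat (?u # l)) ?Y) + scl (sg l) (lin ?h (lin (cat l) ?Y))"
  proof -
   have "lin (DXb ix) (?h a) = unit_vec a - lin (%x. unit_vec (?u # x, w, E)) (bd l) + scl (sg (?u # l)) (lin (cat (?u # l)) ?Y)"
    by (simp add: aa DXb_def DX_left[of ix "?u # l"] lin_lin del: DX.simps)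
   moreover have "lin ?h (DXb ix a) = lin (%x. unit_vec (?u # x, w, E)) (bd l) + scl (sg l) (lin ?h (lin (cat l) ?Y))"
    unfolding aa DXb_def prod.case DX_left[of ix l w E] by (simp add: lin_lin)
   ultimately show ?thesis by simp
  qed
  have sm: "hF (v, F) < hF (w, E)" if "(p, v, F) : keys ?Y" for p v F
  proof -
   have "okX ([], w, E)" using ok(1) by (simp add: okX_def)
   from keys_DX_ok[OF this that] show ?thesis by (simp add: hX_def)
  qed
  show "keys (lin (DXb ix) (?h a) + lin ?h (DXb ix a) - unit_vec a) <= {b. hF (snd b) < hF (snd a)}"
   unfolding e
  proof (rule keys_add_subset; rule keys_scl_subset)
   show "keys (lin (cat (?u # l)) ?Y) <= {b. hF (snd b) < hF (snd a)}"
    by (rule keys_lin_subset) (use sm in \<open>auto simp: cat_def aa split: prod.splits\<close>)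
   have "lin ?h (lin (cat l) ?Y) = lin (%y. lin ?h (cat l y)) ?Y" by (rule lin_lin)
   also have "keys ... <= {b. hF (snd b) < hF (snd a)}"
    by (rule keys_lin_subset) (use sm in \<open>auto simp: cat_def aa split: prod.splits\<close>)
   finally show "keys (lin ?h (lin (cat l) ?Y)) <= {b. hF (snd b) < hF (snd a)}" .
  qed
 qed
qed

section \<open>The bar resolution of the residue field\<close>

definition prj :: "'g xbase => ('g list list \<times> nat set \<Rightarrow>\<^sub>0 'k::field)" where
 "prj = (%(l, b). if l = [] then unit_vec b else 0)"

text \<open>The augmentation of the list factor to the quotient ring, applied to the bar
  differential. As a matrix of scalars \<open>fD\<close> need not square to zero: the terms with
  nonempty left factor that \<open>prj\<close> drops carry monomials of the ideal and vanish only
  after restriction to strands.\<close>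

definition fD :: "'g list list \<times> nat set => ('g list list \<times> nat set \<Rightarrow>\<^sub>0 'k::field)" where
 "fD b = lin prj (DXb ix ([], b))"

definition okF :: "'g list list \<times> nat set => bool" where "okF b \<longleftrightarrow> okX ([], b)"

definition BF :: "nat => ('g list list \<times> nat set) set" where "BF j = {b. okF b & hF b = j}"

lemma keys_prj: "b : keys (prj a :: 'g list list \<times> nat set \<Rightarrow>\<^sub>0 'k::field) ==> a = ([], b)"
 by (cases a) (auto simp: prj_def split: if_splits)

lemma keys_fD:
 assumes b: "okF b" and b': "b' : keys (fD b :: 'g list list \<times> nat set \<Rightarrow>\<^sub>0 'k::field)"
 shows "okF b' & mle (dF b') (dF b) & hF b = Suc (hF b')"
proof -
 have "b' : keys (lin prj (DXb ix ([], b)) :: 'g list list \<times> nat set \<Rightarrow>\<^sub>0 'k)" using b' by (simp add: fD_def)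
 then obtain a where a: "a : keys (DXb ix ([], b) :: ('g xbase, 'k) fv)" "b' : keys (prj a :: 'g list list \<times> nat set \<Rightarrow>\<^sub>0 'k)"
  by (rule keys_linE)
 obtain w E w' E' where bb: "b = (w, E)" "b' = (w', E')" by (cases b; cases b')
 have "([], w', E') : keys (DX ix [] w E :: ('g xbase, 'k) fv)" using a(1) keys_prj[OF a(2)] bb by (simp add: DXb_def)
 from keys_DX_ok[OF _ this] show ?thesis using b by (simp add: okF_def bb dX_Nil hX_Nil)
qed

lemma dF_zero:
 assumes b: "okF b" and z: "mle (dF b) 0"
 shows "b = ([], {})"
proof -
 obtain w E where bb: "b = (w, E)" by (cases b)
 have fE: "finite E" using b finite_subset[of E "{1..n}"] by (auto simp: bb okF_def okX_def)
 have E: "E = {}"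
 proof (rule ccontr)
  assume "E ~= {}"
  then obtain i where "i : E" by blast
  thus False using z fE by (auto simp: bb mle_def dF_def lookup_add lookup_sqf dest: spec[of _ i])
 qed
 have "w = []"
 proof (cases w)
  case (Cons m v)
  then obtain u m' where m: "m = u # m'" "u : GL" using b by (cases m) (auto simp: bb okF_def okX_def okW_def)
  have "mle (gs u) (dF b)"
   using mle_trans[OF mle_gs_lc[of u m] mle_add(1)] by (simp add: bb Cons m(1) dF_Cons dX_def del: lc.simps)
  hence "mle (gs u) 0" using z mle_trans by blast
  hence "gs u = 0" by (intro mle_antisym) auto
  thus ?thesis using ix[OF m(2)] by simp
 qed simp
 with E show ?thesis by (simp add: bb)
qed

text \<open>The strand of the complex over the quotient ring is \<open>Xal\<close> modulo
  \<open>Nal\<close>. For al \<noteq> 0 both of these are acyclic, hence so is the quotient; the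
  long exact sequence argument is carried out by hand, with \<open>?ex\<close> as inclusion and
  \<open>?q\<close> as projection. For al = 0 there is nothing in positive homological
  degree.\<close>

lemma fD_strand_exact:
 fixes x :: "'g list list \<times> nat set \<Rightarrow>\<^sub>0 'k::field"
 assumes al: "al : exponents n" and x: "keys x <= strand WI dF (BF (Suc j)) al"
 shows "restr (strand WI dF (BF j) al) (lin fD x) = 0 \<longleftrightarrow>
  (EX y. keys y <= strand WI dF (BF (Suc (Suc j))) al & restr (strand WI dF (BF (Suc j)) al) (lin fD y) = x)"
proof (cases "al = 0")
 case True
 have "strand WI dF (BF (Suc j)) al = {}"
 proof (rule ccontr)
  assume "strand WI dF (BF (Suc j)) al ~= {}"
  then obtain b where "okF b" "hF b = Suc j" "mle (dF b) 0" using True by (auto simp: strand_def BF_def)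
  thus False using dF_zero[of b] by (simp add: hF_def hW_def)
 qed
 hence "x = 0" using x by (metis keys_eq_empty subset_empty)
 thus ?thesis by (auto intro!: exI[of _ 0])
next
 case False
 define S where "S = {b. okF b & mle (dF b) al & al - dF b ~: WI}"
 have strS: "strand WI dF (BF i) al = S \<inter> {b. hF b = i}" for i by (auto simp: strand_def BF_def S_def)
 let ?ex = "lin (%b. unit_vec ([], b)) :: ('g list list \<times> nat set \<Rightarrow>\<^sub>0 'k) => ('g xbase, 'k) fv"
 let ?q = "%y :: ('g xbase, 'k) fv. restr S (lin prj y)"
 let ?D = "lin (DXb ix) :: ('g xbase, 'k) fv => ('g xbase, 'k) fv"
 have pex: "lin prj (?ex z) = z" for z by (simp add: lin_lin prj_def)
 have exX: "keys (?ex z) <= Xal al" if "keys z <= S" for z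
  by (rule keys_lin_subset) (use that in \<open>auto simp: S_def Xal_def okF_def dX_def\<close>)
 have fDq: "restr S (lin fD z) = ?q (?D (?ex z))" for z by (simp add: lin_lin fD_def[abs_def])
 have qN: "?q z = 0" if "keys z <= Nal WI al" for z
 proof -
  have "keys (lin prj z :: 'g list list \<times> nat set \<Rightarrow>\<^sub>0 'k) <= - S"
  proof
   fix b assume "b : keys (lin prj z :: 'g list list \<times> nat set \<Rightarrow>\<^sub>0 'k)"
   then obtain a where "a : keys z" "b : keys (prj a :: 'g list list \<times> nat set \<Rightarrow>\<^sub>0 'k)" by (rule keys_linE)
   hence "([], b) : Nal WI al" using that keys_prj by blast
   thus "b : - S" by (simp add: Nal_def S_def)
  qed
  thus ?thesis unfolding restr_zero_iff by blast
 qed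
 have lkq: "lkp (lin prj y) b = lkp y ([], b)" for y :: "('g xbase, 'k) fv" and b
 proof -
  have "lkp (lin prj y) b = (\<Sum>a\<in>keys y. if a = ([], b) then lkp y ([], b) else 0)"
   unfolding lookup_lin by (rule sum.cong) (auto simp: prj_def lookup_single when_def split: prod.splits)
  thus ?thesis by (auto simp: in_keys_iff)
 qed
 have lkex: "lkp (?ex z) (l, b) = (if l = [] then lkp z b else 0)" for z l b
 proof -
  have "lkp (?ex z) (l, b) = (\<Sum>a\<in>keys z. if a = b then (if l = [] then lkp z b else 0) else 0)"
   unfolding lookup_lin by (rule sum.cong) (auto simp: lookup_single when_def)
  thus ?thesis by (auto simp: in_keys_iff)
 qed
 \<comment> \<open>If the left factor begins with a generator u, then u divides al - dF b, so the
   term belongs to \<open>Nal\<close>; the remaining terms are exactly those returned by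
   \<open>?q\<close>.\<close>
 have splitN: "keys (y - ?ex (?q y)) <= Nal WI al" if y: "keys y <= Xal al" for y
 proof
  fix a assume a: "a : keys (y - ?ex (?q y))"
  obtain l b where ab: "a = (l, b)" by (cases a)
  have z: "lkp y a ~= (if l = [] & b : S then lkp y ([], b) else 0)"
   using a by (auto simp: ab in_keys_iff lookup_minus lkex lkq split: if_splits)
  have nS: "~ (l = [] & b : S)"
  proof
   assume "l = [] & b : S"
   thus False using z by (simp add: ab)
  qed
  hence "lkp y a ~= 0" using z by (simp split: if_splits)
  hence aX: "a : Xal al" using y by (auto simp: in_keys_iff)
  obtain w E where b: "b = (w, E)" by (cases b)
  have X: "okX (l, w, E)" "mle (lc l + dF b) al" using aX by (auto simp: ab b Xal_def dX_def)
  hence m: "mle (dF b) al" "mle (lc l) (al - dF b)" by (auto simp: mle_plus_iff)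
  have "al - dF b : WI"
  proof (cases l)
   case Nil
   thus ?thesis using nS X(1) m(1) by (auto simp: S_def okF_def b okX_def)
  next
   case (Cons u l')
   hence "u : GL" "mle (gs u) (al - dF b)" using X(1) m(2) by (auto simp: okX_def mle_mlcm)
   thus ?thesis using exponents_diff[OF al] by (auto simp: WI_def)
  qed
  with aX show "a : Nal WI al" by (simp add: Nal_def ab)
 qed
 have DX: "keys (?D y) <= Xal al" if "keys y <= Xal al" for y
  by (rule keys_lin_subset) (use that DXb_Xal in blast)
 have DN: "keys (?D y) <= Nal WI al" if "keys y <= Nal WI al" for y
  by (rule keys_lin_subset) (use that DXb_Nal[OF al] in blast)
 have DD: "?D (?D y) = 0" if "keys y <= Xal al" for y
 proof -
  have "?D (?D y) = lin (%a. 0) y" unfolding lin_lin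
   by (rule lin_cong) (use that DXb_DXb in \<open>auto simp: Xal_def\<close>)
  thus ?thesis by simp
 qed
 have NX: "keys y <= Nal WI al ==> keys y <= Xal al" for y :: "('g xbase, 'k) fv" by (auto simp: Nal_def)
 have hom: "keys (lin fD z) <= {b. hF b = i}" if "keys z <= strand WI dF (BF (Suc i)) al" for z :: "'g list list \<times> nat set \<Rightarrow>\<^sub>0 'k" and i
 proof (rule keys_lin_subset)
  fix b assume "b : keys z"
  hence b: "okF b" "hF b = Suc i" using that by (auto simp: strand_def BF_def)
  show "keys (fD b :: 'g list list \<times> nat set \<Rightarrow>\<^sub>0 'k) <= {b. hF b = i}" using keys_fD[OF b(1), where 'k = 'k] b(2) by auto
 qed
 have rS: "restr (strand WI dF (BF i) al) (lin fD z) = restr S (lin fD z)"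
  if "keys z <= strand WI dF (BF (Suc i)) al" for z :: "'g list list \<times> nat set \<Rightarrow>\<^sub>0 'k" and i
  by (rule poly_mapping_eqI) (use hom[OF that] in \<open>auto simp: strS in_keys_iff subset_iff\<close>)
 have xS: "keys x <= S" and xh: "keys x <= {b. hF b = Suc j}" using x by (auto simp: strS)
 show ?thesis
 proof
  assume "EX y. keys y <= strand WI dF (BF (Suc (Suc j))) al & restr (strand WI dF (BF (Suc j)) al) (lin fD y) = x"
  then obtain y where y: "keys y <= strand WI dF (BF (Suc (Suc j))) al" "restr (strand WI dF (BF (Suc j)) al) (lin fD y) = x" by blast
  have yS: "keys y <= S" using y(1) by (auto simp: strS)
  have xq: "x = ?q (?D (?ex y))" using y(2) rS[OF y(1)] fDq by simp
  have n: "keys (?D (?ex y) - ?ex x) <= Nal WI al" unfolding xq by (rule splitN[OF DX[OF exX[OF yS]]])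
  have "?D (?ex x) = - ?D (?D (?ex y) - ?ex x)" using DD[OF exX[OF yS]] by simp
  hence "?q (?D (?ex x)) = - ?q (?D (?D (?ex y) - ?ex x))" by (simp only: lin_minus restr_linear)
  also have "... = 0" using qN[OF DN[OF n]] by simp
  finally show "restr (strand WI dF (BF j) al) (lin fD x) = 0" using rS[OF x] fDq by simp
 next
  assume "restr (strand WI dF (BF j) al) (lin fD x) = 0"
  hence q0: "?q (?D (?ex x)) = 0" using rS[OF x] fDq by simp
  have n: "keys (?D (?ex x)) <= Nal WI al" using splitN[OF DX[OF exX[OF xS]]] unfolding q0 by simp
  obtain n' where n': "keys n' <= Nal WI al" "?D n' = ?D (?ex x)"
   using Nal_acyclic[OF al n DD[OF exX[OF xS]]] by blast
  have k: "keys (?ex x - n') <= Xal al" by (rule keys_diff_subset[OF exX[OF xS] NX[OF n'(1)]])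
  have "?D (?ex x - n') = 0" using n'(2) by simp
  then obtain y where y: "keys y <= Xal al" "?D y = ?ex x - n'" using Xal_acyclic[OF al False k] by blast
  have "x = ?q (?ex x)" by (simp add: pex restr_id[OF xS])
  also have "... = ?q (?ex x - n')" using qN[OF n'(1)] by simp
  also have "... = ?q (?D (?ex (?q y)) + ?D (y - ?ex (?q y)))" using y(2) by simp
  also have "... = ?q (?D (?ex (?q y)))" using qN[OF DN[OF splitN[OF y(1)]]] by (simp only: lin_add restr_linear add_0_right)
  also have "... = restr S (lin fD (?q y))" using fDq by simp
  also have "... = lin (%b. restr S (fD b)) (?q y)" by (simp add: restr_def lin_lin)
  finally have xe: "lin (%b. restr S (fD b)) (?q y) = x" by (rule sym)
  \<comment> \<open>The preimage obtained so far may have components in other homological degrees,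
    which are discarded here.\<close>
  have "EX z. keys z <= S \<inter> {b. hF b = Suc (Suc j)} & lin (%b. restr S (fD b)) z = x"
  proof (rule graded_preimage[OF _ _ xe xh])
   show "keys (?q y) <= S" by (auto simp: keys_restr)
   fix a b assume "a : S" "b : keys (restr S (fD a) :: 'g list list \<times> nat set \<Rightarrow>\<^sub>0 'k)"
   thus "hF a = Suc (hF b)" using keys_fD[of a b, where 'k = 'k] by (auto simp: keys_restr S_def)
  qed
  then obtain z where z: "keys z <= S \<inter> {b. hF b = Suc (Suc j)}" "lin (%b. restr S (fD b)) z = x" by blast
  have kz: "keys z <= strand WI dF (BF (Suc (Suc j))) al" using z(1) by (simp add: strS)
  moreover have "restr (strand WI dF (BF (Suc j)) al) (lin fD z) = x"
   using rS[OF kz] z(2) by (simp add: restr_def lin_lin)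
  ultimately show "EX y. keys y <= strand WI dF (BF (Suc (Suc j))) al & restr (strand WI dF (BF (Suc j)) al) (lin fD y) = x" by blast
 qed
qed

end

section \<open>The minimal part of the bar resolution\<close>

lemma restr_lin: "restr S (lin f x) = lin (%a. restr S (f a)) x"
 by (simp add: restr_def lin_lin)

text \<open>Degrees never increase along D. A path of two steps whose ends have the same degree
  therefore stays in that degree, so the square of the degree-preserving part is the
  degree-preserving part of the square.\<close>

lemma deg_part_square:
 fixes D :: "'b => ('b, 'k::field) fv"
 assumes DD: "lin D (D b) = 0" and keysD: "!!a c. a : insert b (keys (D b)) ==> c : keys (D a) ==> mle (dg c) (dg a)"
 shows "lin (deg_part dg D) (deg_part dg D b) = 0"
proof -
 let ?S = "{c. dg c = dg b}"
 have "lin (deg_part dg D) (deg_part dg D b) = lin (%a. restr ?S (D a)) (D b)"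
  unfolding deg_part_def[of dg D b] restr_def[of _ "D b"] lin_lin
 proof (rule lin_cong)
  fix a assume a: "a : keys (D b)"
  have "restr ?S (D a) = 0" if "dg a ~= dg b"
  proof -
   have "keys (D a) \<inter> ?S = {}"
   proof (rule ccontr)
    assume "keys (D a) \<inter> ?S ~= {}"
    then obtain c where c: "c : keys (D a)" "dg c = dg b" by blast
    have "mle (dg b) (dg a)" "mle (dg a) (dg b)" using keysD[of a c] keysD[of b a] a c by auto
    thus False using that mle_antisym by blast
   qed
   thus ?thesis by (simp add: restr_zero_iff)
  qed
  thus "lin (deg_part dg D) (if a : {b'. dg b' = dg b} then unit_vec a else 0) = restr ?S (D a)"
   by (auto simp: deg_part_def)
 qed
 also have "... = restr ?S (lin D (D b))" by (rule restr_lin[symmetric])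
 finally show ?thesis using DD by simp
qed

context bar_setup
begin

abbreviation bt :: "'g list => ('g list, 'k::field) fv" where "bt \<equiv> deg_part lc bd"

text \<open>The lcm of the joined list equals the product of the two lcms exactly when these are
  coprime (\<open>coprm_iff\<close>). Then merging preserves the multidegree, so its coefficient is
  a unit.\<close>

definition coprm :: "'g list => 'g list => bool" where "coprm l m \<longleftrightarrow> lc (l @ m) = lc l + lc m"

definition mg :: "'g list => 'g list list => ('g list list, 'k::field) fv" where
 "mg m w = (case w of [] => 0 | p # v => if coprm m p then unit_vec ((m @ p) # v) else 0)"

fun dB :: "'g list list => ('g list list, 'k::field) fv" where
 "dB [] = 0"
| "dB (m # w) = - lin (%x. unit_vec (x # w)) (bt m) - scl (sg m) (mg m w)
  - scl (sg m) (lin (%v. unit_vec (m # v)) (dB w))"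

lemma bd_mle: "x : keys (bd l :: ('g list, 'k::field) fv) ==> mle (lc x) (lc l)"
 using keys_bd lc_mono by blast

lemma bt_bt: "lin bt (bt l) = (0 :: ('g list, 'k::field) fv)"
 by (rule deg_part_square) (use bd_mle in \<open>auto simp: bd_bd\<close>)

lemma lc_zero: "set l <= GL ==> lc l = 0 ==> l = []"
proof (cases l)
 case (Cons u m)
 assume l: "set l <= GL" "lc l = 0"
 have "mle (gs u) 0" using mle_gs_lc[of u l] l by (simp add: Cons)
 hence "lkp (gs u) (ix u) = 0" by (simp add: mle_def)
 thus ?thesis using ix[of u] l by (simp add: Cons)
qed simp

definition fpsi :: "'g list => 'g list list => nat set => ('g list list \<times> nat set \<Rightarrow>\<^sub>0 'k::field)" where
 "fpsi m w E = (if w = [] then lin (%F. unit_vec ([], F)) (psi ix m E) else 0)"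

definition fbeta :: "'g xbase => ('g list list \<times> nat set \<Rightarrow>\<^sub>0 'k::field)" where
 "fbeta = (%(p, v, F). if p = [] then 0 else unit_vec (p # v, F))"

lemma prj_beta: "lin prj (beta y) = (fbeta y :: 'g list list \<times> nat set \<Rightarrow>\<^sub>0 'k::field)"
 by (cases y) (simp add: beta_def prj_def fbeta_def)

lemma prj_irho: "lin prj (irho ix (m, w, E)) = (fpsi m w E :: 'g list list \<times> nat set \<Rightarrow>\<^sub>0 'k::field)"
 by (simp add: irho_def fpsi_def lin_lin prj_def)

lemma fD_Cons: "m ~= [] ==> fD (m # w, E) = - fpsi m w E - (lin fbeta (DX ix m w E) :: 'g list list \<times> nat set \<Rightarrow>\<^sub>0 'k::field)"
proof -
 assume m: "m ~= []"
 have "fD (m # w, E) = lin prj (unit_vec (m, w, E) - irho ix (m, w, E) - lin beta (DX ix m w E) :: ('g xbase, 'k) fv)"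
  by (simp add: fD_def DXb_def cat_simp)
 also have "... = - lin prj (irho ix (m, w, E)) - lin (%y. lin prj (beta y)) (DX ix m w E)"
  using m by (simp add: prj_def lin_lin)
 finally show ?thesis by (simp add: prj_irho prj_beta)
qed

definition mgF :: "'g list => 'g list list => nat set => ('g list list \<times> nat set \<Rightarrow>\<^sub>0 'k::field)" where
 "mgF m w E = (case w of [] => 0 | p # v => unit_vec ((m @ p) # v, E))"

text \<open>The recursion of \<open>DX\<close> passes through triples with a nonempty left factor.
  Projecting it eliminates that auxiliary factor and leaves a recursion on the bar word alone:
  action on E, boundary of the first letter, merging of the first two letters, and the differential
  of the rest.\<close>

lemma fD_rec:
 assumes m: "m ~= []" and w: "[] ~: set w"
 shows "fD (m # w, E) = - fpsi m w E - lin (%x. if x = [] then 0 else unit_vec (x # w, E)) (bd m)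
  - scl (sg m) (mgF m w E) - scl (sg m) (lin (%(v, F). unit_vec (m # v, F)) (fD (w, E)) :: 'g list list \<times> nat set \<Rightarrow>\<^sub>0 'k::field)"
proof -
 let ?c = "%(v, F). unit_vec (m # v, F) :: 'g list list \<times> nat set \<Rightarrow>\<^sub>0 'k"
 have key: "lin fbeta (lin (cat m) (DX ix [] w E)) = mgF m w E + lin ?c (fD (w, E))"
 proof (cases w)
  case Nil
  have "fD ([], E) = (lin (%F. unit_vec ([], F)) (bK E) :: 'g list list \<times> nat set \<Rightarrow>\<^sub>0 'k)"
   by (simp add: fD_def DXb_def lin_lin prj_def)
  thus ?thesis using m by (simp add: Nil lin_lin cat_def fbeta_def mgF_def)
 next
  case (Cons p v)
  have p: "p ~= []" using w Cons by auto
  have "lin fbeta (lin (cat m) (beta y)) = (lin ?c (fbeta y) :: 'g list list \<times> nat set \<Rightarrow>\<^sub>0 'k)" for y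
   using m by (cases y) (simp add: beta_def cat_def fbeta_def)
  moreover have "lin fbeta (lin (cat m) (irho ix (p, v, E))) = (lin ?c (fpsi p v E) :: 'g list list \<times> nat set \<Rightarrow>\<^sub>0 'k)"
   using m by (simp add: irho_def fpsi_def lin_lin cat_def fbeta_def)
  moreover have "lin fbeta (lin (cat m) (unit_vec (p, v, E))) = (mgF m w E :: 'g list list \<times> nat set \<Rightarrow>\<^sub>0 'k)"
   using m by (simp add: Cons mgF_def cat_def fbeta_def)
  ultimately show ?thesis unfolding Cons fD_Cons[OF p]
   by (simp add: lin_lin Cons cat_simp)
 qed
 have "lin fbeta (DX ix m w E) = lin (%x. if x = [] then 0 else unit_vec (x # w, E)) (bd m)
   + scl (sg m) (mgF m w E + lin ?c (fD (w, E)) :: 'g list list \<times> nat set \<Rightarrow>\<^sub>0 'k)"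
  unfolding DX_left[of ix m w E] lin_add lin_scl key by (simp add: lin_lin fbeta_def)
 thus ?thesis unfolding fD_Cons[OF m] by (simp add: pm.scale_right_distrib)
qed

end

text \<open>The assumption says that acting by a list on the Koszul factor always lowers the
  multidegree strictly, hence always has a nonunit coefficient. It is the form in which generation
  in degree at least two is used.\<close>

locale bar_min = bar_setup gs n GL ix for gs :: "'g => expo" and n GL ix +
 assumes ixs: "!!m. m ~= [] ==> set m <= GL ==> distinct (map ix m) ==> sqf (ix ` set m) ~= lc m"
begin

text \<open>Both the Koszul boundary and the action on E lower the multidegree strictly and drop
  out. The differential that remains acts on the word only, and E is carried along unchanged, which
  is the origin of the factor (1+t)^n.\<close>

lemma deg_part_fD:
 assumes w: "okW w" and E: "E <= {1..n}"
 shows "deg_part dF fD (w, E) = lin (%v. unit_vec (v, E)) (dB w :: ('g list list, 'k::field) fv)"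
 using w
proof (induction w)
 case Nil
 have fE: "finite E" using E finite_subset by blast
 have "keys (fD ([], E) :: 'g list list \<times> nat set \<Rightarrow>\<^sub>0 'k) \<inter> {b. dF b = dF ([], E)} = {}"
 proof (rule ccontr)
  assume "~ ?thesis"
  then obtain b where b: "b : keys (fD ([], E) :: 'g list list \<times> nat set \<Rightarrow>\<^sub>0 'k)" "dF b = dF ([], E)" by blast
  have "fD ([], E) = (lin (%F. unit_vec ([], F)) (bK E) :: 'g list list \<times> nat set \<Rightarrow>\<^sub>0 'k)"
   by (simp add: fD_def DXb_def lin_lin prj_def)
  hence "b : keys (lin (%F. unit_vec ([], F)) (bK E) :: 'g list list \<times> nat set \<Rightarrow>\<^sub>0 'k)" using b(1) by simp
  then obtain F where F: "F : keys (bK E :: (nat set, 'k) fv)" "b : keys (unit_vec ([], F) :: 'g list list \<times> nat set \<Rightarrow>\<^sub>0 'k)"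
   by (rule keys_linE)
  obtain i where i: "i : E" "F = E - {i}" using keys_bK[OF F(1)] by blast
  have "sqf (E - {i}) = sqf E" using b(2) F(2) i by (simp add: dF_def dW_def)
  hence "lkp (sqf (E - {i})) i = lkp (sqf E) i" by simp
  thus False using fE i by (simp add: lookup_sqf)
 qed
 thus ?case by (simp add: deg_part_def restr_zero_iff)
next
 case (Cons m w)
 have ok: "okW w" "m ~= []" "set m <= GL" "[] ~: set w" using Cons.prems by (auto simp: okW_def)
 have fE: "finite E" using E finite_subset by blast
 let ?S = "{b. dF b = dF (m # w, E)}"
 let ?c = "%(v, F). unit_vec (m # v, F) :: 'g list list \<times> nat set \<Rightarrow>\<^sub>0 'k"
 have dc: "dF (x # v, F) = lc x + dF (v, F)" for x v F by (simp add: dF_Cons dX_def)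
 have 1: "restr ?S (fpsi m w E :: 'g list list \<times> nat set \<Rightarrow>\<^sub>0 'k) = 0"
 proof (cases "w = []")
  case True
  have "keys (fpsi m w E :: 'g list list \<times> nat set \<Rightarrow>\<^sub>0 'k) \<inter> ?S = {}"
  proof (rule ccontr)
   assume "~ ?thesis"
   then obtain b where b: "b : keys (lin (%F. unit_vec ([], F)) (psi ix m E) :: 'g list list \<times> nat set \<Rightarrow>\<^sub>0 'k)" "b : ?S"
    using True by (auto simp: fpsi_def)
   obtain F where F: "F : keys (psi ix m E :: (nat set, 'k) fv)" "b : keys (unit_vec ([], F) :: 'g list list \<times> nat set \<Rightarrow>\<^sub>0 'k)"
    using b(1) by (rule keys_linE)
   note k = keys_psi[OF F(1)]
   have "sqf F = lc m + sqf E" using b(2) F(2) True by (simp add: dF_def dW_def)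
   moreover have "sqf F = sqf (ix ` set m) + sqf E"
    by (rule poly_mapping_eqI) (use k fE in \<open>auto simp: lookup_add lookup_sqf\<close>)
   ultimately have "sqf (ix ` set m) = lc m" by simp
   thus False using ixs[OF ok(2,3)] k by simp
  qed
  thus ?thesis by (simp add: restr_zero_iff)
 qed (simp add: fpsi_def)
 have 2: "restr ?S (lin (%x. if x = [] then 0 else unit_vec (x # w, E)) (bd m))
  = lin (%v. unit_vec (v, E)) (lin (%x. unit_vec (x # w)) (bt m) :: ('g list list, 'k) fv)"
  unfolding restr_lin deg_part_def restr_def[of _ "bd m"] lin_lin
 proof (rule lin_cong)
  fix x assume "x : keys (bd m :: ('g list, 'k) fv)"
  have "lc m ~= 0" using lc_zero[OF ok(3)] ok(2) by blast
  thus "restr ?S (if x = [] then 0 else unit_vec (x # w, E)) = lin (%a. lin (%v. unit_vec (v, E)) (unit_vec (a # w)))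
    (if x : {b'. lc b' = lc m} then unit_vec x else 0 :: ('g list, 'k) fv)"
   by (auto simp: restr_single dc)
 qed
 have 3: "restr ?S (mgF m w E) = lin (%v. unit_vec (v, E)) (mg m w :: ('g list list, 'k) fv)"
  by (auto simp: mgF_def mg_def restr_single dc coprm_def add.assoc[symmetric] split: list.split)
 have 4: "restr ?S (lin ?c (fD (w, E))) = lin (%v. unit_vec (v, E)) (lin (%v. unit_vec (m # v)) (dB w :: ('g list list, 'k) fv))"
 proof -
  have "restr ?S (lin ?c (fD (w, E))) = lin ?c (restr {b. dF b = dF (w, E)} (fD (w, E)))"
   unfolding restr_lin restr_def[of _ "fD (w, E)"] lin_lin by (rule lin_cong) (auto simp: restr_single dc)
  also have "... = lin ?c (lin (%v. unit_vec (v, E)) (dB w))" using Cons.IH[OF ok(1)] by (simp add: deg_part_def)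
  finally show ?thesis by (simp add: lin_lin)
 qed
 show ?case unfolding deg_part_def fD_rec[OF ok(2,4)]
  by (simp add: 1 2 3 4)
qed

text \<open>The square-zero map is \<open>DXb\<close>, not \<open>fD\<close>, so the omitted terms
  need an argument. A term (l, v, F) of the differential of ([], b) with l nonempty has dF (v, F)
  different from dF b, since lc l is nonzero and the total degree is bounded by dF b; emptying l
  later therefore never leads back to the degree of b.\<close>

lemma deg_part_fD_square:
 assumes b: "okF b"
 shows "lin (deg_part dF fD) (deg_part dF fD b) = (0 :: 'g list list \<times> nat set \<Rightarrow>\<^sub>0 'k::field)"
proof -
 let ?S = "{c. dF c = dF b}" and ?y = "DXb ix ([], b) :: ('g xbase, 'k) fv"
 have okb: "okX ([], b)" using b by (simp add: okF_def)
 obtain w E where bb: "b = (w, E)" by (cases b)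
 have e: "deg_part dF fD b = (lin (%a. restr ?S (prj a)) ?y :: 'g list list \<times> nat set \<Rightarrow>\<^sub>0 'k)"
  by (simp only: deg_part_def fD_def restr_lin)
 have "lin (deg_part dF fD) (deg_part dF fD b) = lin (%a. restr ?S (lin prj (DXb ix a))) ?y"
  unfolding e lin_lin
 proof (rule lin_cong)
  fix a assume a: "a : keys ?y"
  obtain l v F where aa: "a = (l, v, F)" by (cases a)
  have ok: "okX (l, v, F) & mle (dX (l, v, F)) (dX ([], w, E))"
   using keys_DX_ok[of "[]" w E l v F, where 'k = 'k] okb a by (simp add: aa bb DXb_def)
  have lt: "dF (v, F) = dF b --> lc l = 0"
  proof
   assume e: "dF (v, F) = dF b"
   have "mle (lc l + dF b) (dF b)" using ok e by (simp add: dX_def bb)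
   hence "mle (lc l) (dF b - dF b)" by (simp add: mle_plus_iff)
   thus "lc l = 0" by (simp add: mle_antisym)
  qed
  show "lin (deg_part dF fD) (restr ?S (prj a)) = restr ?S (lin prj (DXb ix a) :: 'g list list \<times> nat set \<Rightarrow>\<^sub>0 'k)"
  proof (cases "l = []")
   case True
   have okv: "okF (v, F)" using ok True by (simp add: okF_def)
   have fdv: "lin prj (DXb ix a) = (fD (v, F) :: 'g list list \<times> nat set \<Rightarrow>\<^sub>0 'k)" by (simp add: fD_def aa True)
   have "restr ?S (fD (v, F) :: 'g list list \<times> nat set \<Rightarrow>\<^sub>0 'k) = 0" if "dF (v, F) ~= dF b"
   proof -
    have "c ~: ?S" if c: "c : keys (fD (v, F) :: 'g list list \<times> nat set \<Rightarrow>\<^sub>0 'k)" for c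
    proof
     assume "c : ?S"
     hence "mle (dF b) (dF (v, F))" using keys_fD[OF okv c] by auto
     moreover have "mle (dF (v, F)) (dF b)" using ok True by (simp add: dX_def bb)
     ultimately show False using \<open>dF (v, F) ~= dF b\<close> mle_antisym by blast
    qed
    thus ?thesis unfolding restr_zero_iff by blast
   qed
   thus ?thesis unfolding fdv by (auto simp: aa True prj_def restr_single deg_part_def)
  next
   case False
   have nz: "lc l ~= 0" using False lc_zero[of l] ok by (auto simp: okX_def)
   have "restr ?S (lin prj (DX ix l v F) :: 'g list list \<times> nat set \<Rightarrow>\<^sub>0 'k) = 0"
   proof -
    have "lin prj (lin (cat l) (DX ix [] v F)) = (lin (%a. 0) (DX ix [] v F) :: 'g list list \<times> nat set \<Rightarrow>\<^sub>0 'k)"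
     unfolding lin_lin by (rule lin_cong) (use False in \<open>auto simp: cat_def prj_def split: prod.splits\<close>)
    moreover have "restr ?S (lin prj (lin (%x. unit_vec (x, v, F)) (bd l))) = (lin (%a. 0) (bd l) :: 'g list list \<times> nat set \<Rightarrow>\<^sub>0 'k)"
     unfolding lin_lin restr_lin by (rule lin_cong) (use lt nz in \<open>auto simp: prj_def restr_single\<close>)
    ultimately show ?thesis unfolding DX_left[of ix l v F] by (simp add: restr_lin del: DX.simps)
   qed
   thus ?thesis using False by (simp add: aa DXb_def prj_def)
  qed
 qed
 also have "... = restr ?S (lin prj (lin (DXb ix) ?y))" by (simp add: restr_lin lin_lin)
 finally show ?thesis using DXb_DXb[OF okb, where 'k = 'k] by simp
qed

lemma dB_dB: "okW w ==> lin dB (dB w) = (0 :: ('g list list, 'k::field) fv)"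
proof -
 assume w: "okW w"
 have ok: "okW v" if v: "v : keys (dB w :: ('g list list, 'k) fv)" for v
 proof -
  have e: "deg_part dF fD (w, {}) = lin (%v. unit_vec (v, {})) (dB w :: ('g list list, 'k) fv)" by (rule deg_part_fD[OF w]) simp
  have "lin (%(v, F). unit_vec v) (deg_part dF fD (w, {})) = (dB w :: ('g list list, 'k) fv)" unfolding e by (simp add: lin_lin)
  hence "v : keys (lin (%(v, F). unit_vec v) (deg_part dF fD (w, {})) :: ('g list list, 'k) fv)" using v by simp
  then obtain b where b: "b : keys (deg_part dF fD (w, {}) :: 'g list list \<times> nat set \<Rightarrow>\<^sub>0 'k)" "v : keys ((case b of (v, E) => unit_vec v) :: ('g list list, 'k) fv)"
   by (rule keys_linE)
  have "okF (w, {})" using w by (simp add: okF_def okX_def)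
  moreover have "b : keys (fD (w, {}) :: 'g list list \<times> nat set \<Rightarrow>\<^sub>0 'k)" using b(1) by (simp add: deg_part_def keys_restr)
  ultimately have "okF b" using keys_fD by blast
  thus ?thesis using b(2) by (cases b) (auto simp: okF_def okX_def)
 qed
 have "lin (deg_part dF fD) (deg_part dF fD (w, {})) = (0 :: 'g list list \<times> nat set \<Rightarrow>\<^sub>0 'k)"
  by (rule deg_part_fD_square) (use w in \<open>simp add: okF_def okX_def\<close>)
 moreover have "lin (deg_part dF fD) (deg_part dF fD (w, {})) = lin (%v. deg_part dF fD (v, {})) (dB w :: ('g list list, 'k) fv)"
  unfolding deg_part_fD[OF w empty_subsetI] by (simp add: lin_lin)
 moreover have "... = lin (%v. lin (%u. unit_vec (u, {})) (dB v)) (dB w :: ('g list list, 'k) fv)"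
  by (rule lin_cong) (use ok deg_part_fD in blast)
 ultimately have z: "lin (%u. unit_vec (u, {})) (lin dB (dB w)) = (0 :: 'g list list \<times> nat set \<Rightarrow>\<^sub>0 'k)" by (simp add: lin_lin)
 have "lin (%(u, F). unit_vec u) (lin (%u. unit_vec (u, {} :: nat set)) (lin dB (dB w))) = (lin dB (dB w) :: ('g list list, 'k) fv)"
  by (simp add: lin_lin[of _ _ "lin dB (dB w)"])
 thus ?thesis unfolding z by simp
qed

end

section \<open>Homology, generating functions, and the Golod identity as a lifting property of
  words\<close>

section \<open>Contractions onto homology\<close>

lemma linear_eq_lin: "Vector_Spaces.linear scl scl \<Phi> ==> \<Phi> x = lin (%b. \<Phi> (unit_vec b)) (x :: ('b, 'k::field) fv)"
proof -
 assume \<Phi>: "Vector_Spaces.linear scl scl \<Phi>"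
 have "\<Phi> x = \<Phi> (lin unit_vec x)" by simp
 also have "... = (\<Sum>a\<in>keys x. \<Phi> (scl (lkp x a) (unit_vec a)))" unfolding lin_def by (rule pmp.linear_sum[OF \<Phi>])
 also have "... = lin (%b. \<Phi> (unit_vec b)) x" unfolding lin_def by (simp only: pmp.linear_scale[OF \<Phi>])
 finally show ?thesis .
qed

lemma subspace_param:
 fixes H :: "('b, 'k::field) fv set" and C :: "'c set"
 assumes H: "pm.subspace H" "finite B" "H <= {x. keys x <= B}" and C: "finite C" "card C = pm.dim H"
 obtains i where "lin i ` {x. keys x <= C} = H" "!!x. keys x <= C ==> lin i x = 0 ==> x = 0"
proof -
 obtain E where E: "finite E" "E <= H" "H <= pm.span E" "card E = pm.dim H"
  by (rule fin_dim_finite[OF H(2,3)]) (rule that)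
 obtain i where i: "bij_betw i C E" using finite_same_card_bij[of C E] E C by auto
 let ?K = "{x :: ('c, 'k) fv. keys x <= C}"
 have im: "lin i ` ?K = H"
 proof
  show "lin i ` ?K <= H"
  proof
   fix y assume "y : lin i ` ?K"
   then obtain x where x: "keys x <= C" "y = lin i x" by auto
   have "(\<Sum>a\<in>keys x. scl (lkp x a) (i a)) : H"
    by (rule pm.subspace_sum[OF H(1)], rule pm.subspace_scale[OF H(1)])
     (use x(1) i E(2) in \<open>auto simp: bij_betw_def\<close>)
   thus "y : H" using x(2) by (simp add: lin_def)
  qed
  have "E <= lin i ` ?K"
  proof
   fix e assume "e : E"
   then obtain c where "c : C" "e = i c" using i by (auto simp: bij_betw_def)
   thus "e : lin i ` ?K" by (intro image_eqI[of _ _ "unit_vec c"]) auto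
  qed
  moreover have "pm.subspace (lin i ` ?K)" by (rule pmp.linear_subspace_image[OF linear_lin subspace_keys])
  ultimately have "pm.span E <= lin i ` ?K" by (rule pm.span_minimal)
  thus "H <= lin i ` ?K" using E(3) by blast
 qed
 have "pm.dim ?K = pm.dim (lin i ` ?K) + pm.dim {x\<in>?K. lin i x = 0}"
  by (rule rank_nullity_pm[OF linear_lin subspace_keys C(1)]) simp
 hence d0: "pm.dim {x\<in>?K. lin i x = 0} = 0" using dim_keys[OF C(1), where 'k = 'k] C(2) im by simp
 have sub: "pm.subspace {x\<in>?K. lin i x = 0}" "pm.subspace {0 :: ('c, 'k) fv}"
  by (rule pm.subspaceI; simp add: keys_add_subset keys_scl_subset)+
 have "{0} = {x\<in>?K. lin i x = 0}"
  by (rule dim_eq_imp_eq[OF C(1) _ _ sub(2,1)]) (use d0 in auto)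
 thus ?thesis using that[of i] im by blast
qed

text \<open>A contraction of the complex V onto a space with basis C and zero differential. By
  \<open>f_i\<close> and \<open>p_f\<close> the model has no differential, so the cardinality of C j
  is the dimension of homology in degree j.\<close>

locale hmodel =
 fixes V :: "nat => 'b set" and f :: "'b => ('b, 'k::field) fv" and C :: "nat => 'c set"
  and s :: "'b => ('b, 'k) fv" and p :: "'b => ('c, 'k) fv" and i :: "'c => ('b, 'k) fv"
 assumes finV: "finite (V j)" and finC: "finite (C j)"
  and fV: "b : V (Suc j) ==> keys (f b) <= V j" and f0: "b : V 0 ==> f b = 0"
  and ff: "b : V j ==> lin f (f b) = 0"
  and sV: "b : V j ==> keys (s b) <= V (Suc j)"
  and pC: "b : V j ==> keys (p b) <= C j"
  and iV: "c : C j ==> keys (i c) <= V j"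
  and f_i: "c : C j ==> lin f (i c) = 0"
  and p_i: "c : C j ==> lin p (i c) = unit_vec c"
  and p_f: "b : V j ==> lin p (f b) = 0"
  and hom: "b : V j ==> lin f (s b) + lin s (f b) = unit_vec b - lin i (p b)"
begin

lemma homotopy:
 assumes "keys x <= V j"
 shows "x = lin f (lin s x) + lin s (lin f x) + lin i (lin p x)"
proof -
 have "lin (%b. lin f (s b) + lin s (f b) + lin i (p b)) x = lin unit_vec x"
  by (rule lin_cong) (use assms hom in \<open>auto simp: subset_iff\<close>)
 thus ?thesis by (simp add: lin_fun_add lin_lin)
qed

lemma f_zero: "keys x <= V j ==> lin f (lin f x) = 0"
proof -
 assume "keys x <= V j"
 hence "lin (%b. lin f (f b)) x = lin (%b. 0) x" by (intro lin_cong) (use ff in blast)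
 thus ?thesis by (simp add: lin_lin)
qed

lemma dim_kernel:
 "pm.dim {x. keys x <= V j & lin f x = 0} = pm.dim (lin f ` {y. keys y <= V (Suc j)}) + card (C j)"
proof -
 let ?K = "{x. keys x <= V j & lin f x = 0}"
 have sK: "pm.subspace ?K" by (rule pm.subspaceI) (simp_all add: keys_add_subset keys_scl_subset)
 have "pm.dim ?K = pm.dim (lin p ` ?K) + pm.dim {x\<in>?K. lin p x = 0}"
  by (rule rank_nullity_pm[OF linear_lin sK finV[of j]]) blast
 moreover have "lin p ` ?K = {x :: ('c, 'k) fv. keys x <= C j}"
 proof
  show "lin p ` ?K <= {x :: ('c, 'k) fv. keys x <= C j}" using pC by (auto dest!: keys_lin[THEN subsetD])
  show "{x :: ('c, 'k) fv. keys x <= C j} <= lin p ` ?K"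
  proof
   fix x :: "('c, 'k) fv" assume "x : {x :: ('c, 'k) fv. keys x <= C j}"
   hence x: "keys x <= C j" by simp
   have "keys (lin i x) <= V j" by (rule keys_lin_subset) (use x iV in blast)
   moreover have "lin (%c. lin f (i c)) x = lin (%c. 0) x" by (rule lin_cong) (use x f_i in blast)
   moreover have "lin (%c. lin p (i c)) x = lin unit_vec x" by (rule lin_cong) (use x p_i in blast)
   ultimately show "x : lin p ` ?K" by (intro image_eqI[of _ _ "lin i x"]) (simp_all add: lin_lin)
  qed
 qed
 moreover have "{x\<in>?K. lin p x = 0} = lin f ` {y. keys y <= V (Suc j)}"
 proof
  show "{x\<in>?K. lin p x = 0} <= lin f ` {y. keys y <= V (Suc j)}"
  proof
   fix x assume "x : {x\<in>?K. lin p x = 0}"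
   hence x: "keys x <= V j" "lin f x = 0" "lin p x = 0" by auto
   have "keys (lin s x) <= V (Suc j)" by (rule keys_lin_subset) (use x(1) sV in blast)
   moreover have "x = lin f (lin s x)" using homotopy[OF x(1)] x by simp
   ultimately show "x : lin f ` {y. keys y <= V (Suc j)}" by (intro image_eqI) auto
  qed
  show "lin f ` {y. keys y <= V (Suc j)} <= {x\<in>?K. lin p x = 0}"
  proof
   fix x assume "x : lin f ` {y. keys y <= V (Suc j)}"
   then obtain y where y: "keys y <= V (Suc j)" "x = lin f y" by auto
   have "keys x <= V j" unfolding y(2) by (rule keys_lin_subset) (use y(1) fV in blast)
   moreover have "lin (%c. lin p (f c)) y = lin (%c. 0) y" by (rule lin_cong) (use y p_f in blast)
   ultimately show "x : {x\<in>?K. lin p x = 0}" using f_zero[OF y(1)] by (simp add: y(2) lin_lin)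
  qed
 qed
 ultimately show ?thesis using dim_keys[OF finC, of j, where 'k = 'k] by simp
qed

lemma dim_homology:
 "pm.dim {x. keys x <= V j & lin f x = 0} - pm.dim (lin f ` {y. keys y <= V (Suc j)}) = card (C j)"
 using dim_kernel[of j] by simp

lemma card_V_Suc:
 "card (V (Suc j)) = pm.dim (lin f ` {y. keys y <= V (Suc j)}) + pm.dim {x. keys x <= V (Suc j) & lin f x = 0}"
proof -
 have "pm.dim {y :: ('b, 'k) fv. keys y <= V (Suc j)} = pm.dim (lin f ` {y. keys y <= V (Suc j)}) + pm.dim {x\<in>{y. keys y <= V (Suc j)}. lin f x = 0}"
  by (rule rank_nullity_pm[OF linear_lin subspace_keys finV[of "Suc j"]]) simp
 thus ?thesis using dim_keys[OF finV, of "Suc j", where 'k = 'k] by simp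
qed

end

text \<open>Over a field the complex splits. \<open>g\<close> inverts f on boundaries and
  \<open>q\<close> projects onto boundaries; \<open>R\<close> = 1 - q - S f is then a projection
  onto cycles complementary to the boundaries, whose image H is the homology. The basis of the model
  in degree j is {j} \<times> {..<d j}, so that the first component records the degree.\<close>

lemma hmodel_exists:
 fixes V :: "nat => 'b set" and f :: "'b => ('b, 'k::field) fv"
 assumes finV: "!!j. finite (V j)" and dgV: "!!b j. b : V j ==> h b = j"
  and fV: "!!b j. b : V (Suc j) ==> keys (f b) <= V j" and f0: "!!b. b : V 0 ==> f b = 0"
  and ff: "!!b j. b : V j ==> lin f (f b) = 0"
 obtains d s p i where "hmodel V f (%j. {j} \<times> {..<d j :: nat}) s p i"
proof -
 let ?V = "%j. {x :: ('b, 'k) fv. keys x <= V j}"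
 define Bd where "Bd j = lin f ` ?V (Suc j)" for j
 have sB: "pm.subspace (Bd j)" for j unfolding Bd_def by (rule pmp.linear_subspace_image[OF linear_lin subspace_keys])
 have BV: "Bd j <= ?V j" for j unfolding Bd_def using fV by (auto dest!: keys_lin[THEN subsetD])
 have fB: "lin f x = 0" if xB: "x : Bd j" for x j
 proof -
  obtain y where y: "keys y <= V (Suc j)" "x = lin f y" using xB unfolding Bd_def by blast
  have "lin (%b. lin f (f b)) y = lin (%b. 0) y" by (rule lin_cong) (use ff y in blast)
  thus ?thesis by (simp add: y(2) lin_lin)
 qed
 have "EX g. Vector_Spaces.linear scl scl g & range g <= ?V (Suc j) & (\<forall>v\<in>Bd j. lin f (g v) = v)" for j
  using pmp.linear_exists_right_inverse_on[OF linear_lin[of f] subspace_keys[of "V (Suc j)"]]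
  unfolding Bd_def by (elim exE conjE, intro exI conjI)
 note exg = this
 define g where "g j = (SOME g. Vector_Spaces.linear scl scl g & range g <= ?V (Suc j) & (\<forall>v\<in>Bd j. lin f (g v) = v))" for j
 have "Vector_Spaces.linear scl scl (g j) & range (g j) <= ?V (Suc j) & (\<forall>v\<in>Bd j. lin f (g j v) = v)" for j
  unfolding g_def by (rule someI_ex[OF exg[of j]])
 hence g: "!!j. Vector_Spaces.linear scl scl (g j)" "!!j. range (g j) <= ?V (Suc j)" "!!j v. v : Bd j ==> lin f (g j v) = v"
  by simp_all
 have "EX q. range q <= Bd j & Vector_Spaces.linear scl scl q & (\<forall>v\<in>Bd j. q v = v)" for j
  using pmp.linear_exists_left_inverse_on[OF linear_lin[of unit_vec] sB[of j]] unfolding lin_unit_vec by (simp add: inj_on_def)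
 note exq = this
 define q where "q j = (SOME q. range q <= Bd j & Vector_Spaces.linear scl scl q & (\<forall>v\<in>Bd j. q v = v))" for j
 have "range (q j) <= Bd j & Vector_Spaces.linear scl scl (q j) & (\<forall>v\<in>Bd j. q j v = v)" for j
  unfolding q_def by (rule someI_ex[OF exq[of j]])
 hence q: "!!j. range (q j) <= Bd j" "!!j. Vector_Spaces.linear scl scl (q j)" "!!j v. v : Bd j ==> q j v = v"
  by simp_all
 note lqd = pmp.linear_diff[OF q(2)] and lqa = pmp.linear_add[OF q(2)] and lqs = pmp.linear_scale[OF q(2)]
  and lga = pmp.linear_add[OF g(1)] and lgs = pmp.linear_scale[OF g(1)]
 \<comment> \<open>The correction makes q (S x) = 0, and this is what makes R idempotent.\<close>
 define S where "S j x = g j (q j x) - q (Suc j) (g j (q j x))" for j x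
 define s where "s b = S (h b) (unit_vec b)" for b
 have linS: "Vector_Spaces.linear scl scl (S j)" for j
  by unfold_locales (simp_all add: S_def lqa lga lqs lgs algebra_simps)
 have sS: "lin s x = S j x" if "keys x <= V j" for x j
  unfolding linear_eq_lin[OF linS[of j], of x] by (rule lin_cong) (use that dgV in \<open>auto simp: s_def\<close>)
 have SV: "S j x : ?V (Suc j)" for j x
 proof -
  have "g j (q j x) : ?V (Suc j)" "q (Suc j) (g j (q j x)) : ?V (Suc j)"
   using range_subsetD[OF g(2)[of j]] subsetD[OF BV[of "Suc j"] range_subsetD[OF q(1)[of "Suc j"]]] by simp_all
  thus ?thesis by (simp add: S_def keys_diff_subset)
 qed
 have qB: "q j x : Bd j" for j x by (rule range_subsetD[OF q(1)])
 have fS: "lin f (S j x) = q j x" for j x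
  by (simp add: S_def g(3)[OF qB] fB[OF qB])
 have qS: "q (Suc j) (S j x) = 0" for j x
  by (simp add: S_def lqd q(3)[OF qB])
 define R where "R j x = x - q j x - lin s (lin f x)" for j x
 have linR: "Vector_Spaces.linear scl scl (R j)" for j
  by unfold_locales (simp_all add: R_def lqa lqs algebra_simps)
 have fx: "(j = 0 --> lin f x = 0) & (\<forall>i. j = Suc i --> lin f x : Bd i)" if "keys x <= V j" for x j
 proof (intro conjI impI allI)
  assume j: "j = 0"
  have "lin f x = lin (%b. 0) x" by (rule lin_cong) (use that f0 j in blast)
  thus "lin f x = 0" by simp
 qed (use that in \<open>auto simp: Bd_def\<close>)
 have sf: "EX z. lin s (lin f x) = z & keys z <= V j & lin f z = lin f x & q j z = 0" if x: "keys x <= V j" for x j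
 proof (cases j)
  case 0
  have fx0: "lin f x = 0" using fx[OF x] 0 by simp
  show ?thesis by (simp add: fx0 pmp.linear_0[OF q(2)])
 next
  case (Suc i)
  have b: "lin f x : Bd i" using fx[OF x] Suc by simp
  have e: "lin s (lin f x) = S i (lin f x)" by (rule sS) (use b BV in blast)
  show ?thesis unfolding e using SV[of i "lin f x"] fS[of i "lin f x"] qS[of i "lin f x"] q(3)[OF b] Suc by simp
 qed
 have RV: "keys (R j x) <= V j" if "keys x <= V j" for x j
  unfolding R_def using sf[OF that] subsetD[OF BV qB[of j x]] by (intro keys_diff_subset that) auto
 have fR: "lin f (R j x) = 0" if "keys x <= V j" for x j
  using sf[OF that] fB[OF qB, of j x] by (auto simp: R_def)
 have Rf: "R j x = 0" if "x : Bd j" for x j using q(3)[OF that] fB[OF that] by (simp add: R_def)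
 have RR: "R j (R j x) = R j x" if x: "keys x <= V j" for x j
 proof -
  have "q j (R j x) = 0" using sf[OF x] q(3)[OF qB, of j x] by (auto simp: R_def lqd)
  thus ?thesis unfolding R_def[of j "R j x"] fR[OF x] by simp
 qed
 define H where "H j = R j ` ?V j" for j
 have sH: "pm.subspace (H j)" for j unfolding H_def by (rule pmp.linear_subspace_image[OF linR subspace_keys])
 have HV: "H j <= ?V j" for j unfolding H_def using RV by blast
 define d where "d j = pm.dim (H j)" for j
 let ?C = "%j. {j} \<times> {..<d j}"
 have "EX i0. lin i0 ` {x. keys x <= ?C j} = H j & (\<forall>x. keys x <= ?C j --> lin i0 x = 0 --> x = 0)" for j
 proof -
  have c: "finite (?C j)" "card (?C j) = pm.dim (H j)" by (simp_all add: d_def)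
  obtain i0 where "lin i0 ` {x. keys x <= ?C j} = H j" "!!x. keys x <= ?C j ==> lin i0 x = 0 ==> x = 0"
   by (rule subspace_param[OF sH finV HV c]) (rule that)
  thus ?thesis by blast
 qed
 note exi = this
 define i0 where "i0 j = (SOME i0. lin i0 ` {x. keys x <= ?C j} = H j & (\<forall>x. keys x <= ?C j --> lin i0 x = 0 --> x = 0))" for j
 have "lin (i0 j) ` {x. keys x <= ?C j} = H j & (\<forall>x. keys x <= ?C j --> lin (i0 j) x = 0 --> x = 0)" for j
  unfolding i0_def by (rule someI_ex[OF exi[of j]])
 hence i0: "!!j. lin (i0 j) ` {x. keys x <= ?C j} = H j"
   "!!j x. keys x <= ?C j ==> lin (i0 j) x = 0 ==> x = 0" by blast+
 have "EX r. range r <= {x. keys x <= ?C j} & Vector_Spaces.linear scl scl r & (\<forall>v\<in>{x. keys x <= ?C j}. r (lin (i0 j) v) = v)" for j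
 proof (rule pmp.linear_exists_left_inverse_on[OF linear_lin subspace_keys])
  show "inj_on (lin (i0 j)) {x. keys x <= ?C j}"
  proof (rule inj_onI)
   fix x y assume xy: "x : {x. keys x <= ?C j}" "y : {x. keys x <= ?C j}" "lin (i0 j) x = lin (i0 j) y"
   have "keys (x - y) <= ?C j" by (rule keys_diff_subset) (use xy in auto)
   hence "x - y = 0" by (rule i0(2)) (use xy(3) in simp)
   thus "x = y" by simp
  qed
 qed
 note exr = this
 define r where "r j = (SOME r. range r <= {x. keys x <= ?C j} & Vector_Spaces.linear scl scl r & (\<forall>v\<in>{x. keys x <= ?C j}. r (lin (i0 j) v) = v))" for j
 have "range (r j) <= {x. keys x <= ?C j} & Vector_Spaces.linear scl scl (r j) & (\<forall>v\<in>{x. keys x <= ?C j}. r j (lin (i0 j) v) = v)" for j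
  unfolding r_def by (rule someI_ex[OF exr[of j]])
 hence r: "!!j. range (r j) <= {x. keys x <= ?C j}" "!!j. Vector_Spaces.linear scl scl (r j)"
   "!!j v. keys v <= ?C j ==> r j (lin (i0 j) v) = v" by simp_all
 define ii where "ii c = i0 (fst c) c" for c :: "nat \<times> nat"
 define p where "p b = r (h b) (R (h b) (unit_vec b))" for b
 have lii: "lin ii x = lin (i0 j) x" if "keys x <= ?C j" for x j
  by (rule lin_cong) (use that in \<open>auto simp: ii_def\<close>)
 have linp: "lin p x = r j (R j x)" if x: "keys x <= V j" for x j
 proof -
  have rR: "Vector_Spaces.linear scl scl (%x. r j (R j x))"
   using Vector_Spaces.linear_compose[OF linR r(2)] by (simp add: o_def)
  show ?thesis unfolding linear_eq_lin[OF rR, of x] by (rule lin_cong) (use x dgV in \<open>auto simp: p_def\<close>)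
 qed
 have ip: "lin ii (r j y) = y" if y: "y : H j" for y j
 proof -
  obtain x where x: "keys x <= ?C j" "y = lin (i0 j) x" using y i0(1)[of j] by blast
  have "r j y = x" using r(3)[OF x(1)] x(2) by simp
  thus ?thesis using lii[OF x(1)] x(2) by simp
 qed
 have iiH: "ii c : H j" if "c : ?C j" for c j
 proof -
  have "lin (i0 j) (unit_vec c) : H j" unfolding i0(1)[symmetric] by (rule imageI) (use that in auto)
  thus ?thesis using that by (auto simp: ii_def)
 qed
 have RH: "R j y = y" if "y : H j" for y j using that RR by (auto simp: H_def)
 have rC: "keys (r j x) <= ?C j" for j x using range_subsetD[OF r(1)[of j], of x] by simp
 have fH: "lin f y = 0" if yH: "y : H j" for y j
 proof -
  obtain x where "keys x <= V j" "y = R j x" using yH unfolding H_def by blast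
  thus ?thesis using fR[of x j] by simp
 qed
 have HVk: "keys y <= V j" if "y : H j" for y j using subsetD[OF HV that] by simp
 have b1: "keys (s b) <= V (Suc j)" if "b : V j" for b j
  using SV[of j "unit_vec b"] by (simp add: s_def dgV[OF that])
 have b2: "keys (p b) <= ?C j" if "b : V j" for b j
  unfolding p_def dgV[OF that] by (rule rC)
 have b3: "lin p (f b) = 0" if b: "b : V j" for b j
 proof (cases j)
  case 0
  thus ?thesis using f0 b by simp
 next
  case (Suc k)
  have kb: "keys (unit_vec b :: ('b, 'k) fv) <= V (Suc k)" using b Suc by simp
  have "lin f (unit_vec b) : Bd k" unfolding Bd_def by (rule imageI) (use kb in simp)
  hence fb: "f b : Bd k" by simp
  have "keys (f b) <= V k" using subsetD[OF BV fb] by simp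
  hence "lin p (f b) = r k (R k (f b))" by (rule linp)
  thus ?thesis using Rf[OF fb] pmp.linear_0[OF r(2)] by simp
 qed
 have b4: "lin f (s b) + lin s (f b) = unit_vec b - lin ii (p b)" if b: "b : V j" for b j
 proof -
  have "R j (unit_vec b) : H j" unfolding H_def by (rule imageI) (use b in simp)
  hence "lin ii (p b) = R j (unit_vec b)" unfolding p_def dgV[OF b] by (rule ip)
  moreover have "lin f (s b) = q j (unit_vec b)" unfolding s_def dgV[OF b] by (rule fS)
  ultimately show ?thesis by (simp add: R_def)
 qed
 have c3: "lin p (ii c) = unit_vec c" if c: "c : ?C j" for c j
 proof -
  have "lin p (ii c) = r j (R j (ii c))" by (rule linp[OF HVk[OF iiH[OF c]]])
  also have "R j (ii c) = ii c" by (rule RH[OF iiH[OF c]])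
  also have "r j (ii c) = r j (lin (i0 j) (unit_vec c))" using c by (auto simp: ii_def)
  also have "... = unit_vec c" by (rule r(3)) (use c in simp)
  finally show ?thesis .
 qed
 have "hmodel V f ?C s p ii"
  by (intro hmodel.intro finV fV f0 ff b1 b2 b3 b4 c3 HVk[OF iiH] fH[OF iiH]; (assumption | simp))
 thus ?thesis by (rule that)
qed

section \<open>Words over a contracted complex\<close>

definition cns :: "('a, 'k::field) fv => ('a list, 'k) fv => ('a list, 'k) fv" where
 "cns x y = lin (%a. lin (%v. unit_vec (a # v)) y) x"

lemma cns_linear [simp]:
 "cns (x + x') y = cns x y + cns x' y" "cns x (y + y') = cns x y + cns x y'"
 "cns (x - x') y = cns x y - cns x' y" "cns x (y - y') = cns x y - cns x y'"
 "cns (- x) y = - cns x y" "cns x (- y) = - cns x y" "cns 0 y = 0" "cns x 0 = 0"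
 "cns (scl c x) y = scl c (cns x y)" "cns x (scl c y) = scl c (cns x y)"
 by (simp_all add: cns_def lin_fun_add lin_fun_diff lin_fun_minus lin_fun_scl)

lemma cns_unit: "cns (unit_vec a) y = lin (%v. unit_vec (a # v)) y"
 by (simp add: cns_def)

lemma cns_unit2: "cns x (unit_vec v) = lin (%a. unit_vec (a # v)) x"
 by (simp add: cns_def)

lemma keys_cns:
 assumes "keys x <= P" "keys y <= Q"
 shows "keys (cns x y) <= {a # v | a v. a : P & v : Q}"
 unfolding cns_def by (rule keys_lin_subset, rule keys_lin_subset) (use assms in auto)

lemma lin_cns_left: "lin (%a. cns (f a) y) x = cns (lin f x) y"
 by (simp add: cns_def lin_lin)

lemma lin_cns_right: "lin (%v. cns x (g v)) y = cns x (lin g y)"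
 unfolding cns_def lin_lin by (rule lin_swap)

lemma lin_cns:
 assumes "!!a v. a : keys x ==> v : keys y ==> G (a # v) = cns (f a) (k v) + scl e (cns (f' a) (g v))"
 shows "lin G (cns x y) = cns (lin f x) (lin k y) + scl e (cns (lin f' x) (lin g y))"
proof -
 have "lin G (cns x y) = lin (%a. lin (%v. G (a # v)) y) x" by (simp add: cns_def lin_lin)
 also have "... = lin (%a. cns (f a) (lin k y) + scl e (cns (f' a) (lin g y))) x"
 proof (rule lin_cong)
  fix a assume a: "a : keys x"
  have "lin (%v. G (a # v)) y = lin (%v. cns (f a) (k v) + scl e (cns (f' a) (g v))) y"
   by (rule lin_cong) (rule assms[OF a])
  thus "lin (%v. G (a # v)) y = cns (f a) (lin k y) + scl e (cns (f' a) (lin g y))"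
   by (simp add: lin_fun_add lin_fun_scl lin_cns_right)
 qed
 finally show ?thesis by (simp add: lin_fun_add lin_fun_scl lin_cns_left)
qed

fun tens :: "('a => ('b, 'k::field) fv) => 'a list => ('b list, 'k) fv" where
 "tens g [] = unit_vec []"
| "tens g (a # w) = cns (g a) (tens g w)"

lemma lin_tens_cns: "lin (tens g) (cns x y) = cns (lin g x) (lin (tens g) y)"
 using lin_cns[of x y "tens g" "%_. 0" "%_. 0" 1 g "tens g"] by simp

definition wd :: "('a => nat) => 'a list => nat" where
 "wd h w = sum_list (map (%a. Suc (h a)) w)"

lemma wd_simps [simp]: "wd h [] = 0" "wd h (a # w) = Suc (h a + wd h w)"
 by (simp_all add: wd_def)

definition WW :: "'a set => ('a => nat) => nat => 'a list set" where
 "WW L h j = {w. set w <= L & wd h w = j}"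

lemma length_le_wd: "length w <= wd h w"
 by (induction w) simp_all

lemma wd_letter: "a : set w ==> h a < wd h w"
 by (induction w) auto

lemma keys_neg: "keys (- x) = keys (x :: ('a, 'k::field) fv)"
 by (auto simp: in_keys_iff)

lemma finite_WW:
 assumes "!!j. finite {a\<in>L. h a = j}"
 shows "finite (WW L h j)"
proof -
 have "WW L h j <= {w. set w <= (\<Union>q<j. {a\<in>L. h a = q}) & length w <= j}"
  using length_le_wd wd_letter by (force simp: WW_def)
 thus ?thesis by (rule finite_subset) (rule finite_lists_length_le, use assms in simp)
qed

text \<open>A nonempty word is a first letter followed by a word, and each letter counts one more
  than its degree. So the series G of words satisfies G = 1 + X H G, where H is the series of
  letters.\<close>

lemma card_WW_fps:
 fixes L :: "'a set" and h :: "'a => nat"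
 assumes fin: "!!j. finite {a\<in>L. h a = j}"
 shows "(1 - fps_X * Abs_fps (%j. of_nat (card {a\<in>L. h a = j}))) * Abs_fps (%j. of_nat (card (WW L h j))) = (1 :: rat fps)"
proof -
 have W0: "WW L h 0 = {[]}"
 proof -
  have "w = []" if "wd h w = 0" for w using that length_le_wd[of w h] by simp
  thus ?thesis by (auto simp: WW_def)
 qed
 have rec: "card (WW L h (Suc j)) = (\<Sum>q=0..j. card {a\<in>L. h a = q} * card (WW L h (j - q)))" for j
 proof -
  let ?S = "%q. (%(a, w). a # w) ` ({a\<in>L. h a = q} \<times> WW L h (j - q))"
  have "WW L h (Suc j) = (\<Union>q\<in>{0..j}. ?S q)"
  proof
   show "WW L h (Suc j) <= (\<Union>q\<in>{0..j}. ?S q)"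
   proof
    fix w assume w: "w : WW L h (Suc j)"
    then obtain a v where av: "w = a # v" by (cases w) (auto simp: WW_def)
    hence "h a : {0..j}" "w : ?S (h a)" using w by (auto simp: WW_def)
    thus "w : (\<Union>q\<in>{0..j}. ?S q)" by blast
   qed
   show "(\<Union>q\<in>{0..j}. ?S q) <= WW L h (Suc j)" by (auto simp: WW_def)
  qed
  also have "card ... = (\<Sum>q=0..j. card (?S q))"
   by (rule card_UN_disjoint) (use fin finite_WW[OF fin] in auto)
  also have "... = (\<Sum>q=0..j. card {a\<in>L. h a = q} * card (WW L h (j - q)))"
   by (rule sum.cong) (simp_all add: card_image inj_on_def card_cartesian_product)
  finally show ?thesis .
 qed
 let ?H = "Abs_fps (%j. of_nat (card {a\<in>L. h a = j})) :: rat fps" and ?G = "Abs_fps (%j. of_nat (card (WW L h j))) :: rat fps"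
 have HG: "fps_nth (?H * ?G) m = of_nat (\<Sum>q=0..m. card {a\<in>L. h a = q} * card (WW L h (m - q)))" for m
  by (simp add: fps_mult_nth)
 have "?G - fps_X * (?H * ?G) = 1"
 proof (rule fps_ext)
  fix m show "fps_nth (?G - fps_X * (?H * ?G)) m = fps_nth 1 m"
   by (cases m) (simp_all add: W0 rec HG del: of_nat_sum)
 qed
 thus ?thesis by (simp add: algebra_simps)
qed

text \<open>The contraction of the complex of letters extends to the words over it. This is the
  Kuenneth theorem for the tensor coalgebra, stated with explicit maps.\<close>

locale hmodel_words =
 fixes L :: "'a set" and h :: "'a => nat" and LC :: "'c set" and hc :: "'c => nat"
  and f :: "'a => ('a, 'k::field) fv" and s :: "'a => ('a, 'k) fv"
  and p :: "'a => ('c, 'k) fv" and i :: "'c => ('a, 'k) fv"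
 assumes hm: "hmodel (%j. {a\<in>L. h a = j}) f (%j. {c\<in>LC. hc c = j}) s p i"
begin

text \<open>The sign for passing a suspended letter, whose degree is h a + 1.\<close>

abbreviation si :: "'a => 'k" where "si a \<equiv> (- 1) ^ Suc (h a)"

fun dw :: "'a list => ('a list, 'k) fv" where
 "dw [] = 0"
| "dw (a # w) = cns (- f a) (unit_vec w) + scl (si a) (cns (unit_vec a) (dw w))"

text \<open>The tensor homotopy: \<open>s\<close> acts on one letter, every letter in front of it is
  projected by i p, and every letter behind it is left alone.\<close>

fun sw :: "'a list => ('a list, 'k) fv" where
 "sw [] = 0"
| "sw (a # w) = cns (- s a) (unit_vec w) + scl (si a) (cns (lin i (p a)) (sw w))"

lemma letter:
 assumes "a : L"
 shows "!!b. b : keys (f a) ==> b : L & h a = Suc (h b)" "!!b. b : keys (s a) ==> b : L & h b = Suc (h a)"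
  "!!c. c : keys (p a) ==> c : LC & hc c = h a"
  "lin f (f a) = 0" "lin p (f a) = 0" "lin f (s a) + lin s (f a) = unit_vec a - lin i (p a)"
proof -
 have a: "a : {b\<in>L. h b = h a}" using assms by simp
 show "!!b. b : keys (s a) ==> b : L & h b = Suc (h a)" "!!c. c : keys (p a) ==> c : LC & hc c = h a"
  using hmodel.sV[OF hm a] hmodel.pC[OF hm a] by auto
 show "lin f (f a) = 0" "lin p (f a) = 0" "lin f (s a) + lin s (f a) = unit_vec a - lin i (p a)"
  using hmodel.ff[OF hm a] hmodel.p_f[OF hm a] hmodel.hom[OF hm a] by auto
 fix b assume b: "b : keys (f a)"
 show "b : L & h a = Suc (h b)"
 proof (cases "h a")
  case 0
  hence "f a = 0" using hmodel.f0[OF hm, of a] assms by simp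
  thus ?thesis using b by simp
 next
  case (Suc q)
  thus ?thesis using hmodel.fV[OF hm, of a q] assms b by auto
 qed
qed

lemma cletter:
 assumes "c : LC"
 shows "!!b. b : keys (i c) ==> b : L & h b = hc c" "lin f (i c) = 0" "lin p (i c) = unit_vec c"
proof -
 have c: "c : {b\<in>LC. hc b = hc c}" using assms by simp
 show "!!b. b : keys (i c) ==> b : L & h b = hc c" using hmodel.iV[OF hm c] by auto
 show "lin f (i c) = 0" "lin p (i c) = unit_vec c" using hmodel.f_i[OF hm c] hmodel.p_i[OF hm c] by auto
qed

lemma lin_dw_cns:
 assumes "!!b. b : keys x ==> si b = e"
 shows "lin dw (cns x y) = - cns (lin f x) y + scl e (cns x (lin dw y))"
proof -
 have "lin dw (cns x y) = cns (lin (%a. - f a) x) (lin unit_vec y) + scl e (cns (lin unit_vec x) (lin dw y))"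
  by (rule lin_cns) (simp only: dw.simps assms)
 thus ?thesis by (simp add: lin_fun_minus)
qed

lemma lin_sw_cns:
 assumes "!!b. b : keys x ==> si b = e"
 shows "lin sw (cns x y) = - cns (lin s x) y + scl e (cns (lin i (lin p x)) (lin sw y))"
proof -
 have "lin sw (cns x y) = cns (lin (%a. - s a) x) (lin unit_vec y) + scl e (cns (lin (%a. lin i (p a)) x) (lin sw y))"
  by (rule lin_cns) (simp only: sw.simps assms)
 thus ?thesis by (simp add: lin_fun_minus lin_lin)
qed

lemma keys_dw: "set w <= L ==> keys (dw w) <= {v. set v <= L & wd h w = Suc (wd h v) & length v = length w}"
proof (induction w)
 case (Cons a w)
 have a: "a : L" using Cons.prems by simp
 have 1: "keys (cns (- f a) (unit_vec w)) <= {b # v | b v. b : {b\<in>L. h a = Suc (h b)} & v : {w}}"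
  by (rule keys_cns) (use letter(1)[OF a] in \<open>auto simp: keys_neg\<close>)
 have 2: "keys (cns (unit_vec a) (dw w)) <= {b # v | b v. b : {a} & v : {v. set v <= L & wd h w = Suc (wd h v) & length v = length w}}"
  by (rule keys_cns) (use Cons in auto)
 show ?case unfolding dw.simps
  by (intro keys_add_subset keys_scl_subset order_trans[OF 1] order_trans[OF 2]) (use a Cons.prems in auto)
qed simp

lemma keys_sw: "set w <= L ==> keys (sw w) <= {v. set v <= L & wd h v = Suc (wd h w) & length v = length w}"
proof (induction w)
 case (Cons a w)
 have a: "a : L" using Cons.prems by simp
 have 1: "keys (cns (- s a) (unit_vec w)) <= {b # v | b v. b : {b\<in>L. h b = Suc (h a)} & v : {w}}"
  by (rule keys_cns) (use letter(2)[OF a] in \<open>auto simp: keys_neg\<close>)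
 have "keys (lin i (p a)) <= {b\<in>L. h b = h a}"
 proof (rule keys_lin_subset)
  fix c assume "c : keys (p a)"
  note l = letter(3)[OF a this]
  show "keys (i c) <= {b\<in>L. h b = h a}" using cletter(1)[OF conjunct1[OF l]] l by auto
 qed
 hence 2: "keys (cns (lin i (p a)) (sw w)) <= {b # v | b v. b : {b\<in>L. h b = h a} & v : {v. set v <= L & wd h v = Suc (wd h w) & length v = length w}}"
  by (rule keys_cns) (use Cons in auto)
 show ?case unfolding sw.simps
  by (intro keys_add_subset keys_scl_subset order_trans[OF 1] order_trans[OF 2]) (use a Cons.prems in auto)
qed simp

lemma keys_tens_p: "set w <= L ==> keys (tens p w) <= {v. set v <= LC & wd hc v = wd h w & length v = length w}"
proof (induction w)
 case (Cons a w)
 have "keys (cns (p a) (tens p w)) <= {b # v | b v. b : {c\<in>LC. hc c = h a} & v : {v. set v <= LC & wd hc v = wd h w & length v = length w}}"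
  by (rule keys_cns) (use Cons letter(3)[of a] in auto)
 thus ?case unfolding tens.simps by (rule order_trans) (use Cons.prems in auto)
qed simp

lemma keys_tens_i: "set w <= LC ==> keys (tens i w) <= {v. set v <= L & wd h v = wd hc w & length v = length w}"
proof (induction w)
 case (Cons a w)
 have "keys (cns (i a) (tens i w)) <= {b # v | b v. b : {c\<in>L. h c = hc a} & v : {v. set v <= L & wd h v = wd hc w & length v = length w}}"
  by (rule keys_cns) (use Cons cletter(1)[of a] in auto)
 thus ?case unfolding tens.simps by (rule order_trans) (use Cons.prems in auto)
qed simp

lemma dw_dw: "set w <= L ==> lin dw (dw w) = 0"
proof (induction w)
 case (Cons a w)
 have a: "a : L" using Cons.prems by simp
 have 1: "lin dw (cns (f a) (unit_vec w)) = - cns (lin f (f a)) (unit_vec w) + scl (- si a) (cns (f a) (lin dw (unit_vec w)))"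
  by (rule lin_dw_cns) (use letter(1)[OF a] in auto)
 have 2: "lin dw (cns (unit_vec a) (dw w)) = - cns (lin f (unit_vec a)) (dw w) + scl (si a) (cns (unit_vec a) (lin dw (dw w)))"
  by (rule lin_dw_cns) auto
 show ?case using Cons by (simp add: 1 2 letter(4)[OF a] pm.scale_minus_left)
qed simp

lemma dw_tens_i: "set w <= LC ==> lin dw (tens i w) = 0"
proof (induction w)
 case (Cons c w)
 have "lin dw (cns (i c) (tens i w)) = - cns (lin f (i c)) (tens i w) + scl ((- 1) ^ Suc (hc c)) (cns (i c) (lin dw (tens i w)))"
  by (rule lin_dw_cns) (use cletter(1)[of c] Cons in auto)
 thus ?case using Cons cletter(2)[of c] by simp
qed simp

lemma tens_p_i: "set w <= LC ==> lin (tens p) (tens i w) = unit_vec w"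
 by (induction w) (simp_all add: lin_tens_cns cletter(3) cns_unit)

lemma tens_p_dw: "set w <= L ==> lin (tens p) (dw w) = 0"
 by (induction w) (simp_all add: lin_tens_cns letter(5))

text \<open>The terms in which both f and s act split by position. At different positions they
  vanish because f i = 0 and p f = 0, or cancel because a letter changed by f or s has the opposite
  sign \<open>si\<close>; at the same position the homotopy identity of letters applies, and the sum
  telescopes.\<close>

lemma sw_homotopy: "set w <= L ==> lin dw (sw w) + lin sw (dw w) = unit_vec w - lin (tens i) (tens p w)"
proof (induction w)
 case (Cons a w)
 have a: "a : L" using Cons.prems by simp
 let ?q = "lin i (p a)"
 have kq: "b : L & h b = h a" if bq: "b : keys ?q" for b
 proof -
  obtain c where c: "c : keys (p a)" "b : keys (i c)" using bq by (rule keys_linE)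
  note l = letter(3)[OF a c(1)]
  show ?thesis using cletter(1)[OF conjunct1[OF l] c(2)] l by simp
 qed
 have fq: "lin f ?q = 0"
 proof -
  have "lin (%c. lin f (i c)) (p a) = lin (%c. 0) (p a)" by (rule lin_cong) (use letter(3)[OF a] cletter(2) in auto)
  thus ?thesis by (simp add: lin_lin)
 qed
 have 1: "lin dw (cns (s a) (unit_vec w)) = - cns (lin f (s a)) (unit_vec w) + scl (- si a) (cns (s a) (lin dw (unit_vec w)))"
  by (rule lin_dw_cns) (use letter(2)[OF a] in auto)
 have 2: "lin dw (cns ?q (sw w)) = - cns (lin f ?q) (sw w) + scl (si a) (cns ?q (lin dw (sw w)))"
  by (rule lin_dw_cns) (use kq in auto)
 have 3: "lin sw (cns (f a) (unit_vec w)) = - cns (lin s (f a)) (unit_vec w) + scl (- si a) (cns (lin i (lin p (f a))) (lin sw (unit_vec w)))"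
  by (rule lin_sw_cns) (use letter(1)[OF a] in auto)
 have 4: "lin sw (cns (unit_vec a) (dw w)) = - cns (lin s (unit_vec a)) (dw w) + scl (si a) (cns (lin i (lin p (unit_vec a))) (lin sw (dw w)))"
  by (rule lin_sw_cns) auto
 have ss: "si a * si a = 1" by (simp add: power_add[symmetric] mult_2[symmetric] flip: power_mult_distrib)
 have "lin dw (sw (a # w)) + lin sw (dw (a # w))
   = cns (lin f (s a) + lin s (f a)) (unit_vec w) + scl (si a * si a) (cns ?q (lin dw (sw w) + lin sw (dw w)))"
  unfolding sw.simps dw.simps cns_linear lin_add lin_minus lin_scl 1 2 3 4 fq letter(5)[OF a]
  by (simp add: pm.scale_minus_left pm.scale_right_diff_distrib pm.scale_right_distrib del: power_Suc)
 also have "... = unit_vec (a # w) - cns ?q (lin (tens i) (tens p w))"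
  unfolding ss letter(6)[OF a] using Cons by (simp add: cns_unit)
 finally show ?case by (simp add: lin_tens_cns)
qed simp

lemma hmodel_words: "hmodel (WW L h) dw (WW LC hc) sw (tens p) (tens i)"
proof (rule hmodel.intro)
 show "finite (WW L h j)" for j by (rule finite_WW) (rule hmodel.finV[OF hm])
 show "finite (WW LC hc j)" for j by (rule finite_WW) (rule hmodel.finC[OF hm])
 fix w j
 show "keys (dw w) <= WW L h j" if "w : WW L h (Suc j)" using that keys_dw[of w] by (auto simp: WW_def)
 show "dw w = 0" if "w : WW L h 0" using that length_le_wd[of w h] by (auto simp: WW_def)
 assume w: "w : WW L h j"
 hence s: "set w <= L" "wd h w = j" by (auto simp: WW_def)
 show "keys (sw w) <= WW L h (Suc j)" using keys_sw[OF s(1)] s by (auto simp: WW_def)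
 show "keys (tens p w) <= WW LC hc j" using keys_tens_p[OF s(1)] s by (auto simp: WW_def)
 show "lin dw (dw w) = 0" by (rule dw_dw[OF s(1)])
 show "lin (tens p) (dw w) = 0" by (rule tens_p_dw[OF s(1)])
 show "lin dw (sw w) + lin sw (dw w) = unit_vec w - lin (tens i) (tens p w)" by (rule sw_homotopy[OF s(1)])
next
 fix w j assume w: "w : WW LC hc j"
 hence s: "set w <= LC" "wd hc w = j" by (auto simp: WW_def)
 show "keys (tens i w) <= WW L h j" using keys_tens_i[OF s(1)] s by (auto simp: WW_def)
 show "lin dw (tens i w) = 0" by (rule dw_tens_i[OF s(1)])
 show "lin (tens p) (tens i w) = unit_vec w" by (rule tens_p_i[OF s(1)])
qed

end

section \<open>Copies of a contracted complex\<close>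

text \<open>The second component is carried along without change; with subsets as second components
  this models the tensor product with an exterior algebra with zero differential.\<close>

definition ext :: "('b => ('c, 'k::field) fv) => 'b \<times> 'e => ('c \<times> 'e \<Rightarrow>\<^sub>0 'k)" where
 "ext g = (%(b, E). lin (%v. unit_vec (v, E)) (g b))"

definition shf :: "'e set => ('e => nat) => (nat => 'b set) => nat => ('b \<times> 'e) set" where
 "shf Es hE V j = {(b, E). E : Es & hE E <= j & b : V (j - hE E)}"

lemma lin_ext: "lin (ext g) (ext g' (b, E)) = lin (%v. unit_vec (v, E)) (lin g (g' b))"
 by (simp add: ext_def lin_lin)

lemma keys_ext: "keys (g b) <= Q ==> (!!v. v : Q ==> (v, E) : P) ==> keys (ext g (b, E)) <= P"
 unfolding ext_def prod.case by (rule keys_lin_subset) auto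

lemma finite_shf: "finite Es \<Longrightarrow> (\<And>j. finite (V j)) \<Longrightarrow> finite (shf Es hE V j)"
proof -
 assume "finite Es" "\<And>j. finite (V j)"
 hence "finite ((\<Union>q\<le>j. V q) \<times> Es)" by simp
 moreover have "shf Es hE V j \<subseteq> (\<Union>q\<le>j. V q) \<times> Es"
  by (rule subsetI, clarsimp simp: shf_def) (rule bexI, assumption, simp)
 ultimately show ?thesis by (rule rev_finite_subset)
qed

lemma hmodel_copies:
 assumes hm: "hmodel V f C s p i" and Es: "finite Es"
 shows "hmodel (shf Es hE V) (ext f) (shf Es hE C) (ext s) (ext p) (ext i)"
proof (rule hmodel.intro)
 show "finite (shf Es hE V j)" "finite (shf Es hE C j)" for j
  using hmodel.finV[OF hm] hmodel.finC[OF hm] Es by (auto intro: finite_shf)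
 show "keys (ext f x) <= shf Es hE V j" if x: "x : shf Es hE V (Suc j)" for x j
 proof -
  obtain b E where bE: "x = (b, E)" "E : Es" "hE E <= Suc j" "b : V (Suc j - hE E)" using x by (auto simp: shf_def)
  show ?thesis
  proof (cases "hE E <= j")
   case True
   hence "b : V (Suc (j - hE E))" using bE(4) by (simp add: Suc_diff_le)
   thus ?thesis unfolding bE(1) by (rule keys_ext[of f b, OF hmodel.fV[OF hm]]) (use bE True in \<open>simp add: shf_def\<close>)
  next
   case False
   hence "b : V 0" using bE by simp
   thus ?thesis using hmodel.f0[OF hm] by (simp add: bE(1) ext_def)
  qed
 qed
 show "ext f x = 0" if "x : shf Es hE V 0" for x
  using that hmodel.f0[OF hm] by (auto simp: shf_def ext_def)
 fix x j
 show "lin (ext f) (ext f x) = 0" "keys (ext s x) <= shf Es hE V (Suc j)" "keys (ext p x) <= shf Es hE C j"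
  "lin (ext p) (ext f x) = 0" "lin (ext f) (ext s x) + lin (ext s) (ext f x) = unit_vec x - lin (ext i) (ext p x)"
  if x: "x : shf Es hE V j"
 proof -
  obtain b E where bE: "x = (b, E)" "E : Es" "hE E <= j" and b: "b : V (j - hE E)" using x by (auto simp: shf_def)
  show "lin (ext f) (ext f x) = 0" "lin (ext p) (ext f x) = 0"
   unfolding bE(1) lin_ext hmodel.ff[OF hm b] hmodel.p_f[OF hm b] by simp_all
  show "keys (ext s x) <= shf Es hE V (Suc j)"
   unfolding bE(1) by (rule keys_ext[of s b, OF hmodel.sV[OF hm b]]) (use bE in \<open>simp add: shf_def Suc_diff_le\<close>)
  show "keys (ext p x) <= shf Es hE C j"
   unfolding bE(1) by (rule keys_ext[of p b, OF hmodel.pC[OF hm b]]) (use bE in \<open>simp add: shf_def Suc_diff_le\<close>)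
  show "lin (ext f) (ext s x) + lin (ext s) (ext f x) = unit_vec x - lin (ext i) (ext p x)"
   unfolding bE(1) lin_ext lin_add[symmetric] hmodel.hom[OF hm b] by simp
 qed
 fix y assume y: "y : shf Es hE C j"
 obtain b E where bE: "y = (b, E)" "E : Es" "hE E <= j" and b: "b : C (j - hE E)" using y by (auto simp: shf_def)
 show "keys (ext i y) <= shf Es hE V j" unfolding bE(1) by (rule keys_ext[of i b, OF hmodel.iV[OF hm b]]) (use bE in \<open>simp add: shf_def Suc_diff_le\<close>)
 show "lin (ext f) (ext i y) = 0" "lin (ext p) (ext i y) = unit_vec y"
  unfolding bE(1) lin_ext hmodel.f_i[OF hm b] hmodel.p_i[OF hm b] by simp_all
qed

lemma one_plus_X_power_nth: "fps_nth ((1 + fps_X :: rat fps) ^ n) q = of_nat (n choose q)"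
proof (induction n arbitrary: q)
 case 0
 thus ?case by (cases q) simp_all
next
 case (Suc n)
 have "fps_nth ((1 + fps_X :: rat fps) ^ Suc n) q = fps_nth ((1 + fps_X) ^ n + fps_X * (1 + fps_X) ^ n) q" by (simp add: algebra_simps)
 thus ?case by (cases q) (simp_all add: Suc)
qed

lemma card_copies_fps:
 assumes fin: "!!j. finite (V j)"
 shows "Abs_fps (%j. of_nat (card (shf (Pow {1..n}) card V j))) = (1 + fps_X :: rat fps) ^ n * Abs_fps (%j. of_nat (card (V j)))"
proof (rule fps_ext)
 fix j
 let ?S = "%q. V (j - q) \<times> {E. E <= {1..n} & card E = q}"
 have fS: "finite {E. E <= {1..n} & card E = q}" for q by simp
 have "shf (Pow {1..n}) card V j = (\<Union>q\<in>{0..j}. ?S q)" by (auto simp: shf_def)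
 also have "card ... = (\<Sum>q=0..j. card (?S q))"
  by (rule card_UN_disjoint) (use fin fS in auto)
 also have "... = (\<Sum>q=0..j. (n choose q) * card (V (j - q)))"
  by (rule sum.cong) (simp_all add: card_cartesian_product n_subsets)
 finally have c: "card (shf (Pow {1..n}) card V j) = (\<Sum>q=0..j. (n choose q) * card (V (j - q)))" .
 show "fps_nth (Abs_fps (%j. of_nat (card (shf (Pow {1..n}) card V j)))) j = fps_nth ((1 + fps_X :: rat fps) ^ n * Abs_fps (%j. of_nat (card (V j)))) j"
  unfolding fps_nth_Abs_fps fps_mult_nth one_plus_X_power_nth c by simp
qed

section \<open>Perturbation by word length\<close>

lemma filtered_nat:
 fixes v k a b :: "nat => nat"
 assumes "v 0 = k 0" "!!q. v (Suc q) = a q + v q" "!!q. k (Suc q) = b q + k q" "!!q. a q <= b q"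
 shows "v Q <= k Q & (v Q = k Q \<longleftrightarrow> (\<forall>q<Q. a q = b q))"
proof (induction Q)
 case (Suc Q)
 thus ?case using assms(2,3)[of Q] assms(4)[of Q] by (auto simp: less_Suc_eq)
qed (simp add: assms(1))

text \<open>Cycles are filtered by word length. The longest part of a d-cycle is an e-cycle, so each
  graded piece of the d-cycles sits inside that of the e-cycles. The total dimensions agree iff all
  pieces agree, that is, iff every e-cycle of pure length is the longest part of some
  d-cycle.\<close>

lemma filtered_dims:
 fixes d e :: "'w list => ('w list, 'k::field) fv" and B :: "'w list set"
 assumes fin: "finite B" and len: "!!w. w : B ==> length w <= J"
  and e: "!!w v. w : B ==> v : keys (e w) ==> length v = length w"
  and de: "!!w v. w : B ==> v : keys (d w - e w) ==> length v < length w"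
 shows "pm.dim {x. keys x <= B & lin d x = 0} = pm.dim {x. keys x <= B & lin e x = 0} \<longleftrightarrow>
  (\<forall>q x. keys x <= B \<inter> {w. length w = q} --> lin e x = 0 -->
   (EX y. keys y <= B \<inter> {w. length w < q} & lin d (x + y) = 0))"
proof -
 define lv where "lv q = B \<inter> {w. length w < q}" for q
 define V where "V q = {x. keys x <= lv q & lin d x = 0}" for q
 define K where "K q = {x. keys x <= lv q & lin e x = 0}" for q
 define T where "T q = {x. keys x <= B \<inter> {w. length w = q} & lin e x = 0}" for q
 let ?R = "%q :: nat. restr {w :: 'w list. length w = q} :: ('w list, 'k) fv => ('w list, 'k) fv"
 have flv: "finite (lv q)" for q using fin by (simp add: lv_def)
 have linR: "Vector_Spaces.linear scl scl (?R q)" for q by unfold_locales simp_all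
 have top: "?R q (lin d x) = lin e (?R q x)" "?R q (lin e x) = lin e (?R q x)" if x: "keys x <= lv (Suc q)" for x q
 proof -
  have "?R q (lin e x) = lin (%w. lin e (?R q (unit_vec w))) x" unfolding restr_lin
  proof (rule lin_cong)
   fix w assume "w : keys x"
   hence w: "w : B" "length w <= q" using x by (auto simp: lv_def)
   show "?R q (e w) = lin e (?R q (unit_vec w))"
   proof (cases "length w = q")
    case True
    have "?R q (e w) = e w" by (rule restr_id) (use e[OF w(1)] True in auto)
    thus ?thesis using True by (simp add: restr_single)
   next
    case False
    have "?R q (e w) = 0" unfolding restr_zero_iff using e[OF w(1)] False by auto
    thus ?thesis using False by (simp add: restr_single)
   qed
  qed
  also have "... = lin e (?R q x)" by (simp add: restr_def lin_lin)
  finally show 1: "?R q (lin e x) = lin e (?R q x)" .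
  have "?R q (lin d x - lin e x) = lin (%w. 0) x" unfolding lin_fun_diff[symmetric] restr_lin
  proof (rule lin_cong)
   fix w assume "w : keys x"
   hence w: "w : B" "length w <= q" using x by (auto simp: lv_def)
   show "?R q (d w - e w) = 0" unfolding restr_zero_iff using de[OF w(1)] w(2) by fastforce
  qed
  thus "?R q (lin d x) = lin e (?R q x)" using 1 by simp
 qed
 have Rlv: "keys (?R q x) <= B \<inter> {w. length w = q}" if "keys x <= lv (Suc q)" for x q
  using that by (auto simp: keys_restr lv_def)
 have RV: "?R q ` V (Suc q) <= T q" for q
 proof
  fix y assume "y : ?R q ` V (Suc q)"
  then obtain x where x: "keys x <= lv (Suc q)" "lin d x = 0" "y = ?R q x" by (auto simp: V_def)
  show "y : T q" using top(1)[OF x(1)] Rlv[OF x(1)] x(2,3) by (simp add: T_def)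
 qed
 have RK: "?R q ` K (Suc q) = T q" for q
 proof
  show "?R q ` K (Suc q) <= T q"
  proof
   fix y assume "y : ?R q ` K (Suc q)"
   then obtain x where x: "keys x <= lv (Suc q)" "lin e x = 0" "y = ?R q x" by (auto simp: K_def)
   show "y : T q" using top(2)[OF x(1)] Rlv[OF x(1)] x(2,3) by (simp add: T_def)
  qed
  show "T q <= ?R q ` K (Suc q)"
  proof
   fix x assume x: "x : T q"
   have "?R q x = x" by (rule restr_id) (use x in \<open>auto simp: T_def\<close>)
   moreover have "x : K (Suc q)" using x by (auto simp: T_def K_def lv_def)
   ultimately show "x : ?R q ` K (Suc q)" by (intro image_eqI[of _ _ x]) simp_all
  qed
 qed
 have sV: "pm.subspace (V q)" "pm.subspace (K q)" "pm.subspace (T q)" for q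
  unfolding V_def K_def T_def by (rule pm.subspaceI; simp add: keys_add_subset keys_scl_subset)+
 have low: "keys x <= lv q \<longleftrightarrow> keys x <= lv (Suc q) & ?R q x = 0" for x q
  unfolding restr_zero_iff lv_def by (auto simp: less_Suc_eq)
 have kerV: "{x : V (Suc q). ?R q x = 0} = V q" and kerK: "{x : K (Suc q). ?R q x = 0} = K q" for q
  using low[of _ q] by (auto simp: V_def K_def)
 have VK: "V q <= {x. keys x <= lv q}" "K q <= {x. keys x <= lv q}" for q by (auto simp: V_def K_def)
 have stepV: "pm.dim (V (Suc q)) = pm.dim (?R q ` V (Suc q)) + pm.dim (V q)" for q
  using rank_nullity_pm[OF linR sV(1) flv VK(1), of "Suc q" q] unfolding kerV .
 have stepK: "pm.dim (K (Suc q)) = pm.dim (T q) + pm.dim (K q)" for q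
  using rank_nullity_pm[OF linR sV(2) flv VK(2), of "Suc q" q] unfolding kerK RK .
 have Tfin: "finite (B \<inter> {w. length w = q})" "T q <= {x. keys x <= B \<inter> {w. length w = q}}" for q
  using fin by (auto simp: T_def)
 have le: "pm.dim (?R q ` V (Suc q)) <= pm.dim (T q)" for q by (rule dim_mono[OF Tfin RV])
 have eq: "pm.dim (?R q ` V (Suc q)) = pm.dim (T q) \<longleftrightarrow> ?R q ` V (Suc q) = T q" for q
 proof
  assume e: "pm.dim (?R q ` V (Suc q)) = pm.dim (T q)"
  show "?R q ` V (Suc q) = T q"
   by (rule dim_eq_imp_eq[OF Tfin RV pmp.linear_subspace_image[OF linR sV(1)] sV(3)]) (use e in simp)
 qed simp
 have V0: "pm.dim (V 0) = pm.dim (K 0)"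
 proof -
  have "V 0 = {0}" "K 0 = {0}" by (auto simp: V_def K_def lv_def)
  thus ?thesis by simp
 qed
 have main: "pm.dim (V (Suc J)) = pm.dim (K (Suc J)) \<longleftrightarrow> (\<forall>q<Suc J. ?R q ` V (Suc q) = T q)"
  unfolding eq[symmetric] using filtered_nat[OF V0 stepV stepK le, of "Suc J"] by blast
 have lvJ: "lv (Suc J) = B" using len by (auto simp: lv_def less_Suc_eq_le)
 have iff: "?R q ` V (Suc q) = T q \<longleftrightarrow> (\<forall>x. keys x <= B \<inter> {w. length w = q} --> lin e x = 0 -->
   (EX y. keys y <= B \<inter> {w. length w < q} & lin d (x + y) = 0))" for q
 proof (intro iffI allI impI)
  fix x assume a: "?R q ` V (Suc q) = T q" and x: "keys x <= B \<inter> {w. length w = q}" "lin e x = 0"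
  have "x : ?R q ` V (Suc q)" unfolding a using x by (simp add: T_def)
  then obtain z where z: "keys z <= lv (Suc q)" "lin d z = 0" "x = ?R q z" by (auto simp: V_def)
  have "keys (z - x) <= lv (Suc q)" by (rule keys_diff_subset[OF z(1)]) (use x(1) in \<open>auto simp: lv_def\<close>)
  moreover have "?R q (z - x) = 0" unfolding restr_linear z(3)[symmetric]
   by (simp add: restr_id[of x] x(1)[THEN order_trans])
  ultimately have "keys (z - x) <= lv q" using low by blast
  thus "EX y. keys y <= B \<inter> {w. length w < q} & lin d (x + y) = 0"
   using z(2) by (intro exI[of _ "z - x"]) (simp add: lv_def)
 next
  assume a: "\<forall>x. keys x <= B \<inter> {w. length w = q} --> lin e x = 0 -->
   (EX y. keys y <= B \<inter> {w. length w < q} & lin d (x + y) = 0)"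
  have "T q <= ?R q ` V (Suc q)"
  proof
   fix x assume "x : T q"
   hence x: "keys x <= B \<inter> {w. length w = q}" "lin e x = 0" by (auto simp: T_def)
   then obtain y where y: "keys y <= B \<inter> {w. length w < q}" "lin d (x + y) = 0" using a by blast
   have "keys (x + y) <= lv (Suc q)" by (rule keys_add_subset) (use x(1) y(1) in \<open>auto simp: lv_def\<close>)
   moreover have "?R q x = x" by (rule restr_id) (use x(1) in auto)
   moreover have "?R q y = 0" unfolding restr_zero_iff using y(1) by auto
   ultimately show "x : ?R q ` V (Suc q)" using y(2)
    by (intro image_eqI[of _ _ "x + y"]) (simp_all add: V_def)
  qed
  thus "?R q ` V (Suc q) = T q" using RV[of q] by blast
 qed
 \<comment> \<open>No word is longer than J, so the bounded and the unbounded quantification over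
   lengths say the same.\<close>
 have big: "EX y. keys y <= B \<inter> {w. length w < q} & lin d (x + y) = 0"
  if q: "~ q < Suc J" and x: "keys x <= B \<inter> {w. length w = q}" for q x
 proof -
  have "w ~: B \<inter> {w. length w = q}" for w using len[of w] q by auto
  hence "B \<inter> {w. length w = q} = {}" by blast
  hence "x = 0" using x by simp
  thus ?thesis by (intro exI[of _ 0]) simp
 qed
 have "(\<forall>q<Suc J. ?R q ` V (Suc q) = T q) \<longleftrightarrow> (\<forall>q x. keys x <= B \<inter> {w. length w = q} --> lin e x = 0 -->
   (EX y. keys y <= B \<inter> {w. length w < q} & lin d (x + y) = 0))"
  unfolding iff using big by blast
 thus ?thesis using main unfolding V_def K_def lvJ by simp
qed

section \<open>The numerical criterion\<close>

text \<open>The two complexes have the same chain spaces. Cycles in degree j+1 determine boundaries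
  in degree j by rank-nullity, so cycle dimensions and homology dimensions determine each other by
  induction from degree 0.\<close>

lemma lift_kernel_dims:
 fixes zb z0 cv :: "nat => nat"
 assumes "zb 0 = z0 0" and "!!j. zb j = rb j + hb j" "!!j. z0 j = r0 j + h0 j"
  and "!!j. cv (Suc j) = rb j + zb (Suc j)" "!!j. cv (Suc j) = r0 j + z0 (Suc j)"
 shows "(\<forall>j. hb j = h0 j) \<longleftrightarrow> (\<forall>j :: nat. zb j = (z0 j :: nat))"
proof
 assume h: "\<forall>j. hb j = h0 j"
 show "\<forall>j. zb j = z0 j"
 proof
  fix j show "zb j = z0 j"
  proof (induction j)
   case (Suc j)
   thus ?case using h[rule_format, of j] assms(2-5)[of j] by linarith
  qed (rule assms(1))
 qed
next
 assume z: "\<forall>j. zb j = z0 j"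
 show "\<forall>j. hb j = h0 j"
 proof
  fix j show "hb j = h0 j" using z[rule_format, of j] z[rule_format, of "Suc j"] assms(2-5)[of j] by linarith
 qed
qed

context bar_min
begin

abbreviation LL :: "'g list set" where "LL \<equiv> {m. m ~= [] & set m <= GL}"

fun d0 :: "'g list list => ('g list list, 'k::field) fv" where
 "d0 [] = 0"
| "d0 (m # w) = - lin (%x. unit_vec (x # w)) (bt m) - scl (sg m) (lin (%v. unit_vec (m # v)) (d0 w))"

lemma keys_bt: "m : LL ==> keys (bt m :: ('g list, 'k::field) fv) <= {x : LL. length m = Suc (length x)}"
proof
 fix x assume m: "m : LL" and "x : keys (bt m :: ('g list, 'k) fv)"
 hence x: "x : keys (bd m :: ('g list, 'k) fv)" "lc x = lc m" by (auto simp: deg_part_def keys_restr)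
 have "lc m ~= 0" using lc_zero[of m] m by blast
 hence "x ~= []" using x(2) by auto
 thus "x : {x : LL. length m = Suc (length x)}" using keys_bd[OF x(1)] m by auto
qed

lemma finite_LL: "finite {m : LL. length m = j}"
 by (rule finite_subset[OF _ finite_lists_length_eq[OF finGL, of j]]) auto

lemma list_model:
 obtains d s p i where "hmodel (%j. {m : LL. length m = j}) (bt :: 'g list => ('g list, 'k::field) fv) (%j. {j} \<times> {..<d j :: nat}) s p i"
proof (rule hmodel_exists[where V = "%j. {m : LL. length m = j}" and f = bt and h = length])
 show "keys (bt b :: ('g list, 'k) fv) <= {m : LL. length m = j}" if "b : {m : LL. length m = Suc j}" for b j
  using keys_bt[of b, where 'k = 'k] that by auto
qed (use finite_LL bt_bt in \<open>auto intro: that\<close>)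

lemma keys_d0: "okW w ==> v : keys (d0 w :: ('g list list, 'k::field) fv) ==> length v = length w"
proof (induction w arbitrary: v)
 case (Cons m w)
 have w: "okW w" using Cons.prems by (simp add: okW_def)
 from Cons.prems(2) show ?case unfolding d0.simps
 proof (rule keys_diffE)
  assume "v : keys (- lin (%x. unit_vec (x # w)) (bt m) :: ('g list list, 'k) fv)"
  hence "v : keys (lin (%x. unit_vec (x # w)) (bt m) :: ('g list list, 'k) fv)" by (simp add: keys_neg)
  then obtain x where "v : keys (unit_vec (x # w) :: ('g list list, 'k) fv)" by (rule keys_linE)
  thus ?thesis by simp
 next
  assume "v : keys (scl (sg m) (lin (%v. unit_vec (m # v)) (d0 w)) :: ('g list list, 'k) fv)"
  hence "v : keys (lin (%v. unit_vec (m # v)) (d0 w) :: ('g list list, 'k) fv)" by (rule keys_sclD)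
  then obtain u where "u : keys (d0 w :: ('g list list, 'k) fv)" "v : keys (unit_vec (m # u) :: ('g list list, 'k) fv)" by (rule keys_linE)
  thus ?thesis using Cons.IH[OF w] by simp
 qed
qed simp

lemma keys_dB_d0: "v : keys (dB w - d0 w :: ('g list list, 'k::field) fv) ==> length w = Suc (length v)"
proof (induction w arbitrary: v)
 case (Cons m w)
 have e: "dB (m # w) - d0 (m # w) = - scl (sg m) (mg m w) - (scl (sg m) (lin (%v. unit_vec (m # v)) (dB w - d0 w)) :: ('g list list, 'k) fv)"
  by (simp add: pm.scale_right_diff_distrib)
 from Cons.prems show ?case unfolding e
 proof (rule keys_diffE)
  assume "v : keys (- scl (sg m) (mg m w) :: ('g list list, 'k) fv)"
  hence "v : keys (scl (sg m) (mg m w) :: ('g list list, 'k) fv)" by (simp add: keys_neg)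
  hence "v : keys (mg m w :: ('g list list, 'k) fv)" by (rule keys_sclD)
  thus ?thesis by (auto simp: mg_def split: list.splits if_splits)
 next
  assume "v : keys (scl (sg m) (lin (%v. unit_vec (m # v)) (dB w - d0 w)) :: ('g list list, 'k) fv)"
  hence "v : keys (lin (%v. unit_vec (m # v)) (dB w - d0 w) :: ('g list list, 'k) fv)" by (rule keys_sclD)
  then obtain u where "u : keys (dB w - d0 w :: ('g list list, 'k) fv)" "v : keys (unit_vec (m # u) :: ('g list list, 'k) fv)" by (rule keys_linE)
  thus ?thesis using Cons.IH by simp
 qed
qed simp

lemma keys_dB: "okW w ==> v : keys (dB w :: ('g list list, 'k::field) fv) ==> okW v & hW w = Suc (hW v)"
proof -
 assume w: "okW w" and v: "v : keys (dB w :: ('g list list, 'k) fv)"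
 have e: "deg_part dF fD (w, {}) = lin (%v. unit_vec (v, {})) (dB w :: ('g list list, 'k) fv)" by (rule deg_part_fD[OF w]) simp
 have "lin (%(v, E). unit_vec v) (deg_part dF fD (w, {})) = (dB w :: ('g list list, 'k) fv)" unfolding e by (simp add: lin_lin)
 hence "v : keys (lin (%(v, E). unit_vec v) (deg_part dF fD (w, {})) :: ('g list list, 'k) fv)" using v by simp
 then obtain b where b: "b : keys (deg_part dF fD (w, {}) :: 'g list list \<times> nat set \<Rightarrow>\<^sub>0 'k)" "v : keys ((case b of (v, E) => unit_vec v) :: ('g list list, 'k) fv)"
  by (rule keys_linE)
 obtain E where bE: "b = (v, E)" using b(2) by (cases b) auto
 have "b : keys (lin (%v. unit_vec (v, {})) (dB w) :: 'g list list \<times> nat set \<Rightarrow>\<^sub>0 'k)" using b(1) e by simp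
 then obtain u where "b : keys (unit_vec (u, {}) :: 'g list list \<times> nat set \<Rightarrow>\<^sub>0 'k)" by (rule keys_linE)
 hence E: "E = {}" by (simp add: bE)
 have okw: "okF (w, {})" using w by (simp add: okF_def okX_def)
 have "b : keys (fD (w, {}) :: 'g list list \<times> nat set \<Rightarrow>\<^sub>0 'k)" using b(1) by (simp add: deg_part_def keys_restr)
 from keys_fD[OF okw this] show "okW v & hW w = Suc (hW v)" by (simp add: bE E okF_def okX_def hF_def)
qed

lemma okW_WW: "{w. okW w & hW w = j} = WW LL length j"
 by (auto simp: okW_def WW_def hW_def wd_def)

text \<open>The argument of type \<open>itself\<close> fixes the coefficient field, which is not
  determined by the generators.\<close>

definition word_lifting :: "'k::field itself => bool" where
 "word_lifting _ \<longleftrightarrow> (\<forall>j q (x :: ('g list list, 'k) fv). keys x <= {w. okW w & hW w = j} \<inter> {w. length w = q} --> lin d0 x = 0 -->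
   (EX y. keys y <= {w. okW w & hW w = j} \<inter> {w. length w < q} & lin dB (x + y) = 0))"

text \<open>The left side is (1+t)^n times the Hilbert series of the homology of \<open>dB\<close>.
  On the right, the words over a basis of the homology of letters have the inverse of the Golod
  denominator as their series, and by \<open>hmodel_words\<close> this is the Hilbert series of the
  homology of \<open>d0\<close>. The invertible factor (1+t)^n cancels, homology dimensions are
  traded for cycle dimensions, and \<open>filtered_dims\<close> turns their equality into
  lifting.\<close>

lemma numerical_criterion:
 assumes r: "!!j. r j = pm.dim {x :: (_, 'k::field) fv. keys x <= BF j & lin (deg_part dF fD) x = 0}
   - pm.dim (lin (deg_part dF fD :: _ => (_, 'k) fv) ` {y. keys y <= BF (Suc j)})"
  and q: "!!j. q j = pm.dim {x :: (_, 'k) fv. keys x <= {l. set l <= GL & length l = j} & lin bt x = 0}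
   - pm.dim (lin (bt :: _ => (_, 'k) fv) ` {y. keys y <= {l. set l <= GL & length l = Suc j}})"
 shows "(Abs_fps (%j. of_nat (r j)) :: rat fps) = (1 + fps_X) ^ n / (1 - fps_X * Abs_fps (%j. if j = 0 then 0 else of_nat (q j)))
  \<longleftrightarrow> word_lifting TYPE('k)"
proof -
 obtain d s p i where hm: "hmodel (%j. {m : LL. length m = j}) (bt :: 'g list => ('g list, 'k) fv) (%j. {j} \<times> {..<d j :: nat}) s p i"
  by (rule list_model) (rule that)
 define LC where "LC = {(j, k). k < d j}"
 have LC: "{c : LC. fst c = j} = {j} \<times> {..<d j}" for j by (auto simp: LC_def)
 interpret hw: hmodel_words LL length LC fst bt s p i by (unfold hmodel_words_def LC) (rule hm)
 have dw: "hw.dw w = d0 w" for w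
  by (induction w) (simp_all add: cns_unit cns_unit2)
 have "hw.dw = d0" using dw by blast
 hence h0: "hmodel (WW LL length) d0 (WW LC fst) hw.sw (tens p) (tens i)" using hw.hmodel_words by simp
 have kB: "w : WW LL length j ==> keys (dB w :: ('g list list, 'k) fv) <= {v : WW LL length (j - 1). Suc (hW v) = j}" for w j
  using keys_dB[of w] unfolding okW_WW[symmetric] by auto
 obtain d' s' p' i' where hB: "hmodel (WW LL length) (dB :: _ => (_, 'k) fv) (%j. {j} \<times> {..<d' j :: nat}) s' p' i'"
 proof (rule hmodel_exists[where V = "WW LL length" and f = dB and h = "wd length"])
  show "finite (WW LL length j)" for j by (rule finite_WW[OF finite_LL])
  show "keys (dB b :: ('g list list, 'k) fv) <= WW LL length j" if "b : WW LL length (Suc j)" for b j using kB[OF that] by auto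
  show "dB b = (0 :: ('g list list, 'k) fv)" if "b : WW LL length 0" for b
   using that length_le_wd[of b length] by (simp add: WW_def)
  show "lin dB (dB b) = (0 :: ('g list list, 'k) fv)" if "b : WW LL length j" for b j
   by (rule dB_dB) (use that in \<open>simp add: okW_WW[symmetric]\<close>)
 qed (auto simp: WW_def intro: that)
 have BF: "BF j = shf (Pow {1..n}) card (WW LL length) j" for j
  unfolding okW_WW[symmetric] by (auto simp: BF_def shf_def okF_def okX_def hF_def)
 have degF: "lin (deg_part dF fD) x = lin (ext dB) (x :: (_, 'k) fv)" if x: "keys x <= BF j" for x j
 proof (rule lin_cong)
  fix b assume b: "b : keys x"
  obtain w E where bb: "b = (w, E)" by (cases b)
  have "okW w" "E <= {1..n}" using b x by (auto simp: bb BF_def okF_def okX_def)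
  thus "deg_part dF fD b = (ext dB b :: (_, 'k) fv)" using deg_part_fD by (simp add: bb ext_def)
 qed
 have hF: "hmodel (shf (Pow {1..n}) card (WW LL length)) (ext (dB :: _ => (_, 'k) fv)) (shf (Pow {1..n}) card (%j. {j} \<times> {..<d' j})) (ext s') (ext p') (ext i')"
  by (rule hmodel_copies[OF hB]) simp
 have rj: "r j = card (shf (Pow {1..n}) card (%j. {j} \<times> {..<d' j}) j)" for j
 proof -
  have e1: "{x :: (_, 'k) fv. keys x <= BF j & lin (deg_part dF fD) x = 0} = {x. keys x <= BF j & lin (ext dB) x = 0}"
   using degF[of _ j] by auto
  have e2: "lin (deg_part dF fD) ` {y :: (_, 'k) fv. keys y <= BF (Suc j)} = lin (ext dB) ` {y. keys y <= BF (Suc j)}"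
   by (rule image_cong) (use degF[of _ "Suc j"] in auto)
  show ?thesis unfolding r e1 e2 unfolding BF by (rule hmodel.dim_homology[OF hF])
 qed
 have qj: "q j = d j" if "j ~= 0" for j
 proof -
  have "{l. set l <= GL & length l = j} = {m : LL. length m = j}"
   "{l. set l <= GL & length l = Suc j} = {m : LL. length m = Suc j}" using that by auto
  thus ?thesis using hmodel.dim_homology[OF hm, of j] unfolding q by simp
 qed
 \<comment> \<open>Bar letters are nonempty lists, so the model has nothing in degree 0. This
   matches the exception made for j = 0 in the Golod denominator.\<close>
 have d00: "d 0 = 0"
 proof -
  have False if k: "k < d 0" for k
  proof -
   have c: "(0, k) : {0} \<times> {..<d 0}" using k by simp
   have "keys (i (0, k)) <= {m : LL. length m = 0}" by (rule hmodel.iV[OF hm c])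
   moreover have "{m : LL. length m = 0} = {}" by auto
   ultimately have "keys (i (0, k)) <= {}" by (simp only:)
   hence "i (0, k) = 0" by simp
   hence "unit_vec (0, k) = (0 :: nat \<times> nat \<Rightarrow>\<^sub>0 'k)" using hmodel.p_i[OF hm c] by simp
   hence "lkp (unit_vec (0, k) :: nat \<times> nat \<Rightarrow>\<^sub>0 'k) (0, k) = 0" by simp
   thus False by (simp add: lookup_single)
  qed
  thus ?thesis by blast
 qed
 have qH: "(%j. if j = 0 then 0 else of_nat (q j)) = (%j. of_nat (card {c : LC. fst c = j}) :: rat)"
  unfolding LC by (rule ext) (simp add: qj d00)
 let ?D = "1 - fps_X * Abs_fps (%j. of_nat (card {c : LC. fst c = j})) :: rat fps"
  and ?G = "Abs_fps (%j. of_nat (card (WW LC fst j))) :: rat fps" and ?B = "Abs_fps (%j. of_nat (d' j)) :: rat fps"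
 have DG: "?D * ?G = 1" by (rule card_WW_fps) (simp add: LC)
 have "fps_nth ?D 0 = 1" by simp
 hence D0: "fps_nth ?D 0 ~= 0" by simp
 have "(1 + fps_X) ^ n / ?D = (1 + fps_X) ^ n * inverse ?D" by (rule fps_divide_unit[OF D0])
 also have "inverse ?D = ?G" using DG by (rule fps_inverse_unique)
 finally have quot: "(1 + fps_X) ^ n / ?D = (1 + fps_X) ^ n * ?G" .
 have res: "(Abs_fps (%j. of_nat (r j)) :: rat fps) = (1 + fps_X) ^ n * ?B"
  unfolding rj using card_copies_fps[of "%j. {j} \<times> {..<d' j}" n] by simp
 have "(1 + fps_X :: rat fps) ^ n ~= 0"
 proof -
  have 1: "fps_nth ((1 + fps_X :: rat fps) ^ n) 0 = 1" by (simp only: one_plus_X_power_nth) simp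
  show ?thesis
  proof
   assume "(1 + fps_X :: rat fps) ^ n = 0"
   thus False using 1 by (simp only: fps_zero_nth zero_neq_one)
  qed
 qed
 hence "(Abs_fps (%j. of_nat (r j)) :: rat fps) = (1 + fps_X) ^ n / ?D \<longleftrightarrow> ?B = ?G"
  unfolding quot res mult_cancel_left by blast
 also have "... \<longleftrightarrow> (\<forall>j. d' j = card (WW LC fst j))" by (simp add: fps_eq_iff)
 also have "... \<longleftrightarrow> (\<forall>j. pm.dim {x :: (_, 'k) fv. keys x <= WW LL length j & lin dB x = 0} = pm.dim {x :: (_, 'k) fv. keys x <= WW LL length j & lin d0 x = 0})"
 proof (rule lift_kernel_dims)
  have "lin dB x = 0 & lin d0 x = 0" if "keys x <= WW LL length 0" for x :: "(_, 'k) fv"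
  proof -
   have "w = []" if "w : WW LL length 0" for w using that length_le_wd[of w length] by (simp add: WW_def)
   hence "lin dB x = lin (%w. 0) x" "lin d0 x = lin (%w. 0) x"
    by (intro lin_cong; use \<open>keys x <= _\<close> in force)+
   thus ?thesis by simp
  qed
  thus "pm.dim {x :: (_, 'k) fv. keys x <= WW LL length 0 & lin dB x = 0} = pm.dim {x :: (_, 'k) fv. keys x <= WW LL length 0 & lin d0 x = 0}"
   by (metis (mono_tags, lifting))
  show "pm.dim {x :: (_, 'k) fv. keys x <= WW LL length j & lin dB x = 0} = pm.dim (lin dB ` {y :: (_, 'k) fv. keys y <= WW LL length (Suc j)}) + d' j" for j
   using hmodel.dim_kernel[OF hB, of j] by simp
  show "pm.dim {x :: (_, 'k) fv. keys x <= WW LL length j & lin d0 x = 0} = pm.dim (lin d0 ` {y :: (_, 'k) fv. keys y <= WW LL length (Suc j)}) + card (WW LC fst j)" for j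
   by (rule hmodel.dim_kernel[OF h0])
  show "card (WW LL length (Suc j)) = pm.dim (lin dB ` {y :: (_, 'k) fv. keys y <= WW LL length (Suc j)}) + pm.dim {x :: (_, 'k) fv. keys x <= WW LL length (Suc j) & lin dB x = 0}" for j
   by (rule hmodel.card_V_Suc[OF hB])
  show "card (WW LL length (Suc j)) = pm.dim (lin d0 ` {y :: (_, 'k) fv. keys y <= WW LL length (Suc j)}) + pm.dim {x :: (_, 'k) fv. keys x <= WW LL length (Suc j) & lin d0 x = 0}" for j
   by (rule hmodel.card_V_Suc[OF h0])
 qed
 also have "... \<longleftrightarrow> word_lifting TYPE('k)"
  unfolding word_lifting_def okW_WW
 proof (rule all_cong1)
  fix j
  show "(pm.dim {x :: (_, 'k) fv. keys x <= WW LL length j & lin dB x = 0} = pm.dim {x :: (_, 'k) fv. keys x <= WW LL length j & lin d0 x = 0}) \<longleftrightarrow>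
   (\<forall>q x. keys x <= WW LL length j \<inter> {w. length w = q} --> lin d0 (x :: (_, 'k) fv) = 0 -->
    (EX y. keys y <= WW LL length j \<inter> {w. length w < q} & lin dB (x + y) = 0))"
  proof (rule filtered_dims[where J = j])
   show "finite (WW LL length j)" by (rule finite_WW[OF finite_LL])
   show "length w <= j" if "w : WW LL length j" for w using that length_le_wd[of w length] by (simp add: WW_def)
   show "length v = length w" if "w : WW LL length j" "v : keys (d0 w :: (_, 'k) fv)" for w v
    by (rule keys_d0[OF _ that(2)]) (use that(1) in \<open>simp add: okW_WW[symmetric]\<close>)
   show "length v < length w" if "w : WW LL length j" "v : keys (dB w - d0 w :: (_, 'k) fv)" for w v
    using keys_dB_d0[OF that(2)] by simp
  qed
 qed
 finally show ?thesis unfolding qH .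
qed

end

section \<open>Generators of one-orbit ideals, and direct criteria for and against lifting\<close>

section \<open>Symmetric monomial ideals with one orbit of generators\<close>

definition ups :: "nat => expo set => expo set" where
 "ups n E = {m : exponents n. \<exists>e\<in>E. mle e m}"

lemma ups_up: "m : ups n E ==> mle m m' ==> m' : exponents n ==> m' : ups n E"
 unfolding ups_def using mle_trans by blast

lemma ups_self: "e : E ==> E <= exponents n ==> e : ups n E"
 unfolding ups_def by (auto intro!: bexI[of _ e])

lemma keys_mult_ups:
 fixes p q :: "'k::field mpol"
 assumes "keys p <= ups n E" "keys q <= exponents n"
 shows "keys (p * q) <= ups n E"
proof
 fix m assume "m : keys (p * q)"
 then obtain a b where ab: "a : keys p" "b : keys q" "m = a + b" using keys_mult[of p q] by blast
 have a: "a : ups n E" and b: "b : exponents n" using ab assms by blast+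
 have "a : exponents n" using a by (simp add: ups_def)
 hence "a + b : exponents n" using b by (rule exponents_add)
 thus "m : ups n E" using ups_up[OF a, of "a + b"] ab(3) by simp
qed

lemma ideal_ups: "ideal {p :: 'k::field mpol. keys p <= ups n E} (mpoly_ring n)"
proof -
 interpret S: cring "mpoly_ring n :: 'k mpol ring" by (rule cring_mpoly_ring)
 let ?I = "{p :: 'k mpol. keys p <= ups n E}"
 have sub: "?I <= carrier (mpoly_ring n)" by (auto simp: mpoly_ring_sel ups_def)
 show ?thesis
 proof (rule idealI[OF S.ring_axioms])
  show "subgroup ?I (add_monoid (mpoly_ring n))"
  proof (rule S.add.subgroupI)
   show "?I <= carrier (mpoly_ring n)" by (rule sub)
   show "?I ~= {}" by (auto intro!: exI[of _ 0])
   fix a assume a: "a : ?I"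
   have "\<ominus>\<^bsub>mpoly_ring n\<^esub> a = - a"
    by (rule S.minus_equality) (use a sub in \<open>auto simp: mpoly_ring_sel keys_def\<close>)
   thus "\<ominus>\<^bsub>mpoly_ring n\<^esub> a : ?I" using a by (simp add: keys_def)
  next
   fix a b :: "'k mpol" assume "a : ?I" "b : ?I"
   thus "a \<oplus>\<^bsub>mpoly_ring n\<^esub> b : ?I" by (simp add: mpoly_ring_sel keys_add_subset)
  qed
 next
  fix a x :: "'k mpol" assume "a : ?I" "x : carrier (mpoly_ring n)"
  thus "x \<otimes>\<^bsub>mpoly_ring n\<^esub> a : ?I" "a \<otimes>\<^bsub>mpoly_ring n\<^esub> x : ?I"
   using keys_mult_ups[of a n E x] by (simp_all add: mpoly_ring_sel mult.commute[of x])
 qed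
qed

lemma genideal_monomials:
 assumes E: "E <= exponents n"
 shows "genideal (mpoly_ring n) (monom_of ` E) = {p :: 'k::field mpol. keys p <= ups n E}"
proof
 interpret S: cring "mpoly_ring n :: 'k mpol ring" by (rule cring_mpoly_ring)
 have EC: "(monom_of ` E :: 'k mpol set) <= carrier (mpoly_ring n)"
  using E by (auto simp: monom_of_def mpoly_ring_sel)
 show "genideal (mpoly_ring n) (monom_of ` E) <= {p :: 'k mpol. keys p <= ups n E}"
  by (rule S.genideal_minimal[OF ideal_ups]) (use ups_self E in \<open>auto simp: monom_of_def\<close>)
 interpret G: ideal "genideal (mpoly_ring n) (monom_of ` E :: 'k mpol set)" "mpoly_ring n" by (rule S.genideal_ideal[OF EC])
 show "{p :: 'k mpol. keys p <= ups n E} <= genideal (mpoly_ring n) (monom_of ` E)"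
 proof
  fix p :: "'k mpol" assume "p : {p. keys p <= ups n E}"
  hence p: "keys p <= ups n E" by simp
  have single: "sgl m (lkp p m) : genideal (mpoly_ring n) (monom_of ` E)" if mk: "m : keys p" for m
  proof -
   obtain e where e: "e : E" "mle e m" "m : exponents n" using p mk by (auto simp: ups_def)
   have "monom_of e : genideal (mpoly_ring n) (monom_of ` E :: 'k mpol set)"
    using S.genideal_self[OF EC] e(1) by blast
   moreover have "sgl (m - e) (lkp p m) : carrier (mpoly_ring n)"
    using exponents_diff[OF e(3), of e] by (simp add: mpoly_ring_sel)
   ultimately have "monom_of e \<otimes>\<^bsub>mpoly_ring n\<^esub> sgl (m - e) (lkp p m) : genideal (mpoly_ring n) (monom_of ` E)"
    by (rule G.I_r_closed)
   thus ?thesis using mle_add_diff[OF e(2)] by (simp add: mpoly_ring_sel monom_of_def mult_single)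
  qed
  have "(\<Sum>m\<in>Q. sgl m (lkp p m)) : genideal (mpoly_ring n) (monom_of ` E)" if "finite Q" "Q <= keys p" for Q
   using that
  proof (induction Q rule: finite_induct)
   case empty
   show ?case using G.zero_closed by (simp add: mpoly_ring_sel)
  next
   case (insert m Q)
   hence "sgl m (lkp p m) \<oplus>\<^bsub>mpoly_ring n\<^esub> (\<Sum>m\<in>Q. sgl m (lkp p m)) : genideal (mpoly_ring n) (monom_of ` E)"
    using single by (intro G.a_closed) auto
   thus ?case using insert by (simp add: mpoly_ring_sel)
  qed
  from this[OF finite_keys subset_refl] show "p : genideal (mpoly_ring n) (monom_of ` E)"
   by (simp flip: poly_sum_single)
 qed
qed

definition perm_exp :: "(nat => nat) => expo => expo" where
 "perm_exp \<pi> m = Poly_Mapping.map_key \<pi> m"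

lemma lookup_perm_exp: "\<pi> permutes Q ==> lkp (perm_exp \<pi> m) i = lkp m (\<pi> i)"
 by (simp add: perm_exp_def map_key.rep_eq permutes_inj)

lemma perm_exp_exponents: "\<pi> permutes {1..n} ==> perm_exp \<pi> m : exponents n \<longleftrightarrow> m : exponents n"
proof -
 assume p: "\<pi> permutes {1..n}"
 have a: "(\<forall>i. lkp m (\<pi> i) ~= 0 --> i : {1..n}) \<longleftrightarrow> (\<forall>i. lkp m i ~= 0 --> i : {1..n})"
  using permutes_in_image[OF p] permutes_surj[OF p] by (metis surjD)
 show ?thesis using a by (simp add: exponents_def subset_iff in_keys_iff lookup_perm_exp[OF p])
qed

lemma perm_exp_inv: "\<pi> permutes Q ==> perm_exp \<pi> (perm_exp (inv_into UNIV \<pi>) m) = m"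
proof -
 assume p: "\<pi> permutes Q"
 show ?thesis by (rule poly_mapping_eqI)
  (simp add: lookup_perm_exp[OF p] lookup_perm_exp[OF permutes_inv[OF p]] permutes_inverses[OF p])
qed

lemma perm_exp_inv': "\<pi> permutes Q ==> perm_exp (inv_into UNIV \<pi>) (perm_exp \<pi> m) = m"
proof -
 assume p: "\<pi> permutes Q"
 show ?thesis by (rule poly_mapping_eqI)
  (simp add: lookup_perm_exp[OF p] lookup_perm_exp[OF permutes_inv[OF p]] permutes_inverses[OF p])
qed

lemma mle_perm_exp: "\<pi> permutes Q ==> mle a b ==> mle (perm_exp \<pi> a) (perm_exp \<pi> b)"
 by (simp add: mle_def lookup_perm_exp)

lemma permute_vars_lookup: "\<pi> permutes Q ==> lkp (permute_vars \<pi> p) m = lkp (p :: 'k::field mpol) (perm_exp \<pi> m)"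
proof -
 assume p: "\<pi> permutes Q"
 have "inj (Poly_Mapping.map_key \<pi> :: expo => _)"
  by (rule inj_on_inverseI[of _ "perm_exp (inv_into UNIV \<pi>)"]) (use perm_exp_inv'[OF p] in \<open>simp add: perm_exp_def[of \<pi>]\<close>)
 thus ?thesis by (simp add: permute_vars_def map_key.rep_eq perm_exp_def)
qed

text \<open>The list of exponents is sorted in descending order. The shifts by one come from list
  positions starting at 0 and variables at 1.\<close>

lemma sort_exponent:
 fixes f :: "nat => nat"
 obtains \<pi> where "\<pi> permutes {1..n}" "!!i j. 1 <= i ==> i <= j ==> j <= n ==> f (\<pi> j) <= f (\<pi> i)"
proof -
 let ?xs = "map f [1..<Suc n]"
 let ?ys = "rev (sort ?xs)"
 have "mset ?ys = mset ?xs" by simp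
 then obtain p where p: "p permutes {..<length ?xs}" "permute_list p ?xs = ?ys" by (rule mset_eq_permutation)
 have len: "length ?xs = n" by simp
 have pn: "p permutes {..<n}" using p(1) by (simp only: len)
 have "bij_betw p {..<n} {..<n}" using pn by (rule permutes_imp_bij)
 moreover have "bij_betw (%i. i - 1) {1..n} {..<n}"
  by (rule bij_betw_byWitness[of _ Suc]) auto
 moreover have "bij_betw Suc {..<n} {1..n}"
  by (rule bij_betw_byWitness[of _ "%i. i - 1"]) auto
 ultimately have "bij_betw (Suc \<circ> (p \<circ> (%i. i - 1))) {1..n} {1..n}" by (meson bij_betw_trans)
 moreover have "bij_betw (%i. if i : {1..n} then Suc (p (i - 1)) else i) {1..n} {1..n} \<longleftrightarrow> bij_betw (Suc \<circ> (p \<circ> (%i. i - 1))) {1..n} {1..n}"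
  by (rule bij_betw_cong) simp
 ultimately have pi: "(%i. if i : {1..n} then Suc (p (i - 1)) else i) permutes {1..n}"
  by (intro bij_imp_permutes) auto
 have val: "f (Suc (p i)) = ?ys ! i" if "i < n" for i
 proof -
  have "p i < n" using permutes_in_image[OF pn, of i] that by simp
  hence "?xs ! (p i) = f (Suc (p i))" by (simp del: upt_Suc)
  moreover have "permute_list p ?xs ! i = ?xs ! (p i)" by (rule permute_list_nth[OF p(1)]) (use that in simp)
  ultimately show ?thesis using p(2) by simp
 qed
 have mono: "f (Suc (p j)) <= f (Suc (p i))" if "i <= j" "j < n" for i j
 proof -
  have "sort ?xs ! (n - Suc j) <= sort ?xs ! (n - Suc i)"
   by (rule sorted_nth_mono) (use that in \<open>simp_all del: upt_Suc\<close>)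
  thus ?thesis using val[of i] val[of j] that by (simp add: rev_nth del: upt_Suc)
 qed
 show ?thesis
 proof (rule that[OF pi])
  fix i j assume "1 <= i" "i <= j" "j <= n"
  thus "f (if j : {1..n} then Suc (p (j - 1)) else j) <= f (if i : {1..n} then Suc (p (i - 1)) else i)"
   using mono[of "i - 1" "j - 1"] by simp
 qed
qed

definition orbit :: "nat => expo => expo set" where
 "orbit n lam = {perm_exp \<pi> lam | \<pi>. \<pi> permutes {1..n}}"

lemma finite_orbit: "finite (orbit n lam)"
proof -
 have "orbit n lam = (%\<pi>. perm_exp \<pi> lam) ` {\<pi>. \<pi> permutes {1..n}}" by (auto simp: orbit_def)
 thus ?thesis by (simp add: finite_permutations)
qed

text \<open>Symmetry of the ideal makes the sorted rearrangement of a minimal generator again a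
  minimal generator. Being a partition it lies in \<open>Lambda n I\<close>, hence equals lam, so
  every generator is in the orbit of lam.\<close>

lemma one_orbit_ideal:
 fixes I :: "'k::field mpol set"
 assumes sym: "symmetric_monomial_ideal n I" and Lam: "Lambda n I = {lam}"
 shows "lam : partitions n" "I = {p. keys p <= ups n (orbit n lam)}"
proof -
 have "lam : Lambda n I" using Lam by simp
 then obtain E where lp: "lam : partitions n" and E: "min_monomial_gens n I E" "lam : E" by (auto simp: Lambda_def)
 show "lam : partitions n" by (rule lp)
 have EE: "E <= exponents n" "genideal (mpoly_ring n) (monom_of ` E) = I"
  and Emin: "!!E'. E' \<subset> E ==> genideal (mpoly_ring n) (monom_of ` E') ~= I" using E(1) by (auto simp: min_monomial_gens_def)
 have IU: "I = {p. keys p <= ups n E}" using genideal_monomials[OF EE(1), where 'k = 'k] EE(2) by simp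
 have inv: "m : ups n E" if p: "\<pi> permutes {1..n}" and m: "perm_exp \<pi> m : ups n E" for \<pi> m
 proof -
  have "monom_of (perm_exp \<pi> m) : I" using m by (simp add: IU monom_of_def)
  moreover have "permute_vars \<pi> ` I = I" using sym p by (simp add: symmetric_monomial_ideal_def)
  ultimately have "permute_vars \<pi> (monom_of (perm_exp \<pi> m)) : I" by blast
  hence k: "keys (permute_vars \<pi> (monom_of (perm_exp \<pi> m) :: 'k mpol)) <= ups n E" by (simp add: IU)
  have "lkp (permute_vars \<pi> (monom_of (perm_exp \<pi> m) :: 'k mpol)) m = 1"
   by (simp add: permute_vars_lookup[OF p] monom_of_def)
  hence "m : keys (permute_vars \<pi> (monom_of (perm_exp \<pi> m) :: 'k mpol))" by (simp add: in_keys_iff)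
  thus ?thesis using k by blast
 qed
 have inv': "perm_exp \<pi> m : ups n E" if p: "\<pi> permutes {1..n}" and m: "m : ups n E" for \<pi> m
  by (rule inv[OF permutes_inv[OF p]]) (use m perm_exp_inv'[OF p] in simp)
 have EU: "e : ups n E" if "e : E" for e by (rule ups_self[OF that EE(1)])
 have min: "e' = e" if e: "e : E" and e': "e' : ups n E" "mle e' e" for e e'
 proof -
  obtain e2 where e2: "e2 : E" "mle e2 e'" using e'(1) by (auto simp: ups_def)
  have e2e: "mle e2 e" using e2(2) e'(2) by (rule mle_trans)
  have "e2 = e"
  proof (rule ccontr)
   assume ne: "e2 ~= e"
   have "ups n (E - {e}) = ups n E"
   proof
    show "ups n (E - {e}) <= ups n E" by (auto simp: ups_def)
    show "ups n E <= ups n (E - {e})"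
    proof
     fix m assume "m : ups n E"
     then obtain c where c: "c : E" "mle c m" "m : exponents n" by (auto simp: ups_def)
     show "m : ups n (E - {e})"
     proof (cases "c = e")
     case True
     hence "mle e2 m" using mle_trans[OF e2e] c(2) by simp
     thus ?thesis using e2(1) ne c(3) by (auto simp: ups_def)
     qed (use c in \<open>auto simp: ups_def\<close>)
    qed
   qed
   moreover have "E - {e} <= exponents n" using EE(1) by blast
   ultimately have "genideal (mpoly_ring n) (monom_of ` (E - {e})) = I"
    using genideal_monomials[of "E - {e}" n, where 'k = 'k] IU by simp
   thus False using Emin[of "E - {e}"] e by blast
  qed
  thus "e' = e" using e2(2) e'(2) mle_antisym by simp
 qed
 have orb: "e : orbit n lam" if e: "e : E" for e
 proof -
  obtain \<pi> where p: "\<pi> permutes {1..n}" "!!i j. 1 <= i ==> i <= j ==> j <= n ==> lkp e (\<pi> j) <= lkp e (\<pi> i)"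
   by (rule sort_exponent[of n "lkp e"]) (rule that)
  let ?m = "perm_exp \<pi> e"
  have mU: "?m : ups n E" by (rule inv'[OF p(1) EU[OF e]])
  then obtain e2 where e2: "e2 : E" "mle e2 ?m" by (auto simp: ups_def)
  have "perm_exp (inv_into UNIV \<pi>) e2 = e"
  proof (rule min[OF e])
   show "perm_exp (inv_into UNIV \<pi>) e2 : ups n E" by (rule inv'[OF permutes_inv[OF p(1)] EU[OF e2(1)]])
   show "mle (perm_exp (inv_into UNIV \<pi>) e2) e"
    using mle_perm_exp[OF permutes_inv[OF p(1)] e2(2)] by (simp add: perm_exp_inv'[OF p(1)])
  qed
  hence m2: "?m = e2" using perm_exp_inv[OF p(1), of e2] by simp
  have "?m : partitions n" using p mU by (auto simp: partitions_def ups_def lookup_perm_exp[OF p(1)])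
  hence "?m : Lambda n I" using E(1) e2(1) m2 by (auto simp: Lambda_def)
  hence "?m = lam" using Lam by simp
  hence "perm_exp (inv_into UNIV \<pi>) lam = e" using perm_exp_inv'[OF p(1), of e] by simp
  thus ?thesis using permutes_inv[OF p(1)] unfolding orbit_def by blast
 qed
 have "ups n (orbit n lam) = ups n E"
 proof
  show "ups n E <= ups n (orbit n lam)" using orb by (auto simp: ups_def)
  show "ups n (orbit n lam) <= ups n E"
  proof
   fix m assume "m : ups n (orbit n lam)"
   then obtain \<pi> where p: "\<pi> permutes {1..n}" "mle (perm_exp \<pi> lam) m" "m : exponents n"
    by (auto simp: ups_def orbit_def)
   show "m : ups n E" by (rule ups_up[OF inv'[OF p(1) EU[OF E(2)]] p(2,3)])
  qed
 qed
 thus "I = {p. keys p <= ups n (orbit n lam)}" using IU by simp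
qed

text \<open>Each monomial occurring in an element of the product ideal is a product of two
  nonconstant monomials, by induction on the formation of the product ideal; this is applied to the
  monomial of the generator.\<close>

lemma degree_two_generators:
 fixes I :: "'k::field mpol set"
 assumes I: "I = {p. keys p <= ups n E}" "E <= exponents n"
  and sq: "I <= ideal_prod (mpoly_ring n) (irrelevant_ideal n) (irrelevant_ideal n)" and e: "e : E"
 obtains k k' where "k ~= 0" "k' ~= 0" "e = k + k'"
proof -
 let ?S = "mpoly_ring n :: 'k mpol ring"
 let ?Q = "{m :: nat \<Rightarrow>\<^sub>0 nat. EX k k'. k ~= 0 & k' ~= 0 & m = k + k'}"
 have "{monom_of (sgl i 1) | i. i : {1..n}} = (monom_of ` (%i. sgl i 1) ` {1..n} :: 'k mpol set)" by auto
 moreover have "(%i. sgl i 1) ` {1..n} <= exponents n" by (auto simp: exponents_def)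
 ultimately have irr: "(irrelevant_ideal n :: 'k mpol set) = {p. keys p <= ups n ((%i. sgl i 1) ` {1..n})}"
  unfolding irrelevant_ideal_def using genideal_monomials[where 'k = 'k] by metis
 have nz: "m ~= 0" if mU: "m : ups n ((%i. sgl i 1) ` {1..n})" for m
 proof
  assume "m = 0"
  then obtain i where "mle (sgl i 1) 0" using mU by (auto simp: ups_def)
  hence "lkp (sgl i (1 :: nat)) i <= lkp 0 i" unfolding mle_def by blast
  thus False by simp
 qed
 have "keys p <= ?Q" if "p : ideal_prod ?S (irrelevant_ideal n) (irrelevant_ideal n)" for p
  using that
 proof (induction rule: ideal_prod.induct)
  case (prod i j)
  show ?case
  proof
   fix m assume "m : keys (i \<otimes>\<^bsub>?S\<^esub> j)"
   then obtain a b where ab: "a : keys i" "b : keys j" "m = a + b" using keys_mult[of i j] by (auto simp: mpoly_ring_sel)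
   have "a ~= 0" "b ~= 0" using ab(1,2) prod nz by (auto simp: irr)
   thus "m : ?Q" using ab(3) by blast
  qed
 next
  case (sum s1 s2)
  show ?case unfolding mpoly_ring_sel by (rule keys_add_subset[OF sum.IH])
 qed
 moreover have "monom_of e : I" using ups_self[OF e I(2)] by (simp add: I(1) monom_of_def)
 ultimately have "keys (monom_of e :: 'k mpol) <= ?Q" using sq by blast
 thus ?thesis using that by (auto simp: monom_of_def)
qed

section \<open>The two extreme cases\<close>

context bar_min
begin

text \<open>Merging never preserves the multidegree here, so the two differentials agree and the
  zero correction lifts every cycle.\<close>

lemma word_lifting_no_coprime:
 assumes "!!l m. l : LL ==> m : LL ==> ~ coprm l m"
 shows "word_lifting TYPE('k::field)"
proof -
 have eq: "dB w = (d0 w :: ('g list list, 'k) fv)" if "okW w" for w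
  using that
 proof (induction w)
  case (Cons m w)
  have ok: "okW w" "m : LL" "!!p. p : set w ==> p : LL" using Cons.prems by (auto simp: okW_def)
  have "mg m w = (0 :: ('g list list, 'k) fv)"
  proof (cases w)
   case (Cons p v)
   hence "~ coprm m p" using assms[OF ok(2)] ok(3) by simp
   thus ?thesis by (simp add: mg_def Cons)
  qed (simp add: mg_def)
  thus ?case using Cons.IH[OF ok(1)] by simp
 qed simp
 show ?thesis unfolding word_lifting_def
 proof (intro allI impI)
  fix j q and x :: "('g list list, 'k) fv"
  assume x: "keys x <= {w. okW w & hW w = j} \<inter> {w. length w = q}" "lin d0 x = 0"
  have "lin dB x = lin d0 x" by (rule lin_cong) (use x(1) eq in blast)
  thus "EX y. keys y <= {w. okW w & hW w = j} \<inter> {w. length w < q} & lin dB (x + y) = 0"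
   using x(2) by (intro exI[of _ 0]) simp
 qed
qed

lemma psi_nonzero:
 "distinct (map am l) ==> am ` set l \<inter> E = {} ==> EX c. c ~= 0 & psi am l E = (sgl (am ` set l \<union> E) c :: (nat set, 'k::field) fv)"
proof (induction l)
 case (Cons u l)
 then obtain c where c: "c ~= 0" "psi am l E = (sgl (am ` set l \<union> E) c :: (nat set, 'k) fv)" by auto
 have e: "psi am l E = scl c (unit_vec (am ` set l \<union> E))" using c(2) by simp
 have n: "am u ~: am ` set l \<union> E" using Cons.prems by auto
 have "psi am (u # l) E = scl c (scl (ksign (am u) (am ` set l \<union> E)) (unit_vec (insert (am u) (am ` set l \<union> E))))"
  using n by (simp add: e eps_def del: scl_single)
 moreover have "ksign (am u) (am ` set l \<union> E) ~= (0 :: 'k)" by (simp add: ksign_def)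
 ultimately show ?case using c(1)
  by (intro exI[of _ "c * ksign (am u) (am ` set l \<union> E)"]) simp
qed (intro exI[of _ 1], simp)

text \<open>The word [l1, l2] is a \<open>d0\<close>-cycle, and \<open>dB\<close> sends it, up to
  sign, to the one-letter word of the product l1 @ l2. The functional P maps one-letter words of
  that multidegree to the exterior algebra by means of the labels \<open>am\<close>, and its
  coefficient at the set T of all labels sees this product. A correction consists of one-letter
  words with one generator more than T has elements; their labels repeat, so P gives nothing on
  their boundaries.\<close>

lemma no_word_lifting:
 fixes am :: "'g => nat"
 assumes l: "l1 : LL" "l2 : LL" and bt: "bt l1 = (0 :: ('g list, 'k::field) fv)" "bt l2 = (0 :: ('g list, 'k) fv)"
  and co: "coprm l1 l2" and dist: "distinct (map am (l1 @ l2))"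
  and am: "!!u. u : GL ==> mle (gs u) (lc (l1 @ l2)) ==> am u : am ` set (l1 @ l2)"
  and tight: "!!m. set m <= GL ==> mle (lc m) (lc (l1 @ l2)) ==> am ` set m = am ` set (l1 @ l2) ==> lc m = lc (l1 @ l2)"
 shows "~ word_lifting TYPE('k)"
proof
 assume lift: "word_lifting TYPE('k)"
 let ?al = "lc (l1 @ l2)" and ?T = "am ` set (l1 @ l2)" and ?N = "length (l1 @ l2)"
 define P where "P w = (case w of [m] => if lc m = ?al then psi am m {} else 0 | _ => (0 :: (nat set, 'k) fv))" for w
 let ?x = "unit_vec [l1, l2] :: ('g list list, 'k) fv"
 have cardT: "card ?T = ?N" using distinct_card[OF dist] by (simp only: set_map length_map)
 have hx: "okW [l1, l2]" "hW [l1, l2] = Suc (Suc ?N)" using l by (auto simp: okW_def hW_def)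
 have "lin d0 ?x = 0" using bt by simp
 moreover have "keys ?x <= {w. okW w & hW w = Suc (Suc ?N)} \<inter> {w. length w = 2}" using hx by simp
 ultimately obtain y where y: "keys y <= {w. okW w & hW w = Suc (Suc ?N)} \<inter> {w. length w < 2}" "lin dB (?x + y) = 0"
  using lift unfolding word_lifting_def by blast
 have Px: "lin P (lin dB ?x) = - scl (sg l1) (psi am (l1 @ l2) {})"
  using bt co by (simp add: mg_def P_def)
 have Py: "lkp (lin P (lin dB y)) ?T = 0"
 proof -
  have "lkp (lin P (dB w)) ?T = 0" if w: "w : keys y" for w
  proof -
   have ww: "okW w" "hW w = Suc (Suc ?N)" "length w < 2" using w y(1) by auto
   \<comment> \<open>The degree is positive and there are fewer than two letters, which leaves a
     single letter made of one more generator than l1 @ l2 has.\<close>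
   then obtain m where m: "w = [m]" by (cases w) (auto simp: hW_def)
   have mG: "set m <= GL" "length m = Suc ?N" using ww by (auto simp: m okW_def hW_def)
   have e: "lin P (dB w) = - lin (%x. P [x]) (bt m)" by (simp add: m mg_def lin_lin)
   show ?thesis
   proof (cases "lc m = ?al")
    case False
    have "lin (%x. P [x]) (bt m) = lin (%x. 0) (bt m :: ('g list, 'k) fv)"
     by (rule lin_cong) (use False in \<open>auto simp: deg_part_def keys_restr P_def\<close>)
    thus ?thesis by (simp add: e)
   next
    case True
    have "psi am m {} = (0 :: (nat set, 'k) fv)"
    proof (rule ccontr)
     assume "psi am m {} ~= (0 :: (nat set, 'k) fv)"
     then obtain E where "E : keys (psi am m {} :: (nat set, 'k) fv)" by (metis all_not_in_conv keys_eq_empty)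
     from keys_psi[OF this] have d: "distinct (map am m)" by simp
     have "am ` set m <= ?T"
     proof
     fix i assume "i : am ` set m"
     then obtain u where u: "u : set m" "i = am u" by auto
     have "mle (gs u) ?al" using mle_gs_lc[OF u(1)] True by simp
     thus "i : ?T" using am[of u] u mG(1) by auto
     qed
     hence "card (am ` set m) <= card ?T" by (rule card_mono[rotated]) simp
     thus False using distinct_card[OF d] cardT mG(2) by (simp only: set_map length_map)
    qed
    moreover have "lin bK (psi am m {}) = lin (%x. psi am x {}) (bd m) + scl (sg m) (lin (psi am m) (bK {}) :: (nat set, 'k) fv)"
     by (rule psi_chain) simp
    ultimately have z: "lin (%x. psi am x {}) (bd m) = (0 :: (nat set, 'k) fv)" by (simp add: bK_def)
    have e2: "lin (%x. P [x]) (bt m) = lin (%x. lin (%x. P [x]) (if x : {b'. lc b' = lc m} then unit_vec x else 0)) (bd m)"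
     by (simp only: deg_part_def restr_def lin_lin)
    have "lkp (lin (%x. P [x]) (bt m)) ?T = lkp (lin (%x. psi am x {}) (bd m)) ?T"
     unfolding e2 lookup_lin[of _ "bd m"]
    proof (rule sum.cong[OF refl])
     fix x assume x: "x : keys (bd m :: ('g list, 'k) fv)"
     \<comment> \<open>The Koszul identity concerns the full boundary \<open>bd\<close>, whereas
       \<open>bt\<close> keeps only terms of multidegree \<open>?al\<close>. By \<open>tight\<close>
       the other terms have no coefficient at \<open>?T\<close>.\<close>
     have "lkp (psi am x {} :: (nat set, 'k) fv) ?T = 0" if ne: "lc x ~= ?al"
     proof (rule ccontr)
     assume "lkp (psi am x {} :: (nat set, 'k) fv) ?T ~= 0"
     hence "?T : keys (psi am x {} :: (nat set, 'k) fv)" by (simp add: in_keys_iff)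
     hence "am ` set x = ?T" using keys_psi by fastforce
     moreover have "mle (lc x) ?al" using bd_mle[OF x] True by simp
     moreover have "set x <= GL" using keys_bd[OF x] mG(1) by auto
     ultimately show False using tight ne by blast
     qed
     thus "lkp (bd m) x * lkp (lin (%x. P [x]) (if x : {b'. lc b' = lc m} then unit_vec x else 0)) ?T
     = lkp (bd m) x * lkp (psi am x {} :: (nat set, 'k) fv) ?T"
     using True by (auto simp: P_def)
    qed
    thus ?thesis using z by (simp add: e)
   qed
  qed
  thus ?thesis by (simp add: lin_lin lookup_lin[of _ y])
 qed
 obtain c where c: "c ~= 0" "psi am (l1 @ l2) {} = (sgl ?T c :: (nat set, 'k) fv)"
  using psi_nonzero[OF dist, of "{}", where 'k = 'k] by auto
 have "lin P (lin dB ?x) + lin P (lin dB y) = 0" using y(2) by (metis lin_add lin_zero)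
 hence "lkp (lin P (lin dB ?x)) ?T + lkp (lin P (lin dB y)) ?T = 0" by (metis lookup_add lookup_zero)
 hence "lkp (lin P (lin dB ?x)) ?T = 0" unfolding Py by (simp only: add_0_right)
 hence "lkp (- scl (sg l1) (psi am (l1 @ l2) {}) :: (nat set, 'k) fv) ?T = 0" unfolding Px .
 thus False using c by (simp del: set_append)
qed

end

section \<open>Trivial Massey products and lifting when the two largest parts agree\<close>

section \<open>Massey products in an acyclic ideal\<close>

definition lin2 :: "('a => 'b => ('c, 'k::field) fv) => ('a, 'k) fv => ('b, 'k) fv => ('c, 'k) fv" where
 "lin2 g x y = lin (%a. lin (g a) y) x"

lemma lin2_linear [simp]:
 "lin2 g (x + x') y = lin2 g x y + lin2 g x' y" "lin2 g x (y + y') = lin2 g x y + lin2 g x y'"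
 "lin2 g (- x) y = - lin2 g x y" "lin2 g x (- y) = - lin2 g x y" "lin2 g 0 y = 0" "lin2 g x 0 = 0"
 "lin2 g (scl c x) y = scl c (lin2 g x y)" "lin2 g x (scl c y) = scl c (lin2 g x y)"
 by (simp_all add: lin2_def lin_fun_add lin_fun_minus lin_fun_scl)

lemma lin2_sum: "lin2 g (sum x Q) y = (\<Sum>a\<in>Q. lin2 g (x a) y)" "lin2 g z (sum x' Q) = (\<Sum>a\<in>Q. lin2 g z (x' a))"
 by (induction Q rule: infinite_finite_induct) simp_all

lemma lin2_cong: "(!!a b. a : keys x ==> b : keys y ==> g a b = g' a b) ==> lin2 g x y = lin2 g' x y"
 unfolding lin2_def by (intro lin_cong) simp

lemma lin_lin2: "lin f (lin2 g x y) = lin2 (%a b. lin f (g a b)) x y"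
 by (simp add: lin2_def lin_lin)

lemma keys_lin2: "(!!a b. a : keys x ==> b : keys y ==> keys (g a b) <= Q) ==> keys (lin2 g x y) <= Q"
 unfolding lin2_def by (intro keys_lin_subset) auto

lemma keys_sum_subset: "(!!j. j : Q ==> keys (x j) <= S) ==> keys (sum x Q) <= S"
 by (induction Q rule: infinite_finite_induct) (simp_all add: keys_add_subset)

lemma sum_triangle:
 "(\<Sum>b\<in>{i<..<k :: nat}. \<Sum>a\<in>{i<..<b}. t a b) = (\<Sum>a\<in>{i<..<k}. \<Sum>b\<in>{a<..<k}. t a b :: 'v::comm_monoid_add)"
proof -
 have "(\<Sum>b\<in>{i<..<k}. \<Sum>a\<in>{i<..<b}. t a b) = (\<Sum>b\<in>{i<..<k}. \<Sum>a\<in>{i<..<k}. if a < b then t a b else 0)"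
  by (intro sum.cong sum.mono_neutral_cong_left) auto
 also have "... = (\<Sum>a\<in>{i<..<k}. \<Sum>b\<in>{i<..<k}. if a < b then t a b else 0)" by (rule sum.swap)
 also have "... = (\<Sum>a\<in>{i<..<k}. \<Sum>b\<in>{a<..<k}. t a b)"
  by (intro sum.cong sum.mono_neutral_cong_right) auto
 finally show ?thesis .
qed

text \<open>All products fall into the span of \<open>NB\<close>, and every cycle in this span
  bounds inside it. Every obstruction to a defining system is a sum of products, so it can be
  removed.\<close>

locale massey =
 fixes CB NB :: "'c set" and f :: "'c => ('c, 'k::field) fv" and mu :: "'c => 'c => ('c, 'k) fv" and h :: "'c => nat"
 assumes fC: "!!a b. a : CB ==> b : keys (f a) ==> b : CB & h a = Suc (h b)"
  and NC: "NB <= CB"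
  and muN: "!!a b c. a : CB ==> b : CB ==> c : keys (mu a b) ==> c : NB & h c = h a + h b"
  and leib: "!!a b. a : CB ==> b : CB ==>
   lin f (mu a b) = lin (%c. mu c b) (f a) + scl ((- 1) ^ h a) (lin (mu a) (f b))"
  and assoc: "!!a b c. a : CB ==> b : CB ==> c : CB ==> lin (%d. mu d c) (mu a b) = lin (mu a) (mu b c)"
  and acyc: "!!x. keys x <= NB ==> lin f x = 0 ==> EX y. keys y <= NB & lin f y = x"
begin

abbreviation mul :: "('c, 'k) fv => ('c, 'k) fv => ('c, 'k) fv" where "mul \<equiv> lin2 mu"

lemma mul_leib:
 assumes x: "keys x <= CB \<inter> {b. h b = q}" and y: "keys y <= CB"
 shows "lin f (mul x y) = mul (lin f x) y + scl ((- 1) ^ q) (mul x (lin f y))"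
proof -
 have "lin f (mul x y) = lin2 (%a b. lin (%c. mu c b) (f a) + scl ((- 1) ^ q) (lin (mu a) (f b))) x y"
  unfolding lin_lin2
 proof (rule lin2_cong)
  fix a b assume "a : keys x" "b : keys y"
  hence "a : CB" "b : CB" "h a = q" using x y by auto
  thus "lin f (mu a b) = lin (%c. mu c b) (f a) + scl ((- 1) ^ q) (lin (mu a) (f b))" using leib[of a b] by simp
 qed
 also have "... = lin2 (%a b. lin (%c. mu c b) (f a)) x y + scl ((- 1) ^ q) (lin2 (%a b. lin (mu a) (f b)) x y)"
  by (simp add: lin2_def lin_fun_add lin_fun_scl)
 also have "lin2 (%a b. lin (%c. mu c b) (f a)) x y = mul (lin f x) y"
  unfolding lin2_def lin_lin by (rule lin_cong) (rule lin_swap)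
 also have "lin2 (%a b. lin (mu a) (f b)) x y = mul x (lin f y)"
  unfolding lin2_def lin_lin ..
 finally show ?thesis .
qed

lemma mul_assoc:
 assumes "keys x <= CB" "keys y <= CB" "keys z <= CB"
 shows "mul (mul x y) z = mul x (mul y z)"
proof -
 have "mul (mul x y) z = lin (%a. lin (%b. lin (%c. lin (%d. mu d c) (mu a b)) z) y) x"
  unfolding lin2_def lin_lin by (intro lin_cong) (rule lin_swap)
 also have "... = lin (%a. lin (%b. lin (%c. lin (mu a) (mu b c)) z) y) x"
  by (intro lin_cong assoc) (use assms in auto)
 also have "... = mul x (mul y z)" unfolding lin2_def lin_lin ..
 finally show ?thesis .
qed

lemma keys_mul:
 assumes "keys x <= CB \<inter> {b. h b = q}" "keys y <= CB \<inter> {b. h b = r}"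
 shows "keys (mul x y) <= NB \<inter> {b. h b = q + r}"
 by (rule keys_lin2) (use assms muN in fastforce)

text \<open>A defining system for the sequence of cycles x, built by increasing length of the
  interval from i to k. The sum of products attached to an interval is a cycle by the Leibniz rule
  and associativity, and it lies in the span of \<open>NB\<close>; a preimage in that span, cut down
  to the right degree, extends the system.\<close>

lemma massey_exists:
 fixes x :: "nat => ('c, 'k) fv" and dg :: "nat => nat" and p :: nat
 defines "Dg \<equiv> %i k. (\<Sum>t\<in>{i..<k}. Suc (dg t)) - 1"
 assumes x: "!!t. t < p ==> keys (x t) <= CB \<inter> {b. h b = dg t} & lin f (x t) = 0"
 shows "EX gmm. \<forall>i k. i < k & k <= p & k - i <= M --> keys (gmm i k) <= CB \<inter> {b. h b = Dg i k} &
  lin f (gmm i k) = - (\<Sum>j\<in>{i<..<k}. scl ((- 1) ^ Dg i j) (mul (gmm i j) (gmm j k))) & (k = Suc i --> gmm i k = x i)"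
proof (induction M)
 case 0
 show ?case by auto
next
 case (Suc M)
 \<comment> \<open>\<open>Dg\<close> is the sum of suspended degrees minus one. Cutting an interval
   produces two such corrections in place of one, hence the successor.\<close>
 have Dg_split: "Dg i k = Suc (Dg i j + Dg j k)" if ijk: "i < j" "j < k" for i j k
 proof -
  have "(\<Sum>t\<in>{i..<k}. Suc (dg t)) = (\<Sum>t\<in>{i..<j}. Suc (dg t)) + (\<Sum>t\<in>{j..<k}. Suc (dg t))"
   by (rule sum.atLeastLessThan_concat[symmetric]) (use ijk in auto)
  moreover have "(\<Sum>t\<in>{i..<j}. Suc (dg t)) \<ge> 1" "(\<Sum>t\<in>{j..<k}. Suc (dg t)) \<ge> 1"
   using sum.atLeast_Suc_lessThan[OF ijk(1), of "%t. Suc (dg t)"] sum.atLeast_Suc_lessThan[OF ijk(2), of "%t. Suc (dg t)"] by simp_all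
  ultimately show ?thesis unfolding Dg_def by linarith
 qed
 obtain gmm where gmm: "!!i k. i < k ==> k <= p ==> k - i <= M ==> keys (gmm i k) <= CB \<inter> {b. h b = Dg i k} &
  lin f (gmm i k) = - (\<Sum>j\<in>{i<..<k}. scl ((- 1) ^ Dg i j) (mul (gmm i j) (gmm j k))) & (k = Suc i --> gmm i k = x i)"
  using Suc by blast
 define good where "good i k z \<longleftrightarrow> keys z <= CB \<inter> {b. h b = Dg i k} &
  lin f z = - (\<Sum>j\<in>{i<..<k}. scl ((- 1) ^ Dg i j) (mul (gmm i j) (gmm j k))) & (k = Suc i --> z = x i)" for i k z
 have ex: "EX z. good i k z" if ik: "i < k" "k <= p" "k - i = Suc M" for i k
 proof (cases "k = Suc i")
  case True
  have "{i<..<k} = {}" using True by auto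
  thus ?thesis using x[of i] ik True by (intro exI[of _ "x i"]) (simp add: good_def Dg_def)
 next
  case False
  let ?s = "%a b. (- 1) ^ Dg a b :: 'k"
  let ?E = "\<Sum>j\<in>{i<..<k}. scl (?s i j) (mul (gmm i j) (gmm j k))"
  have g1: "keys (gmm a b) <= CB \<inter> {c. h c = Dg a b}" "keys (gmm a b) <= CB"
    "lin f (gmm a b) = - (\<Sum>j\<in>{a<..<b}. scl (?s a j) (mul (gmm a j) (gmm j b)))"
   if "a < b" "i <= a" "b <= k" "~ (a = i & b = k)" for a b
  proof -
   have "a < b" "b <= p" "b - a <= M" using that ik by auto
   from gmm[OF this] show "keys (gmm a b) <= CB \<inter> {c. h c = Dg a b}" "keys (gmm a b) <= CB"
    "lin f (gmm a b) = - (\<Sum>j\<in>{a<..<b}. scl (?s a j) (mul (gmm a j) (gmm j b)))" by auto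
  qed
  have ss: "?s a b * ?s a b = 1" for a b by (simp flip: power_mult_distrib)
  let ?T = "%a b. scl (?s a b) (mul (gmm i a) (mul (gmm a b) (gmm b k)))"
  have tmeq: "lin f (scl (?s i j) (mul (gmm i j) (gmm j k))) = (\<Sum>a\<in>{i<..<j}. ?T a j) - (\<Sum>b\<in>{j<..<k}. ?T j b)"
   if j: "j : {i<..<k}" for j
  proof -
   have l: "lin f (mul (gmm i j) (gmm j k)) = mul (lin f (gmm i j)) (gmm j k) + scl (?s i j) (mul (gmm i j) (lin f (gmm j k)))"
    by (rule mul_leib) (use g1 j in auto)
   have fi: "lin f (gmm i j) = - (\<Sum>a\<in>{i<..<j}. scl (?s i a) (mul (gmm i a) (gmm a j)))"
    and fj: "lin f (gmm j k) = - (\<Sum>b\<in>{j<..<k}. scl (?s j b) (mul (gmm j b) (gmm b k)))"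
    using g1(3)[of i j] g1(3)[of j k] j by auto
   have 1: "scl (?s i j) (mul (lin f (gmm i j)) (gmm j k)) = (\<Sum>a\<in>{i<..<j}. ?T a j)"
    unfolding fi lin2_linear lin2_sum pm.scale_minus_right pm.scale_sum_right sum_negf[symmetric]
   proof (rule sum.cong[OF refl])
    fix a assume a: "a : {i<..<j}"
    have s1: "?s i j = - (?s i a * ?s a j)" using Dg_split[of i a j] a by (simp add: power_add)
    have "?s i j * ?s i a = - ?s a j * (?s i a * ?s i a)" unfolding s1 by (simp add: mult_ac)
    hence s: "?s i j * ?s i a = - ?s a j" unfolding ss by simp
    have "mul (mul (gmm i a) (gmm a j)) (gmm j k) = mul (gmm i a) (mul (gmm a j) (gmm j k))"
     by (rule mul_assoc) (use g1(2)[of i a] g1(2)[of a j] g1(2)[of j k] a j in auto)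
    thus "- scl (?s i j) (scl (?s i a) (mul (mul (gmm i a) (gmm a j)) (gmm j k))) = ?T a j"
     unfolding pm.scale_scale s by simp
   qed
   have 2: "scl (?s i j) (scl (?s i j) (mul (gmm i j) (lin f (gmm j k)))) = - (\<Sum>b\<in>{j<..<k}. ?T j b)"
    unfolding fj pm.scale_scale ss lin2_linear lin2_sum by simp
   show ?thesis unfolding lin_scl l pm.scale_right_distrib 1 2 by simp
  qed
  \<comment> \<open>Both double sums run over all pairs a < b strictly between i and k, and so they
    cancel.\<close>
  have "lin f ?E = (\<Sum>j\<in>{i<..<k}. \<Sum>a\<in>{i<..<j}. ?T a j) - (\<Sum>j\<in>{i<..<k}. \<Sum>b\<in>{j<..<k}. ?T j b)"
   unfolding lin_sum sum_subtractf[symmetric] by (rule sum.cong[OF refl tmeq])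
  hence z: "lin f (- ?E) = 0" unfolding sum_triangle by simp
  have kE: "keys ?E <= NB \<inter> {c. h c = Dg i k - 1}"
  proof -
   have t: "keys (scl (?s i j) (mul (gmm i j) (gmm j k))) <= NB \<inter> {c. h c = Dg i k - 1}" if j: "j : {i<..<k}" for j
   proof (rule keys_scl_subset)
    have "keys (mul (gmm i j) (gmm j k)) <= NB \<inter> {c. h c = Dg i j + Dg j k}"
     by (rule keys_mul) (use g1(1)[of i j] g1(1)[of j k] j in auto)
    thus "keys (mul (gmm i j) (gmm j k)) <= NB \<inter> {c. h c = Dg i k - 1}"
     using Dg_split[of i j k] j by simp
   qed
   show ?thesis by (rule keys_sum_subset[OF t])
  qed
  have kN: "keys (- ?E) <= NB" using kE by (auto simp: keys_neg)
  obtain y0 where y0: "keys y0 <= NB" "lin f y0 = - ?E" using acyc[OF kN z] by blast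
  have "EX y. keys y <= NB \<inter> {b. h b = Suc (Dg i k - 1)} & lin f y = - ?E"
   by (rule graded_preimage[OF _ y0]) (use fC NC kE in \<open>auto simp: keys_neg\<close>)
  then obtain y where y: "keys y <= NB \<inter> {b. h b = Suc (Dg i k - 1)}" "lin f y = - ?E" by blast
  have "Suc (Dg i k - 1) = Dg i k" using Dg_split[of i "Suc i" k] ik False by simp
  thus ?thesis using y NC False by (intro exI[of _ y]) (auto simp: good_def)
 qed
 define \<delta> where "\<delta> i k = (if k - i = Suc M & i < k & k <= p then SOME z. good i k z else gmm i k)" for i k
 have old: "\<delta> i k = gmm i k" if "k - i <= M" for i k using that by (simp add: \<delta>_def)
 show ?case
 proof (intro exI[of _ \<delta>] allI impI)
  fix i k assume ik: "i < k & k <= p & k - i <= Suc M"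
  have sums: "(\<Sum>j\<in>{i<..<k}. scl ((- 1) ^ Dg i j) (mul (\<delta> i j) (\<delta> j k))) = (\<Sum>j\<in>{i<..<k}. scl ((- 1) ^ Dg i j) (mul (gmm i j) (gmm j k)))"
   by (rule sum.cong[OF refl]) (use ik old in auto)
  have "good i k (\<delta> i k)"
  proof (cases "k - i = Suc M")
   case True
   hence "\<delta> i k = (SOME z. good i k z)" using ik by (simp add: \<delta>_def)
   thus ?thesis using someI_ex[OF ex[of i k]] ik True by simp
  next
   case False
   hence "k - i <= M" using ik by simp
   thus ?thesis using gmm[of i k] ik old by (simp add: good_def)
  qed
  thus "keys (\<delta> i k) <= CB \<inter> {b. h b = Dg i k} &
   lin f (\<delta> i k) = - (\<Sum>j\<in>{i<..<k}. scl ((- 1) ^ Dg i j) (mul (\<delta> i j) (\<delta> j k))) & (k = Suc i --> \<delta> i k = x i)"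
   unfolding good_def sums .
 qed
qed

end

section \<open>Cycles of the bar construction\<close>

text \<open>The sum over all ways of cutting the interval from i to p into consecutive blocks, a
  block from j to k contributing the letter g j k. It is the bar cycle attached to a defining
  system.\<close>

function cw :: "nat => (nat => nat => ('a, 'k::field) fv) => nat => ('a list, 'k) fv" where
 "cw p g i = (if i < p then \<Sum>k\<in>{i<..<Suc p}. cns (g i k) (cw p g k) else unit_vec [])"
 by pat_completeness auto
termination by (relation "measure (%(p, g, i). p - i)") auto

declare cw.simps [simp del]

lemma cns_sum: "cns (sum x Q) y = (\<Sum>a\<in>Q. cns (x a) y)" "cns z (sum x' Q) = (\<Sum>a\<in>Q. cns z (x' a))"
 by (induction Q rule: infinite_finite_induct) simp_all

context bar_min
begin

definition mu0 :: "'g list => 'g list => ('g list, 'k::field) fv" where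
 "mu0 a b = (if coprm a b then unit_vec (a @ b) else 0)"

lemma dB_cns:
 assumes "!!m. m : keys x ==> sg m = e"
 shows "lin dB (cns x w) = - cns (lin bt x) w - scl e (lin2 mg x w) - scl e (cns x (lin dB w) :: ('g list list, 'k::field) fv)"
proof -
 have "lin dB (cns x w) = lin2 (%m v. dB (m # v)) x w" by (simp add: cns_def lin2_def lin_lin)
 also have "... = lin2 (%m v. - cns (bt m) (unit_vec v) - scl e (mg m v) - scl e (cns (unit_vec m) (dB v))) x w"
  by (rule lin2_cong) (simp add: assms cns_unit cns_unit2)
 also have "... = - lin (%m. lin (%v. cns (bt m) (unit_vec v)) w) x - scl e (lin2 mg x w)
   - scl e (lin (%m. lin (%v. cns (unit_vec m) (dB v)) w) x)"
  by (simp add: lin2_def lin_fun_diff lin_fun_minus lin_fun_scl)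
 also have "lin (%m. lin (%v. cns (bt m) (unit_vec v)) w) x = cns (lin bt x) w"
  unfolding lin_cns_right lin_unit_vec lin_cns_left ..
 also have "lin (%m. lin (%v. cns (unit_vec m) (dB v)) w) x = cns x (lin dB w)"
  unfolding lin_cns_right lin_cns_left lin_unit_vec ..
 finally show ?thesis .
qed

lemma mg_cns: "lin2 mg x (cns y w) = (cns (lin2 mu0 x y) w :: ('g list list, 'k::field) fv)"
proof -
 have "lin2 mg x (cns y w) = lin (%m. lin (%p. lin (%v. mg m (p # v)) w) y) x"
  by (simp add: lin2_def cns_def lin_lin)
 also have "... = lin (%m. lin (%p. lin (%v. cns (mu0 m p) (unit_vec v)) w) y) x"
  by (intro lin_cong) (simp add: mg_def mu0_def cns_unit2)
 also have "... = lin (%m. lin (%p. cns (mu0 m p) w) y) x"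
  unfolding lin_cns_right lin_unit_vec ..
 also have "... = cns (lin2 mu0 x y) w" unfolding lin_cns_left lin2_def ..
 finally show ?thesis .
qed

text \<open>The boundary of a block is the signed sum over its cuts into two blocks. These terms
  cancel against the merging of two adjacent blocks.\<close>

lemma cw_cycle:
 fixes g :: "nat => nat => ('g list, 'k::field) fv" and Dg :: "nat => nat => nat"
 assumes kg: "!!i k. i < k ==> k <= p ==> keys (g i k) <= {m : LL. length m = Dg i k}"
  and bg: "!!i k. i < k ==> k <= p ==> lin bt (g i k) = - (\<Sum>j\<in>{i<..<k}. scl ((- 1) ^ Dg i j) (lin2 mu0 (g i j) (g j k)))"
 shows "i <= p ==> lin dB (cw p g i) = 0"
proof (induction "p - i" arbitrary: i rule: less_induct)
 case less
 show ?case
 proof (cases "i < p")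
  case False
  thus ?thesis by (simp add: cw.simps[of p g i])
 next
  case True
  let ?U = "%j k. scl ((- 1) ^ Dg i j) (cns (lin2 mu0 (g i j) (g j k)) (cw p g k))"
  have tk: "lin dB (cns (g i k) (cw p g k)) = (\<Sum>j\<in>{i<..<k}. ?U j k) - (\<Sum>t\<in>{k<..<Suc p}. ?U k t)" if k: "k : {i<..<Suc p}" for k
  proof -
   have ih: "lin dB (cw p g k) = 0" by (rule less) (use k in auto)
   have d: "lin dB (cns (g i k) (cw p g k)) = - cns (lin bt (g i k)) (cw p g k) - scl ((- 1) ^ Dg i k) (lin2 mg (g i k) (cw p g k))
     - scl ((- 1) ^ Dg i k) (cns (g i k) (lin dB (cw p g k)))"
    by (rule dB_cns) (use kg[of i k] k in auto)
   have b: "lin bt (g i k) = - (\<Sum>j\<in>{i<..<k}. scl ((- 1) ^ Dg i j) (lin2 mu0 (g i j) (g j k)))" by (rule bg) (use k in auto)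
   have m: "lin2 mg (g i k) (cw p g k) = (\<Sum>t\<in>{k<..<Suc p}. cns (lin2 mu0 (g i k) (g k t)) (cw p g t))"
   proof (cases "k < p")
    case True
    thus ?thesis unfolding cw.simps[of p g k] by (simp add: lin2_sum mg_cns)
   next
    case False
    hence "{k<..<Suc p} = {}" by auto
    moreover have "lin2 mg (g i k) (unit_vec []) = (0 :: ('g list list, 'k) fv)" by (simp add: lin2_def mg_def)
    ultimately show ?thesis using False by (simp add: cw.simps[of p g k])
   qed
   show ?thesis unfolding d ih b m by (simp add: cns_sum pm.scale_sum_right)
  qed
  have "lin dB (cw p g i) = (\<Sum>k\<in>{i<..<Suc p}. (\<Sum>j\<in>{i<..<k}. ?U j k) - (\<Sum>t\<in>{k<..<Suc p}. ?U k t))"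
   unfolding cw.simps[of p g i] if_P[OF True] lin_sum by (rule sum.cong[OF refl tk])
  thus ?thesis unfolding sum_subtractf sum_triangle by simp
 qed
qed

text \<open>The finest cut gives the one word of full length, with the letters g t (Suc t). Every
  other cut has fewer blocks, so the remainder consists of shorter words.\<close>

lemma cw_keys:
 fixes g :: "nat => nat => ('g list, 'k::field) fv" and dg :: "nat => nat"
 defines "Dg \<equiv> %i k. (\<Sum>t\<in>{i..<k}. Suc (dg t)) - 1"
 assumes kg: "!!i k. i < k ==> k <= p ==> keys (g i k) <= {m : LL. length m = Dg i k}"
 shows "i <= p ==> keys (cw p g i) <= {w : WW LL length (\<Sum>t\<in>{i..<p}. Suc (dg t)). length w <= p - i} &
  keys (cw p g i - foldr cns (map (%t. g t (Suc t)) [i..<p]) (unit_vec [])) <= {w : WW LL length (\<Sum>t\<in>{i..<p}. Suc (dg t)). length w < p - i}"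
proof (induction "p - i" arbitrary: i rule: less_induct)
 case less
 show ?case
 proof (cases "i < p")
  case False
  hence ip: "i = p" using less.prems by simp
  show ?thesis unfolding ip by (simp add: cw.simps[of p g p] WW_def)
 next
  case True
  have part: "keys (cns (g i k) y) <= {w : WW LL length (\<Sum>t\<in>{i..<p}. Suc (dg t)). length w <= Suc q}"
   if k: "i < k" "k <= p" and y: "keys y <= {w : WW LL length (\<Sum>t\<in>{k..<p}. Suc (dg t)). length w <= q}" for k y q
  proof -
   have "(\<Sum>t\<in>{i..<k}. Suc (dg t)) \<ge> 1"
    using sum.atLeast_Suc_lessThan[OF k(1), of "%t. Suc (dg t)"] by simp
   moreover have "(\<Sum>t\<in>{i..<p}. Suc (dg t)) = (\<Sum>t\<in>{i..<k}. Suc (dg t)) + (\<Sum>t\<in>{k..<p}. Suc (dg t))"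
    by (rule sum.atLeastLessThan_concat[symmetric]) (use k in auto)
   ultimately have e: "(\<Sum>t\<in>{i..<p}. Suc (dg t)) = Suc (Dg i k + (\<Sum>t\<in>{k..<p}. Suc (dg t)))" unfolding Dg_def by linarith
   show ?thesis by (rule order_trans[OF keys_cns[OF kg[OF k] y]]) (auto simp: WW_def e subset_iff)
  qed
  have ih: "keys (cw p g k) <= {w : WW LL length (\<Sum>t\<in>{k..<p}. Suc (dg t)). length w <= p - k}" if "i < k" "k <= p" for k
   using less.hyps[of k] that True by simp
  have pk: "keys (cns (g i k) (cw p g k)) <= {w : WW LL length (\<Sum>t\<in>{i..<p}. Suc (dg t)). length w <= Suc (p - k)}" if "i < k" "k <= p" for k
   by (rule part[OF that ih[OF that]])
  have 1: "keys (cw p g i) <= {w : WW LL length (\<Sum>t\<in>{i..<p}. Suc (dg t)). length w <= p - i}"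
  proof -
   have "cw p g i = (\<Sum>k\<in>{i<..<Suc p}. cns (g i k) (cw p g k))" using True by (simp add: cw.simps[of p g i])
   also have "keys ... <= {w : WW LL length (\<Sum>t\<in>{i..<p}. Suc (dg t)). length w <= p - i}"
    by (rule keys_sum_subset, rule order_trans[OF pk]) auto
   finally show ?thesis .
  qed
  let ?tn = "%i. foldr cns (map (%t. g t (Suc t)) [i..<p]) (unit_vec [])"
  have ihs: "keys (cw p g (Suc i) - ?tn (Suc i)) <= {w : WW LL length (\<Sum>t\<in>{Suc i..<p}. Suc (dg t)). length w < p - Suc i}"
   using less.hyps[of "Suc i"] True by auto
  have tn: "?tn i = cns (g i (Suc i)) (?tn (Suc i))" using True by (simp add: upt_conv_Cons)
  have "{i<..<Suc p} = insert (Suc i) {Suc i<..<Suc p}" using True by auto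
  hence "cw p g i = cns (g i (Suc i)) (cw p g (Suc i)) + (\<Sum>k\<in>{Suc i<..<Suc p}. cns (g i k) (cw p g k))"
   using True by (simp add: cw.simps[of p g i])
  hence e: "cw p g i - ?tn i = cns (g i (Suc i)) (cw p g (Suc i) - ?tn (Suc i)) + (\<Sum>k\<in>{Suc i<..<Suc p}. cns (g i k) (cw p g k))"
   unfolding tn by simp
  have 2: "keys (cns (g i (Suc i)) (cw p g (Suc i) - ?tn (Suc i))) <= {w : WW LL length (\<Sum>t\<in>{i..<p}. Suc (dg t)). length w < p - i}"
  proof (cases "p - Suc i")
   case 0
   hence "cw p g (Suc i) - ?tn (Suc i) = 0" using ihs by simp
   thus ?thesis by simp
  next
   case (Suc q)
   have "keys (cns (g i (Suc i)) (cw p g (Suc i) - ?tn (Suc i))) <= {w : WW LL length (\<Sum>t\<in>{i..<p}. Suc (dg t)). length w <= Suc q}"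
    by (rule part) (use ihs True Suc in auto)
   thus ?thesis using Suc by auto
  qed
  have 3: "keys (\<Sum>k\<in>{Suc i<..<Suc p}. cns (g i k) (cw p g k)) <= {w : WW LL length (\<Sum>t\<in>{i..<p}. Suc (dg t)). length w < p - i}"
   by (rule keys_sum_subset, rule order_trans[OF pk]) auto
  have "keys (cw p g i - ?tn i) <= {w : WW LL length (\<Sum>t\<in>{i..<p}. Suc (dg t)). length w < p - i}"
   unfolding e by (rule keys_add_subset[OF 2 3])
  with 1 show ?thesis by blast
 qed
qed

text \<open>By the word homotopy a \<open>d0\<close>-cycle x is \<open>d0\<close> of some s plus
  words in chosen homology representatives. The first summand is the longest part of
  \<open>dB\<close> s, which is a \<open>dB\<close>-cycle. For the words, the representatives are
  lifted to cycles of the auxiliary algebra, a defining system is found there, and its image under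
  \<open>pp\<close> yields the bar cycle \<open>cw\<close>. What is asked of \<open>pp\<close> is to
  be a multiplicative chain map along which cycles lift to cycles.\<close>

lemma word_lifting_massey:
 fixes f :: "'c => ('c, 'k::field) fv" and pp :: "'c => ('g list, 'k) fv"
 assumes C: "massey CB NB f mu h"
  and ppC: "!!a. a : CB ==> keys (pp a) <= {m : LL. length m = h a}"
  and pp_f: "!!a. a : CB ==> lin pp (f a) = lin bt (pp a)"
  and pp_mu: "!!a b. a : CB ==> b : CB ==> lin pp (mu a b) = lin2 mu0 (pp a) (pp b)"
  and surj: "!!z q. keys z <= {m : LL. length m = q} ==> lin bt z = 0 ==>
   EX x. keys x <= CB \<inter> {b. h b = q} & lin f x = 0 & lin pp x = z"
 shows "word_lifting TYPE('k)"
proof -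
 interpret C: massey CB NB f mu h by (rule C)
 obtain d s p i where hm: "hmodel (%j. {m : LL. length m = j}) (bt :: 'g list => ('g list, 'k) fv) (%j. {j} \<times> {..<d j :: nat}) s p i"
  by (rule list_model) (rule that)
 define LC where "LC = {(j, k). k < d j}"
 have LC: "{c : LC. fst c = j} = {j} \<times> {..<d j}" for j by (auto simp: LC_def)
 interpret hw: hmodel_words LL length LC fst bt s p i by (unfold hmodel_words_def LC) (rule hm)
 have dw: "hw.dw w = d0 w" for w
  by (induction w) (simp_all add: cns_unit cns_unit2)
 hence dwd: "hw.dw = d0" by blast
 have tens_foldr: "tens i c = foldr cns (map i c) (unit_vec [])" for c by (induction c) simp_all
 have ppx: "keys (lin pp x) <= {m : LL. length m = q}" if "keys x <= CB \<inter> {b. h b = q}" for x q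
  by (rule keys_lin_subset) (use that ppC in fastforce)
 have ppf: "lin pp (lin f x) = lin bt (lin pp x)" if "keys x <= CB" for x
  unfolding lin_lin by (rule lin_cong) (use that pp_f in auto)
 have ppm: "lin pp (lin2 mu x y) = lin2 mu0 (lin pp x) (lin pp y)" if "keys x <= CB" "keys y <= CB" for x y
 proof -
  have "lin pp (lin2 mu x y) = lin2 (%a b. lin2 mu0 (pp a) (pp b)) x y"
   unfolding lin_lin2 by (rule lin2_cong) (use that pp_mu in auto)
  also have "... = lin2 mu0 (lin pp x) (lin pp y)"
   unfolding lin2_def lin_lin by (rule lin_cong) (rule lin_swap)
  finally show ?thesis .
 qed
 have one: "EX y. keys y <= {w : WW LL length (wd fst c). length w < length c} & lin dB (tens i c + y) = 0"
  if c: "set c <= LC" for c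
 proof -
  let ?p = "length c" and ?dg = "%t. fst (c ! t)"
  define Dg where "Dg = (%i k. (\<Sum>t\<in>{i..<k}. Suc (?dg t)) - 1)"
  have "EX x. keys x <= CB \<inter> {b. h b = ?dg t} & lin f x = 0 & lin pp x = i (c ! t)" if t: "t < ?p" for t
  proof (rule surj)
   have m: "c ! t : LC" using c t by (meson nth_mem subsetD)
   show "keys (i (c ! t)) <= {m : LL. length m = ?dg t}" using hw.cletter(1)[OF m] by auto
   show "lin bt (i (c ! t)) = 0" by (rule hw.cletter(2)[OF m])
  qed
  then obtain x where x: "!!t. t < ?p ==> keys (x t) <= CB \<inter> {b. h b = ?dg t} & lin f (x t) = 0 & lin pp (x t) = i (c ! t)"
   by metis
  have x': "keys (x t) <= CB \<inter> {b. h b = ?dg t} & lin f (x t) = 0" if "t < ?p" for t using x[OF that] by blast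
  obtain gmm where gmm0: "\<forall>i k. i < k & k <= ?p & k - i <= ?p --> keys (gmm i k) <= CB \<inter> {b. h b = Dg i k} &
   lin f (gmm i k) = - (\<Sum>j\<in>{i<..<k}. scl ((- 1) ^ Dg i j) (lin2 mu (gmm i j) (gmm j k))) & (k = Suc i --> gmm i k = x i)"
   using C.massey_exists[of ?p x ?dg ?p, OF x'] unfolding Dg_def by blast
  have gmm: "keys (gmm i k) <= CB \<inter> {b. h b = Dg i k}"
   "lin f (gmm i k) = - (\<Sum>j\<in>{i<..<k}. scl ((- 1) ^ Dg i j) (lin2 mu (gmm i j) (gmm j k)))" "k = Suc i ==> gmm i k = x i"
   if "i < k" "k <= ?p" for i k using gmm0[rule_format, of i k] that by auto
  define g where "g a b = lin pp (gmm a b)" for a b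
  have gmmC: "keys (gmm a b) <= CB" if "a < b" "b <= ?p" for a b using gmm(1)[OF that] by blast
  have kg: "keys (g a b) <= {m : LL. length m = Dg a b}" if "a < b" "b <= ?p" for a b
   unfolding g_def by (rule ppx[OF gmm(1)[OF that]])
  have bg: "lin bt (g a b) = - (\<Sum>j\<in>{a<..<b}. scl ((- 1) ^ Dg a j) (lin2 mu0 (g a j) (g j b)))" if ab: "a < b" "b <= ?p" for a b
  proof -
   have "lin bt (g a b) = lin pp (lin f (gmm a b))" unfolding g_def by (rule ppf[OF gmmC[OF ab], symmetric])
   also have "... = - (\<Sum>j\<in>{a<..<b}. scl ((- 1) ^ Dg a j) (lin pp (lin2 mu (gmm a j) (gmm j b))))"
    unfolding gmm(2)[OF ab] by (simp add: lin_sum)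
   also have "... = - (\<Sum>j\<in>{a<..<b}. scl ((- 1) ^ Dg a j) (lin2 mu0 (g a j) (g j b)))"
   proof -
    have "lin pp (lin2 mu (gmm a j) (gmm j b)) = lin2 mu0 (g a j) (g j b)" if "j : {a<..<b}" for j
     unfolding g_def by (rule ppm) (use gmmC that ab in auto)
    thus ?thesis by simp
   qed
   finally show ?thesis .
  qed
  let ?c = "cw ?p g 0"
  have lead: "foldr cns (map (%t. g t (Suc t)) [0..<?p]) (unit_vec []) = tens i c"
  proof -
   have "map (%t. g t (Suc t)) [0..<?p] = map (%t. i (c ! t)) [0..<?p]"
    using gmm(3) x by (auto simp: g_def)
   also have "... = map i c" by (rule nth_equalityI) simp_all
   finally show ?thesis by (simp add: tens_foldr)
  qed
  have "(\<Sum>t\<in>{0..<?p}. Suc (?dg t)) = wd fst c"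
   by (simp add: wd_def sum_list_sum_nth)
  hence k: "keys (?c - tens i c) <= {w : WW LL length (wd fst c). length w < ?p}"
   using cw_keys[of ?p g ?dg 0, OF kg[unfolded Dg_def]] lead by simp
  have "lin dB ?c = 0" by (rule cw_cycle[of ?p g Dg, OF kg bg]) simp_all
  thus ?thesis using k by (intro exI[of _ "?c - tens i c"]) simp
 qed
 define Y where "Y c = (SOME y. keys y <= {w : WW LL length (wd fst c). length w < length c} & lin dB (tens i c + y) = 0)" for c
 have Y: "keys (Y c) <= {w : WW LL length (wd fst c). length w < length c} & lin dB (tens i c + Y c) = 0" if "set c <= LC" for c
  unfolding Y_def by (rule someI_ex[OF one[OF that]])
 show ?thesis unfolding word_lifting_def
 proof (intro allI impI)
  fix j q and x :: "('g list list, 'k) fv"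
  assume x0: "keys x <= {w. okW w & hW w = j} \<inter> {w. length w = q}" and dx: "lin d0 x = 0"
  have x: "w : keys x ==> set w <= LL & wd length w = j & length w = q" for w
   using x0 unfolding okW_WW by (auto simp: WW_def)
  let ?s = "lin hw.sw x" and ?v = "lin (tens p) x"
  have ks: "keys ?s <= {w. okW w & hW w = Suc j} \<inter> {w. length w = q}"
   unfolding okW_WW
  proof (rule keys_lin_subset)
   fix w assume "w : keys x"
   note xw = x[OF this]
   show "keys (hw.sw w) <= WW LL length (Suc j) \<inter> {w. length w = q}" using hw.keys_sw[of w] xw by (auto simp: WW_def)
  qed
  have kv: "c : keys ?v ==> set c <= LC & wd fst c = j & length c = q" for c
  proof -
   assume "c : keys ?v"
   then obtain w where w: "w : keys x" "c : keys (tens p w)" by (rule keys_linE)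
   show ?thesis using hw.keys_tens_p[of w] x[OF w(1)] w(2) by auto
  qed
  \<comment> \<open>The homotopy term with \<open>d0\<close> x is zero, so the cycle is a boundary
    plus a combination of words of representatives.\<close>
  have hom: "x = lin d0 ?s + lin (tens i) ?v"
  proof -
   have "lin (%w. lin d0 (hw.sw w) + lin hw.sw (d0 w) + lin (tens i) (tens p w)) x = lin unit_vec x"
    by (rule lin_cong) (use hw.sw_homotopy x in \<open>simp add: dwd\<close>)
   thus ?thesis using dx by (simp add: lin_fun_add lin_lin[symmetric])
  qed
  have dd: "lin dB (lin dB ?s) = 0"
  proof -
   have "lin dB (lin dB ?s) = lin (%w. 0) ?s" unfolding lin_lin[of dB dB]
    by (rule lin_cong) (use ks dB_dB in blast)
   thus ?thesis by simp
  qed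
  let ?y1 = "lin dB ?s - lin d0 ?s" and ?y2 = "lin Y ?v"
  have y1: "keys ?y1 <= {w. okW w & hW w = j} \<inter> {w. length w < q}"
  proof -
   have e: "?y1 = lin (%w. dB w - d0 w) ?s" by (simp add: lin_fun_diff)
   show ?thesis unfolding e
   proof (rule keys_lin_subset)
    fix w assume "w : keys ?s"
    hence w: "okW w" "hW w = Suc j" "length w = q" using ks by auto
    have wL: "set w <= LL" using w(1) by (auto simp: okW_def)
    have a: "keys (dB w :: ('g list list, 'k) fv) <= {w. okW w & hW w = j}" using keys_dB[OF w(1), where 'k = 'k] w(2) by auto
    have b: "keys (d0 w :: ('g list list, 'k) fv) <= {w. okW w & hW w = j}"
     using hw.keys_dw[OF wL] w(2) unfolding dwd okW_WW by (auto simp: WW_def hW_def wd_def)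
    show "keys (dB w - d0 w :: ('g list list, 'k) fv) <= {w. okW w & hW w = j} \<inter> {w. length w < q}"
     using keys_diff_subset[OF a b] keys_dB_d0[of _ w, where 'k = 'k] w(3) by fastforce
   qed
  qed
  have y2: "keys ?y2 <= {w. okW w & hW w = j} \<inter> {w. length w < q}"
   unfolding okW_WW
  proof (rule keys_lin_subset)
   fix c assume "c : keys ?v"
   note vc = kv[OF this]
   show "keys (Y c) <= WW LL length j \<inter> {w. length w < q}" using Y[of c] vc by auto
  qed
  have "lin (%c. lin dB (tens i c + Y c)) ?v = lin (%c. 0) ?v" by (rule lin_cong) (use kv Y in blast)
  hence z: "lin dB (lin (tens i) ?v) + lin dB ?y2 = 0" by (simp add: lin_lin lin_fun_add)
  have "x + (?y1 + ?y2) = lin dB ?s + (lin (tens i) ?v + ?y2)" by (subst hom) (simp add: algebra_simps)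
  hence "lin dB (x + (?y1 + ?y2)) = 0" using dd z by (metis add_0_left lin_add)
  thus "EX y. keys y <= {w. okW w & hW w = j} \<inter> {w. length w < q} & lin dB (x + y) = 0"
   using keys_add_subset[OF y1 y2] by blast
 qed
qed

end

section \<open>An algebra with an acyclic ideal containing all products\<close>

lemma bd_map: "bd (map \<sigma> l) = (lin (%x. unit_vec (map \<sigma> x)) (bd l) :: ('b list, 'k::field) fv)"
proof (induction l)
 case (Cons u l)
 thus ?case by (simp add: lin_lin)
qed simp

text \<open>Lists over 'g + nat mix Taylor letters, the generators tagged \<open>Inl\<close>, with
  Koszul letters, the variables tagged \<open>Inr\<close>. \<open>gl\<close> and \<open>xv\<close>
  extract the two kinds as sets.\<close>

definition gl :: "('g + nat) list => 'g set" where "gl l = {u. Inl u : set l}"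
definition xv :: "('g + nat) list => nat set" where "xv l = {i. Inr i : set l}"

lemma gl_simps [simp]: "gl [] = {}" "gl (Inl u # l) = insert u (gl l)" "gl (Inr i # l) = gl l" "gl (l @ m) = gl l \<union> gl m"
 "gl (map Inl k) = set k" by (auto simp: gl_def)

lemma xv_simps [simp]: "xv [] = {}" "xv (Inl u # l) = xv l" "xv (Inr i # l) = insert i (xv l)" "xv (l @ m) = xv l \<union> xv m"
 "xv (map Inl k) = {}" by (auto simp: xv_def)

lemma finite_gl [simp]: "finite (gl l)" "finite (xv l)"
proof -
 have "gl l = Inl -` set l" "xv l = Inr -` set l" by (auto simp: gl_def xv_def)
 thus "finite (gl l)" "finite (xv l)" by (simp_all add: finite_vimageI)
qed

lemma gl_xv_mono: "set m <= set l ==> gl m <= gl l & xv m <= xv l" by (auto simp: gl_def xv_def)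

lemma xv_empty': "xv l = {} ==> map (Inl \<circ> projl) l = l"
proof (induction l)
 case (Cons a l)
 thus ?case by (cases a) auto
qed simp

lemma xv_empty: "xv l = {} ==> l = map Inl (map projl l)"
 unfolding map_map by (rule xv_empty'[symmetric])

lemma gl_projl: "xv l = {} ==> set (map projl l) = gl l"
proof (induction l)
 case (Cons a l)
 thus ?case by (cases a) auto
qed simp

lemma mle_sqf_mono: "A <= B ==> finite B ==> mle (sqf A) (sqf B)"
 using finite_subset[of A B] by (auto simp: mle_def lookup_sqf)

definition fA :: "expo \<times> 'x list => (expo \<times> 'x list \<Rightarrow>\<^sub>0 'k::field)" where
 "fA = (%(al, l). lin (%x. unit_vec (al, x)) (bd l))"

definition disj :: "expo => expo => bool" where
 "disj al \<beta> \<longleftrightarrow> (\<forall>i. lkp al i = 0 | lkp \<beta> i = 0)"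

text \<open>Multidegrees add and lists are concatenated. The product is cut to zero unless the
  multidegrees are coprime, which is also when merging survives in the minimal part.\<close>

definition muA :: "expo \<times> 'x list => expo \<times> 'x list => (expo \<times> 'x list \<Rightarrow>\<^sub>0 'k::field)" where
 "muA = (%(al, l) (\<beta>, m). if disj al \<beta> then unit_vec (al + \<beta>, l @ m) else 0)"

lemma fA_fA: "lin fA (fA a) = (0 :: expo \<times> 'x list \<Rightarrow>\<^sub>0 'k::field)"
proof -
 obtain al l where a: "a = (al, l)" by (cases a)
 have "lin fA (fA a) = lin (%x. unit_vec (al, x)) (lin bd (bd l :: ('x list, 'k) fv))" by (simp add: a fA_def lin_lin)
 thus ?thesis by (simp add: bd_bd)
qed

lemma keys_fA: "b : keys (fA (al, l) :: expo \<times> 'x list \<Rightarrow>\<^sub>0 'k::field) ==>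
 EX m. b = (al, m) & m : keys (bd l :: ('x list, 'k) fv) & set m <= set l & length l = Suc (length m)"
proof -
 assume "b : keys (fA (al, l) :: expo \<times> 'x list \<Rightarrow>\<^sub>0 'k)"
 hence "b : keys (lin (%x. unit_vec (al, x)) (bd l) :: expo \<times> 'x list \<Rightarrow>\<^sub>0 'k)" by (simp add: fA_def)
 then obtain m where m: "m : keys (bd l :: ('x list, 'k) fv)" "b : keys (unit_vec (al, m) :: expo \<times> 'x list \<Rightarrow>\<^sub>0 'k)" by (rule keys_linE)
 show ?thesis using m keys_bd[OF m(1)] by auto
qed

lemma disj_add: "disj (al + \<beta>) gmm \<longleftrightarrow> disj al gmm & disj \<beta> gmm" "disj gmm (al + \<beta>) \<longleftrightarrow> disj gmm al & disj gmm \<beta>"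
 unfolding disj_def lookup_add add_is_0 by metis+

context bar_min
begin

lemma lookup_lc_append: "lkp (lc (l @ m)) i = max (lkp (lc l) i) (lkp (lc m) i)"
 by (induction l) (auto simp: lookup_mlcm)

lemma coprm_iff: "coprm l m \<longleftrightarrow> disj (lc l) (lc m)"
proof -
 have m: "max a b = a + b \<longleftrightarrow> a = 0 | b = 0" for a b :: nat by (auto simp: max_def)
 show ?thesis unfolding coprm_def disj_def poly_mapping_eq_iff fun_eq_iff lookup_lc_append lookup_add m ..
qed

text \<open>Strands of a complex built from Taylor and Koszul letters together, with monomial
  coefficients in an ideal: al - sqf (xv l) is the monomial left after the Koszul letters. It has to
  lie in W and to be divisible by every Taylor letter.\<close>

definition inA :: "expo set => (expo \<times> ('g + nat) list) set" where
 "inA W = {(al, l). al : exponents n & gl l <= GL & mle (sqf (xv l)) al & (\<forall>u\<in>gl l. mle (gs u + sqf (xv l)) al)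
  & al - sqf (xv l) : W}"

text \<open>Reduction to the minimal part: only lists of Taylor letters whose lcm is the full
  multidegree survive, because anything else carries a Koszul letter or a nonunit
  coefficient.\<close>

definition ppA :: "expo \<times> ('g + nat) list => ('g list, 'k::field) fv" where
 "ppA = (%(al, l). if xv l = {} & lc (map projl l) = al then unit_vec (map projl l) else 0)"

lemma inA_sub:
 assumes up: "!!m m'. m : W ==> mle m m' ==> m' : exponents n ==> m' : W"
  and a: "(al, l) : inA W" and s: "set m <= set l"
 shows "(al, m) : inA W"
proof -
 have s': "gl m <= gl l" "xv m <= xv l" using gl_xv_mono[OF s] by auto
 have sq: "mle (sqf (xv m)) (sqf (xv l))" by (rule mle_sqf_mono[OF s'(2)]) simp
 have A: "al : exponents n" "gl l <= GL" "mle (sqf (xv l)) al" "\<forall>u\<in>gl l. mle (gs u + sqf (xv l)) al" "al - sqf (xv l) : W"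
  using a by (auto simp: inA_def)
 have "al - sqf (xv m) : W" by (rule up[OF A(5) mle_diff_mono[OF sq] exponents_diff[OF A(1)]])
 moreover have "mle (gs u + sqf (xv m)) al" if "u : gl m" for u
  by (rule mle_trans[OF mle_mono[OF mle_refl sq]]) (use A(4) s'(1) that in blast)
 ultimately show ?thesis using A s' mle_trans[OF sq A(3)] by (auto simp: inA_def)
qed

text \<open>\<open>WJ\<close> is to be thought of as the monomials of a proper ideal J containing I.
  \<open>J_minus\<close> puts every quotient of a monomial of I by a variable into J (the
  subtraction is truncated, so a variable that does not occur changes nothing), and
  \<open>J_mult\<close> says that coprime monomials of J multiply into I. Coefficients in J give the
  algebra, coefficients in I its acyclic ideal.\<close>

context
 fixes WJ :: "expo set"
 assumes J_up: "!!m m'. m : WJ ==> mle m m' ==> m' : exponents n ==> m' : WJ"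
  and J_minus: "!!m i. m : WI ==> m - sgl i 1 : WJ"
  and J_mult: "!!m m'. m : WJ ==> m' : WJ ==> disj m m' ==> m + m' : WI"
  and J_zero: "0 ~: WJ"
begin

lemma WI_WJ: "m : WI ==> m : WJ"
proof -
 assume m: "m : WI"
 have "mle (m - sgl i 1) m" for i by (simp add: mle_def lookup_minus)
 moreover have "m : exponents n" using m by (simp add: WI_def)
 ultimately show ?thesis by (rule J_up[OF J_minus[OF m, of 0]])
qed

abbreviation (input) "CA \<equiv> inA WJ"
abbreviation (input) "NA \<equiv> inA WI"

lemma NA_CA: "NA <= CA" using WI_WJ by (auto simp: inA_def)

lemma fA_in:
 assumes "a : CA" "b : keys (fA a :: (_, 'k::field) fv)"
 shows "b : CA & length (snd a) = Suc (length (snd b))" "a : NA ==> b : NA"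
proof -
 obtain al l where a: "a = (al, l)" by (cases a)
 obtain m where m: "b = (al, m)" "set m <= set l" "length l = Suc (length m)" using keys_fA[of b al l, where 'k = 'k] assms(2) unfolding a by blast
 show "b : CA & length (snd a) = Suc (length (snd b))" using inA_sub[where W = WJ and al = al and l = l and m = m, OF J_up] assms(1) m a by auto
 show "a : NA ==> b : NA" using inA_sub[where W = WI and al = al and l = l and m = m, OF WI_up] m a by auto
qed

text \<open>A generator dividing al - sqf (xv l) exists since this monomial lies in I, and
  prepending it contracts. It depends only on the set of Koszul letters, so the error terms have
  fewer distinct Koszul letters.\<close>

lemma NA_acyclic:
 fixes x :: "expo \<times> ('g + nat) list \<Rightarrow>\<^sub>0 'k::field"
 assumes x: "keys x <= NA" "lin fA x = 0"
 shows "EX y. keys y <= NA & lin fA y = x"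
proof -
 define U where "U al l = (SOME u. u : GL & mle (gs u) (al - sqf (xv l)))" for al :: "nat \<Rightarrow>\<^sub>0 nat" and l :: "('g + nat) list"
 let ?h = "%(al, l). unit_vec (al, Inl (U al l) # l) :: (_, 'k) fv"
 show ?thesis
 proof (rule triangular_acyclic[where m = "%a. card (xv (snd a))" and h = ?h, OF _ _ _ _ x])
  fix a assume a: "a : NA"
  obtain al l where aa: "a = (al, l)" by (cases a)
  show "keys (fA a :: (_, 'k) fv) <= NA" by (rule subsetI, rule fA_in(2)[OF subsetD[OF NA_CA a] _ a])
  show "lin fA (fA a :: (_, 'k) fv) = 0" by (rule fA_fA)
  have A: "al : exponents n" "gl l <= GL" "mle (sqf (xv l)) al" "\<forall>u\<in>gl l. mle (gs u + sqf (xv l)) al" "al - sqf (xv l) : WI"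
   using a by (auto simp: inA_def aa)
  have u: "U al l : GL & mle (gs (U al l)) (al - sqf (xv l))"
   unfolding U_def by (rule someI_ex) (use A(5) in \<open>auto simp: WI_def\<close>)
  have "mle (gs (U al l) + sqf (xv l)) al" using u A(3) by (simp add: mle_plus_iff)
  thus "keys (?h a) <= NA" using A u by (simp add: aa inA_def)
  have "lin fA (?h a) + lin ?h (fA a) - unit_vec a
   = lin (%x. unit_vec (al, Inl (U al x) # x) - unit_vec (al, Inl (U al l) # x)) (bd l)"
   by (simp add: aa fA_def lin_lin lin_fun_diff)
  moreover have "keys ... <= {b. card (xv (snd b)) < card (xv (snd a))}"
  proof (rule keys_lin_subset)
   fix y assume y: "y : keys (bd l :: ('g + nat) list \<Rightarrow>\<^sub>0 'k)"
   have sub: "xv y <= xv l" using gl_xv_mono[of y l] keys_bd[OF y] by blast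
   show "keys (unit_vec (al, Inl (U al y) # y) - unit_vec (al, Inl (U al l) # y) :: (_, 'k) fv) <= {b. card (xv (snd b)) < card (xv (snd a))}"
   proof (cases "xv y = xv l")
    case True
    thus ?thesis by (simp add: U_def)
   next
    case False
    hence "card (xv y) < card (xv l)" using sub by (intro psubset_card_mono) auto
    thus ?thesis by (intro keys_diff_subset) (simp_all add: aa)
   qed
  qed
  ultimately show "keys (lin fA (?h a) + lin ?h (fA a) - unit_vec a) <= {b. card (xv (snd b)) < card (xv (snd a))}" by simp
 qed
qed

text \<open>Coprime multidegrees have disjoint sets of Koszul letters, so the residual monomials of
  the factors multiply to that of the product. They are coprime monomials of J, and
  \<open>J_mult\<close> places their product in I.\<close>

lemma muA_in:
 assumes "a : CA" "b : CA" "c : keys (muA a b :: (_, 'k::field) fv)"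
 shows "c : NA & length (snd c) = length (snd a) + length (snd b)"
proof -
 obtain al l \<beta> m where ab: "a = (al, l)" "b = (\<beta>, m)" by (cases a; cases b)
 have d: "disj al \<beta>" and c: "c = (al + \<beta>, l @ m)" using assms(3) by (auto simp: muA_def ab split: if_splits)
 have A: "al : exponents n" "gl l <= GL" "mle (sqf (xv l)) al" "\<forall>u\<in>gl l. mle (gs u + sqf (xv l)) al" "al - sqf (xv l) : WJ"
  and B: "\<beta> : exponents n" "gl m <= GL" "mle (sqf (xv m)) \<beta>" "\<forall>u\<in>gl m. mle (gs u + sqf (xv m)) \<beta>" "\<beta> - sqf (xv m) : WJ"
  using assms(1,2) by (auto simp: inA_def ab)
 have dx: "i ~: xv l | i ~: xv m" for i
 proof (rule ccontr)
  assume "~ ?thesis"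
  hence "lkp (sqf (xv l)) i = 1" "lkp (sqf (xv m)) i = 1" by (simp_all add: lookup_sqf)
  hence "1 <= lkp al i" "1 <= lkp \<beta> i" using A(3) B(3) unfolding mle_def by metis+
  thus False using d unfolding disj_def by (metis not_one_le_zero)
 qed
 have sq: "sqf (xv l \<union> xv m) = sqf (xv l) + sqf (xv m)"
  by (rule poly_mapping_eqI) (use dx in \<open>auto simp: lookup_sqf lookup_add\<close>)
 have "disj (al - sqf (xv l)) (\<beta> - sqf (xv m))" unfolding disj_def lookup_minus
 proof
  fix i show "lkp al i - lkp (sqf (xv l)) i = 0 | lkp \<beta> i - lkp (sqf (xv m)) i = 0"
   using d[unfolded disj_def, rule_format, of i] by auto
 qed
 hence "(al - sqf (xv l)) + (\<beta> - sqf (xv m)) : WI" by (rule J_mult[OF A(5) B(5)])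
 moreover have "(al - sqf (xv l)) + (\<beta> - sqf (xv m)) = al + \<beta> - sqf (xv l \<union> xv m)"
  unfolding sq
 proof (rule poly_mapping_eqI)
  fix i
  have "lkp (sqf (xv l)) i <= lkp al i" "lkp (sqf (xv m)) i <= lkp \<beta> i" using A(3) B(3) by (simp_all add: mle_def)
  thus "lkp (al - sqf (xv l) + (\<beta> - sqf (xv m))) i = lkp (al + \<beta> - (sqf (xv l) + sqf (xv m))) i"
   by (simp add: lookup_add lookup_minus)
 qed
 ultimately have W: "al + \<beta> - sqf (xv l \<union> xv m) : WI" by simp
 have "mle (gs u + sqf (xv l \<union> xv m)) (al + \<beta>)" if "u : gl l \<union> gl m" for u
 proof (cases "u : gl l")
  case True
  thus ?thesis using mle_mono[OF A(4)[rule_format, OF True] B(3)] by (simp add: sq add.assoc)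
 next
  case False
  hence um: "u : gl m" using that by blast
  show ?thesis using mle_mono[OF A(3) B(4)[rule_format, OF um]] by (simp add: sq add_ac)
 qed
 moreover have "mle (sqf (xv l \<union> xv m)) (al + \<beta>)" unfolding sq by (rule mle_mono[OF A(3) B(3)])
 ultimately show ?thesis using A(1,2) B(1,2) W by (auto simp: c ab inA_def exponents_add)
qed

lemma massey_A: "massey CA NA (fA :: _ => (_, 'k::field) fv) muA (%a. length (snd a))"
proof
 show "b : CA & length (snd a) = Suc (length (snd b))" if "a : CA" "b : keys (fA a :: (_, 'k) fv)" for a b
  by (rule fA_in(1)[OF that])
 show "NA <= CA" by (rule NA_CA)
 show "c : NA & length (snd c) = length (snd a) + length (snd b)" if "a : CA" "b : CA" "c : keys (muA a b :: (_, 'k) fv)" for a b c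
  by (rule muA_in[OF that])
 show "EX y. keys y <= NA & lin fA y = x" if "keys x <= NA" "lin fA x = 0" for x :: "(_, 'k) fv" by (rule NA_acyclic[OF that])
 fix a b c :: "expo \<times> ('g + nat) list"
 obtain al l \<beta> m gmm k where abc: "a = (al, l)" "b = (\<beta>, m)" "c = (gmm, k)" by (cases a; cases b; cases c)
 show "lin fA (muA a b) = lin (%c. muA c b) (fA a) + scl ((- 1) ^ length (snd a)) (lin (muA a) (fA b) :: (_, 'k) fv)"
  by (cases "disj al \<beta>") (simp_all add: abc muA_def fA_def bd_append lin_lin)
 show "lin (%d. muA d c) (muA a b) = lin (muA a) (muA b c :: (_, 'k) fv)"
  by (auto simp: abc muA_def disj_add add.assoc)
qed

lemma ppA_map: "ppA (al, map Inl l) = (if lc l = al then unit_vec l else 0 :: ('g list, 'k::field) fv)"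
 by (simp add: ppA_def o_def)

lemma lc_le:
 assumes "(al, l) : CA"
 shows "lc (map projl l) = al ==> xv l = {} ==> map projl l : LL" "!!k. set k <= gl l ==> mle (lc k) (al - sqf (xv l))"
proof -
 have A: "gl l <= GL" "mle (sqf (xv l)) al" "\<forall>u\<in>gl l. mle (gs u + sqf (xv l)) al" "al - sqf (xv l) : WJ"
  using assms by (auto simp: inA_def)
 show "mle (lc k) (al - sqf (xv l))" if k: "set k <= gl l" for k
  unfolding mle_lc
 proof
  fix u assume "u : set k"
  hence "mle (gs u + sqf (xv l)) al" using A(3) k by blast
  thus "mle (gs u) (al - sqf (xv l))" by (simp add: mle_plus_iff)
 qed
 assume e: "lc (map projl l) = al" and x: "xv l = {}"
 have "al : WJ" using A(4) x by simp
 hence ne: "l ~= []" using e J_zero by auto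
 have "gl l = set (map projl l)" by (rule gl_projl[OF x, symmetric])
 thus "map projl l : LL" using A(1) ne by simp
qed

text \<open>A Koszul letter for x_i uses up one power of x_i. The lcm of the Taylor letters
  therefore divides al with that power removed and cannot be equal to al.\<close>

lemma ppA_X:
 assumes "(al, l) : CA" "xv l ~= {}" "set m <= set l"
 shows "ppA (al, m) = (0 :: ('g list, 'k::field) fv)"
proof -
 have False if x: "xv m = {}" and e: "lc (map projl m) = al"
 proof -
  obtain i where i: "i : xv l" using assms(2) by blast
  have "set (map projl m) = gl m" by (rule gl_projl[OF x])
  hence "mle (lc (map projl m)) (al - sqf (xv l))" using gl_xv_mono[OF assms(3)] by (intro lc_le(2)[OF assms(1)]) simp
  hence "lkp al i <= lkp al i - lkp (sqf (xv l)) i" using e unfolding mle_def lookup_minus by metis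
  moreover have "lkp (sqf (xv l)) i <= lkp al i" using assms(1) by (auto simp: inA_def mle_def)
  moreover have "lkp (sqf (xv l)) i = 1" using i by (simp add: lookup_sqf)
  ultimately show False by simp
 qed
 thus ?thesis by (auto simp: ppA_def)
qed

text \<open>Both sides retain the boundary terms of lcm exactly al. Since the boundary never raises
  an lcm, no such term can come from a list whose lcm is a proper divisor of al.\<close>

lemma ppA_chain:
 assumes "a : CA"
 shows "lin ppA (fA a) = (lin bt (ppA a) :: ('g list, 'k::field) fv)"
proof -
 obtain al l where a: "a = (al, l)" by (cases a)
 have e: "lin ppA (fA a) = (lin (%x. ppA (al, x)) (bd l) :: ('g list, 'k) fv)" by (simp add: a fA_def lin_lin)
 show ?thesis
 proof (cases "xv l = {}")
  case False
  have "lin (%x. ppA (al, x)) (bd l) = (lin (%x. 0) (bd l) :: ('g list, 'k) fv)"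
  proof (rule lin_cong)
   fix x assume "x : keys (bd l :: ('g + nat) list \<Rightarrow>\<^sub>0 'k)"
   hence "set x <= set l" using keys_bd by blast
   thus "ppA (al, x) = (0 :: ('g list, 'k) fv)" by (rule ppA_X[OF assms[unfolded a] False])
  qed
  thus ?thesis using False by (simp add: e) (simp add: a ppA_def)
 next
  case True
  define k where "k = map projl l"
  have l: "l = map Inl k" unfolding k_def by (rule xv_empty[OF True])
  have "mle (lc k) (al - sqf (xv l))" by (rule lc_le(2)[OF assms[unfolded a]]) (simp add: l)
  hence le: "mle (lc k) al" using True by simp
  have "lin ppA (fA a) = (lin (%x. if lc x = al then unit_vec x else 0) (bd k) :: ('g list, 'k) fv)"
   unfolding e l bd_map lin_lin by (simp add: ppA_map)
  also have "... = (if lc k = al then bt k else 0)"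
  proof (cases "lc k = al")
   case True
   thus ?thesis by (simp add: deg_part_def restr_def)
  next
   case False
   have "lin (%x. if lc x = al then unit_vec x else 0) (bd k) = (lin (%x. 0) (bd k) :: ('g list, 'k) fv)"
   proof (rule lin_cong)
    fix x assume "x : keys (bd k :: ('g list, 'k) fv)"
    hence "mle (lc x) (lc k)" by (rule bd_mle)
    thus "(if lc x = al then unit_vec x else 0 :: ('g list, 'k) fv) = 0" using le False mle_antisym by auto
   qed
   thus ?thesis using False by simp
  qed
  also have "... = lin bt (ppA a)" by (simp add: a l ppA_map)
  finally show ?thesis .
 qed
qed

text \<open>Each lcm divides its multidegree. For coprime multidegrees the joint lcm is the product
  of the two, so it is full only if both are full.\<close>

lemma ppA_mult:
 assumes "a : CA" "b : CA"
 shows "lin ppA (muA a b) = (lin2 mu0 (ppA a) (ppA b) :: ('g list, 'k::field) fv)"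
proof -
 obtain al l \<beta> m where ab: "a = (al, l)" "b = (\<beta>, m)" by (cases a; cases b)
 show ?thesis
 proof (cases "xv l = {} & xv m = {}")
  case False
  hence "ppA a = (0 :: ('g list, 'k) fv) | ppA b = (0 :: ('g list, 'k) fv)" by (auto simp: ab ppA_def)
  hence "lin2 mu0 (ppA a) (ppA b) = (0 :: ('g list, 'k) fv)" by auto
  moreover have "lin ppA (muA a b) = (0 :: ('g list, 'k) fv)" using False by (auto simp: ab muA_def ppA_def)
  ultimately show ?thesis by simp
 next
  case True
  define k j where "k = map projl l" and "j = map projl m"
  have l: "l = map Inl k" "m = map Inl j" unfolding k_def j_def by (rule xv_empty, use True in simp)+
  have "mle (lc k) (al - sqf (xv l))" by (rule lc_le(2)[OF assms(1)[unfolded ab]]) (simp add: l)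
  moreover have "mle (lc j) (\<beta> - sqf (xv m))" by (rule lc_le(2)[OF assms(2)[unfolded ab]]) (simp add: l)
  ultimately have le: "mle (lc k) al" "mle (lc j) \<beta>" using True by simp_all
  have iff: "lc (k @ j) = al + \<beta> \<longleftrightarrow> lc k = al & lc j = \<beta>" if d: "disj al \<beta>"
  proof -
   have "disj (lc k) (lc j)" using d le unfolding disj_def mle_def by (metis le_zero_eq)
   hence e: "lc (k @ j) = lc k + lc j" using coprm_iff[of k j] unfolding coprm_def by simp
   have "lc k = al & lc j = \<beta>" if s: "lc k + lc j = al + \<beta>"
   proof -
    have p: "lkp (lc k) i = lkp al i & lkp (lc j) i = lkp \<beta> i" for i
    proof -
     have "lkp (lc k) i + lkp (lc j) i = lkp al i + lkp \<beta> i" using s by (metis lookup_add)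
     moreover have "lkp (lc k) i <= lkp al i" "lkp (lc j) i <= lkp \<beta> i" using le by (simp_all add: mle_def)
     ultimately show ?thesis by linarith
    qed
    thus ?thesis by (intro conjI poly_mapping_eqI) auto
   qed
   thus ?thesis using e by auto
  qed
  have "ppA (al + \<beta>, map Inl k @ map Inl j) = (if lc (k @ j) = al + \<beta> then unit_vec (k @ j) else 0 :: ('g list, 'k) fv)"
   using ppA_map[of "al + \<beta>" "k @ j", where 'k = 'k] by simp
  hence L: "lin ppA (muA a b) = (if disj al \<beta> & lc k = al & lc j = \<beta> then unit_vec (k @ j) else 0 :: ('g list, 'k) fv)"
   using iff by (auto simp: ab l muA_def)
  show ?thesis unfolding L by (auto simp: ab l ppA_map lin2_def mu0_def coprm_iff)
 qed
qed

text \<open>The naive lift \<open>c0\<close> puts each list l into multidegree lc l; its boundary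
  consists of lists whose lcm has dropped. As long as Taylor letters are present, a variable in
  which the lcm dropped provides a Koszul letter to cone with. What remains has no Taylor letter,
  and is contracted by a Koszul letter at the price of coefficients in J instead of I. Neither
  correction is seen by \<open>ppA\<close>.\<close>

lemma ppA_onto:
 fixes z :: "('g list, 'k::field) fv"
 assumes z: "keys z <= {m : LL. length m = q}" and bz: "lin bt z = 0"
 shows "EX x. keys x <= CA \<inter> {b. length (snd b) = q} & lin fA x = 0 & lin ppA x = z"
proof (cases q)
 case 0
 have "l ~: keys z" for l using z 0 by auto
 hence "keys z = {}" by blast
 hence "z = 0" by simp
 thus ?thesis by (intro exI[of _ 0]) simp
next
 case (Suc j)
 let ?e = "%l. (lc l, map Inl l) :: expo \<times> ('g + nat) list"
 define c0 where "c0 = (lin (%l. unit_vec (?e l)) z :: (_, 'k) fv)"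
 define r where "r = lin fA c0"
 \<comment> \<open>Here some variable has slack: its exponent in al exceeds that in every Taylor
   letter. In \<open>G0\<close> there are no Taylor letters at all.\<close>
 define Q where "Q = {(al, l). (al, l) : NA & gl l ~= {} & (EX i. \<forall>u\<in>gl l. lkp (gs u) i < lkp al i)}"
 define G0 where "G0 = {(al, l). (al, l) : NA & gl l = {}}"
 have lcN: "?e l : NA" if l: "l : LL" for l
 proof -
  have ex: "lc l : exponents n" by (rule lc_exponents) (use l gs in auto)
  obtain u where u: "u : set l" using l by (cases l) auto
  have "lc l : WI" using ex u l mle_gs_lc[OF u] by (auto simp: WI_def)
  thus ?thesis using ex l mle_gs_lc by (auto simp: inA_def)
 qed
 have kc0: "keys c0 <= NA \<inter> {b. length (snd b) = q}" unfolding c0_def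
 proof (rule keys_lin_subset)
  fix l assume "l : keys z"
  hence "l : LL" "length l = q" using z by auto
  thus "keys (unit_vec (?e l) :: (_, 'k) fv) <= NA \<inter> {b. length (snd b) = q}" using lcN[of l] by simp
 qed
 \<comment> \<open>The boundary terms of unchanged lcm add up to zero because z is a cycle for
   \<open>bt\<close>.\<close>
 have rr: "r = lin (%l. lin (%x. if lc x = lc l then 0 else unit_vec (lc l, map Inl x)) (bd l)) z"
 proof -
  have "r = lin (%l. lin (%x. unit_vec (lc l, map Inl x)) (bd l)) z"
   by (simp add: r_def c0_def lin_lin fA_def bd_map)
  moreover have "lin (%l. lin (%x. if lc x = lc l then unit_vec (lc l, map Inl x) else 0) (bd l)) z = (0 :: expo \<times> ('g + nat) list \<Rightarrow>\<^sub>0 'k)"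
  proof -
   have "lin (%x. unit_vec (?e x)) (lin bt z) = lin (%l. lin (%x. if lc x = lc l then unit_vec (lc l, map Inl x) else (0 :: expo \<times> ('g + nat) list \<Rightarrow>\<^sub>0 'k)) (bd l)) z"
    unfolding deg_part_def restr_def lin_lin by (intro lin_cong) auto
   thus ?thesis using bz by simp
  qed
  ultimately have "r = lin (%l. lin (%x. unit_vec (lc l, map Inl x)) (bd l)) z
    - lin (%l. lin (%x. if lc x = lc l then unit_vec (lc l, map Inl x) else 0) (bd l)) z" by simp
  also have "... = lin (%l. lin (%x. unit_vec (lc l, map Inl x) - (if lc x = lc l then unit_vec (lc l, map Inl x) else 0)) (bd l)) z"
   by (simp only: lin_fun_diff)
  also have "... = lin (%l. lin (%x. if lc x = lc l then 0 else unit_vec (lc l, map Inl x)) (bd l)) z"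
   by (intro lin_cong) simp
  finally show ?thesis .
 qed
 have fr: "lin fA r = 0"
 proof -
  have "lin fA r = lin (%a. lin fA (fA a)) c0" by (simp add: r_def lin_lin)
  thus ?thesis by (simp add: fA_fA)
 qed
 have kr: "keys r <= Q \<union> G0"
  unfolding rr
 proof (rule keys_lin_subset, rule keys_lin_subset)
  fix l x assume l: "l : keys z" and x: "x : keys (bd l :: ('g list, 'k) fv)"
  have lL: "l : LL" using l z by blast
  have N: "(lc l, map Inl x) : NA"
   by (rule inA_sub[OF WI_up lcN[OF lL]]) (use keys_bd[OF x] in auto)
  have "(lc l, map Inl x) : Q \<union> G0" if ne: "lc x ~= lc l"
  proof (cases "x = []")
   case True
   thus ?thesis using N by (simp add: G0_def)
  next
   case False
   have le: "mle (lc x) (lc l)" by (rule bd_mle[OF x])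
   obtain i where "lkp (lc x) i ~= lkp (lc l) i" using ne by (metis poly_mapping_eqI)
   moreover have "lkp (lc x) i <= lkp (lc l) i" using le by (simp add: mle_def)
   ultimately have i: "lkp (lc x) i < lkp (lc l) i" by simp
   have "lkp (gs u) i < lkp (lc l) i" if "u : set x" for u
    using mle_gs_lc[OF that] i by (meson le_less_trans mle_def)
   thus ?thesis using N False by (auto simp: Q_def)
  qed
  thus "keys (if lc x = lc l then 0 else unit_vec (lc l, map Inl x) :: (_, 'k) fv) <= Q \<union> G0" by simp
 qed
 have QN: "a : Q \<union> G0 ==> a : NA" for a by (auto simp: Q_def G0_def)
 have fQG: "b : Q \<union> G0" if a: "a : Q \<union> G0" and b: "b : keys (fA a :: (_, 'k) fv)" for a b
 proof -
  obtain al l where aa: "a = (al, l)" by (cases a)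
  obtain m where m: "b = (al, m)" "set m <= set l" using keys_fA[of b al l, where 'k = 'k] b unfolding aa by blast
  have "b : NA" using fA_in(2)[OF _ b] QN[OF a] NA_CA by blast
  moreover have "gl m <= gl l" using gl_xv_mono[OF m(2)] by blast
  ultimately show ?thesis using a by (auto simp: Q_def G0_def aa m(1))
 qed
 have fG: "b : G0" if a: "a : G0" and b: "b : keys (fA a :: (_, 'k) fv)" for a b
 proof -
  obtain al l where aa: "a = (al, l)" by (cases a)
  obtain m where m: "b = (al, m)" "set m <= set l" using keys_fA[of b al l, where 'k = 'k] b unfolding aa by blast
  show ?thesis using fQG[OF _ b] a gl_xv_mono[OF m(2)] by (auto simp: Q_def G0_def aa m(1))
 qed
 have QG: "Q \<inter> G0 = {}" by (auto simp: Q_def G0_def)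
 let ?fQ = "%a. restr Q (fA a) :: (_, 'k) fv"
 have fQr: "lin ?fQ (restr Q v) = restr Q (lin fA v)" if v: "keys v <= Q \<union> G0" for v
 proof -
  have "restr Q (lin fA v) = lin (%a. lin ?fQ (if a : Q then unit_vec a else 0)) v" unfolding restr_lin
  proof (rule lin_cong)
   fix a assume "a : keys v"
   hence "a : Q | a : G0" using v by blast
   moreover have "restr Q (fA a :: (_, 'k) fv) = 0" if "a : G0" unfolding restr_zero_iff using fG[OF that] QG by blast
   ultimately show "restr Q (fA a) = lin ?fQ (if a : Q then unit_vec a else 0)" by auto
  qed
  thus ?thesis by (simp add: restr_def[of Q v] lin_lin)
 qed
 \<comment> \<open>The slack variable is chosen from the set of Taylor letters alone, so the cone
   formula is exact while that set is preserved; error terms have fewer distinct Taylor letters. The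
   complex is taken relative to \<open>G0\<close>, where there is no Taylor letter left to guarantee
   the coefficient.\<close>
 define ii where "ii al U = (SOME i. \<forall>u\<in>U. lkp (gs u) i < lkp al i)" for al :: "nat \<Rightarrow>\<^sub>0 nat" and U :: "'g set"
 let ?h = "%(al, l). unit_vec (al, Inr (ii al (gl l)) # l) :: expo \<times> ('g + nat) list \<Rightarrow>\<^sub>0 'k"
 have "EX y. keys y <= Q & lin ?fQ y = restr Q r"
 proof (rule triangular_acyclic[where m = "%a. card (gl (snd a))" and h = ?h])
  show "keys (restr Q r) <= Q" by (simp add: keys_restr)
  show "lin ?fQ (restr Q r) = 0" unfolding fQr[OF kr] fr by simp
  fix a assume a: "a : Q"
  show "keys (?fQ a) <= Q" by (simp add: keys_restr)
  have "keys (fA a :: (_, 'k) fv) <= Q \<union> G0" using fQG a by blast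
  from fQr[OF this] show "lin ?fQ (?fQ a) = 0" by (simp add: fA_fA)
  obtain al l where aa: "a = (al, l)" by (cases a)
  have A: "al : exponents n" "gl l <= GL" "mle (sqf (xv l)) al" "\<forall>u\<in>gl l. mle (gs u + sqf (xv l)) al" "al - sqf (xv l) : WI"
   and ne: "gl l ~= {}" and exi: "EX i. \<forall>u\<in>gl l. lkp (gs u) i < lkp al i"
   using a by (auto simp: Q_def inA_def aa)
  let ?i = "ii al (gl l)"
  have i: "\<forall>u\<in>gl l. lkp (gs u) ?i < lkp al ?i" unfolding ii_def by (rule someI_ex[OF exi])
  have m: "mle (gs u + sqf (insert ?i (xv l))) al" if u: "u : gl l" for u
   unfolding mle_def
  proof
   fix c
   have "lkp (gs u + sqf (xv l)) c <= lkp al c" using A(4) u by (simp add: mle_def)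
   moreover have "lkp (gs u) ?i < lkp al ?i" using i u by blast
   ultimately show "lkp (gs u + sqf (insert ?i (xv l))) c <= lkp al c" by (auto simp: lookup_add lookup_sqf)
  qed
  obtain u where u: "u : gl l" using ne by blast
  have ms: "mle (gs u) (al - sqf (insert ?i (xv l)))" "mle (sqf (insert ?i (xv l))) al"
   using m[OF u] by (auto simp: mle_plus_iff)
  have "al - sqf (insert ?i (xv l)) : WI" using ms(1) u A(2) exponents_diff[OF A(1)] by (auto simp: WI_def)
  hence "(al, Inr ?i # l) : Q" using A m ms ne i by (auto simp: Q_def inA_def)
  thus "keys (?h a) <= Q" by (simp add: aa)
  have xQ: "(al, x) : Q \<longleftrightarrow> gl x ~= {}" "(al, Inr ?i # x) : Q \<longleftrightarrow> gl x ~= {}" if x: "x : keys (bd l :: (_, 'k) fv)" for x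
  proof -
   have s: "set x <= set l" using keys_bd[OF x] by blast
   have s': "set (Inr ?i # x) <= set (Inr ?i # l)" using s by auto
   have N: "(al, x) : NA" "(al, Inr ?i # x) : NA"
    using inA_sub[where W = WI and al = al, OF WI_up _ s] inA_sub[where W = WI and al = al, OF WI_up _ s'] a \<open>(al, Inr ?i # l) : Q\<close> by (auto simp: aa Q_def)
   have "EX i. \<forall>u\<in>gl x. lkp (gs u) i < lkp al i" using exi gl_xv_mono[OF s] by blast
   thus "(al, x) : Q \<longleftrightarrow> gl x ~= {}" "(al, Inr ?i # x) : Q \<longleftrightarrow> gl x ~= {}" using N by (auto simp: Q_def)
  qed
  let ?d = "%x. if gl x ~= {} then unit_vec (al, Inr (ii al (gl x)) # x) - unit_vec (al, Inr ?i # x) else 0 :: (_, 'k) fv"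
  have e1: "lin ?fQ (?h a) = unit_vec a - lin (%x. if gl x ~= {} then unit_vec (al, Inr ?i # x) else 0) (bd l)"
  proof -
   have "lin ?fQ (?h a) = restr Q (unit_vec a) - restr Q (lin (%x. unit_vec (al, Inr ?i # x)) (bd l))"
    by (simp add: aa fA_def lin_lin)
   also have "restr Q (lin (%x. unit_vec (al, Inr ?i # x)) (bd l)) = lin (%x. if gl x ~= {} then unit_vec (al, Inr ?i # x) else 0 :: (_, 'k) fv) (bd l)"
    unfolding restr_lin by (rule lin_cong) (simp add: restr_single xQ)
   finally show ?thesis using a by (simp add: restr_single)
  qed
  have e2: "lin ?h (?fQ a) = lin (%x. if gl x ~= {} then unit_vec (al, Inr (ii al (gl x)) # x) else 0) (bd l)"
   unfolding aa fA_def prod.case restr_lin lin_lin by (rule lin_cong) (simp add: restr_single xQ)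
  have "lin ?fQ (?h a) + lin ?h (?fQ a) - unit_vec a = lin ?d (bd l)"
  proof -
   have "lin ?d (bd l) = lin (%x. (if gl x ~= {} then unit_vec (al, Inr (ii al (gl x)) # x) else 0) - (if gl x ~= {} then unit_vec (al, Inr ?i # x) else 0)) (bd l :: (_, 'k) fv)"
    by (rule lin_cong) simp
   thus ?thesis unfolding e1 e2 lin_fun_diff by simp
  qed
  moreover have "keys (lin ?d (bd l)) <= {b. card (gl (snd b)) < card (gl (snd a))}"
  proof (rule keys_lin_subset)
   fix x assume x: "x : keys (bd l :: (_, 'k) fv)"
   have sub: "gl x <= gl l" using gl_xv_mono[of x l] keys_bd[OF x] by blast
   show "keys (?d x) <= {b. card (gl (snd b)) < card (gl (snd a))}"
   proof (cases "gl x = gl l")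
    case True
    thus ?thesis by simp
   next
    case False
    hence "card (gl x) < card (gl l)" using sub by (intro psubset_card_mono) auto
    hence "keys (unit_vec (al, Inr (ii al (gl x)) # x) - unit_vec (al, Inr ?i # x) :: (_, 'k) fv) <= {b. card (gl (snd b)) < card (gl (snd a))}"
     by (intro keys_diff_subset) (simp_all add: aa)
    thus ?thesis by simp
   qed
  qed
  ultimately show "keys (lin ?fQ (?h a) + lin ?h (?fQ a) - unit_vec a) <= {b. card (gl (snd b)) < card (gl (snd a))}" by simp
 qed
 then obtain y0 where y0: "keys y0 <= Q" "lin ?fQ y0 = restr Q r" by blast
 have lenr: "keys r <= {b. length (snd b) = j}"
 proof
  fix b assume "b : keys r"
  then obtain a where a: "a : keys c0" "b : keys (fA a :: (_, 'k) fv)" unfolding r_def by (rule keys_linE)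
  have "a : CA" "length (snd a) = q" using a(1) kc0 NA_CA by auto
  thus "b : {b. length (snd b) = j}" using fA_in(1)[OF _ a(2)] Suc by auto
 qed
 have "EX y. keys y <= Q \<inter> {b. length (snd b) = Suc j} & lin ?fQ y = restr Q r"
 proof (rule graded_preimage[OF _ y0])
  show "keys (restr Q r) <= {b. length (snd b) = j}" using lenr by (auto simp: keys_restr)
  fix a b assume a: "a : Q" and b: "b : keys (?fQ a)"
  have "a : CA" using QN[of a] a NA_CA by blast
  moreover have "b : keys (fA a :: (_, 'k) fv)" using b by (simp add: keys_restr)
  ultimately show "length (snd a) = Suc (length (snd b))" using fA_in(1) by blast
 qed
 then obtain y where y: "keys y <= Q \<inter> {b. length (snd b) = Suc j}" "lin ?fQ y = restr Q r" by blast
 define \<rho> where "\<rho> = r - lin fA y"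
 have kfy: "keys (lin fA y) <= Q \<union> G0" by (rule keys_lin_subset) (use y(1) fQG in blast)
 have "restr Q (lin fA y) = restr Q r"
 proof -
  have yQ: "keys y <= Q" "keys y <= Q \<union> G0" using y(1) by auto
  show ?thesis using fQr[OF yQ(2)] y(2) by (simp add: restr_id[OF yQ(1)])
 qed
 hence "restr Q \<rho> = 0" by (simp add: \<rho>_def)
 moreover have "keys \<rho> <= Q \<union> G0" unfolding \<rho>_def by (rule keys_diff_subset[OF kr kfy])
 ultimately have k\<rho>: "keys \<rho> <= G0" unfolding restr_zero_iff by blast
 have f\<rho>: "lin fA \<rho> = 0"
 proof -
  have "lin fA (lin fA y) = lin (%a. lin fA (fA a)) y" by (rule lin_lin)
  thus ?thesis using fr by (simp add: \<rho>_def fA_fA)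
 qed
 have len\<rho>: "keys \<rho> <= {b. length (snd b) = j}" unfolding \<rho>_def
 proof (rule keys_diff_subset[OF lenr], rule keys_lin_subset)
  fix a assume "a : keys y"
  hence "a : CA" "length (snd a) = Suc j" using y(1) QN NA_CA by blast+
  thus "keys (fA a :: (_, 'k) fv) <= {b. length (snd b) = j}" using fA_in(1) by fastforce
 qed
 \<comment> \<open>Any variable occurring in al serves; it depends on al only, so the contraction of
   \<open>G0\<close> has no error term.\<close>
 define st where "st al = (SOME i. lkp al i ~= 0)" for al :: "nat \<Rightarrow>\<^sub>0 nat"
 define w where "w = lin (%(al, l). unit_vec (al, Inr (st al) # l)) \<rho>"
 have wC: "(al, Inr (st al) # l) : CA" if al: "(al, l) : G0" for al l
 proof -
  have A: "al : exponents n" "gl l = {}" "mle (sqf (xv l)) al" "al - sqf (xv l) : WI"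
   using al by (auto simp: G0_def inA_def)
  have "al ~= 0"
  proof
   assume "al = 0"
   moreover have "0 - sqf (xv l) = 0" by (rule poly_mapping_eqI) (simp add: lookup_minus)
   ultimately have "0 : WI" using A(4) by simp
   thus False using WI_WJ J_zero by blast
  qed
  hence "EX i. lkp al i ~= 0" by (metis lookup_zero poly_mapping_eqI)
  hence st: "lkp al (st al) ~= 0" unfolding st_def by (rule someI_ex)
  have m: "mle (sqf (insert (st al) (xv l))) al" unfolding mle_def
  proof
   fix c
   have "lkp (sqf (xv l)) c <= lkp al c" using A(3) by (simp add: mle_def)
   thus "lkp (sqf (insert (st al) (xv l))) c <= lkp al c" using st by (auto simp: lookup_sqf)
  qed
  have "al - sqf (insert (st al) (xv l)) : WJ"
  proof (cases "st al : xv l")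
   case True
   thus ?thesis using WI_WJ[OF A(4)] by (simp add: insert_absorb)
  next
   case False
   \<comment> \<open>A new Koszul letter divides the coefficient by one more variable. The
     coefficient may leave I, but it stays in J by \<open>J_minus\<close>.\<close>
   have "al - sqf (insert (st al) (xv l)) = al - sqf (xv l) - sgl (st al) 1"
    by (rule poly_mapping_eqI) (use False in \<open>auto simp: lookup_minus lookup_sqf lookup_single when_def\<close>)
   thus ?thesis using J_minus[OF A(4)] by simp
  qed
  thus ?thesis using A m by (simp add: inA_def)
 qed
 have kw: "keys w <= CA \<inter> {b. length (snd b) = q}" unfolding w_def
 proof (rule keys_lin_subset)
  fix a assume a: "a : keys \<rho>"
  obtain al l where aa: "a = (al, l)" by (cases a)
  have "(al, l) : G0" "length l = j" using a k\<rho> len\<rho> aa by auto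
  thus "keys ((case a of (al, l) => unit_vec (al, Inr (st al) # l)) :: (_, 'k) fv) <= CA \<inter> {b. length (snd b) = q}"
   using wC Suc by (simp add: aa)
 qed
 have fw: "lin fA w = \<rho>"
 proof -
  have "lin fA w = lin (%a. unit_vec a - lin (%(al, l). unit_vec (al, Inr (st al) # l)) (fA a)) \<rho>"
   unfolding w_def lin_lin by (rule lin_cong) (auto simp: fA_def lin_lin split: prod.splits)
  also have "... = \<rho> - lin (%(al, l). unit_vec (al, Inr (st al) # l)) (lin fA \<rho>)" by (simp add: lin_fun_diff lin_lin)
  finally show ?thesis using f\<rho> by simp
 qed
 \<comment> \<open>With slack in x_i the lcm of the Taylor letters divides al / x_i, so it is not
   al.\<close>
 have ppy: "lin ppA y = (0 :: ('g list, 'k) fv)"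
 proof -
  have "lin ppA y = lin (%a. 0 :: ('g list, 'k) fv) y"
  proof (rule lin_cong)
   fix a assume "a : keys y"
   hence aQ: "a : Q" using y(1) by blast
   obtain al l where aa: "a = (al, l)" by (cases a)
   obtain i where i: "\<forall>u\<in>gl l. lkp (gs u) i < lkp al i" and ne: "gl l ~= {}" using aQ by (auto simp: Q_def aa)
   have False if x: "xv l = {}" and e: "lc (map projl l) = al"
   proof -
    have s: "set (map projl l) = gl l" by (rule gl_projl[OF x])
    have pos: "0 < lkp al i" using i ne by (metis all_not_in_conv gr0I not_less0)
    have "mle (lc (map projl l)) (al - sgl i 1)" unfolding mle_lc s
    proof
     fix u assume u: "u : gl l"
     have "mle (gs u) (lc (map projl l))" by (rule mle_gs_lc) (use u s in blast)
     hence "lkp (gs u) c <= lkp al c" for c using e by (simp add: mle_def)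
     thus "mle (gs u) (al - sgl i 1)"
     using i u by (auto simp: mle_def lookup_minus lookup_single when_def)
    qed
    hence "lkp al i <= lkp al i - 1" using e by (auto simp: mle_def lookup_minus lookup_single when_def dest: spec[of _ i])
    thus False using pos by simp
   qed
   thus "ppA a = (0 :: ('g list, 'k) fv)" by (auto simp: aa ppA_def)
  qed
  thus ?thesis by simp
 qed
 have ppw: "lin ppA w = (0 :: ('g list, 'k) fv)"
 proof -
  have "lin ppA w = lin (%a. 0 :: ('g list, 'k) fv) \<rho>"
   unfolding w_def lin_lin by (rule lin_cong) (auto simp: ppA_def split: prod.splits)
  thus ?thesis by simp
 qed
 have ppc: "lin ppA c0 = z" by (simp add: c0_def lin_lin ppA_map)
 have "keys (c0 - y - w) <= CA \<inter> {b. length (snd b) = q}"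
  by (intro keys_diff_subset kw) (use kc0 y(1) QN NA_CA Suc in blast)+
 moreover have "lin fA (c0 - y - w) = 0" using fw by (simp add: r_def[symmetric] \<rho>_def)
 moreover have "lin ppA (c0 - y - w) = z" by (simp add: ppy ppw ppc)
 ultimately show ?thesis by blast
qed

lemma word_lifting_acyclic_ideal: "word_lifting TYPE('k::field)"
proof (rule word_lifting_massey[OF massey_A])
 show "keys (ppA a :: ('g list, 'k) fv) <= {m : LL. length m = length (snd a)}" if "a : CA" for a
  using lc_le(1)[of "fst a" "snd a"] that by (auto simp: ppA_def subset_iff split: prod.splits)
qed (rule ppA_chain ppA_mult ppA_onto; assumption)+

end

end

section \<open>Betti numbers from the explicit resolutions, and the three cases for one
  orbit\<close>

section \<open>Betti numbers from the two resolutions\<close>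

lemma module_restrict:
 assumes S: "cring S" and R: "cring R" and f: "f : Ring.ring_hom S R"
 shows "module S (restrict_scalars f (ring_module R))"
proof -
 interpret S: cring S by (rule S)
 interpret R: cring R by (rule R)
 let ?M = "restrict_scalars f (ring_module R)"
 have sel: "carrier ?M = carrier R" "!!x y. x \<oplus>\<^bsub>?M\<^esub> y = x \<oplus>\<^bsub>R\<^esub> y" "\<zero>\<^bsub>?M\<^esub> = \<zero>\<^bsub>R\<^esub>" "!!a x. a \<odot>\<^bsub>?M\<^esub> x = f a \<otimes>\<^bsub>R\<^esub> x"
  by (simp_all add: restrict_scalars_def ring_module_def)
 have fc: "!!a. a : carrier S ==> f a : carrier R" "!!a b. a : carrier S ==> b : carrier S ==> f (a \<oplus>\<^bsub>S\<^esub> b) = f a \<oplus>\<^bsub>R\<^esub> f b"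
  "!!a b. a : carrier S ==> b : carrier S ==> f (a \<otimes>\<^bsub>S\<^esub> b) = f a \<otimes>\<^bsub>R\<^esub> f b" "f \<one>\<^bsub>S\<^esub> = \<one>\<^bsub>R\<^esub>"
  using f by (auto simp: Ring.ring_hom_def)
 have "abelian_group ?M"
 proof (rule abelian_groupI)
  show "\<exists>y\<in>carrier ?M. y \<oplus>\<^bsub>?M\<^esub> x = \<zero>\<^bsub>?M\<^esub>" if "x : carrier ?M" for x
   using that R.l_neg[of x] R.a_inv_closed[of x] unfolding sel by blast
 qed (simp_all add: sel R.a_ac)
 thus ?thesis
  by (intro moduleI S) (simp_all add: sel fc R.l_distr R.r_distr R.m_assoc)
qed

context bar_min
begin

lemma WI_ups: "WI = ups n (gs ` GL)" by (auto simp: WI_def ups_def)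

lemma zero_notin_WI: "0 ~: WI"
proof
 assume "0 : WI"
 then obtain u where u: "u : GL" "mle (gs u) 0" by (auto simp: WI_def)
 hence "lkp (gs u) (ix u) = 0" by (simp add: mle_def)
 thus False using ix[OF u(1)] by simp
qed

lemma quotient_facts:
 fixes I :: "'k::field mpol set"
 assumes I: "I = {p. keys p <= WI}"
 shows "cring (mpoly_ring n Quot I)" "(%s. I +>\<^bsub>mpoly_ring n\<^esub> s) : Ring.ring_hom (mpoly_ring n) (mpoly_ring n Quot I)"
  "carrier (mpoly_ring n Quot I) = (%s. I +>\<^bsub>mpoly_ring n\<^esub> s) ` carrier (mpoly_ring n)"
  "p : carrier (mpoly_ring n) ==> I +>\<^bsub>mpoly_ring n\<^esub> p = \<zero>\<^bsub>mpoly_ring n Quot I\<^esub> \<longleftrightarrow> keys p <= WI"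
  "p : carrier (mpoly_ring n) ==> the_elem (const_coeff ` (I +>\<^bsub>mpoly_ring n\<^esub> p)) = const_coeff p"
proof -
 interpret S: cring "mpoly_ring n :: 'k mpol ring" by (rule cring_mpoly_ring)
 have Id: "ideal I (mpoly_ring n)" unfolding I WI_ups by (rule ideal_ups)
 interpret Id: ideal I "mpoly_ring n" by (rule Id)
 show "cring (mpoly_ring n Quot I)" by (rule Id.quotient_is_cring[OF cring_mpoly_ring])
 show "(%s. I +>\<^bsub>mpoly_ring n\<^esub> s) : Ring.ring_hom (mpoly_ring n) (mpoly_ring n Quot I)" by (rule Id.rcos_ring_hom)
 show "carrier (mpoly_ring n Quot I) = (%s. I +>\<^bsub>mpoly_ring n\<^esub> s) ` carrier (mpoly_ring n)"
  by (auto simp: FactRing_def A_RCOSETS_def')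
 assume p: "p : carrier (mpoly_ring n)"
 have z: "\<zero>\<^bsub>mpoly_ring n Quot I\<^esub> = I" by (simp add: FactRing_def)
 have "I +>\<^bsub>mpoly_ring n\<^esub> p = I \<longleftrightarrow> p : I" using Id.rcos_const_imp_mem[OF p] S.a_rcos_zero[OF Id] by blast
 thus "I +>\<^bsub>mpoly_ring n\<^esub> p = \<zero>\<^bsub>mpoly_ring n Quot I\<^esub> \<longleftrightarrow> keys p <= WI" unfolding z by (simp add: I)
 have c0: "const_coeff q = 0" if "q : I" for q :: "'k mpol"
 proof -
  have "0 ~: keys q" using that zero_notin_WI by (auto simp: I)
  thus ?thesis by (simp add: const_coeff_def in_keys_iff)
 qed
 have zI: "0 : I" by (simp add: I)
 have "const_coeff ` (I +>\<^bsub>mpoly_ring n\<^esub> p) = {const_coeff p}"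
 proof
  show "const_coeff ` (I +>\<^bsub>mpoly_ring n\<^esub> p) <= {const_coeff p}"
   using c0 by (auto simp: a_r_coset_def' mpoly_ring_sel const_coeff_def lookup_add)
  have "p : I +>\<^bsub>mpoly_ring n\<^esub> p" using zI by (auto simp: a_r_coset_def' mpoly_ring_sel intro: bexI[of _ 0])
  thus "{const_coeff p} <= const_coeff ` (I +>\<^bsub>mpoly_ring n\<^esub> p)" by blast
 qed
 thus "the_elem (const_coeff ` (I +>\<^bsub>mpoly_ring n\<^esub> p)) = const_coeff p" by simp
qed

text \<open>The instance with \<open>W\<close> empty and lists as basis. The strand at al consists
  of all lists over the generators dividing al; if there is such a generator, prepending it
  contracts the strand, and otherwise only the empty list is left. The minimal part of this
  resolution is \<open>bt\<close>.\<close>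

lemma quot_betti_eq:
 fixes I :: "'k::field mpol set"
 assumes I: "I = {p. keys p <= WI}"
 shows "quot_betti n I j = pm.dim {x :: (_, 'k) fv. keys x <= {l. set l <= GL & length l = j} & lin bt x = 0}
   - pm.dim (lin (bt :: _ => (_, 'k) fv) ` {y. keys y <= {l. set l <= GL & length l = Suc j}})"
proof -
 note qf = quotient_facts[OF I]
 interpret R: cring "mpoly_ring n Quot I" by (rule qf(1))
 interpret T: mono_quotient n "mpoly_ring n :: 'k mpol ring" "%p. p" "{}" const_coeff const_pol
  by (rule mono_quotient.intro) (auto simp: mpoly_ring_sel Ring.ring_hom_def cring_mpoly_ring)
 let ?M = "restrict_scalars (%s. I +>\<^bsub>mpoly_ring n\<^esub> s) (ring_module (mpoly_ring n Quot I))"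
 let ?g = "\<one>\<^bsub>mpoly_ring n Quot I\<^esub>"
 let ?LB = "%j. {l. set l <= GL & length l = j}"
 have sel: "carrier ?M = carrier (mpoly_ring n Quot I)" "\<zero>\<^bsub>?M\<^esub> = \<zero>\<^bsub>mpoly_ring n Quot I\<^esub>"
  "!!a x. a \<odot>\<^bsub>?M\<^esub> x = (I +>\<^bsub>mpoly_ring n\<^esub> a) \<otimes>\<^bsub>mpoly_ring n Quot I\<^esub> x"
  by (simp_all add: restrict_scalars_def ring_module_def)
 have ag: "a \<odot>\<^bsub>?M\<^esub> ?g = I +>\<^bsub>mpoly_ring n\<^esub> a" if "a : carrier (mpoly_ring n)" for a
  unfolding sel by (rule R.r_one) (use qf(3) that in blast)
 have "kdim const_pol (Tor (mpoly_ring n) j ?M (restrict_scalars const_coeff (ring_module class_ring))) =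
  pm.dim {x :: (_, 'k) fv. keys x <= ?LB j & lin bt x = 0} - pm.dim (lin (bt :: _ => (_, 'k) fv) ` {y. keys y <= ?LB (Suc j)})"
 proof (rule T.kdim_Tor_graded[where g = ?g and W' = WI and ?b0.0 = "[]"])
  show "finite (?LB i)" for i by (rule finite_lists_length_eq[OF finGL])
  show "lc l : exponents n" if "l : ?LB i" for i l by (rule lc_exponents) (use gs that in auto)
  show "keys (bd l :: (_, 'k) fv) <= ?LB i" if "l : ?LB (Suc i)" for i l
  proof
   fix m assume "m : keys (bd l :: (_, 'k) fv)"
   from keys_bd[OF this] show "m : ?LB i" using that by auto
  qed
  show "mle (lc m) (lc l)" if "m : keys (bd l :: (_, 'k) fv)" for l m by (rule bd_mle[OF that])
  show "?LB 0 = {[]}" by auto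
  show "lc [] = 0" "bd [] = (0 :: (_, 'k) fv)" by simp_all
  show "module (mpoly_ring n) ?M" by (rule module_restrict[OF cring_mpoly_ring qf(1,2)])
  show "?g : carrier ?M" by (simp add: sel)
  show "\<exists>a\<in>carrier (mpoly_ring n). m = a \<odot>\<^bsub>?M\<^esub> ?g" if "m : carrier ?M" for m
  proof -
   have "m : (%s. I +>\<^bsub>mpoly_ring n\<^esub> s) ` carrier (mpoly_ring n)" using that unfolding sel qf(3) .
   then obtain a where "a : carrier (mpoly_ring n)" "m = I +>\<^bsub>mpoly_ring n\<^esub> a" by (rule imageE)
   thus ?thesis using ag[of a] by (intro bexI[of _ a]) simp_all
  qed
  show "(p \<odot>\<^bsub>?M\<^esub> ?g = \<zero>\<^bsub>?M\<^esub>) = (keys p <= WI)" if "keys p <= exponents n" for p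
  proof -
   have p: "p : carrier (mpoly_ring n)" using that by (simp add: mpoly_ring_sel)
   show ?thesis unfolding ag[OF p] unfolding sel by (rule qf(4)[OF p])
  qed
  show "lin bt (bt l) = (0 :: (_, 'k) fv)" for l by (rule bt_bt)
 next
  fix al :: "nat \<Rightarrow>\<^sub>0 nat" and i and x :: "('g list, 'k) fv"
  let ?GA = "{u : GL. mle (gs u) al}"
  have st: "strand {} lc (?LB q) al = {l. set l <= ?GA & length l = q}" for q
   by (auto simp: strand_def mle_lc)
  have kb: "keys (lin bd y :: ('g list, 'k) fv) <= {l. set l <= ?GA & length l = q}"
   if y: "keys y <= {l. set l <= ?GA & length l = Suc q}" for y q
  proof (rule keys_lin_subset, rule subsetI)
   fix l m assume "l : keys y" "m : keys (bd l :: ('g list, 'k) fv)"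
   hence "set l <= ?GA" "length l = Suc q" "set m <= set l" "length l = Suc (length m)"
    using y keys_bd[of m l, where 'k = 'k] by blast+
   thus "m : {l. set l <= ?GA & length l = q}" by auto
  qed
  assume "keys x <= strand {} lc (?LB (Suc i)) al"
  hence x: "keys x <= {l. set l <= ?GA & length l = Suc i}" unfolding st .
  show "restr (strand {} lc (?LB i) al) (lin bd x) = 0 \<longleftrightarrow>
   (EX y. keys y <= strand {} lc (?LB (Suc (Suc i))) al & restr (strand {} lc (?LB (Suc i)) al) (lin bd y) = x)"
   unfolding st restr_id[OF kb[OF x]]
  proof
   assume "EX y. keys y <= {l. set l <= ?GA & length l = Suc (Suc i)} & restr {l. set l <= ?GA & length l = Suc i} (lin bd y) = x"
   then obtain y where y: "keys y <= {l. set l <= ?GA & length l = Suc (Suc i)}" "restr {l. set l <= ?GA & length l = Suc i} (lin bd y) = x" by blast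
   have "x = lin bd y" using y(2) restr_id[OF kb[OF y(1)]] by simp
   thus "lin bd x = 0" by (simp add: lin_lin bd_bd)
  next
   assume z: "lin bd x = 0"
   show "EX y. keys y <= {l. set l <= ?GA & length l = Suc (Suc i)} & restr {l. set l <= ?GA & length l = Suc i} (lin bd y) = x"
   proof (cases "?GA = {}")
    case True
    have "keys x = {}"
    proof (rule ccontr)
     assume "keys x ~= {}"
     then obtain l where "l : keys x" by blast
     hence "set l <= {}" "length l = Suc i" using x True by auto
     thus False by simp
    qed
    hence "x = 0" by simp
    thus ?thesis by (intro exI[of _ 0]) simp
   next
    case False
    then obtain u where u: "u : ?GA" by blast
    let ?y = "lin (%l. unit_vec (u # l)) x"
    have ky: "keys ?y <= {l. set l <= ?GA & length l = Suc (Suc i)}"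
    proof (rule keys_lin_subset)
     fix l assume "l : keys x"
     hence "set l <= ?GA" "length l = Suc i" using x by auto
     thus "keys (unit_vec (u # l) :: ('g list, 'k) fv) <= {l. set l <= ?GA & length l = Suc (Suc i)}" using u by simp
    qed
    have "lin bd ?y = x - lin (%l. unit_vec (u # l)) (lin bd x)" by (simp add: lin_lin lin_fun_diff)
    hence "lin bd ?y = x" using z by simp
    thus ?thesis using ky restr_id[OF kb[OF ky]] by (intro exI[of _ ?y]) simp
   qed
  qed
 next
  fix al :: "nat \<Rightarrow>\<^sub>0 nat" assume al: "al : exponents n"
  show "al : WI \<longleftrightarrow> (\<exists>y :: ('g list, 'k) fv. keys y <= strand {} lc (?LB 1) al & restr {[]} (lin bd y) = unit_vec [])"
  proof
   assume "al : WI"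
   then obtain u where "u : GL" "mle (gs u) al" by (auto simp: WI_def)
   hence "keys (unit_vec [u] :: ('g list, 'k) fv) <= strand {} lc (?LB 1) al" by (simp add: strand_def mle_mlcm)
   moreover have "restr {[]} (lin bd (unit_vec [u])) = (unit_vec [] :: ('g list, 'k) fv)" by (simp add: restr_single)
   ultimately show "\<exists>y :: ('g list, 'k) fv. keys y <= strand {} lc (?LB 1) al & restr {[]} (lin bd y) = unit_vec []" by blast
  next
   assume "\<exists>y :: ('g list, 'k) fv. keys y <= strand {} lc (?LB 1) al & restr {[]} (lin bd y) = unit_vec []"
   then obtain y :: "('g list, 'k) fv" where y: "keys y <= strand {} lc (?LB 1) al" "restr {[]} (lin bd y) = unit_vec []" by blast
   have "y ~= 0"
   proof
    assume "y = 0"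
    hence "lkp (unit_vec [] :: ('g list, 'k) fv) [] = lkp 0 []" using y(2) by simp
    thus False by simp
   qed
   then obtain l where l: "l : keys y" by (metis all_not_in_conv keys_eq_empty)
   hence ls: "set l <= GL" "length l = 1" "mle (lc l) al" using y(1) by (auto simp: strand_def)
   then obtain u where "l = [u]" by (metis One_nat_def length_0_conv length_Suc_conv)
   thus "al : WI" using ls al by (auto simp: WI_def mle_mlcm)
  qed
 qed
 thus ?thesis by (simp add: quot_betti_def Let_def residue_module_def)
qed

lemma dF_exponents: "okF b ==> dF b : exponents n"
proof -
 have "okW w ==> dW w : exponents n" for w
 proof (induction w)
  case (Cons m w)
  have "lc m : exponents n" by (rule lc_exponents) (use Cons.prems gs in \<open>auto simp: okW_def\<close>)
  moreover have "dW w : exponents n" by (rule Cons.IH) (use Cons.prems in \<open>simp add: okW_def\<close>)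
  ultimately show ?case by (simp add: dW_def exponents_add)
 qed (simp add: dW_def)
 thus "okF b ==> dF b : exponents n"
  by (cases b) (auto simp: okF_def okX_def dF_def intro!: exponents_add sqf_exponents)
qed

lemma finite_BF: "finite (BF j)"
proof -
 have "BF j \<subseteq> (\<Union>q\<le>j. WW LL length q) \<times> Pow {1..n}"
  unfolding okW_WW[symmetric] by (auto simp: BF_def okF_def okX_def hF_def)
 thus ?thesis by (rule finite_subset) (simp add: finite_WW[OF finite_LL])
qed

text \<open>The instance with \<open>W\<close> the monomials of the ideal and the bar words with
  Koszul sets as basis. The module is the residue field, so its annihilating monomials are those of
  nonzero exponent. In lowest degree they are reached by the Koszul element e_i, for a variable i
  occurring in al.\<close>

lemma residue_betti_eq:
 fixes I :: "'k::field mpol set"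
 assumes I: "I = {p. keys p \<subseteq> WI}"
 shows "residue_betti n I j = pm.dim {x :: (_, 'k) fv. keys x <= BF j & lin (deg_part dF fD) x = 0}
   - pm.dim (lin (deg_part dF fD :: _ => (_, 'k) fv) ` {y. keys y <= BF (Suc j)})"
proof -
 note qf = quotient_facts[OF I]
 interpret T: mono_quotient n "mpoly_ring n Quot I" "%s. I +>\<^bsub>mpoly_ring n\<^esub> s" WI
  "%V. the_elem (const_coeff ` V)" "%c. I +>\<^bsub>mpoly_ring n\<^esub> const_pol c"
 proof (rule mono_quotient.intro)
  show "WI <= exponents n" by (auto simp: WI_def)
  show "\<mu> + \<nu> : WI" if "\<mu> : WI" "\<nu> : exponents n" for \<mu> \<nu>
   using that by (intro WI_up[OF that(1)] exponents_add) (auto simp: WI_def)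
 qed (use qf zero_notin_WI in auto)
 let ?N = "restrict_scalars (%V. the_elem (const_coeff ` V)) (ring_module (class_ring :: 'k ring))"
 have sel: "carrier ?N = UNIV" "\<zero>\<^bsub>?N\<^esub> = 0" "!!a x. a \<odot>\<^bsub>?N\<^esub> x = the_elem (const_coeff ` a) * x"
  by (simp_all add: restrict_scalars_def ring_module_def)
 have BFok: "b : BF i ==> okF b" for b i by (simp add: BF_def)
 have okn: "okF ([], {})" by (simp add: okF_def okX_def okW_def)
 have "kdim (%c. I +>\<^bsub>mpoly_ring n\<^esub> const_pol c) (Tor (mpoly_ring n Quot I) j ?N ?N) =
  pm.dim {x :: (_, 'k) fv. keys x <= BF j & lin (deg_part dF fD) x = 0} - pm.dim (lin (deg_part dF fD :: _ => (_, 'k) fv) ` {y. keys y <= BF (Suc j)})"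
 proof (rule T.kdim_Tor_graded[where g = 1 and W' = "{al : exponents n. al ~= 0}" and ?b0.0 = "([], {})"])
  show "finite (BF i)" for i by (rule finite_BF)
  show "dF b : exponents n" if "b : BF i" for b i by (rule dF_exponents[OF BFok[OF that]])
  show "keys (fD b :: (_, 'k) fv) <= BF i" if "b : BF (Suc i)" for b i
  proof
   fix c assume "c : keys (fD b :: (_, 'k) fv)"
   from keys_fD[OF BFok[OF that] this] show "c : BF i" using that by (simp add: BF_def)
  qed
  show "mle (dF c) (dF b)" if "b : BF (Suc i)" "c : keys (fD b :: (_, 'k) fv)" for b c i
   using keys_fD[OF BFok[OF that(1)] that(2)] by simp
  have "b = ([], {})" if "b : BF 0" for b
  proof -
   obtain w E where b: "b = (w, E)" by (cases b)
   have "finite E" using that finite_subset[of E "{1..n}"] by (auto simp: b BF_def okF_def okX_def)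
   moreover have "w = []" using that by (cases w) (auto simp: b BF_def hF_def hW_def)
   ultimately show ?thesis using that by (simp add: b BF_def hF_def)
  qed
  thus "BF 0 = {([], {})}" using okn by (auto simp: BF_def hF_def hW_def)
  show "dF ([], {}) = 0" by (simp add: dF_def dW_def)
  show "fD ([], {}) = (0 :: (_, 'k) fv)" by (simp add: fD_def DXb_def bK_def)
  show "restr (strand WI dF (BF i) al) (lin fD x) = 0 \<longleftrightarrow>
   (EX y. keys y <= strand WI dF (BF (Suc (Suc i))) al & restr (strand WI dF (BF (Suc i)) al) (lin fD y) = x)"
   if "al : exponents n" "keys x <= strand WI dF (BF (Suc i)) al" for al i and x :: "(_, 'k) fv"
   by (rule fD_strand_exact[OF that])
  show "module (mpoly_ring n Quot I) ?N" by (rule T.module_N)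
  show "1 : carrier ?N" by (simp add: sel)
  show "\<exists>a\<in>carrier (mpoly_ring n Quot I). m = a \<odot>\<^bsub>?N\<^esub> 1" for m
  proof -
   have c: "const_pol m : carrier (mpoly_ring n)" by (simp add: const_pol_def mpoly_ring_sel)
   have "I +>\<^bsub>mpoly_ring n\<^esub> const_pol m : carrier (mpoly_ring n Quot I)" unfolding qf(3) by (rule imageI[OF c])
   moreover have "(I +>\<^bsub>mpoly_ring n\<^esub> const_pol m) \<odot>\<^bsub>?N\<^esub> 1 = m"
    unfolding sel qf(5)[OF c] by (simp add: const_coeff_def const_pol_def)
   ultimately show ?thesis by force
  qed
  show "((I +>\<^bsub>mpoly_ring n\<^esub> p) \<odot>\<^bsub>?N\<^esub> 1 = \<zero>\<^bsub>?N\<^esub>) = (keys p <= {al : exponents n. al ~= 0})" if p: "keys p <= exponents n" for p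
  proof -
   have c: "p : carrier (mpoly_ring n)" using p by (simp add: mpoly_ring_sel)
   have "0 : keys p \<longleftrightarrow> const_coeff p ~= 0" by (simp add: const_coeff_def in_keys_iff)
   thus ?thesis unfolding sel qf(5)[OF c] using p by auto
  qed
  show "lin (deg_part dF fD) (deg_part dF fD b) = (0 :: (_, 'k) fv)" if "b : BF (Suc (Suc i))" for b i
   by (rule deg_part_fD_square[OF BFok[OF that]])
 next
  fix al :: "nat \<Rightarrow>\<^sub>0 nat" assume al: "al : exponents n" "al ~: WI"
  show "al : {al : exponents n. al ~= 0} \<longleftrightarrow> (\<exists>y :: (_, 'k) fv. keys y <= strand WI dF (BF 1) al & restr {([], {})} (lin fD y) = unit_vec ([], {}))"
  proof
   assume "al : {al : exponents n. al ~= 0}"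
   then obtain i where i: "lkp al i ~= 0" by (metis (mono_tags, lifting) lookup_zero mem_Collect_eq poly_mapping_eqI)
   have "i : {1..n}" using al(1) i by (auto simp: exponents_def in_keys_iff subset_iff)
   hence ok: "okF ([], {i})" by (simp add: okF_def okX_def okW_def)
   have m: "mle (dF ([], {i})) al" using i by (auto simp: dF_def dW_def mle_def lookup_sqf)
   have "al - dF ([], {i}) ~: WI"
   proof
    assume "al - dF ([], {i}) : WI"
    moreover have "mle (al - dF ([], {i})) al" by (simp add: mle_def lookup_minus)
    ultimately show False using WI_up al by blast
   qed
   hence st: "([], {i}) : strand WI dF (BF 1) al" using ok m by (simp add: strand_def BF_def hF_def hW_def)
   have emp: "{j. j = i & j < i} = {}" by auto
   have "fD ([], {i}) = (unit_vec ([], {}) :: (_, 'k) fv)"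
    by (simp add: fD_def DXb_def lin_lin prj_def bK_def ksign_def emp)
   thus "\<exists>y :: (_, 'k) fv. keys y <= strand WI dF (BF 1) al & restr {([], {})} (lin fD y) = unit_vec ([], {})"
    using st by (intro exI[of _ "unit_vec ([], {i})"]) (simp add: restr_single)
  next
   assume "\<exists>y :: (_, 'k) fv. keys y <= strand WI dF (BF 1) al & restr {([], {})} (lin fD y) = unit_vec ([], {})"
   then obtain y :: "(_, 'k) fv" where y: "keys y <= strand WI dF (BF 1) al" "restr {([], {})} (lin fD y) = unit_vec ([], {})" by blast
   have "y ~= 0"
   proof
    assume "y = 0"
    hence "lkp (unit_vec ([], {}) :: 'g list list \<times> nat set \<Rightarrow>\<^sub>0 'k) ([], {}) = lkp 0 ([], {})" using y(2) by simp
    thus False by simp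
   qed
   then obtain b where "b : keys y" by (metis all_not_in_conv keys_eq_empty)
   hence b: "okF b" "hF b = 1" "mle (dF b) al" using y(1) by (auto simp: strand_def BF_def)
   have "al ~= 0"
   proof
    assume "al = 0"
    hence "b = ([], {})" using dF_zero[OF b(1)] b(3) by simp
    thus False using b(2) by (simp add: hF_def hW_def)
   qed
   thus "al : {al : exponents n. al ~= 0}" using al by simp
  qed
 qed
 thus ?thesis by (simp add: residue_betti_def Let_def residue_module_quot_def)
qed

lemma golod_iff_word_lifting:
 fixes I :: "'k::field mpol set"
 assumes I: "I = {p. keys p <= WI}"
 shows "golod n I \<longleftrightarrow> word_lifting TYPE('k)"
 unfolding golod_def by (rule numerical_criterion[OF residue_betti_eq[OF I] quot_betti_eq[OF I]])

end

section \<open>One orbit of generators\<close>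

lemma nonzero_lookup: "x ~= 0 ==> EX i. lkp x i ~= 0"
proof (rule ccontr)
 assume "x ~= 0" "~ (EX i. lkp x i ~= 0)"
 hence "x = 0" by (intro poly_mapping_eqI) simp
 thus False using \<open>x ~= 0\<close> by simp
qed

lemma transpose_permutes: "i : S ==> j : S ==> transpose i j permutes S"
 by (rule permutes_swap_id)

text \<open>The second assumption records that each generator has degree at least two, in the form
  produced by \<open>degree_two_generators\<close>.\<close>

locale one_orbit =
 fixes n :: nat and lam :: "nat \<Rightarrow>\<^sub>0 nat"
 assumes part: "lam : partitions n"
  and sq: "!!e. e : orbit n lam ==> EX k k'. k ~= 0 & k' ~= 0 & e = k + k'"
begin

abbreviation "G \<equiv> orbit n lam"
abbreviation "a \<equiv> lkp lam 1"
abbreviation "len \<equiv> partition_length lam"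

lemma lam_exp: "lam : exponents n" using part by (simp add: partitions_def)

lemma lam_mono: "1 <= i ==> i <= j ==> j <= n ==> lkp lam j <= lkp lam i"
 using part by (auto simp: partitions_def)

lemma lam_out: "i ~: {1..n} ==> lkp lam i = 0"
 using lam_exp by (auto simp: exponents_def in_keys_iff subset_iff)

lemma G_exp: "G <= exponents n"
 using lam_exp by (auto simp: orbit_def perm_exp_exponents)

lemma G_E:
 assumes "u : G"
 obtains \<pi> where "\<pi> permutes {1..n}" "!!i. lkp u i = lkp lam (\<pi> i)"
proof -
 obtain \<pi> where p: "\<pi> permutes {1..n}" "u = perm_exp \<pi> lam" using assms by (auto simp: orbit_def)
 show thesis by (rule that[OF p(1)]) (simp add: p(2) lookup_perm_exp[OF p(1)])
qed

lemma G_I: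
 assumes "\<pi> permutes {1..n}" shows "perm_exp \<pi> lam : G"
 using assms by (auto simp: orbit_def)

lemma lam_G: "lam : G"
proof -
 have "perm_exp id lam : G" by (rule G_I) (rule permutes_id)
 moreover have "perm_exp id lam = lam"
  by (rule poly_mapping_eqI) (simp add: lookup_perm_exp[OF permutes_id])
 ultimately show ?thesis by simp
qed

lemma G_perm:
 assumes u: "u : G" and p: "\<pi> permutes {1..n}"
 shows "perm_exp \<pi> u : G"
proof -
 obtain \<sigma> where s: "\<sigma> permutes {1..n}" "!!i. lkp u i = lkp lam (\<sigma> i)" using u by (rule G_E) (rule that)
 have c: "\<sigma> \<circ> \<pi> permutes {1..n}" by (rule permutes_compose[OF p s(1)])
 have "perm_exp \<pi> u = perm_exp (\<sigma> \<circ> \<pi>) lam"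
  by (rule poly_mapping_eqI) (simp add: lookup_perm_exp[OF p] lookup_perm_exp[OF c] s(2))
 thus ?thesis using G_I[OF c] by simp
qed

lemma a_pos: "a > 0" "n \<ge> 1"
proof -
 have "EX k k'. k ~= 0 & k' ~= 0 & lam = k + k'" by (rule sq[OF lam_G])
 then obtain k k' where kk: "k ~= 0 & k' ~= 0 & lam = k + k'" by (elim exE) (rule that)
 obtain i where "lkp k i ~= 0" using nonzero_lookup[OF conjunct1[OF kk]] by (elim exE) (rule that)
 moreover have "lkp lam i = lkp k i + lkp k' i" by (simp only: kk lookup_add)
 ultimately have i: "lkp lam i ~= 0" by simp
 hence "i : {1..n}" using lam_out[of i] by (cases "i : {1..n}") simp_all
 hence n: "1 <= i" "i <= n" by simp_all
 show "n \<ge> 1" using n by simp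
 have "lkp lam i <= a" by (rule lam_mono[OF _ n]) simp
 thus "a > 0" using i by simp
qed

lemma keys_lam: "lkp lam i ~= 0 \<longleftrightarrow> i : {1..len}" "1 <= len" "len <= n"
proof -
 let ?S = "{i. lkp lam i ~= 0}"
 have S: "1 <= i & i <= n" if "lkp lam i ~= 0" for i
 proof (rule ccontr)
  assume "~ (1 <= i & i <= n)"
  hence "i ~: {1..n}" by simp
  thus False using lam_out[of i] that by simp
 qed
 hence "?S <= {1..n}" by auto
 hence fin: "finite (insert 0 ?S)" using finite_subset[of ?S "{1..n}"] by simp
 have ge: "i <= len" if "lkp lam i ~= 0" for i
  unfolding partition_length_def by (rule Max_ge[OF fin]) (use that in simp)
 show l1: "1 <= len" by (rule ge) (use a_pos(1) in simp)
 have "len : insert 0 ?S" unfolding partition_length_def by (rule Max_in[OF fin]) simp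
 hence lS: "lkp lam len ~= 0" using l1 by simp
 show ln: "len <= n" using S[OF lS] by simp
 show "lkp lam i ~= 0 \<longleftrightarrow> i : {1..len}"
 proof
  assume "lkp lam i ~= 0"
  thus "i : {1..len}" using ge[of i] S[of i] by simp
 next
  assume "i : {1..len}"
  hence "lkp lam len <= lkp lam i" by (intro lam_mono) (use ln in auto)
  thus "lkp lam i ~= 0" using lS by simp
 qed
qed

lemma le_a: "u : G ==> lkp u i <= a"
proof -
 assume "u : G"
 then obtain \<pi> where s: "\<pi> permutes {1..n}" "!!i. lkp u i = lkp lam (\<pi> i)" by (rule G_E) (rule that)
 show ?thesis using lam_mono[of 1 "\<pi> i"] lam_out[of "\<pi> i"] s(2) by (cases "\<pi> i : {1..n}") auto
qed

lemma card_supp: "u : G ==> card (keys u) = len & keys u <= {1..n}"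
proof -
 assume u: "u : G"
 then obtain \<pi> where s: "\<pi> permutes {1..n}" "!!i. lkp u i = lkp lam (\<pi> i)" by (rule G_E) (rule that)
 have "\<pi> ` keys u = {1..len}"
 proof
  show "\<pi> ` keys u <= {1..len}" using keys_lam(1) s(2) by (auto simp: in_keys_iff)
  show "{1..len} <= \<pi> ` keys u"
  proof
   fix i assume i: "i : {1..len}"
   obtain t where "i = \<pi> t" using permutes_surj[OF s(1)] by (metis surjD)
   thus "i : \<pi> ` keys u" using keys_lam(1)[of i] s(2)[of t] i by (auto simp: in_keys_iff)
  qed
 qed
 moreover have "card (\<pi> ` keys u) = card (keys u)" by (rule card_image) (rule inj_on_subset[OF permutes_inj[OF s(1)]], simp)
 ultimately show ?thesis using u G_exp by (auto simp: exponents_def)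
qed

text \<open>Generators serve as their own labels. Choosing the smallest variable of each generator,
  rather than an arbitrary one, is what the verification of \<open>bar_min\<close> relies
  on.\<close>

sublocale bar_setup "%u. u" n G "%u. Min (keys u)"
proof
 show "finite G" by (rule finite_orbit)
 show "u : exponents n" if "u : G" for u using that G_exp by blast
 have Mk: "Min (keys u) : keys u" if "u : G" for u
 proof (rule Min_in)
  show "finite (keys u)" by simp
  show "keys u ~= {}" using card_supp[OF that] keys_lam(2) by auto
 qed
 show "Min (keys u) : {1..n} & lkp u (Min (keys u)) ~= 0" if "u : G" for u
  using subsetD[OF conjunct2[OF card_supp[OF that]] Mk[OF that]] Mk[OF that] by (simp add: in_keys_iff)
qed

text \<open>Suppose the squarefree monomial on the smallest variables T were the lcm of the letters.
  Every letter would then be squarefree with support in T. A letter whose smallest variable is the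
  largest element of T has no room for a second variable, so its degree is one, contrary to the
  degree assumption.\<close>

sublocale bar_min "%u. u" n G "%u. Min (keys u)"
proof
 fix m :: "expo list"
 let ?T = "(%u. Min (keys u)) ` set m"
 assume m: "m ~= []" "set m <= G"
 show "sqf ?T ~= lc m"
 proof
  assume e: "sqf ?T = lc m"
  have le: "lkp v i <= lkp (lc m) i" if "v : set m" for v i
   using mle_gs_lc[OF that] by (simp add: mle_def)
  have fT: "finite ?T" by simp
  have "Max ?T : ?T" by (rule Max_in) (use m in auto)
  then obtain v where v: "v : set m" "Max ?T = Min (keys v)" by auto
  have vG: "v : G" using v m by blast
  have "EX k k'. k ~= 0 & k' ~= 0 & v = k + k'" by (rule sq[OF vG])
  then obtain k k' where k: "k ~= 0" "k' ~= 0" "v = k + k'" by (elim exE conjE) (rule that)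
  obtain i i' where i: "lkp k i ~= 0" "lkp k' i' ~= 0" using nonzero_lookup[OF k(1)] nonzero_lookup[OF k(2)] by (elim exE) (rule that)
  have v1: "lkp v c <= 1 & (lkp v c ~= 0 --> c : ?T)" for c
   using le[OF v(1), of c] unfolding e[symmetric] lookup_sqf[OF fT] by (auto split: if_splits)
  have "i ~= i'"
  proof
   assume "i = i'"
   hence "lkp v i \<ge> 2" using i by (simp add: k(3) lookup_add)
   thus False using v1[of i] by simp
  qed
  moreover have "c = Min (keys v)" if "lkp v c ~= 0" for c
  proof -
   have "c : ?T" using v1 that by blast
   hence "c <= Min (keys v)" using Max_ge[OF fT] v(2) by metis
   moreover have "Min (keys v) <= c" by (rule Min_le) (use that in \<open>simp_all add: in_keys_iff\<close>)
   ultimately show ?thesis by simp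
  qed
  moreover have "lkp v i ~= 0" "lkp v i' ~= 0" using i by (simp_all add: k(3) lookup_add)
  ultimately show False by metis
 qed
qed

text \<open>Two supports with more than half of the variables each must meet, so no two generators,
  and no two lists, are coprime.\<close>

lemma long_case: "n div 2 < len ==> word_lifting TYPE('k::field)"
proof (rule word_lifting_no_coprime)
 assume big: "n div 2 < len"
 fix l m assume l: "l : LL" and m: "m : LL"
 obtain u v where u: "u : set l" "u : G" and v: "v : set m" "v : G" using l m by (cases l; cases m) auto
 have "keys u \<inter> keys v ~= {}"
 proof
  assume d: "keys u \<inter> keys v = {}"
  have "card (keys u \<union> keys v) = card (keys u) + card (keys v)" by (rule card_Un_disjoint) (use d in auto)
  moreover have "card (keys u \<union> keys v) <= card {1..n}" by (rule card_mono) (use card_supp[OF u(2)] card_supp[OF v(2)] in auto)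
  ultimately show False using card_supp[OF u(2)] card_supp[OF v(2)] big by simp
 qed
 then obtain i where i: "lkp u i ~= 0" "lkp v i ~= 0" by (auto simp: in_keys_iff)
 have "lkp u i <= lkp (lc l) i" "lkp v i <= lkp (lc m) i" using mle_gs_lc[OF u(1)] mle_gs_lc[OF v(1)] by (simp_all add: mle_def)
 hence "~ disj (lc l) (lc m)" using i unfolding disj_def by (metis le_zero_eq)
 thus "~ coprm l m" by (simp add: coprm_iff)
qed

lemma a_index: "u : G ==> \<exists>i\<in>{1..n}. lkp u i = a"
proof -
 assume u: "u : G"
 then obtain \<pi> where s: "\<pi> permutes {1..n}" "!!i. lkp u i = lkp lam (\<pi> i)" by (rule G_E) (rule that)
 obtain t where t: "\<pi> t = 1" using permutes_surj[OF s(1)] by (metis surjD)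
 have "t : {1..n}" using permutes_in_image[OF s(1), of t] a_pos(2) t by simp
 thus ?thesis using s(2)[of t] t by auto
qed

text \<open>Each generator attains the largest exponent at least twice. One of these entries can be
  erased while another still forces enough divisibility, and permuting entries keeps one inside the
  orbit.\<close>

lemma equal_case:
 assumes eq: "a = lkp lam 2"
 shows "word_lifting TYPE('k::field)"
proof -
 have n2: "2 : {1..n}" using a_pos(1) eq lam_out[of 2] by force
 define dr where "dr i u = u - sgl i (lkp u i)" for i and u :: "nat \<Rightarrow>\<^sub>0 nat"
 have dr: "lkp (dr i u) t = (if t = i then 0 else lkp u t)" for i u t
  by (simp add: dr_def lookup_minus lookup_single when_def)
 \<comment> \<open>J is generated by the generators with one entry of size a replaced by
   zero.\<close>
 define WJ where "WJ = {m : exponents n. \<exists>u\<in>G. EX i. lkp u i = a & mle (dr i u) m}"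
 have two: "EX t. t ~= j & t : {1..n} & lkp u t = a" if u: "u : G" for u j
 proof -
  obtain \<pi> where s: "\<pi> permutes {1..n}" "!!i. lkp u i = lkp lam (\<pi> i)" using u by (rule G_E) (rule that)
  obtain t1 t2 where t: "\<pi> t1 = 1" "\<pi> t2 = 2" using permutes_surj[OF s(1)] by (metis surjD)
  have "t1 : {1..n}" "t2 : {1..n}" using permutes_in_image[OF s(1), of t1] permutes_in_image[OF s(1), of t2] n2 t by simp_all
  moreover have "lkp u t1 = a" "lkp u t2 = a" using s(2)[of t1] s(2)[of t2] t eq by simp_all
  moreover have "t1 ~= t2" using t by auto
  ultimately show ?thesis by metis
 qed
 show ?thesis
 proof (rule word_lifting_acyclic_ideal[of WJ])
  show "m' : WJ" if "m : WJ" "mle m m'" "m' : exponents n" for m m'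
   using that mle_trans unfolding WJ_def by blast
  show "0 ~: WJ"
  proof
   assume "0 : WJ"
   then obtain u i where u: "u : G" "mle (dr i u) 0" by (auto simp: WJ_def)
   obtain t where "t ~= i" "lkp u t = a" using two[OF u(1), of i] by blast
   hence "lkp (dr i u) t = a" by (simp add: dr)
   moreover have "lkp (dr i u) t <= 0" using u(2) by (simp add: mle_def)
   ultimately show False using a_pos(1) by simp
  qed
  \<comment> \<open>An entry a of u is moved to position i by a transposition, and the entry at i
    moves to the old place of a, where it still fits because it is at most a. After erasing position
    i the loss of x_i does not matter.\<close>
  show "m - sgl i 1 : WJ" if mW: "m : WI" for m i
  proof -
   obtain u where u: "u : G" "mle u m" "m : exponents n" using mW by (auto simp: WI_def)
   obtain j where j: "j : {1..n}" "lkp u j = a" using a_index[OF u(1)] by blast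
   have ex: "m - sgl i 1 : exponents n" by (rule exponents_diff[OF u(3)])
   have um: "lkp u t <= lkp m t" for t using u(2) by (simp add: mle_def)
   show ?thesis
   proof (cases "i : {1..n}")
    case False
    hence "lkp u i = 0" "lkp m i = 0" using u(1,3) G_exp by (auto simp: exponents_def in_keys_iff subset_iff)
    hence "mle (dr j u) (m - sgl i 1)"
     using um by (auto simp: mle_def dr lookup_minus lookup_single when_def)
    thus ?thesis using ex u(1) j(2) unfolding WJ_def by blast
   next
    case True
    let ?v = "perm_exp (transpose i j) u"
    have p: "transpose i j permutes {1..n}" by (rule transpose_permutes[OF True j(1)])
    have v: "lkp ?v t = lkp u (transpose i j t)" for t by (rule lookup_perm_exp[OF p])
    have vi: "lkp ?v i = a" by (simp add: v j(2))
    have "mle (dr i ?v) (m - sgl i 1)" unfolding mle_def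
    proof
     fix t
     have "lkp u i <= lkp m j" using le_a[OF u(1), of i] j(2) um[of j] by simp
     thus "lkp (dr i ?v) t <= lkp (m - sgl i 1) t"
     using um[of t] by (auto simp: dr v lookup_minus lookup_single when_def transpose_def)
    qed
    thus ?thesis using ex vi G_perm[OF u(1) p] unfolding WJ_def by blast
   qed
  qed
  show "m + m' : WI" if mm: "m : WJ" "m' : WJ" "disj m m'" for m m'
  proof -
   obtain u i where u: "u : G" "lkp u i = a" "mle (dr i u) m" "m : exponents n" using mm(1) by (auto simp: WJ_def)
   obtain v j where v: "v : G" "mle (dr j v) m'" "m' : exponents n" using mm(2) by (auto simp: WJ_def)
   \<comment> \<open>The second largest entry of v survives the erasure at j, so m' has exponent at
     least a at t, and coprimality gives exponent 0 of m there. Moving the erased entry of u from i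
     to t then produces a generator dividing m m'.\<close>
   obtain t where t: "t ~= j" "t : {1..n}" "lkp v t = a" using two[OF v(1), of j] by blast
   have mt: "a <= lkp m' t" using v(2) t by (auto simp: mle_def dr dest: spec[of _ t])
   hence "lkp m t = 0" using mm(3) a_pos(1) unfolding disj_def by (metis le_zero_eq neq0_conv)
   have um: "s ~= i ==> lkp u s <= lkp m s" for s using u(3) by (auto simp: mle_def dr dest: spec[of _ s])
   have ex: "m + m' : exponents n" by (rule exponents_add[OF u(4) v(3)])
   have i: "i : {1..n}" using u(1,2) G_exp a_pos(1) by (auto simp: exponents_def in_keys_iff subset_iff)
   let ?w = "perm_exp (transpose i t) u"
   have p: "transpose i t permutes {1..n}" by (rule transpose_permutes[OF i t(2)])
   have w: "lkp ?w s = lkp u (transpose i t s)" for s by (rule lookup_perm_exp[OF p])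
   have "mle ?w (m + m')" unfolding mle_def
   proof
    fix s
    have "t ~= i ==> lkp u t = 0" using um[of t] \<open>lkp m t = 0\<close> by simp
    thus "lkp ?w s <= lkp (m + m') s"
     unfolding w lookup_add transpose_def using um[of s] mt u(2) by (cases "s = t"; cases "s = i") auto
   qed
   thus ?thesis using ex G_perm[OF u(1) p] by (auto simp: WI_def)
  qed
 qed
qed

text \<open>Two disjoint blocks of \<open>len\<close> variables exist. In each block the generators
  with support the block and the peak a at each position in turn have lcm a on the whole block, and
  every one of them is needed for it. The two resulting lists are coprime cycles with nonzero
  product.\<close>

lemma strict_case:
 assumes ne: "a ~= lkp lam 2" and small: "len <= n div 2"
 shows "~ word_lifting TYPE('k::field)"
proof -
 have one: "lkp lam i = a \<longleftrightarrow> i = 1" for i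
 proof (cases "i : {2..n}")
  case True
  hence "lkp lam i <= lkp lam 2" "lkp lam 2 <= a" using lam_mono[of 2 i] lam_mono[of 1 2] by auto
  thus ?thesis using ne True by auto
 next
  case False
  thus ?thesis using lam_out[of i] a_pos by (cases "i = 1") auto
 qed
 \<comment> \<open>The position of the peak a, unique because a occurs only once in lam. It serves
   as the label in \<open>no_word_lifting\<close>.\<close>
 define am where "am u = (THE t. lkp u t = a)" for u :: "nat \<Rightarrow>\<^sub>0 nat"
 have am: "lkp u t = a \<longleftrightarrow> t = am u" if u: "u : G" for u t
 proof -
  obtain \<pi> where s: "\<pi> permutes {1..n}" "!!i. lkp u i = lkp lam (\<pi> i)" using u by (rule G_E) (rule that)
  obtain t0 where t0: "\<pi> t0 = 1" using permutes_surj[OF s(1)] by (metis surjD)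
  have iff: "lkp u t = a \<longleftrightarrow> t = t0" for t
   using s(2)[of t] one[of "\<pi> t"] t0 permutes_inj[OF s(1)] by (metis injD)
  hence "am u = t0" unfolding am_def by (intro the_equality) auto
  thus ?thesis using iff by simp
 qed
 \<comment> \<open>The involution exchanging the blocks {1..len} and {len+1..2 len}; the assumption
   on \<open>len\<close> makes both fit into {1..n}.\<close>
 define \<sigma> where "\<sigma> t = (if t : {1..len} then t + len else if t : {Suc len..2 * len} then t - len else t)" for t
 have s2: "2 * len <= n" using small by simp
 have sp: "\<sigma> permutes {1..n}"
 proof (rule bij_imp_permutes)
  show "bij_betw \<sigma> {1..n} {1..n}"
   by (rule bij_betw_byWitness[of _ \<sigma>]) (use s2 in \<open>auto simp: \<sigma>_def\<close>)
  show "\<sigma> t = t" if "t ~: {1..n}" for t using that s2 by (auto simp: \<sigma>_def)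
 qed
 \<comment> \<open>u i has its peak at i and the block containing i as its support: a transposition
   moves the peak inside the first block, and \<sigma> carries the result to the second.\<close>
 define u where "u i = (if i <= len then perm_exp (transpose 1 i) lam else perm_exp \<sigma> (perm_exp (transpose 1 (i - len)) lam))" for i
 have tp: "transpose 1 i permutes {1..n}" if "i : {1..len}" for i
  by (rule transpose_permutes) (use that keys_lam in auto)
 have uG: "u i : G" if i: "i : {1..2 * len}" for i
 proof (cases "i <= len")
  case True
  hence "i : {1..len}" using i by auto
  thus ?thesis using G_perm[OF lam_G tp] True by (simp add: u_def)
 next
  case False
  hence "i - len : {1..len}" using i by auto
  thus ?thesis using G_perm[OF G_perm[OF lam_G tp] sp] False by (simp add: u_def)
 qed
 have tl: "lkp lam (transpose 1 i t) ~= 0 \<longleftrightarrow> t : {1..len}" if "i : {1..len}" for i t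
  unfolding keys_lam(1) using that by (auto simp: transpose_def)
 have lu: "lkp (u i) t = lkp lam (transpose 1 i t)" if "i : {1..len}" for i t
 proof -
  have ui: "u i = perm_exp (transpose 1 i) lam" using that by (simp add: u_def)
  show ?thesis unfolding ui by (rule lookup_perm_exp[OF tp[OF that]])
 qed
 have lu2: "lkp (u i) t = lkp lam (transpose 1 (i - len) (\<sigma> t))" if "i : {Suc len..2 * len}" for i t
 proof -
  have m: "i - len : {1..len}" using that by auto
  have ui: "u i = perm_exp \<sigma> (perm_exp (transpose 1 (i - len)) lam)" using that by (simp add: u_def)
  show ?thesis unfolding ui lookup_perm_exp[OF sp] by (rule lookup_perm_exp[OF tp[OF m]])
 qed
 have su: "lkp (u i) t ~= 0 \<longleftrightarrow> t : {1..len}" if "i : {1..len}" for i t unfolding lu[OF that] by (rule tl[OF that])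
 have su2: "lkp (u i) t ~= 0 \<longleftrightarrow> t : {Suc len..2 * len}" if "i : {Suc len..2 * len}" for i t
 proof -
  have "lkp (u i) t ~= 0 \<longleftrightarrow> \<sigma> t : {1..len}" unfolding lu2[OF that] by (rule tl) (use that in auto)
  also have "... \<longleftrightarrow> t : {Suc len..2 * len}" by (auto simp: \<sigma>_def)
  finally show ?thesis .
 qed
 have amu: "am (u i) = i" if i: "i : {1..2 * len}" for i
 proof -
  have "lkp (u i) i = a"
  proof (cases "i <= len")
   case True
   thus ?thesis using lu[of i i] i by simp
  next
   case False
   hence "\<sigma> i = i - len" using i by (auto simp: \<sigma>_def)
   thus ?thesis using lu2[of i i] i False by simp
  qed
  thus ?thesis using am[OF uG[OF i]] by simp
 qed
 \<comment> \<open>Every position of T receives the value a from the letter that peaks there, no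
   letter exceeds a, and no letter reaches outside T.\<close>
 have block: "lkp (lc l) t = (if t : T then a else 0)"
  if l: "set l <= G" "!!w s. w : set l ==> lkp w s ~= 0 ==> s : T" "T <= am ` set l" for l T t
 proof -
  have le: "lkp (lc l) t <= (if t : T then a else 0)" using l(1,2)
  proof (induction l)
   case (Cons w l)
   have "lkp w t <= (if t : T then a else 0)" using Cons.prems(2)[of w t] le_a[of w t] Cons.prems(1) by auto
   moreover have "lkp (lc l) t <= (if t : T then a else 0)"
   proof (rule Cons.IH)
    show "set l <= G" using Cons.prems(1) by simp
    show "s : T" if "w : set l" "lkp w s ~= 0" for w s by (rule Cons.prems(2)[of w s]) (use that in simp_all)
   qed
   ultimately show ?case by (simp add: lookup_mlcm)
  qed simp
  show ?thesis
  proof (cases "t : T")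
   case True
   then obtain w where w: "w : set l" "am w = t" using l(3) by auto
   have "lkp w t = a" using am[of w t] w l(1) by auto
   moreover have "lkp w t <= lkp (lc l) t" using mle_gs_lc[OF w(1)] by (simp add: mle_def)
   ultimately show ?thesis using le True by simp
  qed (use le in simp)
 qed
 let ?l1 = "map u [1..<Suc len]" and ?l2 = "map u [Suc len..<Suc (2 * len)]"
 have S: "set ?l1 = u ` {1..len}" "set ?l2 = u ` {Suc len..2 * len}" by auto
 have A: "am ` set ?l1 = {1..len}" "am ` set ?l2 = {Suc len..2 * len}"
  unfolding S image_image by (auto simp: amu intro!: image_eqI)
 have Gl: "set ?l1 <= G" "set ?l2 <= G" unfolding S using uG by auto
 have L1: "lkp (lc ?l1) t = (if t : {1..len} then a else 0)" for t
  by (rule block[OF Gl(1)]) (use su A in \<open>auto simp: S\<close>)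
 have L2: "lkp (lc ?l2) t = (if t : {Suc len..2 * len} then a else 0)" for t
  by (rule block[OF Gl(2)]) (use su2 A in \<open>auto simp: S\<close>)
 have dj: "disj (lc ?l1) (lc ?l2)" unfolding disj_def L1 L2 by auto
 have L: "lkp (lc (?l1 @ ?l2)) t = (if t : {1..2 * len} then a else 0)" for t
  unfolding lookup_lc_append L1 L2 by auto
 \<comment> \<open>A list with fewer letters than T has positions misses a peak, so each boundary
   term has a smaller lcm and no term of the minimal boundary is left.\<close>
 have btz: "bt l = (0 :: expo list \<Rightarrow>\<^sub>0 'k)"
  if l: "set l <= G" "!!t. lkp (lc l) t = (if t : T then a else 0)" "card T = length l" "finite T" for l T
 proof -
  have "lc x ~= lc l" if x: "x : keys (bd l :: (_, 'k) fv)" for x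
  proof
   assume e: "lc x = lc l"
   have xs: "set x <= set l" "length l = Suc (length x)" using keys_bd[OF x] by auto
   have "T <= am ` set x"
   proof
    fix t assume t: "t : T"
    have lx: "\<exists>w\<in>set x. lkp w t = c" if "lkp (lc x) t = c" "c > 0" for x c
     using that
    proof (induction x)
     case (Cons w x)
     thus ?case by (cases "lkp w t \<ge> lkp (lc x) t") (auto simp: lookup_mlcm max_def split: if_splits)
    qed simp
    have "lkp (lc x) t = a" using e l(2) t by simp
    then obtain w where "w : set x" "lkp w t = a" using lx a_pos(1) by blast
    thus "t : am ` set x" using am[of w t] xs(1) l(1) by auto
   qed
   hence "card T <= card (am ` set x)" by (rule card_mono[rotated]) simp
   also have "... <= length x" using card_image_le[of "set x" am] card_length[of x] by simp
   finally show False using l(3) xs(2) by simp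
  qed
  thus ?thesis unfolding deg_part_def restr_zero_iff by blast
 qed
 show ?thesis
 proof (rule no_word_lifting[of ?l1 ?l2 am])
  show "?l1 : LL" "?l2 : LL" using Gl keys_lam(2) by auto
  show "bt ?l1 = (0 :: (_, 'k) fv)" by (rule btz[OF Gl(1) L1]) simp_all
  show "bt ?l2 = (0 :: (_, 'k) fv)" by (rule btz[OF Gl(2) L2]) simp_all
  show "coprm ?l1 ?l2" using dj by (simp add: coprm_iff)
  have "?l1 @ ?l2 = map u [1..<Suc (2 * len)]"
   unfolding map_append[symmetric] by (rule arg_cong[of _ _ "map u"]) (use upt_add_eq_append[of 1 "Suc len" len] in \<open>simp add: mult_2 del: upt_Suc\<close>)
  moreover have "map am (map u [1..<Suc (2 * len)]) = [1..<Suc (2 * len)]"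
   by (rule nth_equalityI) (use amu in \<open>auto simp del: upt_Suc\<close>)
  ultimately show "distinct (map am (?l1 @ ?l2))" by simp
  have T: "am ` set (?l1 @ ?l2) = {1..2 * len}" unfolding set_append image_Un A by auto
  show "am w : am ` set (?l1 @ ?l2)" if w: "w : G" "mle w (lc (?l1 @ ?l2))" for w
  proof -
   have "lkp w (am w) = a" using am[OF w(1)] by blast
   moreover have "lkp w (am w) <= lkp (lc (?l1 @ ?l2)) (am w)" using w(2) by (simp add: mle_def)
   ultimately show ?thesis unfolding T L using a_pos(1) by (auto split: if_splits)
  qed
  show "lc m = lc (?l1 @ ?l2)" if m: "set m <= G" "mle (lc m) (lc (?l1 @ ?l2))" "am ` set m = am ` set (?l1 @ ?l2)" for m
  proof (rule mle_antisym[OF m(2)])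
   show "mle (lc (?l1 @ ?l2)) (lc m)" unfolding mle_def L
   proof
    fix t
    show "(if t : {1..2 * len} then a else 0) <= lkp (lc m) t"
    proof (cases "t : {1..2 * len}")
     case True
     then obtain w where w: "w : set m" "am w = t" using m(3) unfolding T by (metis imageE)
     have "lkp w t = a" using am[of w t] w m(1) by auto
     moreover have "lkp w t <= lkp (lc m) t" using mle_gs_lc[OF w(1)] by (simp add: mle_def)
     ultimately show ?thesis using True by simp
    next
     case False
     thus ?thesis by (simp only: if_False le0)
    qed
   qed
  qed
 qed
qed

lemma golod_one_orbit:
 fixes I :: "'k::field mpol set"
 assumes I: "I = {p. keys p <= ups n G}"
 shows "golod n I \<longleftrightarrow> n div 2 < len | (len <= n div 2 & a = lkp lam 2)"
proof -
 have "golod n I \<longleftrightarrow> word_lifting TYPE('k)"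
  by (rule golod_iff_word_lifting) (simp add: I WI_ups)
 thus ?thesis using long_case[where 'k = 'k] equal_case[where 'k = 'k] strict_case[where 'k = 'k]
  by (cases "n div 2 < len"; cases "a = lkp lam 2") auto
qed

end

theorem theorem1p9:
  fixes n :: nat and I :: "'k::field mpol set" and lam :: "nat \<Rightarrow>\<^sub>0 nat"
  assumes "symmetric_monomial_ideal n I"
    and "I \<subseteq> ideal_prod (mpoly_ring n) (irrelevant_ideal n) (irrelevant_ideal n)"
    and "Lambda n I = {lam}"
  shows "golod n I \<longleftrightarrow>
    partition_length lam > n div 2 \<or>
    (partition_length lam \<le> n div 2 \<and> Poly_Mapping.lookup lam 1 = Poly_Mapping.lookup lam 2)"
proof -
  note o = one_orbit_ideal[OF assms(1,3)]
  have "lam \<in> exponents n" using o(1) by (simp add: partitions_def)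
  then have ex: "orbit n lam \<subseteq> exponents n" by (auto simp: orbit_def perm_exp_exponents)
  interpret one_orbit n lam
  proof
    show "lam \<in> partitions n" by (rule o(1))
    fix e assume e: "e \<in> orbit n lam"
    obtain k k' where "k \<noteq> 0" "k' \<noteq> 0" "e = k + k'" by (rule degree_two_generators[OF o(2) ex assms(2) e]) (rule that)
    then show "\<exists>k k'. k \<noteq> 0 \<and> k' \<noteq> 0 \<and> e = k + k'" by (intro exI conjI)
  qed
  show ?thesis by (rule golod_one_orbit[OF o(2)])
qed

end
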